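(* Let $(W,S)$ be a Coxeter system, let $k\ge 1$, and let $\mathbf{q}$ be a multiparameter of positive reals such that $\mathbf{q}\in\mathcal{R}_{\mathrm{St}(T)}$ for every spherical subset $T\subseteq S$ with $|T|=k$. Let $\Sigma$ denote the Davis complex with its Coxeter cellulation and $\Sigma^{(k-1)}$ its $(k-1)$-skeleton. Then $L^2_\mathbf{q}H_i(\Sigma,\Sigma^{(k-1)})=0$ for all $i\neq k$.
   Context: A Coxeter system $(W,S)$: $W$ is generated by $S$ with relations $(st)^{m_{st}}=1$ for $m_{st}<\infty$. For $U\subseteq S$, $W_U=\langle U\rangle$; $U$ is spherical if $W_U$ is finite. A multiparameter is $\mathbf{q}=(q_s)_{s\in S}$, $q_s>0$, $q_s=q_{s'}$ when $s,s'$ are conjugate; $q_w=q_{s_1}\cdots q_{s_n}$ for a reduced expression $w=s_1\cdots s_n$. $\mathcal{R}_U$ is the set of $\mathbf{t}\in(0,\infty)^S$ where the growth series $\sum_{w\in W_U}t_w$ converges. $\mathrm{St}(T)=\bigcup\{U\subseteq S: U\cup T \text{ spherical}\}$. The Coxeter cellulation of the Davis complex has cells $wc_U$ ($w\in W$, $U$ spherical), $c_U$ of dimension $|U|$ with boundary the Coxeter complex of $W_U$. Weighted $L^2$-homology: cell $w\sigma$ gets measure $q_u$, $u$ the shortest element of $wW_{S(\sigma)}$ ($S(\sigma)$ the type of $\sigma$); $L^2_\mathbf{q}C_i$ are the square-summable chains for the weighted inner product $\sum f(\sigma)g(\sigma)\mu_\mathbf{q}(\sigma)$; the boundary $\partial^\mathbf{q}$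 is the adjoint of the coboundary for this inner product; reduced homology is $\ker\partial^\mathbf{q}/\overline{\operatorname{im}\partial^\mathbf{q}}$, with relative version for pairs.
   Formalization: The generating set S is assumed finite; for infinite S each vertex of Σ lies in infinitely many edges, so the coboundary of a vertex is not square-summable and the weighted boundary is not defined on the square-summable 1-chains of Σ. *)

theory Defs
  imports "HOL-Algebra.Coset" "HOL-Algebra.Generated_Groups" "HOL-Analysis.Infinite_Sum"
begin

definition word_prod :: "'a monoid \<Rightarrow> 'a list \<Rightarrow> 'a" where
  "word_prod G ss = foldr (\<lambda>s x. s \<otimes>\<^bsub>G\<^esub> x) ss \<one>\<^bsub>G\<^esub>"

text \<open>(W,S) is a Coxeter system: W is generated by the involutions S and is presented by
  the relations (st)^(m_st) = 1, m_st the order of st.  The presentation is expressed by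
  the universal property; it suffices to test it on groups whose elements are sets of
  words over S (every group generated by the image of S is isomorphic to such a group).
  The condition on n says that (f s f t)^n = 1 whenever (st)^n = 1, i.e. (f s f t)^(m_st) = 1.\<close>
definition coxeter_system :: "'a monoid \<Rightarrow> 'a set \<Rightarrow> bool" where
  "coxeter_system G S \<longleftrightarrow>
     group G \<and> S \<subseteq> carrier G \<and> \<one>\<^bsub>G\<^esub> \<notin> S \<and>
     (\<forall>s\<in>S. s \<otimes>\<^bsub>G\<^esub> s = \<one>\<^bsub>G\<^esub>) \<and>
     generate G S = carrier G \<and>
     (\<forall>(H :: 'a list set monoid) f.
        group H \<and> f \<in> S \<rightarrow> carrier H \<and>
        (\<forall>s\<in>S. \<forall>t\<in>S. \<forall>n::nat.
            (s \<otimes>\<^bsub>G\<^esub> t) [^]\<^bsub>G\<^esub> n = \<one>\<^bsub>G\<^esub> \<longrightarrow>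
            (f s \<otimes>\<^bsub>H\<^esub> f t) [^]\<^bsub>H\<^esub> n = \<one>\<^bsub>H\<^esub>)
        \<longrightarrow> (\<exists>h\<in>hom G H. \<forall>s\<in>S. h s = f s))"

definition cox_length :: "'a monoid \<Rightarrow> 'a set \<Rightarrow> 'a \<Rightarrow> nat" where
  "cox_length G S w = (LEAST n. \<exists>ss. set ss \<subseteq> S \<and> length ss = n \<and> word_prod G ss = w)"

definition qw :: "'a monoid \<Rightarrow> 'a set \<Rightarrow> ('a \<Rightarrow> real) \<Rightarrow> 'a \<Rightarrow> real" where
  "qw G S q w = (SOME x. \<exists>ss. set ss \<subseteq> S \<and> word_prod G ss = w \<and>
                          length ss = cox_length G S w \<and> x = prod_list (map q ss))"

definition multiparameter :: "'a monoid \<Rightarrow> 'a set \<Rightarrow> ('a \<Rightarrow> real) \<Rightarrow> bool" where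
  "multiparameter G S q \<longleftrightarrow>
     (\<forall>s\<in>S. q s > 0) \<and>
     (\<forall>s\<in>S. \<forall>s'\<in>S. (\<exists>g\<in>carrier G. s' = g \<otimes>\<^bsub>G\<^esub> s \<otimes>\<^bsub>G\<^esub> inv\<^bsub>G\<^esub> g) \<longrightarrow> q s = q s')"

definition spherical :: "'a monoid \<Rightarrow> 'a set \<Rightarrow> 'a set \<Rightarrow> bool" where
  "spherical G S U \<longleftrightarrow> U \<subseteq> S \<and> finite (generate G U)"

definition growth_region :: "'a monoid \<Rightarrow> 'a set \<Rightarrow> 'a set \<Rightarrow> ('a \<Rightarrow> real) set" where
  "growth_region G S U = {t. (\<forall>s\<in>S. t s > 0) \<and> (\<lambda>w. qw G S t w) summable_on generate G U}"

definition St :: "'a monoid \<Rightarrow> 'a set \<Rightarrow> 'a set \<Rightarrow> 'a set" where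
  "St G S T = \<Union>{U. U \<subseteq> S \<and> spherical G S (U \<union> T)}"

text \<open>The cell w c_U is represented by the pair (w W_U, U); its dimension is |U|.\<close>
type_synonym 'a cell = "'a set \<times> 'a set"

definition davis_cells :: "'a monoid \<Rightarrow> 'a set \<Rightarrow> nat \<Rightarrow> 'a cell set" where
  "davis_cells G S i = {(l_coset G w (generate G U), U) | w U.
       w \<in> carrier G \<and> spherical G S U \<and> card U = i}"

definition minrep :: "'a monoid \<Rightarrow> 'a set \<Rightarrow> 'a set \<Rightarrow> 'a" where
  "minrep G S C = (SOME u. u \<in> C \<and> (\<forall>v\<in>C. cox_length G S u \<le> cox_length G S v))"

definition cell_measure :: "'a monoid \<Rightarrow> 'a set \<Rightarrow> ('a \<Rightarrow> real) \<Rightarrow> 'a cell \<Rightarrow> real" where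
  "cell_measure G S q \<sigma> = qw G S q (minrep G S (fst \<sigma>))"

text \<open>A fixed total ordering of S (used only to orient cells).\<close>
definition cox_enum :: "'a set \<Rightarrow> 'a \<Rightarrow> nat" where
  "cox_enum S = (SOME r. inj_on r S)"

text \<open>Incidence numbers [sigma : tau] of the cellular chain complex.  The cell u c_U (u the
  shortest element of its coset) is oriented as the translate by u of a fixed orientation
  of c_U; W_U acts on c_U by the sign character (-1)^l(v), and the codimension-one faces
  of u c_U are the cells u v c_{U-{s}} with s in U and v in W_U shortest in v W_{U-{s}}.
  This gives  d(u c_U) = sum_s (-1)^{#{t in U. t < s}} sum_v (-1)^l(v) u v c_{U-{s}}.\<close>
definition incidence :: "'a monoid \<Rightarrow> 'a set \<Rightarrow> 'a cell \<Rightarrow> 'a cell \<Rightarrow> real" where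
  "incidence G S \<sigma> \<tau> =
     (if fst \<tau> \<subseteq> fst \<sigma> \<and> snd \<tau> \<subseteq> snd \<sigma> \<and> card (snd \<sigma> - snd \<tau>) = 1 then
        (let s = the_elem (snd \<sigma> - snd \<tau>);
             v = inv\<^bsub>G\<^esub> (minrep G S (fst \<sigma>)) \<otimes>\<^bsub>G\<^esub> minrep G S (fst \<tau>)
         in (-1) ^ card {t \<in> snd \<sigma>. cox_enum S t < cox_enum S s} * (-1) ^ cox_length G S v)
      else 0)"

definition l2_chains :: "'a monoid \<Rightarrow> 'a set \<Rightarrow> ('a \<Rightarrow> real) \<Rightarrow> nat \<Rightarrow> ('a cell \<Rightarrow> real) set" where
  "l2_chains G S q i = {f. (\<forall>\<sigma>. \<sigma> \<notin> davis_cells G S i \<longrightarrow> f \<sigma> = 0) \<and>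
        (\<lambda>\<sigma>. (f \<sigma>)\<^sup>2 * cell_measure G S q \<sigma>) summable_on davis_cells G S i}"

definition l2_norm :: "'a monoid \<Rightarrow> 'a set \<Rightarrow> ('a \<Rightarrow> real) \<Rightarrow> nat \<Rightarrow> ('a cell \<Rightarrow> real) \<Rightarrow> real" where
  "l2_norm G S q i f = sqrt (\<Sum>\<^sub>\<infinity>\<sigma>\<in>davis_cells G S i. (f \<sigma>)\<^sup>2 * cell_measure G S q \<sigma>)"

text \<open>The boundary d^q : L^2_q C_i \<rightarrow> L^2_q C_{i-1}, the adjoint of the coboundary
  (delta f)(sigma) = sum_tau [sigma:tau] f(tau) for the weighted inner product
  <f,g> = sum f(sigma) g(sigma) mu_q(sigma); written out:
  (d^q g)(tau) = sum over cofaces sigma of tau of [sigma:tau] g(sigma) mu(sigma) / mu(tau).\<close>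
definition bdry_q :: "'a monoid \<Rightarrow> 'a set \<Rightarrow> ('a \<Rightarrow> real) \<Rightarrow> nat \<Rightarrow> ('a cell \<Rightarrow> real) \<Rightarrow> ('a cell \<Rightarrow> real)" where
  "bdry_q G S q i g = (\<lambda>\<tau>.
     if 1 \<le> i \<and> \<tau> \<in> davis_cells G S (i - 1) then
       (\<Sum>\<sigma>\<in>{\<sigma> \<in> davis_cells G S i. fst \<tau> \<subseteq> fst \<sigma> \<and> snd \<tau> \<subseteq> snd \<sigma>}.
          incidence G S \<sigma> \<tau> * g \<sigma> * cell_measure G S q \<sigma> / cell_measure G S q \<tau>)
     else 0)"

text \<open>Relative chains: L^2_q C_i(Sigma)/L^2_q C_i(Sigma^(k-1)), i.e. all L^2 i-chains if
  i \<ge> k and 0 otherwise; the relative boundary is the induced map.\<close>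
definition rel_chains :: "'a monoid \<Rightarrow> 'a set \<Rightarrow> ('a \<Rightarrow> real) \<Rightarrow> nat \<Rightarrow> nat \<Rightarrow> ('a cell \<Rightarrow> real) set" where
  "rel_chains G S q k i = (if k \<le> i then l2_chains G S q i else {\<lambda>_. 0})"

definition rel_bdry :: "'a monoid \<Rightarrow> 'a set \<Rightarrow> ('a \<Rightarrow> real) \<Rightarrow> nat \<Rightarrow> nat \<Rightarrow> ('a cell \<Rightarrow> real) \<Rightarrow> ('a cell \<Rightarrow> real)" where
  "rel_bdry G S q k i g = (if 1 \<le> i \<and> k \<le> i - 1 then bdry_q G S q i g else (\<lambda>_. 0))"

definition rel_closure :: "'a monoid \<Rightarrow> 'a set \<Rightarrow> ('a \<Rightarrow> real) \<Rightarrow> nat \<Rightarrow> nat \<Rightarrow> ('a cell \<Rightarrow> real) set \<Rightarrow> ('a cell \<Rightarrow> real) set" where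
  "rel_closure G S q k i A = {g \<in> rel_chains G S q k i.
      \<forall>e>0. \<exists>a\<in>A. l2_norm G S q i (\<lambda>\<sigma>. g \<sigma> - a \<sigma>) < e}"

definition rel_L2_homology_vanishes :: "'a monoid \<Rightarrow> 'a set \<Rightarrow> ('a \<Rightarrow> real) \<Rightarrow> nat \<Rightarrow> nat \<Rightarrow> bool" where
  "rel_L2_homology_vanishes G S q k i \<longleftrightarrow>
     {g \<in> rel_chains G S q k i. rel_bdry G S q k i g = (\<lambda>_. 0)} =
     rel_closure G S q k i (rel_bdry G S q k (Suc i) ` rel_chains G S q k (Suc i))"

end

theory Submission
  imports Defs "HOL-Algebra.Multiplicative_Group" "HOL-Analysis.Analysis"
begin

text \<open>Cellular chains are right-alternating functions on \<open>W\<close> indexed by spherical subsets. In degrees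
  above \<open>k\<close> even the unreduced complex is exact. Filtering by the spherical subsets that contain a
  given \<open>T\<close> and using long exact sequences, one reduces to the complex of \<open>W\<^sub>V\<close>-cells in
  positive degrees when the growth series of \<open>W\<^sub>V\<close> converges (\<open>V\<close> is the star of a spherical set
  with \<open>k\<close> elements). There the lexicographically least reduced words comb \<open>W\<^sub>V\<close>: finiteness of the
  set of elementary roots makes neighbouring paths stay uniformly close, so the combing yields
  uniformly local chain homotopies that contract the finitely supported complex. A convergent growth
  series converges with exponential slack, because the sums over spheres are submultiplicative, and
  this makes the contraction bounded on the weighted square-summable chains.\<close>

section \<open>Coxeter groups and the sign character\<close>

text \<open>The bound on the degree comes from bookkeeping. Growing \<open>T\<close> to
  \<open>k\<close> elements costs no degree, and a type containing such a \<open>T\<close> lies in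
  its star, so only \<open>W_V\<close> with \<open>V\<close> the star matters. Emptying
  \<open>T\<close> again with \<open>V\<close> fixed costs one degree per element, and the complex
  of \<open>W_V\<close>-cells can be contracted in positive degrees only: in degree 0 the combing
  ends at a vertex, not at zero. So the degrees above \<open>k\<close> remain; below
  \<open>k\<close> there are no relative chains. The obstacle is that \<open>W_V\<close> may be
  infinite, so that a homotopy built cell by cell needs bounds. Its local pieces are chosen
  equivariantly, whence finitely many occur up to translation; the one global quantity left is the
  mass of a chain whose combing paths pass through a point \<open>p\<close>. Such paths start at
  \<open>p u\<close> with \<open>u\<close> in \<open>W_V\<close>, where
  \<open>q_pu = q_p q_u\<close>, so Cauchy-Schwarz brings in exactly the growth series of
  \<open>W_V\<close>. Bare convergence would not control the sum over the points of a path, whose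
  length is unbounded; the slack supplies a geometric discount along the path.\<close>

locale cox =
  fixes G :: "'a monoid" (structure) and S :: "'a set"
  assumes coxeter: "coxeter_system G S" and finS: "finite S"
begin

lemma grp: "group G"
  using coxeter unfolding coxeter_system_def by auto

end

sublocale cox \<subseteq> group G by (rule grp)

context cox
begin

abbreviation W where "W \<equiv> carrier G"
abbreviation wp where "wp \<equiv> word_prod G"
abbreviation len where "len \<equiv> cox_length G S"

lemma S_carrier: "S \<subseteq> W" and one_notin_S: "\<one> \<notin> S"
  and S_involution: "s \<in> S \<Longrightarrow> s \<otimes> s = \<one>" and generate_S: "generate G S = W"
  using coxeter unfolding coxeter_system_def by auto

lemma S_closed [simp, intro]: "s \<in> S \<Longrightarrow> s \<in> W"
  using S_carrier by auto

lemma inv_S [simp]: "s \<in> S \<Longrightarrow> inv s = s"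
  using S_involution inv_equality S_closed by metis

lemma mult_S_S [simp]: "s \<in> S \<Longrightarrow> w \<in> W \<Longrightarrow> w \<otimes> s \<otimes> s = w"
  by (simp add: m_assoc S_involution)

lemma S_mult_S [simp]: "s \<in> S \<Longrightarrow> w \<in> W \<Longrightarrow> s \<otimes> (s \<otimes> w) = w"
  by (simp add: m_assoc[symmetric] S_involution)

lemma wp_Nil [simp]: "wp [] = \<one>" and wp_Cons [simp]: "wp (s # ss) = s \<otimes> wp ss"
  by (simp_all add: word_prod_def)

lemma wp_closed [simp]: "set ss \<subseteq> S \<Longrightarrow> wp ss \<in> W"
  by (induction ss) auto

lemma wp_append: "set a \<subseteq> S \<Longrightarrow> set b \<subseteq> S \<Longrightarrow> wp (a @ b) = wp a \<otimes> wp b"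
  by (induction a) (auto simp: m_assoc)

lemma wp_snoc [simp]: "set a \<subseteq> S \<Longrightarrow> s \<in> S \<Longrightarrow> wp (a @ [s]) = wp a \<otimes> s"
  by (simp add: wp_append)

lemma wp_rev: "set a \<subseteq> S \<Longrightarrow> wp (rev a) = inv (wp a)"
  by (induction a) (auto simp: wp_append inv_mult_group)

lemma generate_words:
  assumes "U \<subseteq> S" shows "w \<in> generate G U \<longleftrightarrow> (\<exists>ss. set ss \<subseteq> U \<and> wp ss = w)"
proof
  assume "w \<in> generate G U"
  then show "\<exists>ss. set ss \<subseteq> U \<and> wp ss = w"
  proof (induction rule: generate.induct)
    case one then show ?case by (intro exI[of _ "[]"]) auto
  next
    case (incl h) then show ?case using assms by (intro exI[of _ "[h]"]) auto
  next
    case (inv h) then show ?case using assms by (intro exI[of _ "[h]"]) (auto simp: subset_iff)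
  next
    case (eng h1 h2)
    then obtain a b where "set a \<subseteq> U" "wp a = h1" "set b \<subseteq> U" "wp b = h2" by auto
    then show ?case using assms by (intro exI[of _ "a @ b"]) (auto simp: wp_append)
  qed
next
  assume "\<exists>ss. set ss \<subseteq> U \<and> wp ss = w"
  then obtain ss where "set ss \<subseteq> U" "wp ss = w" by auto
  then show "w \<in> generate G U"
    by (induction ss arbitrary: w) (auto intro: generate.one generate.eng generate.incl)
qed

lemma word_exists: "w \<in> W \<Longrightarrow> \<exists>ss. set ss \<subseteq> S \<and> wp ss = w"
  using generate_words[of S] generate_S by auto

lemma len_word:
  assumes "w \<in> W" obtains ss where "set ss \<subseteq> S" "length ss = len w" "wp ss = w"
proof -
  from word_exists[OF assms] obtain ss where "set ss \<subseteq> S" "wp ss = w" by auto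
  then have "\<exists>n. \<exists>ss. set ss \<subseteq> S \<and> length ss = n \<and> wp ss = w" by auto
  then have "\<exists>ss. set ss \<subseteq> S \<and> length ss = len w \<and> wp ss = w"
    unfolding cox_length_def by (rule LeastI_ex)
  then show ?thesis using that by auto
qed

lemma len_le: "set ss \<subseteq> S \<Longrightarrow> len (wp ss) \<le> length ss"
  unfolding cox_length_def by (rule Least_le) auto

lemma len_one [simp]: "len \<one> = 0"
  using len_le[of "[]"] by simp

lemma len_0: "w \<in> W \<Longrightarrow> len w = 0 \<Longrightarrow> w = \<one>"
  by (metis len_word length_0_conv wp_Nil)

lemma len_mult_le: "x \<in> W \<Longrightarrow> y \<in> W \<Longrightarrow> len (x \<otimes> y) \<le> len x + len y"
proof -
  assume "x \<in> W" "y \<in> W"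
  then obtain a b where "set a \<subseteq> S" "length a = len x" "wp a = x"
    "set b \<subseteq> S" "length b = len y" "wp b = y" by (metis len_word)
  then show ?thesis using len_le[of "a @ b"] by (simp add: wp_append)
qed

lemma len_inv_le: "x \<in> W \<Longrightarrow> len (inv x) \<le> len x"
  by (metis len_le len_word length_rev set_rev wp_rev)

lemma len_inv [simp]: "x \<in> W \<Longrightarrow> len (inv x) = len x"
  using len_inv_le[of x] len_inv_le[of "inv x"] by simp

lemma len_S_le: "s \<in> S \<Longrightarrow> len s \<le> 1"
  using len_le[of "[s]"] by simp

lemma len_S [simp]: "s \<in> S \<Longrightarrow> len s = 1"
  using len_S_le[of s] len_0[of s] one_notin_S by (cases "len s") auto

text \<open>The universal property for target groups of arbitrary type: the subgroup generated by the
  image is encoded by the sets of words representing its elements.\<close>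

lemma universal_property:
  fixes K :: "'b monoid"
  assumes K: "group K" and f: "f \<in> S \<rightarrow> carrier K"
    and rel: "\<And>s t (n::nat). s \<in> S \<Longrightarrow> t \<in> S \<Longrightarrow> (s \<otimes> t) [^] n = \<one> \<Longrightarrow>
        (f s \<otimes>\<^bsub>K\<^esub> f t) [^]\<^bsub>K\<^esub> n = \<one>\<^bsub>K\<^esub>"
  obtains h where "h \<in> hom G K" "\<And>s. s \<in> S \<Longrightarrow> h s = f s"
proof -
  interpret K: group K by fact
  have fK: "f s \<in> carrier K" if "s \<in> S" for s using f that by auto
  have ff: "f s \<otimes>\<^bsub>K\<^esub> f s = \<one>\<^bsub>K\<^esub>" if "s \<in> S" for s
    using rel[of s s 1] that fK S_involution by simp
  define ev where "ev = (\<lambda>ss. foldr (\<lambda>s x. f s \<otimes>\<^bsub>K\<^esub> x) ss \<one>\<^bsub>K\<^esub>)"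
  have ev_simps: "ev [] = \<one>\<^bsub>K\<^esub>" "\<And>s ss. ev (s # ss) = f s \<otimes>\<^bsub>K\<^esub> ev ss" by (simp_all add: ev_def)
  have ev_closed: "ev ss \<in> carrier K" if "set ss \<subseteq> S" for ss
    using that by (induction ss) (auto simp: ev_simps fK)
  have ev_append: "ev (a @ b) = ev a \<otimes>\<^bsub>K\<^esub> ev b" if "set a \<subseteq> S" "set b \<subseteq> S" for a b
    using that by (induction a) (auto simp: ev_simps ev_closed fK K.m_assoc)
  have ev_rev: "ev (rev a) \<otimes>\<^bsub>K\<^esub> ev a = \<one>\<^bsub>K\<^esub>" if "set a \<subseteq> S" for a
    using that
  proof (induction a)
    case (Cons s a)
    then have "ev (rev (s # a)) \<otimes>\<^bsub>K\<^esub> ev (s # a) = ev (rev a) \<otimes>\<^bsub>K\<^esub> (f s \<otimes>\<^bsub>K\<^esub> f s) \<otimes>\<^bsub>K\<^esub> ev a"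
      by (simp add: ev_append ev_simps fK ev_closed K.m_assoc)
    then show ?case using Cons by (simp add: ff ev_closed)
  qed (simp add: ev_simps)
  define D where "D = {ev ss | ss. set ss \<subseteq> S}"
  have DK: "x \<in> carrier K" if "x \<in> D" for x using that ev_closed by (auto simp: D_def)
  have D1: "\<one>\<^bsub>K\<^esub> \<in> D" unfolding D_def using ev_simps(1) by (auto intro!: exI[of _ "[]"])
  have Dm: "x \<otimes>\<^bsub>K\<^esub> y \<in> D" if xy: "x \<in> D" "y \<in> D" for x y
  proof -
    obtain a b where "set a \<subseteq> S" "x = ev a" "set b \<subseteq> S" "y = ev b" using xy by (auto simp: D_def)
    then show ?thesis unfolding D_def by (auto simp: ev_append intro!: exI[of _ "a @ b"])
  qed
  have Di: "\<exists>y\<in>D. y \<otimes>\<^bsub>K\<^esub> x = \<one>\<^bsub>K\<^esub>" if "x \<in> D" for x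
    using that ev_rev unfolding D_def by (auto, metis set_rev)
  have fD: "f s \<in> D" if "s \<in> S" for s
    using that unfolding D_def by (auto intro!: exI[of _ "[s]"] simp: ev_simps fK)
  define cls where "cls = (\<lambda>k. {ss. set ss \<subseteq> S \<and> ev ss = k})"
  have inj: "inj_on cls D"
    unfolding inj_on_def cls_def D_def by auto
  define dec where "dec = inv_into D cls"
  have dec: "dec (cls k) = k" if "k \<in> D" for k
    unfolding dec_def using inj that by simp
  define H :: "'a list set monoid" where
    "H = \<lparr>carrier = cls ` D, monoid.mult = (\<lambda>A B. cls (dec A \<otimes>\<^bsub>K\<^esub> dec B)), one = cls \<one>\<^bsub>K\<^esub>\<rparr>"
  have H1: "\<one>\<^bsub>H\<^esub> = cls \<one>\<^bsub>K\<^esub>" by (simp add: H_def)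
  have Hm: "cls x \<otimes>\<^bsub>H\<^esub> cls y = cls (x \<otimes>\<^bsub>K\<^esub> y)" if "x \<in> D" "y \<in> D" for x y
    using that by (simp add: H_def dec)
  have "group H"
  proof (rule groupI)
    fix x assume "x \<in> carrier H"
    then obtain k where "k \<in> D" "x = cls k" by (auto simp: H_def)
    moreover obtain y where "y \<in> D" "y \<otimes>\<^bsub>K\<^esub> k = \<one>\<^bsub>K\<^esub>" using Di \<open>k \<in> D\<close> by auto
    ultimately show "\<exists>y\<in>carrier H. y \<otimes>\<^bsub>H\<^esub> x = \<one>\<^bsub>H\<^esub>"
      by (intro bexI[of _ "cls y"]) (auto simp: Hm, simp_all add: H_def)
  qed (auto simp: H_def dec Dm D1 DK K.m_assoc)
  have pow: "(cls x) [^]\<^bsub>H\<^esub> (n::nat) = cls (x [^]\<^bsub>K\<^esub> n) \<and> x [^]\<^bsub>K\<^esub> n \<in> D" if "x \<in> D" for x n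
    by (induction n) (use that D1 in \<open>auto simp: nat_pow_def H_def dec Dm\<close>)
  have "\<exists>h\<in>hom G H. \<forall>s\<in>S. h s = cls (f s)"
  proof -
    have "\<forall>(H :: 'a list set monoid) f.
        group H \<and> f \<in> S \<rightarrow> carrier H \<and>
        (\<forall>s\<in>S. \<forall>t\<in>S. \<forall>n::nat. (s \<otimes> t) [^] n = \<one> \<longrightarrow> (f s \<otimes>\<^bsub>H\<^esub> f t) [^]\<^bsub>H\<^esub> n = \<one>\<^bsub>H\<^esub>)
        \<longrightarrow> (\<exists>h\<in>hom G H. \<forall>s\<in>S. h s = f s)"
      using coxeter unfolding coxeter_system_def by blast
    moreover have "(\<lambda>s. cls (f s)) \<in> S \<rightarrow> carrier H" by (auto simp: H_def fD)
    moreover have "\<forall>s\<in>S. \<forall>t\<in>S. \<forall>n::nat. (s \<otimes> t) [^] n = \<one> \<longrightarrow>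
        (cls (f s) \<otimes>\<^bsub>H\<^esub> cls (f t)) [^]\<^bsub>H\<^esub> n = \<one>\<^bsub>H\<^esub>"
      using rel by (simp add: Hm fD pow Dm H1)
    ultimately show ?thesis using \<open>group H\<close> by blast
  qed
  then obtain h where h: "h \<in> hom G H" "\<And>s. s \<in> S \<Longrightarrow> h s = cls (f s)" by auto
  have "(\<lambda>x. dec (h x)) \<in> hom G K"
  proof (rule homI)
    fix x assume "x \<in> W"
    then have "h x \<in> carrier H" using h(1) by (auto simp: hom_def)
    then show "dec (h x) \<in> carrier K" by (auto simp: H_def dec DK)
  next
    fix x y assume "x \<in> W" "y \<in> W"
    then have "h x \<in> carrier H" "h y \<in> carrier H" "h (x \<otimes> y) = h x \<otimes>\<^bsub>H\<^esub> h y" using h(1) by (auto simp: hom_def)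
    then show "dec (h (x \<otimes> y)) = dec (h x) \<otimes>\<^bsub>K\<^esub> dec (h y)" by (auto simp: H_def dec Dm)
  qed
  then show thesis using that[of "\<lambda>x. dec (h x)"] h(2) dec fD by auto
qed

definition sgn_grp :: "real monoid" where
  "sgn_grp = \<lparr>carrier = {1, -1}, monoid.mult = (*), one = 1\<rparr>"

lemma sgn_exists: "\<exists>h. h \<in> hom G sgn_grp \<and> (\<forall>s\<in>S. h s = -1)"
proof -
  have "group sgn_grp"
    by (rule groupI) (auto simp: sgn_grp_def)
  moreover have "(-1 \<otimes>\<^bsub>sgn_grp\<^esub> -1) [^]\<^bsub>sgn_grp\<^esub> n = \<one>\<^bsub>sgn_grp\<^esub>" for n :: nat
    by (induction n) (auto simp: sgn_grp_def nat_pow_def)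
  ultimately obtain h where "h \<in> hom G sgn_grp" "\<And>s. s \<in> S \<Longrightarrow> h s = -1"
    using universal_property[of sgn_grp "\<lambda>_. -1"] by (auto simp: sgn_grp_def)
  then show ?thesis by auto
qed

definition eps :: "'a \<Rightarrow> real" where "eps w = (-1) ^ len w"

text \<open>The homomorphism to the group of signs gives the same value on a word and on a shortest
  word for the same element, so their lengths have the same parity. This is what makes
  \<open>eps\<close> multiplicative.\<close>

lemma eps_word: assumes "set ss \<subseteq> S" shows "eps (wp ss) = (-1) ^ length ss"
proof -
  obtain h where h: "h \<in> hom G sgn_grp" "\<forall>s\<in>S. h s = -1" using sgn_exists by auto
  have mult: "h (x \<otimes> y) = h x * h y" if "x \<in> W" "y \<in> W" for x y
    using h(1) that by (auto simp: hom_def sgn_grp_def)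
  have "h \<one> \<in> {1,-1}" using h(1) by (auto simp: hom_def sgn_grp_def)
  then have h1: "h \<one> = 1" using mult[of \<one> \<one>] by auto
  have *: "h (wp ss) = (-1) ^ length ss" if "set ss \<subseteq> S" for ss
    using that by (induction ss) (auto simp: mult h h1)
  obtain ss' where "set ss' \<subseteq> S" "length ss' = len (wp ss)" "wp ss' = wp ss"
    using len_word[of "wp ss"] assms by auto
  then show ?thesis using *[OF assms] *[of ss'] by (simp add: eps_def)
qed

lemma eps_mult: assumes "x \<in> W" "y \<in> W" shows "eps (x \<otimes> y) = eps x * eps y"
proof -
  obtain a b where "set a \<subseteq> S" "wp a = x" "set b \<subseteq> S" "wp b = y" using assms word_exists by metis
  then show ?thesis using eps_word[of "a @ b"] eps_word[of a] eps_word[of b]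
    by (auto simp: wp_append power_add)
qed

lemma eps_S [simp]: "s \<in> S \<Longrightarrow> eps s = -1" and eps_one [simp]: "eps \<one> = 1"
  by (simp_all add: eps_def)

lemma eps_sq [simp]: "eps w * eps w = 1"
  by (simp add: eps_def flip: power_mult_distrib)

lemma eps_inv [simp]: "w \<in> W \<Longrightarrow> eps (inv w) = eps w" by (simp add: eps_def)

text \<open>The triangle inequality leaves a change of at most one; no change at all would
  contradict the sign.\<close>

lemma len_mult_S:
  assumes "w \<in> W" "s \<in> S" shows "len (w \<otimes> s) = Suc (len w) \<or> Suc (len (w \<otimes> s)) = len w"
proof -
  have "len (w \<otimes> s) \<le> Suc (len w)" using len_mult_le[of w s] assms by simp
  moreover have "len w \<le> Suc (len (w \<otimes> s))" using len_mult_le[of "w \<otimes> s" s] assms by simp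
  moreover have "len (w \<otimes> s) \<noteq> len w"
  proof
    assume "len (w \<otimes> s) = len w"
    then have "eps w = - eps w" using eps_mult[of w s] assms by (simp add: eps_def)
    then have "eps w = 0" by simp
    then show False by (simp add: eps_def)
  qed
  ultimately show ?thesis by linarith
qed

end

section \<open>The geometric representation\<close>

type_synonym 'a vec = "'a \<Rightarrow> real"

definition simple_root :: "'a \<Rightarrow> 'a vec" where "simple_root s = (\<lambda>r. if r = s then 1 else 0)"

lemma simple_root_simps [simp]: "simple_root s s = 1" "r \<noteq> s \<Longrightarrow> simple_root s r = 0" by (auto simp: simple_root_def)

lemma simple_root_nonneg [simp]: "0 \<le> simple_root s r" by (auto simp: simple_root_def)

text \<open>Chebyshev polynomials of the second kind, \<open>cheb c (Suc n)\<close> being U_n(c).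
  They are the coordinates of the roots of a rank two root system whose simple roots have form value
  \<open>- c\<close>: the finite case is c = cos (pi / m), the infinite one is c at least 1.\<close>

fun cheb :: "real \<Rightarrow> nat \<Rightarrow> real" where
  "cheb c 0 = 0"
| "cheb c (Suc 0) = 1"
| "cheb c (Suc (Suc n)) = 2 * c * cheb c (Suc n) - cheb c n"

lemma cheb_cos: "sin t * cheb (cos t) n = sin (n * t)"
proof (induction n rule: induct_nat_012)
  case (ge2 n)
  have "sin t * cheb (cos t) (Suc (Suc n)) = 2 * cos t * sin (Suc n * t) - sin (n * t)"
    using ge2 by (simp add: algebra_simps)
  also have "\<dots> = sin (Suc (Suc n) * t)"
  proof -
    have "sin (Suc (Suc n) * t) = sin (Suc n * t + t)" "sin (n * t) = sin (Suc n * t - t)"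
      by (simp_all add: algebra_simps)
    then show ?thesis by (simp only: sin_add sin_diff) (simp add: algebra_simps)
  qed
  finally show ?case .
qed auto

lemma cheb_1: "cheb 1 n = n"
  by (induction n rule: induct_nat_012) auto

lemma cheb_ge1_aux: "1 \<le> c \<Longrightarrow> cheb c n + 1 \<le> cheb c (Suc n) \<and> 0 \<le> cheb c n"
proof (induction n)
  case (Suc n)
  then have "cheb c n + 1 \<le> cheb c (Suc n)" "0 \<le> cheb c n" by auto
  moreover have "1 * cheb c (Suc n) \<le> c * cheb c (Suc n)"
    using Suc calculation by (intro mult_right_mono) auto
  moreover have "2 * c * cheb c (Suc n) = 2 * (c * cheb c (Suc n))" by simp
  ultimately show ?case unfolding cheb.simps(3) by linarith
qed auto

lemma cheb_Suc_ge: "1 \<le> c \<Longrightarrow> cheb c n + 1 \<le> cheb c (Suc n)"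
  and cheb_nonneg: "1 \<le> c \<Longrightarrow> 0 \<le> cheb c n"
  using cheb_ge1_aux by blast+

text \<open>The value is sin (n pi / m) / sin (pi / m), and n at most m keeps the angle in the upper
  half circle. For m = 1 the denominator vanishes, so that case is separate.\<close>

lemma cheb_nonneg_pi:
  assumes "0 < m" "n \<le> m" shows "0 \<le> cheb (cos (pi / real m)) n"
proof (cases "m = 1")
  case True
  then have "n = 0 \<or> n = 1" using assms by auto
  then show ?thesis by auto
next
  case False
  then have "1 < real m" using assms by simp
  then have "0 < pi / m" "pi / m < pi" by (auto simp: field_simps)
  then have "0 < sin (pi / m)" by (rule sin_gt_zero)
  moreover have "0 \<le> sin (n * (pi / m))"
    using assms by (intro sin_ge_zero) (auto simp: field_simps)
  ultimately show ?thesis using cheb_cos[of "pi / m" n] by (metis zero_le_mult_iff not_less)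
qed

text \<open>The recursion appends on the right, so a nonempty word always ends in \<open>x\<close>:
  the last letter acts first on a vector, and it is the one that shows a descent.\<close>

fun alt_word :: "'a \<Rightarrow> 'a \<Rightarrow> nat \<Rightarrow> 'a list" where
  "alt_word x y 0 = []"
| "alt_word x y (Suc k) = alt_word y x k @ [x]"

lemma length_alt_word [simp]: "length (alt_word x y k) = k"
  by (induction k arbitrary: x y) auto

lemma set_alt_word: "set (alt_word x y k) \<subseteq> {x, y}"
  by (induction k arbitrary: x y) auto

lemma alt_word_add: "\<exists>p. set p \<subseteq> {x, y} \<and> length p = j \<and> alt_word x y (j + k) = p @ alt_word x y k"
proof (induction k arbitrary: x y)
  case 0 then show ?case using set_alt_word[of x y j] by (intro exI[of _ "alt_word x y j"]) auto
next
  case (Suc k)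
  then obtain p where "set p \<subseteq> {y, x}" "length p = j" "alt_word y x (j + k) = p @ alt_word y x k" by blast
  then show ?case by (intro exI[of _ p]) auto
qed

lemma distinct_adj_alt_word:
  assumes "distinct_adj a" "set a \<subseteq> {x, y}" "x \<noteq> y" "a \<noteq> [] \<Longrightarrow> last a = x"
  shows "a = alt_word x y (length a)"
  using assms
proof (induction a arbitrary: x y rule: rev_induct)
  case (snoc z a)
  then have z: "z = x" by simp
  have "a = alt_word y x (length a)"
  proof (rule snoc.IH)
    show "distinct_adj a" using snoc.prems by (auto simp: distinct_adj_append_iff)
    show "last a = y" if "a \<noteq> []"
    proof -
      have "last a \<noteq> x" using snoc.prems z that by (auto simp: distinct_adj_append_iff)
      then show ?thesis using snoc.prems last_in_set[OF that] by auto
    qed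
  qed (use snoc.prems in auto)
  then show ?case using z by simp
qed auto

lemma not_distinct_adj: "\<not> distinct_adj a \<Longrightarrow> \<exists>p r q. a = p @ [r, r] @ q"
proof (induction a)
  case (Cons x a)
  show ?case
  proof (cases "distinct_adj a")
    case True
    then have "a \<noteq> []" "hd a = x" using Cons.prems by (auto simp: distinct_adj_Cons)
    then show ?thesis by (intro exI[of _ "[]"] exI[of _ x] exI[of _ "tl a"]) (cases a, auto)
  next
    case False
    then obtain p r q where "a = p @ [r, r] @ q" using Cons by blast
    then show ?thesis by (intro exI[of _ "x # p"]) auto
  qed
qed auto

definition lin_grp :: "('a vec \<Rightarrow> 'a vec) monoid" where
  "lin_grp = \<lparr>carrier = {f. bij f}, monoid.mult = (\<circ>), one = id\<rparr>"

lemma group_lin_grp: "group lin_grp"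
proof (rule groupI)
  fix x :: "'a vec \<Rightarrow> 'a vec" assume "x \<in> carrier lin_grp"
  then show "\<exists>y\<in>carrier lin_grp. y \<otimes>\<^bsub>lin_grp\<^esub> x = \<one>\<^bsub>lin_grp\<^esub>"
    by (intro bexI[of _ "inv_into UNIV x"]) (auto simp: lin_grp_def bij_imp_bij_inv bij_is_inj)
qed (auto simp: lin_grp_def bij_comp comp_assoc)

lemma lin_grp_pow: "f [^]\<^bsub>lin_grp\<^esub> (n::nat) = f ^^ n"
  by (induction n) (simp_all add: lin_grp_def nat_pow_def funpow_Suc_right del: funpow.simps(2))

section \<open>The Tits form and the reflection representation\<close>

context cox
begin

text \<open>Matrix of the Tits form. An infinite order is \<open>0\<close> here, and its entry -1 is
  the limit of - cos (pi / m).\<close>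

definition cos_mat :: "'a \<Rightarrow> 'a \<Rightarrow> real" where
  "cos_mat s t = (if s = t then 1 else if ord (s \<otimes> t) = 0 then -1 else - cos (pi / real (ord (s \<otimes> t))))"

lemma ord_sym: "s \<in> S \<Longrightarrow> t \<in> S \<Longrightarrow> ord (t \<otimes> s) = ord (s \<otimes> t)"
  using ord_inv[of "s \<otimes> t"] by (simp add: inv_mult_group)

lemma ord_ne_1: assumes "s \<in> S" "t \<in> S" "s \<noteq> t" shows "ord (s \<otimes> t) \<noteq> 1"
proof
  assume "ord (s \<otimes> t) = 1"
  then have "s \<otimes> t = \<one>" using assms ord_eq_1[of "s \<otimes> t"] by auto
  then have "s = t" using assms by (metis S_closed inv_S inv_equality)
  then show False using assms by simp
qed

lemma cos_mat_sym: "s \<in> S \<Longrightarrow> t \<in> S \<Longrightarrow> cos_mat s t = cos_mat t s"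
  by (auto simp: cos_mat_def ord_sym)

lemma cos_mat_same [simp]: "cos_mat s s = 1" by (simp add: cos_mat_def)

lemma cos_mat_le_0: assumes "s \<in> S" "t \<in> S" "s \<noteq> t" shows "cos_mat s t \<le> 0"
proof (cases "ord (s \<otimes> t) = 0")
  case False
  then have "2 \<le> real (ord (s \<otimes> t))" using ord_ne_1[OF assms] by linarith
  then have "0 \<le> pi / ord (s \<otimes> t)" "pi / ord (s \<otimes> t) \<le> pi / 2" by (auto simp: field_simps)
  then have "0 \<le> cos (pi / ord (s \<otimes> t))" by (intro cos_ge_zero) (use pi_gt_zero in linarith)+
  then show ?thesis using False assms by (simp add: cos_mat_def)
qed (use assms in \<open>auto simp: cos_mat_def\<close>)

definition form :: "'a vec \<Rightarrow> 'a vec \<Rightarrow> real" where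
  "form u v = (\<Sum>s\<in>S. \<Sum>t\<in>S. u s * cos_mat s t * v t)"

definition form_at :: "'a vec \<Rightarrow> 'a \<Rightarrow> real" where "form_at v t = (\<Sum>s\<in>S. v s * cos_mat s t)"

definition reflect :: "'a \<Rightarrow> 'a vec \<Rightarrow> 'a vec" where "reflect t v = (\<lambda>r. v r - 2 * form_at v t * simple_root t r)"

lemma form_sym: "form u v = form v u"
  unfolding form_def by (subst sum.swap) (auto intro!: sum.cong simp: cos_mat_sym mult_ac)

lemma form_lin: "form (\<lambda>r. a * u r + b * v r) w = a * form u w + b * form v w"
  unfolding form_def by (simp add: sum_distrib_left sum.distrib algebra_simps)

lemma form_lin2: "form w (\<lambda>r. a * u r + b * v r) = a * form w u + b * form w v"
  using form_lin[of a u b v w] by (simp only: form_sym[of w])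

lemma form_simple_root: assumes "t \<in> S" shows "form v (simple_root t) = form_at v t"
proof -
  have "(\<Sum>r\<in>S. v s * cos_mat s r * simple_root t r) = v s * cos_mat s t" for s
    using assms finS by (subst sum.remove[of _ t]) (auto intro!: sum.neutral)
  then show ?thesis by (simp add: form_def form_at_def)
qed

lemma form_ax': "t \<in> S \<Longrightarrow> form (simple_root t) v = form_at v t"
  by (subst form_sym) (rule form_simple_root)

lemma form_form_at: "form u v = (\<Sum>t\<in>S. v t * form_at u t)"
  unfolding form_def form_at_def by (subst sum.swap) (simp add: sum_distrib_left mult_ac)

lemma form_at_lin: "form_at (\<lambda>r. a * u r + b * v r) t = a * form_at u t + b * form_at v t"
  by (simp add: form_at_def sum_distrib_left sum.distrib algebra_simps)

lemma form_at_simple_root: assumes "s \<in> S" shows "form_at (simple_root s) t = cos_mat s t"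
  unfolding form_at_def using assms finS by (subst sum.remove[of _ s]) (auto intro!: sum.neutral)

lemma reflect_alt: "reflect t v = (\<lambda>r. 1 * v r + (- 2 * form_at v t) * simple_root t r)"
  by (simp add: reflect_def)

lemma form_at_refl: "t \<in> S \<Longrightarrow> form_at (reflect t v) s = form_at v s - 2 * form_at v t * cos_mat t s"
  unfolding reflect_alt form_at_lin by (simp add: form_at_simple_root)

lemma reflect_refl [simp]: "t \<in> S \<Longrightarrow> reflect t (reflect t v) = v"
  unfolding reflect_def[of t "reflect t v"] by (rule ext) (simp add: form_at_refl, simp add: reflect_def)

lemma form_refl: "t \<in> S \<Longrightarrow> form (reflect t u) (reflect t v) = form u v"
  unfolding reflect_alt form_lin form_lin2
  by (simp add: form_simple_root form_ax' form_at_simple_root algebra_simps)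

lemma reflect_lin: "reflect t (\<lambda>r. a * u r + b * v r) = (\<lambda>r. a * reflect t u r + b * reflect t v r)"
  by (simp add: reflect_def form_at_lin algebra_simps)

text \<open>The product of the two reflections rotates the plane of the two simple roots by twice
  \<open>x\<close>, which gives closed formulas for the multiples of them that are added to
  \<open>v\<close>. The formulas are multiplied by the squared sine to avoid division; when sin (N
  x) = 0 both right-hand sides vanish, which is how \<open>reflect_rel\<close> uses them.\<close>

lemma reflect_pow:
  fixes x :: real
  assumes st: "s \<in> S" "t \<in> S" "s \<noteq> t" and c: "cos_mat s t = - cos x"
  shows "\<exists>X Y. ((reflect s \<circ> reflect t) ^^ N) v = (\<lambda>r. v r + X * simple_root s r + Y * simple_root t r) \<and>
     (sin x)\<^sup>2 * X = -2 * (sin (real N * x) * sin (real (Suc N) * x) * form_at v t + (sin (real N * x))\<^sup>2 * form_at v s) \<and>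
     (sin x)\<^sup>2 * Y = -2 * ((sin (real N * x))\<^sup>2 * form_at v t + sin (real N * x) * sin (real N * x - x) * form_at v s)"
proof (induction N)
  case (Suc N)
  then obtain X Y where XY: "((reflect s \<circ> reflect t) ^^ N) v = (\<lambda>r. v r + X * simple_root s r + Y * simple_root t r)"
    "(sin x)\<^sup>2 * X = -2 * (sin (real N * x) * sin (real (Suc N) * x) * form_at v t + (sin (real N * x))\<^sup>2 * form_at v s)"
    "(sin x)\<^sup>2 * Y = -2 * ((sin (real N * x))\<^sup>2 * form_at v t + sin (real N * x) * sin (real N * x - x) * form_at v s)" by blast
  define p where "p = form_at v s" define q where "q = form_at v t"
  let ?u = "\<lambda>r. v r + X * simple_root s r + Y * simple_root t r"
  have u: "?u = (\<lambda>r. 1 * (1 * v r + X * simple_root s r) + Y * simple_root t r)" by simp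
  have pu: "form_at ?u r = form_at v r + X * cos_mat s r + Y * cos_mat t r" for r
    unfolding u form_at_lin using st by (simp add: form_at_simple_root)
  define c where "c = cos x"
  have ct: "cos_mat t s = - c" "cos_mat s t = - c" using c st by (simp_all add: cos_mat_sym c_def)
  define Y' where "Y' = Y - 2 * (q - c * X + Y)"
  define X' where "X' = X - 2 * (p + X - c * Y + 2 * c * (q - c * X + Y))"
  have "((reflect s \<circ> reflect t) ^^ Suc N) v = reflect s (reflect t ?u)" using XY(1) by simp
  also have "\<dots> = (\<lambda>r. v r + X' * simple_root s r + Y' * simple_root t r)"
    unfolding reflect_def[of s] form_at_refl[OF st(2)] unfolding reflect_def[of t] pu ct
    by (auto simp: X'_def Y'_def p_def q_def algebra_simps)
  finally have 1: "((reflect s \<circ> reflect t) ^^ Suc N) v = (\<lambda>r. v r + X' * simple_root s r + Y' * simple_root t r)" .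
  define a where "a = sin (real N * x)" define b where "b = cos (real N * x)" define d where "d = sin x"
  have sx: "real (Suc n) * x = real n * x + x" for n by (simp add: algebra_simps)
  have s1: "sin (real (Suc N) * x) = a * c + b * d"
    unfolding sx sin_add by (simp add: a_def b_def c_def d_def)
  have c1: "cos (real (Suc N) * x) = b * c - a * d"
    unfolding sx cos_add by (simp add: a_def b_def c_def d_def)
  have s2: "sin (real (Suc (Suc N)) * x) = (a * c + b * d) * c + (b * c - a * d) * d"
    unfolding sx[of "Suc N"] sin_add s1 c1 by (simp add: c_def d_def)
  have s0: "sin (real N * x - x) = a * c - b * d"
    unfolding sin_diff by (simp add: a_def b_def c_def d_def)
  have s0': "sin (real (Suc N) * x - x) = a"
    unfolding sx by (simp add: a_def)
  have py: "d\<^sup>2 + c\<^sup>2 = 1" "a\<^sup>2 + b\<^sup>2 = 1" by (simp_all add: a_def b_def c_def d_def)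
  have X: "d\<^sup>2 * X = -2 * (a * (a * c + b * d) * q + a\<^sup>2 * p)"
   and Y: "d\<^sup>2 * Y = -2 * (a\<^sup>2 * q + a * (a * c - b * d) * p)"
    using XY(2,3) unfolding s1 s0 s0' by (simp_all add: a_def d_def p_def q_def)
  \<comment> \<open>The two Pythagorean relations are carried along as quantities that happen to be
    zero; this turns the induction step into polynomial identities.\<close>
  define e1 where "e1 = d\<^sup>2 + c\<^sup>2 - 1" define e2 where "e2 = a\<^sup>2 + b\<^sup>2 - 1"
  have e: "e1 = 0" "e2 = 0" using py by (simp_all add: e1_def e2_def)
  have "d\<^sup>2 * Y' = - (d\<^sup>2 * Y) - 2 * d\<^sup>2 * q + 2 * c * (d\<^sup>2 * X)" by (simp add: Y'_def algebra_simps)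
  also have "\<dots> = -2 * ((a * c + b * d)\<^sup>2 * q + (a * c + b * d) * a * p)
     + q * (- 2 * a\<^sup>2 * e1 + 2 * d\<^sup>2 * e2)"
    unfolding X Y e1_def e2_def by (simp add: algebra_simps power2_eq_square)
  finally have Y2: "d\<^sup>2 * Y' = -2 * ((a * c + b * d)\<^sup>2 * q + (a * c + b * d) * a * p)" using e by simp
  have "d\<^sup>2 * X' = (4 * c\<^sup>2 - 1) * (d\<^sup>2 * X) - 2 * c * (d\<^sup>2 * Y) - 2 * d\<^sup>2 * p - 4 * c * d\<^sup>2 * q"
    by (simp add: X'_def algebra_simps power2_eq_square)
  also have "\<dots> = -2 * ((a * c + b * d) * ((a * c + b * d) * c + (b * c - a * d) * d) * q + (a * c + b * d)\<^sup>2 * p)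
    + p * (- 2 * a\<^sup>2 * e1 + 2 * d\<^sup>2 * e2) + q * (- (6 * a\<^sup>2 * c + 2 * a * b * d) * e1 + 4 * c * d\<^sup>2 * e2)"
    unfolding X Y e1_def e2_def by (simp add: algebra_simps power2_eq_square)
  finally have X2: "d\<^sup>2 * X' = -2 * ((a * c + b * d) * ((a * c + b * d) * c + (b * c - a * d) * d) * q + (a * c + b * d)\<^sup>2 * p)"
    using e by simp
  show ?case
    using 1 X2 Y2 unfolding s1 s0' s2 d_def p_def q_def by blast
next
  case 0 show ?case by (intro exI[of _ 0]) simp
qed

lemma reflect_rel:
  assumes "s \<in> S" "t \<in> S" "(s \<otimes> t) [^] (n::nat) = \<one>"
  shows "(reflect s \<circ> reflect t) ^^ n = id"
proof (cases "s = t")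
  case True
  have "reflect s \<circ> reflect s = id" using assms by auto
  then show ?thesis using True by (simp add: id_funpow)
next
  case False
  let ?m = "ord (s \<otimes> t)"
  have dv: "?m dvd n" using assms pow_eq_id[of "s \<otimes> t" n] by auto
  show ?thesis
  proof (cases "?m = 0")
    case True then show ?thesis using dv by auto
  next
    case m: False
    then have "1 < real ?m" using ord_ne_1[OF assms(1,2) False] by linarith
    define x where "x = pi / real ?m"
    have "0 < x" "x < pi" using \<open>1 < real ?m\<close> by (auto simp: x_def field_simps)
    then have sx: "sin x \<noteq> 0" using sin_gt_zero[of x] by simp
    have cmx: "cos_mat s t = - cos x" using m False by (simp add: cos_mat_def x_def)
    have mx: "sin (?m * x) = 0" using m by (simp add: x_def)
    have "((reflect s \<circ> reflect t) ^^ ?m) v = v" for v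
    proof -
      obtain X Y where "((reflect s \<circ> reflect t) ^^ ?m) v = (\<lambda>r. v r + X * simple_root s r + Y * simple_root t r)"
        "(sin x)\<^sup>2 * X = 0" "(sin x)\<^sup>2 * Y = 0"
        using reflect_pow[OF assms(1,2) False cmx, of ?m v] by (auto simp: mx)
      then show ?thesis using sx by auto
    qed
    then have "(reflect s \<circ> reflect t) ^^ ?m = id" by auto
    moreover obtain j where j: "n = ?m * j" using dv by auto
    moreover have "(reflect s \<circ> reflect t) ^^ (?m * j) = ((reflect s \<circ> reflect t) ^^ ?m) ^^ j"
      by (simp only: funpow_mult mult.commute)
    ultimately show ?thesis by (simp only: j id_funpow)
  qed
qed

lemma act_exists: "\<exists>h. h \<in> hom G lin_grp \<and> (\<forall>s\<in>S. h s = reflect s)"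
proof -
  have b: "bij (reflect s)" if "s \<in> S" for s
    by (rule o_bij[of "reflect s"]) (use that in auto)
  have r: "(reflect s \<otimes>\<^bsub>lin_grp\<^esub> reflect t) [^]\<^bsub>lin_grp\<^esub> n = \<one>\<^bsub>lin_grp\<^esub>"
    if "s \<in> S" "t \<in> S" "(s \<otimes> t) [^] (n::nat) = \<one>" for s t n
    using reflect_rel[OF that] unfolding lin_grp_pow by (simp add: lin_grp_def)
  have "reflect \<in> S \<rightarrow> carrier lin_grp" using b by (simp add: lin_grp_def)
  then show ?thesis by (rule universal_property[OF group_lin_grp]) (use r in auto)
qed

definition act :: "'a \<Rightarrow> 'a vec \<Rightarrow> 'a vec" where
  "act = (SOME h. h \<in> hom G lin_grp \<and> (\<forall>s\<in>S. h s = reflect s))"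

lemma act_hom: "act \<in> hom G lin_grp" and act_S [simp]: "s \<in> S \<Longrightarrow> act s = reflect s"
  using someI_ex[OF act_exists] unfolding act_def by auto

lemma act_mult: "x \<in> W \<Longrightarrow> y \<in> W \<Longrightarrow> act (x \<otimes> y) v = act x (act y v)"
  using act_hom by (auto simp: hom_def lin_grp_def)

lemma act_one [simp]: "act \<one> v = v"
proof -
  have "bij (act \<one>)" using act_hom by (auto simp: hom_def lin_grp_def)
  moreover have "act \<one> (act \<one> v) = act \<one> v" using act_mult[of \<one> \<one> v] by simp
  ultimately show ?thesis by (metis bij_is_inj inj_def)
qed

lemma act_inv [simp]: "x \<in> W \<Longrightarrow> act (inv x) (act x v) = v" "x \<in> W \<Longrightarrow> act x (act (inv x) v) = v"
  using act_mult[of "inv x" x v] act_mult[of x "inv x" v] by auto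

lemma act_word: "set ss \<subseteq> S \<Longrightarrow> act (wp ss) v = foldr reflect ss v"
  by (induction ss) (auto simp: act_mult)

lemma act_lin:
  assumes "w \<in> W" shows "act w (\<lambda>r. a * u r + b * v r) = (\<lambda>r. a * act w u r + b * act w v r)"
proof -
  obtain ss where ss: "set ss \<subseteq> S" "wp ss = w" using word_exists assms by blast
  have "foldr reflect ss (\<lambda>r. a * u r + b * v r) = (\<lambda>r. a * foldr reflect ss u r + b * foldr reflect ss v r)"
    using ss(1) by (induction ss) (auto simp: reflect_lin)
  then show ?thesis using act_word[OF ss(1)] ss(2) by simp
qed

lemma form_act: assumes "w \<in> W" shows "form (act w u) (act w v) = form u v"
proof -
  obtain ss where ss: "set ss \<subseteq> S" "wp ss = w" using word_exists assms by blast
  have "form (foldr reflect ss u) (foldr reflect ss v) = form u v"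
    using ss(1) by (induction ss) (auto simp: form_refl)
  then show ?thesis using act_word[OF ss(1)] ss(2) by simp
qed

lemma act_out: assumes "w \<in> generate G U" "U \<subseteq> S" "r \<notin> U" shows "act w v r = v r"
proof -
  obtain ss where ss: "set ss \<subseteq> U" "wp ss = w" using generate_words assms by blast
  have "foldr reflect ss v r = v r"
    using ss(1) assms(3) by (induction ss) (auto simp: reflect_def simple_root_def)
  then show ?thesis using act_word[of ss] ss assms by auto
qed

text \<open>Each reflection replaces a pair of consecutive Chebyshev coefficients by the next pair;
  the offset \<open>j\<close> is there for the induction. With \<open>j = 0\<close> the initial
  vector is \<open>simple_root y\<close>, so this computes the image of a simple root under an
  alternating word.\<close>

lemma alt_comb:
  assumes "x \<in> S" "y \<in> S" "x \<noteq> y" "c = - cos_mat x y"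
  shows "\<exists>z z'. {z, z'} = {x, y} \<and>
    foldr reflect (alt_word x y k) (\<lambda>r. cheb c (Suc j) * simple_root y r + cheb c j * simple_root x r) =
    (\<lambda>r. cheb c (Suc (j + k)) * simple_root z r + cheb c (j + k) * simple_root z' r)"
  using assms
proof (induction k arbitrary: x y j)
  case 0 then show ?case by (intro exI[of _ y] exI[of _ x]) auto
next
  case (Suc k)
  have "reflect x (\<lambda>r. cheb c (Suc j) * simple_root y r + cheb c j * simple_root x r) =
      (\<lambda>r. cheb c (Suc (Suc j)) * simple_root x r + cheb c (Suc j) * simple_root y r)"
    unfolding reflect_def form_at_lin using Suc.prems cos_mat_sym[of y x] by (intro ext) (simp add: form_at_simple_root algebra_simps)
  then have *: "foldr reflect (alt_word x y (Suc k)) (\<lambda>r. cheb c (Suc j) * simple_root y r + cheb c j * simple_root x r) =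
     foldr reflect (alt_word y x k) (\<lambda>r. cheb c (Suc (Suc j)) * simple_root x r + cheb c (Suc j) * simple_root y r)" by simp
  from Suc.IH[of y x "Suc j"] Suc.prems cos_mat_sym[of x y] obtain z z' where z: "{z, z'} = {y, x}"
    "foldr reflect (alt_word y x k) (\<lambda>r. cheb c (Suc (Suc j)) * simple_root x r + cheb c (Suc j) * simple_root y r) =
    (\<lambda>r. cheb c (Suc (Suc j + k)) * simple_root z r + cheb c (Suc j + k) * simple_root z' r)" by auto
  show ?case unfolding * z(2) using z(1) by (intro exI[of _ z] exI[of _ z']) auto
qed

text \<open>For \<open>k\<close> equal to the order of \<open>s \<otimes> t\<close> the right-hand
  side is trivial, and the two alternating words represent the same element: the braid
  relation.\<close>

lemma alt_word_quotient:
  assumes "s \<in> S" "t \<in> S" shows "inv (wp (alt_word s t k)) \<otimes> wp (alt_word t s k) = (s \<otimes> t) [^] k"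
proof -
  have cl: "set (alt_word x y k) \<subseteq> S" if "x \<in> S" "y \<in> S" for x y k using set_alt_word[of x y k] that by auto
  show ?thesis
  proof (induction k)
    case (Suc k)
    let ?P = "wp (alt_word t s k)" and ?Q = "wp (alt_word s t k)"
    have PQ: "?P \<in> W" "?Q \<in> W" using cl assms by auto
    have st: "s \<in> W" "t \<in> W" using assms by auto
    have "inv (wp (alt_word s t (Suc k))) \<otimes> wp (alt_word t s (Suc k)) = inv (?P \<otimes> s) \<otimes> (?Q \<otimes> t)"
      using assms cl by simp
    also have "\<dots> = s \<otimes> inv (inv ?Q \<otimes> ?P) \<otimes> t"
      using PQ assms by (simp add: inv_mult_group m_assoc)
    also have "\<dots> = s \<otimes> inv ((s \<otimes> t) [^] k) \<otimes> t" using Suc by simp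
    also have "inv ((s \<otimes> t) [^] k) = (t \<otimes> s) [^] k"
      using nat_pow_inv[of "s \<otimes> t" k] assms by (simp add: inv_mult_group)
    also have "s \<otimes> (t \<otimes> s) [^] k \<otimes> t = (s \<otimes> t) [^] Suc k"
    proof (induction k)
      case (Suc k)
      have "s \<otimes> (t \<otimes> s) [^] Suc k \<otimes> t = s \<otimes> (t \<otimes> s) [^] k \<otimes> t \<otimes> (s \<otimes> t)"
        using st by (simp add: m_assoc)
      then show ?case using Suc by simp
    qed (use st in simp)
    finally show ?case .
  qed simp
qed

text \<open>Split off the part of \<open>w\<close> in the dihedral group of \<open>s\<close> and a
  descent \<open>t\<close>: \<open>w = v a\<close> with lengths adding and \<open>v\<close> as short
  as possible. By induction \<open>v\<close> keeps both simple roots nonnegative. The word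
  \<open>a\<close> alternates, ends in \<open>t\<close> (if it is not empty) and is shorter than the
  order of \<open>s \<otimes> t\<close> if that is finite, so it sends \<open>simple_root s\<close>
  to a combination of the two with nonnegative Chebyshev coefficients.\<close>

theorem act_nonneg:
  assumes "w \<in> W" "s \<in> S" "len w < len (w \<otimes> s)"
  shows "0 \<le> act w (simple_root s) r"
  using assms
proof (induction "len w" arbitrary: w s r rule: less_induct)
  case less
  show ?case
  proof (cases "len w = 0")
    case True
    then have "w = \<one>" using len_0 less.prems by blast
    then show ?thesis by simp
  next
    case False
    obtain ss where ss: "set ss \<subseteq> S" "length ss = len w" "wp ss = w" using len_word less.prems by blast
    then obtain ss' t where sst: "ss = ss' @ [t]" using False by (cases ss rule: rev_cases) auto
    have t: "t \<in> S" "set ss' \<subseteq> S" using ss sst by auto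
    have "w = wp ss' \<otimes> t" using ss(3) sst t by simp
    then have wt: "w \<otimes> t = wp ss'" using t by simp
    have st: "s \<noteq> t" using wt len_le[of ss'] t ss sst less.prems by auto
    define A where "A = {(v, a). v \<in> W \<and> set a \<subseteq> {s, t} \<and> v \<otimes> wp a = w \<and> len v + length a = len w}"
    have lwt: "len (w \<otimes> t) + 1 = len w"
      using wt len_le[of ss'] t ss sst len_mult_S[of w t] less.prems by auto
    have "(w \<otimes> t, [t]) \<in> A" using less.prems t lwt by (auto simp: A_def)
    then obtain va where va: "va \<in> A" "\<And>x. x \<in> A \<Longrightarrow> len (fst va) \<le> len (fst x)"
      using ex_has_least_nat[of "\<lambda>x. x \<in> A" _ "\<lambda>x. len (fst x)"] by blast
    obtain v a where [simp]: "va = (v, a)" by (cases va)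
    have v: "v \<in> W" "set a \<subseteq> {s, t}" "v \<otimes> wp a = w" "len v + length a = len w"
      and least: "\<And>v' a'. (v', a') \<in> A \<Longrightarrow> len v \<le> len v'" using va by (auto simp: A_def)
    have aS: "set a \<subseteq> S" using v t less.prems by auto
    have comb_len: "len v < len w" using least[OF \<open>(w \<otimes> t, [t]) \<in> A\<close>] lwt by simp
    \<comment> \<open>Otherwise \<open>x\<close> could be moved from the end of \<open>v\<close> to
      the front of the word, against the minimality of \<open>v\<close>.\<close>
    have up: "len v < len (v \<otimes> x)" if x: "x \<in> {s, t}" for x
    proof (rule ccontr)
      assume "\<not> len v < len (v \<otimes> x)"
      then have l: "Suc (len (v \<otimes> x)) = len v" using len_mult_S[of v x] v x t less.prems by auto
      have "x \<in> S" using x t less.prems by auto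
      then have "v \<otimes> x \<otimes> (x \<otimes> wp a) = v \<otimes> wp a" using v(1) aS by (simp add: m_assoc)
      then have "v \<otimes> x \<otimes> (x \<otimes> wp a) = w" using v(3) by simp
      then have "(v \<otimes> x, x # a) \<in> A" using v x t less.prems l by (auto simp: A_def)
      from least[OF this] l show False by simp
    qed
    have min1: "length a \<le> length b" if b: "set b \<subseteq> {s, t}" "wp b = wp a" for b
    proof -
      have "set b \<subseteq> S" using b t less.prems by auto
      then have "len w \<le> len v + length b"
        using len_mult_le[of v "wp b"] len_le[of b] v b wp_closed[OF aS] by auto
      then show ?thesis using v by simp
    qed
    \<comment> \<open>A word of the same length ending in \<open>s\<close> would make
      \<open>w \<otimes> s\<close> shorter than \<open>w\<close>.\<close>
    have min2: False if b: "set b \<subseteq> {s, t}" "wp (b @ [s]) = wp a" "length (b @ [s]) = length a" for b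
    proof -
      have "set b \<subseteq> S" using b t less.prems by auto
      then have "wp a = wp b \<otimes> s" using b(2) less.prems by simp
      then have "w = v \<otimes> (wp b \<otimes> s)" using v(3) by simp
      then have "w = v \<otimes> wp b \<otimes> s" using v(1) \<open>set b \<subseteq> S\<close> less.prems by (simp add: m_assoc)
      then have "w \<otimes> s = v \<otimes> wp b" using v(1) \<open>set b \<subseteq> S\<close> less.prems by simp
      then have "len (w \<otimes> s) \<le> len v + length b"
        using len_mult_le[of v "wp b"] len_le[of b] v(1) \<open>set b \<subseteq> S\<close> by simp
      then show False using v(4) b(3) less.prems(3) by simp
    qed
    have da: "distinct_adj a"
    proof (rule ccontr)
      assume "\<not> distinct_adj a"
      then obtain p x q where a: "a = p @ [x, x] @ q" using not_distinct_adj by blast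
      then have "wp (p @ q) = wp a" using aS by (simp add: wp_append)
      then show False using min1[of "p @ q"] v(2) unfolding a by simp
    qed
    have la: "last a = t" if ne: "a \<noteq> []"
    proof (rule ccontr)
      assume "last a \<noteq> t"
      then have "last a = s" using last_in_set[OF ne] v(2) by auto
      then obtain b where "a = b @ [s]" using ne by (cases a rule: rev_cases) auto
      then show False using min2[of b] v(2) by simp
    qed
    have "set a \<subseteq> {t, s}" using v(2) by auto
    then have alt_word: "a = alt_word t s (length a)" by (rule distinct_adj_alt_word[OF da _ st[symmetric] la])
    \<comment> \<open>A word at least as long as the order ends in a full alternating word, which
      the braid relation rewrites so that it ends in \<open>s\<close>.\<close>
    have short: "length a < ord (s \<otimes> t)" if m: "0 < ord (s \<otimes> t)"
    proof (rule ccontr)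
      let ?m = "ord (s \<otimes> t)"
      assume "\<not> length a < ?m"
      then obtain j where j: "length a = j + ?m" by (metis le_add_diff_inverse2 not_less)
      then obtain p where p: "set p \<subseteq> {t, s}" "length p = j" "a = p @ alt_word t s ?m"
        using alt_word_add[of t s j ?m] unfolding j[symmetric] alt_word[symmetric] by blast
      have cl: "set (alt_word s t ?m) \<subseteq> S" "set (alt_word t s ?m) \<subseteq> S" "set p \<subseteq> S"
        using set_alt_word[of s t ?m] set_alt_word[of t s ?m] t less.prems p by auto
      have "inv (wp (alt_word s t ?m)) \<otimes> wp (alt_word t s ?m) = \<one>"
        using alt_word_quotient[of s t ?m] t less.prems by simp
      then have "inv (wp (alt_word t s ?m)) = inv (wp (alt_word s t ?m))" using cl by (intro inv_equality) auto
      then have "wp (alt_word s t ?m) = wp (alt_word t s ?m)" using cl inv_inv wp_closed by metis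
      then have e: "wp (p @ alt_word s t ?m) = wp a" using cl p(3) by (simp add: wp_append)
      obtain m' where "?m = Suc m'" using m by (cases ?m) auto
      then have "p @ alt_word s t ?m = (p @ alt_word t s m') @ [s]" by simp
      then show False using min2[of "p @ alt_word t s m'"] e p j set_alt_word[of t s m'] \<open>?m = Suc m'\<close> by auto
    qed
    define c where "c = - cos_mat t s"
    have nonneg: "0 \<le> cheb c n" if "n \<le> Suc (length a)" for n
    proof (cases "ord (t \<otimes> s) = 0")
      case True
      then have "c = 1" using st by (simp add: c_def cos_mat_def)
      then show ?thesis using cheb_1 by simp
    next
      case False
      then have "c = cos (pi / ord (t \<otimes> s))" using st by (simp add: c_def cos_mat_def)
      moreover have "n \<le> ord (t \<otimes> s)" using short ord_sym[of s t] False t less.prems that by auto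
      ultimately show ?thesis using cheb_nonneg_pi False by simp
    qed
    obtain z z' where z: "{z, z'} = {t, s}"
      "foldr reflect a (simple_root s) = (\<lambda>r. cheb c (Suc (length a)) * simple_root z r + cheb c (length a) * simple_root z' r)"
      using alt_comb[of t s c "length a" 0] t less.prems st c_def alt_word by auto
    have "act w (simple_root s) = act (v \<otimes> wp a) (simple_root s)" by (simp only: v(3))
    also have "\<dots> = act v (foldr reflect a (simple_root s))"
      using v(1) aS act_word[OF aS] by (simp add: act_mult)
    also have "\<dots> = (\<lambda>r. cheb c (Suc (length a)) * act v (simple_root z) r + cheb c (length a) * act v (simple_root z') r)"
      unfolding z(2) act_lin[OF v(1)] ..
    finally have "act w (simple_root s) r = cheb c (Suc (length a)) * act v (simple_root z) r + cheb c (length a) * act v (simple_root z') r"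
      by simp
    moreover have "0 \<le> act v (simple_root x) r" if "x \<in> {s, t}" for x
      using less.hyps[OF comb_len v(1) _ up[OF that]] that t less.prems by auto
    then have "0 \<le> act v (simple_root z) r" "0 \<le> act v (simple_root z') r" using z(1) by auto
    ultimately show ?thesis using nonneg by simp
  qed
qed

end

section \<open>Roots, inversions, reflections and the exchange condition\<close>

definition nonneg :: "'a vec \<Rightarrow> bool" where "nonneg v \<longleftrightarrow> (\<forall>r. 0 \<le> v r)"
definition nonpos :: "'a vec \<Rightarrow> bool" where "nonpos v \<longleftrightarrow> (\<forall>r. v r \<le> 0)"

lemma nonneg_uminus [simp]: "nonneg (\<lambda>r. - v r) \<longleftrightarrow> nonpos v" and nonpos_uminus [simp]: "nonpos (\<lambda>r. - v r) \<longleftrightarrow> nonneg v"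
  by (auto simp: nonneg_def nonpos_def)

lemma nonneg_simple_root [simp]: "nonneg (simple_root s)" and nonpos_simple_root [simp]: "\<not> nonpos (simple_root s)"
  by (auto simp: nonneg_def nonpos_def simple_root_def intro!: exI[of _ s])

context cox
begin

definition roots :: "'a vec set" where "roots = {act w (simple_root s) | w s. w \<in> W \<and> s \<in> S}"
definition pos_roots :: "'a vec set" where "pos_roots = {\<beta> \<in> roots. nonneg \<beta>}"

lemma act_uminus: "w \<in> W \<Longrightarrow> act w (\<lambda>r. - v r) = (\<lambda>r. - act w v r)"
  using act_lin[of w "-1" v 0 v] by simp

lemma reflect_uminus: "reflect s (\<lambda>r. - v r) = (\<lambda>r. - reflect s v r)"
  using reflect_lin[of s "-1" v 0 v] by simp

lemma reflect_simple_root [simp]: "s \<in> S \<Longrightarrow> reflect s (simple_root s) = (\<lambda>r. - simple_root s r)"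
  by (simp add: reflect_def form_at_simple_root fun_eq_iff)

lemma act_mult_S: "w \<in> W \<Longrightarrow> s \<in> S \<Longrightarrow> act (w \<otimes> s) (simple_root s) = (\<lambda>r. - act w (simple_root s) r)"
  by (simp add: act_mult act_uminus)

lemma act_of_nonneg: "w \<in> W \<Longrightarrow> s \<in> S \<Longrightarrow> len w < len (w \<otimes> s) \<Longrightarrow> nonneg (act w (simple_root s))"
  using act_nonneg by (simp add: nonneg_def)

lemma act_nonpos: "w \<in> W \<Longrightarrow> s \<in> S \<Longrightarrow> len (w \<otimes> s) < len w \<Longrightarrow> nonpos (act w (simple_root s))"
  using act_of_nonneg[of "w \<otimes> s" s] by (simp add: act_mult_S)

lemma rootI [intro]: "w \<in> W \<Longrightarrow> s \<in> S \<Longrightarrow> act w (simple_root s) \<in> roots"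
  unfolding roots_def by blast

lemma simple_root_root [simp]: "s \<in> S \<Longrightarrow> simple_root s \<in> roots"
  using rootI[of \<one> s] by simp

lemma simple_root_proot [simp]: "s \<in> S \<Longrightarrow> simple_root s \<in> pos_roots" by (simp add: pos_roots_def)

lemma act_root [simp]: assumes "w \<in> W" "\<beta> \<in> roots" shows "act w \<beta> \<in> roots"
proof -
  obtain x s where "x \<in> W" "s \<in> S" "\<beta> = act x (simple_root s)" using assms by (auto simp: roots_def)
  then show ?thesis using assms act_mult[of w x "simple_root s"] rootI[of "w \<otimes> x" s] by simp
qed

lemma reflect_root [simp]: "s \<in> S \<Longrightarrow> \<beta> \<in> roots \<Longrightarrow> reflect s \<beta> \<in> roots"
  using act_root[of s \<beta>] by simp

lemma uminus_root: assumes "\<beta> \<in> roots" shows "(\<lambda>r. - \<beta> r) \<in> roots"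
proof -
  obtain x s where "x \<in> W" "s \<in> S" "\<beta> = act x (simple_root s)" using assms by (auto simp: roots_def)
  then show ?thesis using act_mult_S[of x s] rootI[of "x \<otimes> s" s] by simp
qed

lemma root_cases: assumes "\<beta> \<in> roots" shows "nonneg \<beta> \<or> nonpos \<beta>"
proof -
  obtain x s where "x \<in> W" "s \<in> S" "\<beta> = act x (simple_root s)" using assms by (auto simp: roots_def)
  then show ?thesis using len_mult_S[of x s] act_of_nonneg[of x s] act_nonpos[of x s] by auto
qed

lemma form_root: assumes "\<beta> \<in> roots" shows "form \<beta> \<beta> = 1"
proof -
  obtain x s where "x \<in> W" "s \<in> S" "\<beta> = act x (simple_root s)" using assms by (auto simp: roots_def)
  then show ?thesis by (simp add: form_act form_simple_root form_at_simple_root)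
qed

lemma root_out: assumes "\<beta> \<in> roots" "r \<notin> S" shows "\<beta> r = 0"
proof -
  obtain x s where "x \<in> W" "s \<in> S" "\<beta> = act x (simple_root s)" using assms by (auto simp: roots_def)
  then show ?thesis using act_out[of x S r "simple_root s"] assms generate_S by (auto simp: simple_root_def)
qed

lemma root_not_both: assumes "\<beta> \<in> roots" "nonneg \<beta>" shows "\<not> nonpos \<beta>"
proof
  assume "nonpos \<beta>"
  then have "\<beta> r = 0" for r using assms by (auto simp: nonneg_def nonpos_def intro: antisym)
  then have "form \<beta> \<beta> = 0" by (simp add: form_def)
  then show False using form_root[OF assms(1)] by simp
qed

lemma len_less_iff: assumes "w \<in> W" "s \<in> S"
  shows "len w < len (w \<otimes> s) \<longleftrightarrow> nonneg (act w (simple_root s))" "len (w \<otimes> s) < len w \<longleftrightarrow> nonpos (act w (simple_root s))"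
  using len_mult_S[OF assms] act_of_nonneg[OF assms] act_nonpos[OF assms] root_not_both[of "act w (simple_root s)"] assms
  by auto

lemma len_up: "w \<in> W \<Longrightarrow> s \<in> S \<Longrightarrow> len w < len (w \<otimes> s) \<Longrightarrow> len (w \<otimes> s) = Suc (len w)"
  and len_down: "w \<in> W \<Longrightarrow> s \<in> S \<Longrightarrow> len (w \<otimes> s) < len w \<Longrightarrow> len w = Suc (len (w \<otimes> s))"
  using len_mult_S[of w s] by auto

text \<open>Every root has form value 1 with itself, so a nonnegative multiple of a simple root can
  only be that simple root.\<close>

lemma proot_only:
  assumes "\<beta> \<in> pos_roots" "\<And>r. r \<noteq> s \<Longrightarrow> \<beta> r = 0" shows "\<beta> = simple_root s" "s \<in> S"
proof -
  have R: "\<beta> \<in> roots" "nonneg \<beta>" using assms by (auto simp: pos_roots_def)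
  have B: "form \<beta> \<beta> = 1" using form_root R by simp
  show s: "s \<in> S"
  proof (rule ccontr)
    assume "s \<notin> S"
    then have "\<beta> r = 0" for r using assms(2)[of r] root_out[OF R(1)] by (cases "r = s") auto
    then show False using B by (simp add: form_def)
  qed
  define c where "c = \<beta> s"
  have b: "\<beta> = (\<lambda>r. c * simple_root s r + 0 * simple_root s r)" using assms(2) by (auto simp: fun_eq_iff simple_root_def c_def)
  have "form \<beta> \<beta> = c * c"
    unfolding b form_lin form_lin2 using s by (simp add: form_simple_root form_at_simple_root)
  then have "form \<beta> \<beta> = \<beta> s * \<beta> s" by (simp add: c_def)
  then have "\<beta> s * \<beta> s = 1" using B by simp
  moreover have "0 \<le> \<beta> s" using R by (simp add: nonneg_def)
  ultimately have "\<beta> s = 1" by (metis abs_of_nonneg abs_square_eq_1 power2_eq_square)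
  then show "\<beta> = simple_root s" using assms(2) by (auto simp: fun_eq_iff simple_root_def)
qed

text \<open>Some coordinate away from \<open>s\<close> is positive, and the reflection does not
  change it; a root with a positive coordinate is nonnegative.\<close>

lemma reflect_proot: assumes "\<beta> \<in> pos_roots" "s \<in> S" "\<beta> \<noteq> simple_root s" shows "reflect s \<beta> \<in> pos_roots"
proof -
  obtain r where r: "r \<noteq> s" "\<beta> r \<noteq> 0" using proot_only[of \<beta> s] assms by blast
  have R: "\<beta> \<in> roots" "nonneg \<beta>" using assms by (auto simp: pos_roots_def)
  have "reflect s \<beta> r = \<beta> r" using r by (simp add: reflect_def)
  then have "0 < reflect s \<beta> r" using r R by (simp add: nonneg_def less_le)
  then have "\<not> nonpos (reflect s \<beta>)" by (auto simp: nonpos_def not_le intro!: exI[of _ r])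
  then show ?thesis using root_cases[of "reflect s \<beta>"] R assms by (auto simp: pos_roots_def)
qed

lemma root_pm: "\<beta> \<in> roots \<Longrightarrow> \<beta> \<in> pos_roots \<or> (\<lambda>r. - \<beta> r) \<in> pos_roots"
  using root_cases[of \<beta>] uminus_root[of \<beta>] by (auto simp: pos_roots_def)

definition inversions :: "'a \<Rightarrow> 'a vec set" where "inversions w = {\<beta> \<in> pos_roots. nonpos (act w \<beta>)}"

text \<open>Appending a letter transports the old inversions by a reflection and adds at most the
  simple root of that letter.\<close>

lemma finite_inversions: assumes "w \<in> W" shows "finite (inversions w)"
proof -
  obtain ss where ss: "set ss \<subseteq> S" "wp ss = w" using word_exists assms by blast
  have "finite (inversions (wp ss))" using ss(1)
  proof (induction ss rule: rev_induct)
    case Nil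
    have "inversions \<one> = {}" using root_not_both by (auto simp: inversions_def pos_roots_def)
    then show ?case by simp
  next
    case (snoc s ss)
    have "inversions (wp ss \<otimes> s) \<subseteq> insert (simple_root s) (reflect s ` inversions (wp ss))"
    proof
      fix \<beta> assume b: "\<beta> \<in> inversions (wp ss \<otimes> s)"
      show "\<beta> \<in> insert (simple_root s) (reflect s ` inversions (wp ss))"
      proof (cases "\<beta> = simple_root s")
        case False
        then have "reflect s \<beta> \<in> inversions (wp ss)"
          using b reflect_proot[of \<beta> s] snoc.prems by (auto simp: inversions_def act_mult)
        moreover have "\<beta> = reflect s (reflect s \<beta>)" using snoc.prems by simp
        ultimately show ?thesis by blast
      qed auto
    qed
    then show ?case using snoc by (auto intro: finite_subset)
  qed
  then show ?thesis using ss by simp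
qed

lemma desc_exists: assumes "w \<in> W" "w \<noteq> \<one>" shows "\<exists>s\<in>S. len (w \<otimes> s) < len w"
proof -
  obtain ss where ss: "set ss \<subseteq> S" "length ss = len w" "wp ss = w" using len_word assms by blast
  then obtain ss' t where sst: "ss = ss' @ [t]" using assms by (cases ss rule: rev_cases) auto
  then have "w = wp ss' \<otimes> t" "t \<in> S" "set ss' \<subseteq> S" using ss by auto
  then have "w \<otimes> t = wp ss'" by simp
  then show ?thesis using len_le[of ss'] ss sst by (intro bexI[of _ t]) auto
qed

text \<open>Faithfulness of the representation: a nontrivial element has a descent, and it makes the
  simple root of that descent negative.\<close>

lemma act_inj: assumes "x \<in> W" "y \<in> W" "\<And>v. act x v = act y v" shows "x = y"
proof (rule ccontr)
  assume "x \<noteq> y"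
  let ?w = "inv y \<otimes> x"
  have w: "?w \<in> W" using assms by simp
  have "?w \<noteq> \<one>" using assms \<open>x \<noteq> y\<close> by (metis inv_closed inv_equality inv_inv)
  then obtain s where s: "s \<in> S" "len (?w \<otimes> s) < len ?w" using desc_exists w by blast
  have "act ?w v = v" for v using assms by (simp add: act_mult)
  then show False using act_nonpos[OF w s] by simp
qed

text \<open>The choice is harmless: by \<open>act_root_refl\<close> the action depends on the root
  alone, and the action is faithful.\<close>

definition root_refl :: "'a vec \<Rightarrow> 'a" where
  "root_refl \<beta> = (SOME g. \<exists>w\<in>W. \<exists>s\<in>S. act w (simple_root s) = \<beta> \<and> g = w \<otimes> s \<otimes> inv w)"

lemma act_conj: assumes "w \<in> W" "s \<in> S"
  shows "act (w \<otimes> s \<otimes> inv w) v = (\<lambda>r. v r - 2 * form v (act w (simple_root s)) * act w (simple_root s) r)"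
proof -
  let ?u = "act (inv w) v"
  have "act (w \<otimes> s \<otimes> inv w) v = act w (reflect s ?u)" using assms by (simp add: act_mult)
  also have "\<dots> = (\<lambda>r. 1 * v r + (- 2 * form_at ?u s) * act w (simple_root s) r)"
    unfolding reflect_alt act_lin[OF assms(1)] using assms by simp
  also have "form_at ?u s = form v (act w (simple_root s))"
    using form_act[OF assms(1), of ?u "simple_root s"] assms by (simp add: form_simple_root)
  finally show ?thesis by simp
qed

lemma root_refl_props: assumes "\<beta> \<in> roots"
  shows "\<exists>w\<in>W. \<exists>s\<in>S. act w (simple_root s) = \<beta> \<and> root_refl \<beta> = w \<otimes> s \<otimes> inv w"
proof -
  have "\<exists>g. \<exists>w\<in>W. \<exists>s\<in>S. act w (simple_root s) = \<beta> \<and> g = w \<otimes> s \<otimes> inv w"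
    using assms by (auto simp: roots_def)
  from someI_ex[OF this] show ?thesis unfolding root_refl_def .
qed

lemma root_refl_closed [simp]: "\<beta> \<in> roots \<Longrightarrow> root_refl \<beta> \<in> W"
  using root_refl_props[of \<beta>] by auto

lemma act_root_refl: "\<beta> \<in> roots \<Longrightarrow> act (root_refl \<beta>) v = (\<lambda>r. v r - 2 * form v \<beta> * \<beta> r)"
  using root_refl_props[of \<beta>] act_conj by metis

lemma root_refl_eq: "w \<in> W \<Longrightarrow> s \<in> S \<Longrightarrow> root_refl (act w (simple_root s)) = w \<otimes> s \<otimes> inv w"
  by (rule act_inj) (auto simp: act_root_refl act_conj)

lemma root_refl_simple_root [simp]: "s \<in> S \<Longrightarrow> root_refl (simple_root s) = s"
  using root_refl_eq[of \<one> s] by simp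

lemma root_refl_act: assumes "w \<in> W" "\<beta> \<in> roots" shows "root_refl (act w \<beta>) = w \<otimes> root_refl \<beta> \<otimes> inv w"
proof -
  obtain x s where x: "x \<in> W" "s \<in> S" "\<beta> = act x (simple_root s)" using assms by (auto simp: roots_def)
  then have "root_refl (act w \<beta>) = (w \<otimes> x) \<otimes> s \<otimes> inv (w \<otimes> x)"
    using root_refl_eq[of "w \<otimes> x" s] assms by (simp add: act_mult)
  then show ?thesis using x assms root_refl_eq[of x s] by (simp add: inv_mult_group m_assoc)
qed

lemma root_refl_root_refl [simp]: "\<beta> \<in> roots \<Longrightarrow> root_refl \<beta> \<otimes> root_refl \<beta> = \<one>"
  using root_refl_props[of \<beta>] by (auto simp: m_assoc S_involution simp flip: m_assoc[of "inv _"])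

text \<open>The letters act from the right end. Where the root turns nonpositive it must have been
  the simple root of the letter acting there, as a simple reflection makes no other positive root
  negative. Comparing the two reflections shows that this letter can be deleted.\<close>

lemma exchange:
  assumes "set ss \<subseteq> S" "s \<in> S" "nonpos (act (wp ss) (simple_root s))"
  shows "\<exists>i<length ss. wp (take i ss @ drop (Suc i) ss) = wp ss \<otimes> s"
  using assms
proof (induction ss)
  case (Cons t a)
  have t: "t \<in> S" "set a \<subseteq> S" using Cons.prems by auto
  let ?b = "act (wp a) (simple_root s)"
  have b: "?b \<in> roots" using Cons.prems t by simp
  show ?case
  proof (cases "nonpos ?b")
    case True
    then obtain i where i: "i < length a" "wp (take i a @ drop (Suc i) a) = wp a \<otimes> s" using Cons t by blast
    then show ?thesis using t Cons.prems by (intro exI[of _ "Suc i"]) (auto simp: m_assoc)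
  next
    case False
    then have bp: "?b \<in> pos_roots" using root_cases[OF b] b by (auto simp: pos_roots_def)
    have "nonpos (reflect t ?b)" using Cons.prems t by (simp add: act_mult)
    then have "?b = simple_root t" using reflect_proot[OF bp t(1)] root_not_both by (auto simp: pos_roots_def)
    then have "wp a \<otimes> s \<otimes> inv (wp a) = t" using root_refl_eq[of "wp a" s] t Cons.prems by simp
    then have "t \<otimes> wp a = wp a \<otimes> s"
      using t Cons.prems by (metis S_closed inv_solve_right' m_closed wp_closed)
    then have "t \<otimes> wp a \<otimes> s = wp a" using t Cons.prems by simp
    then show ?thesis by (intro exI[of _ 0]) auto
  qed
qed (use nonpos_simple_root in auto)

lemma finite_ball: "finite {w \<in> W. len w \<le> n}"
proof (rule finite_subset)
  show "{w \<in> W. len w \<le> n} \<subseteq> wp ` {ss. set ss \<subseteq> S \<and> length ss \<le> n}"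
  proof
    fix w assume "w \<in> {w \<in> W. len w \<le> n}"
    then obtain ss where "set ss \<subseteq> S" "length ss = len w" "wp ss = w" "len w \<le> n" using len_word by blast
    then show "w \<in> wp ` {ss. set ss \<subseteq> S \<and> length ss \<le> n}" by auto
  qed
  show "finite (wp ` {ss. set ss \<subseteq> S \<and> length ss \<le> n})"
    using finite_lists_length_le[OF finS] by auto
qed

subsection \<open>Parabolic subgroups\<close>

lemma par_subgroup: "U \<subseteq> S \<Longrightarrow> subgroup (generate G U) G"
  using generate_is_subgroup S_carrier by blast

lemma par_mem [simp]: "U \<subseteq> S \<Longrightarrow> u \<in> generate G U \<Longrightarrow> u \<in> W"
  using par_subgroup subgroup.mem_carrier by metis

lemma par_mult [simp]: "U \<subseteq> S \<Longrightarrow> u \<in> generate G U \<Longrightarrow> v \<in> generate G U \<Longrightarrow> u \<otimes> v \<in> generate G U"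
  using par_subgroup subgroup.m_closed by metis

lemma par_inv [simp]: "U \<subseteq> S \<Longrightarrow> u \<in> generate G U \<Longrightarrow> inv u \<in> generate G U"
  using par_subgroup subgroup.m_inv_closed by metis

lemma par_one [simp]: "\<one> \<in> generate G U" by (rule generate.one)

lemma par_gen [simp]: "s \<in> U \<Longrightarrow> s \<in> generate G U" by (rule generate.incl)

lemma par_mono: "U \<subseteq> V \<Longrightarrow> generate G U \<subseteq> generate G V"
  by (rule mono_generate)

text \<open>Shortening by \<open>exchange\<close> only deletes letters and so never leaves
  \<open>U\<close>: the length within a parabolic subgroup is the length in the whole group.\<close>

lemma par_word:
  assumes "U \<subseteq> S" "u \<in> generate G U"
  obtains ss where "set ss \<subseteq> U" "length ss = len u" "wp ss = u"
proof -
  obtain a where a: "set a \<subseteq> U" "wp a = u" using generate_words assms by blast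
  have "\<exists>ss. set ss \<subseteq> U \<and> length ss = len (wp a) \<and> wp ss = wp a" using a(1)
  proof (induction a rule: rev_induct)
    case (snoc s a)
    then obtain b where b: "set b \<subseteq> U" "length b = len (wp a)" "wp b = wp a" by auto
    have S: "set b \<subseteq> S" "set a \<subseteq> S" "s \<in> S" using b snoc.prems assms by auto
    show ?case
    proof (cases "len (wp a) < len (wp a \<otimes> s)")
      case True
      then show ?thesis using S b snoc.prems len_up[of "wp a" s]
        by (intro exI[of _ "b @ [s]"]) auto
    next
      case False
      then have l: "len (wp a) = Suc (len (wp a \<otimes> s))" using len_mult_S[of "wp a" s] S by auto
      then have "nonpos (act (wp b) (simple_root s))" using act_nonpos[of "wp a" s] S b by auto
      then obtain i where i: "i < length b" "wp (take i b @ drop (Suc i) b) = wp b \<otimes> s" using exchange S by blast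
      moreover have "set (take i b @ drop (Suc i) b) \<subseteq> U"
        using b by (auto dest: in_set_takeD in_set_dropD)
      moreover have "length (take i b @ drop (Suc i) b) = len (wp a \<otimes> s)" using i l b by simp
      ultimately show ?thesis using S b by (intro exI[of _ "take i b @ drop (Suc i) b"]) simp
    qed
  qed auto
  then show ?thesis using that a by auto
qed

lemma reduced_take:
  assumes "set (a @ b) \<subseteq> S" "len (wp (a @ b)) = length (a @ b)"
  shows "len (wp a) = length a" "len (wp b) = length b"
  using assms len_mult_le[of "wp a" "wp b"] len_le[of a] len_le[of b] by (auto simp: wp_append)

lemma act_sum: assumes "v \<in> W" "finite U"
  shows "act v (\<lambda>r. \<Sum>s\<in>U. c s * simple_root s r) = (\<lambda>r. \<Sum>s\<in>U. c s * act v (simple_root s) r)"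
  using assms(2)
proof (induction U rule: finite_induct)
  case empty
  have "act v (\<lambda>r. 0 * simple_root undefined r + 0 * simple_root undefined r) = (\<lambda>r. 0)"
    unfolding act_lin[OF assms(1)] by simp
  then show ?case by simp
next
  case (insert x U)
  have "act v (\<lambda>r. \<Sum>s\<in>insert x U. c s * simple_root s r) =
      act v (\<lambda>r. c x * simple_root x r + 1 * (\<Sum>s\<in>U. c s * simple_root s r))" using insert by simp
  also have "\<dots> = (\<lambda>r. c x * act v (simple_root x) r + 1 * (\<Sum>s\<in>U. c s * act v (simple_root s) r))"
    unfolding act_lin[OF assms(1)] insert.IH ..
  finally show ?case using insert by simp
qed

lemma vec_expand: assumes "U \<subseteq> S" "\<And>r. r \<notin> U \<Longrightarrow> \<beta> r = 0"
  shows "\<beta> = (\<lambda>r. \<Sum>s\<in>U. \<beta> s * simple_root s r)"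
proof
  fix r
  have f: "finite U" using assms finS finite_subset by blast
  show "\<beta> r = (\<Sum>s\<in>U. \<beta> s * simple_root s r)"
  proof (cases "r \<in> U")
    case True
    then show ?thesis using f by (subst sum.remove[OF f True]) (auto intro!: sum.neutral simp: simple_root_def split: if_splits)
  next
    case False
    have "(\<Sum>s\<in>U. \<beta> s * simple_root s r) = 0" using False by (intro sum.neutral) (auto simp: simple_root_def)
    then show ?thesis using assms(2)[OF False] by simp
  qed
qed

lemma act_expand: assumes "v \<in> W" "U \<subseteq> S" "\<And>r. r \<notin> U \<Longrightarrow> \<beta> r = 0"
  shows "act v \<beta> = (\<lambda>r. \<Sum>s\<in>U. \<beta> s * act v (simple_root s) r)"
proof -
  have "act v \<beta> = act v (\<lambda>r. \<Sum>s\<in>U. \<beta> s * simple_root s r)"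
    using vec_expand[OF assms(2,3)] by (rule arg_cong)
  also have "\<dots> = (\<lambda>r. \<Sum>s\<in>U. \<beta> s * act v (simple_root s) r)"
    by (rule act_sum[OF assms(1) finite_subset[OF assms(2) finS]])
  finally show ?thesis .
qed

lemma par_root: assumes "U \<subseteq> S" "set a \<subseteq> U" "s \<in> U" "len (wp (a @ [s])) = length (a @ [s])"
  shows "nonneg (act (wp a) (simple_root s))" "\<And>r. r \<notin> U \<Longrightarrow> act (wp a) (simple_root s) r = 0"
proof -
  have S: "set a \<subseteq> S" "s \<in> S" using assms by auto
  have "len (wp a) = length a" using reduced_take[of a "[s]"] assms S by auto
  then show "nonneg (act (wp a) (simple_root s))" using act_of_nonneg[of "wp a" s] S assms by simp
  have "wp a \<in> generate G U" using generate_words[OF assms(1)] assms by blast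
  then show "act (wp a) (simple_root s) r = 0" if "r \<notin> U" for r using act_out[of "wp a" U r] assms that by (auto simp: simple_root_def)
qed

text \<open>Along a reduced word in \<open>U\<close> every new root is a nonnegative combination of
  the simple roots in \<open>U\<close>, which \<open>v\<close> keeps nonnegative; so each letter
  lengthens the product.\<close>

lemma len_add:
  assumes "v \<in> W" "U \<subseteq> S" "\<And>s. s \<in> U \<Longrightarrow> len v < len (v \<otimes> s)" "u \<in> generate G U"
  shows "len (v \<otimes> u) = len v + len u"
proof -
  have "set a \<subseteq> U \<Longrightarrow> len (wp a) = length a \<Longrightarrow> len (v \<otimes> wp a) = len v + length a" for a
  proof (induction a rule: rev_induct)
    case (snoc s a)
    have S: "set a \<subseteq> S" "s \<in> S" using snoc.prems assms by auto
    have IH: "len (v \<otimes> wp a) = len v + length a" using reduced_take[of a "[s]"] snoc S by auto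
    have b: "nonneg (act (wp a) (simple_root s))" "\<And>r. r \<notin> U \<Longrightarrow> act (wp a) (simple_root s) r = 0"
      using par_root[of U a s] snoc.prems assms by auto
    have "0 \<le> act v (simple_root t) r" if "t \<in> U" for t r
      using act_of_nonneg[of v t] assms that by (auto simp: nonneg_def)
    moreover have "act v (act (wp a) (simple_root s)) = (\<lambda>r. \<Sum>t\<in>U. act (wp a) (simple_root s) t * act v (simple_root t) r)"
      by (rule act_expand[OF assms(1,2) b(2)])
    ultimately have "nonneg (act v (act (wp a) (simple_root s)))" using b(1) by (auto simp: nonneg_def intro!: sum_nonneg)
    then have "nonneg (act (v \<otimes> wp a) (simple_root s))" using act_mult assms S by simp
    then have "len (v \<otimes> wp a \<otimes> s) = Suc (len (v \<otimes> wp a))"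
      using len_less_iff[of "v \<otimes> wp a" s] len_up assms S by simp
    then show ?case using IH assms S by (simp add: m_assoc)
  qed (use assms in simp)
  then show ?thesis using par_word[OF assms(2,4)] by metis
qed

text \<open>As in \<open>len_add\<close>, but \<open>w\<close> sends the simple roots in
  \<open>U\<close> to nonpositive vectors, so each letter shortens the product.\<close>

lemma len_sub:
  assumes "w \<in> W" "U \<subseteq> S" "\<And>s. s \<in> U \<Longrightarrow> len (w \<otimes> s) < len w" "u \<in> generate G U"
  shows "len (w \<otimes> u) + len u = len w"
proof -
  have "set a \<subseteq> U \<Longrightarrow> len (wp a) = length a \<Longrightarrow> len (w \<otimes> wp a) + length a = len w" for a
  proof (induction a rule: rev_induct)
    case (snoc s a)
    have S: "set a \<subseteq> S" "s \<in> S" using snoc.prems assms by auto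
    have IH: "len (w \<otimes> wp a) + length a = len w" using reduced_take[of a "[s]"] snoc S by auto
    have b: "nonneg (act (wp a) (simple_root s))" "\<And>r. r \<notin> U \<Longrightarrow> act (wp a) (simple_root s) r = 0"
      using par_root[of U a s] snoc.prems assms by auto
    have "act w (simple_root t) r \<le> 0" if "t \<in> U" for t r
      using act_nonpos[of w t] assms that by (auto simp: nonpos_def)
    moreover have "act w (act (wp a) (simple_root s)) = (\<lambda>r. \<Sum>t\<in>U. act (wp a) (simple_root s) t * act w (simple_root t) r)"
      by (rule act_expand[OF assms(1,2) b(2)])
    ultimately have "nonpos (act w (act (wp a) (simple_root s)))" using b(1)
      by (auto simp: nonneg_def nonpos_def intro!: sum_nonpos mult_nonneg_nonpos)
    then have "nonpos (act (w \<otimes> wp a) (simple_root s))" using act_mult assms S by simp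
    then have "len (w \<otimes> wp a) = Suc (len (w \<otimes> wp a \<otimes> s))"
      using len_less_iff[of "w \<otimes> wp a" s] len_down assms S by simp
    then show ?case using IH assms S by (simp add: m_assoc)
  qed (use assms in simp)
  then show ?thesis using par_word[OF assms(2,4)] by metis
qed

text \<open>By \<open>len_sub\<close> no element of the parabolic subgroup is longer than
  \<open>w\<close>, and balls are finite.\<close>

lemma desc_spherical:
  assumes "w \<in> W" "U \<subseteq> S" "\<And>s. s \<in> U \<Longrightarrow> len (w \<otimes> s) < len w"
  shows "spherical G S U"
proof -
  have "generate G U \<subseteq> {u \<in> W. len u \<le> len w}"
    using len_sub[OF assms] assms par_mem by fastforce
  then show ?thesis using finite_ball finite_subset assms unfolding spherical_def by blast
qed

definition is_min :: "'a set \<Rightarrow> 'a \<Rightarrow> bool" where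
  "is_min U v \<longleftrightarrow> v \<in> W \<and> (\<forall>s\<in>U. len v < len (v \<otimes> s))"

lemma min_exists: assumes "w \<in> W" "U \<subseteq> S" shows "\<exists>v u. is_min U v \<and> u \<in> generate G U \<and> w = v \<otimes> u"
  using assms(1)
proof (induction "len w" arbitrary: w rule: less_induct)
  case less
  show ?case
  proof (cases "is_min U w")
    case True then show ?thesis using less.prems by (intro exI[of _ w] exI[of _ \<one>]) simp
  next
    case False
    then obtain s where s: "s \<in> U" "\<not> len w < len (w \<otimes> s)" using less.prems by (auto simp: is_min_def)
    have sS: "s \<in> S" using s assms by auto
    then have "len (w \<otimes> s) < len w" using s len_mult_S[of w s] less.prems by auto
    then obtain v u where v: "is_min U v" "u \<in> generate G U" "w \<otimes> s = v \<otimes> u"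
      using less sS by (metis S_closed m_closed)
    have "v \<in> W" "u \<in> W" using v assms by (auto simp: is_min_def)
    then have "w = v \<otimes> (u \<otimes> s)" using v(3) sS less.prems by (metis S_closed m_assoc mult_S_S)
    then show ?thesis using v s assms by (intro exI[of _ v] exI[of _ "u \<otimes> s"]) simp
  qed
qed

lemma is_min_len: "is_min U v \<Longrightarrow> U \<subseteq> S \<Longrightarrow> u \<in> generate G U \<Longrightarrow> len (v \<otimes> u) = len v + len u"
  using len_add[of v U u] by (auto simp: is_min_def)

lemma min_unique:
  assumes "is_min U v" "is_min U v'" "U \<subseteq> S" "u \<in> generate G U" "v' = v \<otimes> u" shows "u = \<one>" "v' = v"
proof -
  have c: "v \<in> W" "v' \<in> W" "u \<in> W" using assms by (auto simp: is_min_def)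
  then have "v = v' \<otimes> inv u" using assms by (simp add: m_assoc)
  then have "len v = len v' + len u" using is_min_len[OF assms(2,3), of "inv u"] assms c by simp
  moreover have "len v' = len v + len u" using is_min_len assms by simp
  ultimately show "u = \<one>" using len_0 c by auto
  then show "v' = v" using assms c by simp
qed

definition min_rep :: "'a set \<Rightarrow> 'a \<Rightarrow> 'a" where
  "min_rep U w = (SOME v. is_min U v \<and> inv v \<otimes> w \<in> generate G U)"

lemma min_rep: assumes "w \<in> W" "U \<subseteq> S" shows "is_min U (min_rep U w)" "inv (min_rep U w) \<otimes> w \<in> generate G U" "min_rep U w \<in> W"
proof -
  obtain v u where "is_min U v" "u \<in> generate G U" "w = v \<otimes> u" using min_exists assms by blast
  then have "is_min U v \<and> inv v \<otimes> w \<in> generate G U" using assms by (auto simp: is_min_def simp flip: m_assoc)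
  from someI[of "\<lambda>v. is_min U v \<and> inv v \<otimes> w \<in> generate G U", OF this]
  show "is_min U (min_rep U w)" "inv (min_rep U w) \<otimes> w \<in> generate G U" unfolding min_rep_def by auto
  then show "min_rep U w \<in> W" by (simp add: is_min_def)
qed

definition par_part :: "'a set \<Rightarrow> 'a \<Rightarrow> 'a" where "par_part U w = inv (min_rep U w) \<otimes> w"

lemma par_part: assumes "w \<in> W" "U \<subseteq> S"
  shows "par_part U w \<in> generate G U" "min_rep U w \<otimes> par_part U w = w" "len w = len (min_rep U w) + len (par_part U w)" "par_part U w \<in> W"
proof -
  show 1: "par_part U w \<in> generate G U" using min_rep[OF assms] by (simp add: par_part_def)
  show 2: "min_rep U w \<otimes> par_part U w = w" using min_rep[OF assms] assms by (simp add: par_part_def flip: m_assoc)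
  show "len w = len (min_rep U w) + len (par_part U w)" using is_min_len[OF min_rep(1)[OF assms] assms(2) 1] 2 by simp
  show "par_part U w \<in> W" using 1 assms by simp
qed

lemma min_rep_unique: assumes "is_min U v" "u \<in> generate G U" "U \<subseteq> S" shows "min_rep U (v \<otimes> u) = v" "par_part U (v \<otimes> u) = u"
proof -
  have c: "v \<in> W" "u \<in> W" using assms by (auto simp: is_min_def)
  let ?w = "v \<otimes> u"
  have "min_rep U ?w = v \<otimes> (u \<otimes> inv (par_part U ?w))"
    using par_part[of ?w U] c assms by (metis inv_closed inv_solve_right' m_assoc m_closed min_rep(3))
  moreover have "u \<otimes> inv (par_part U ?w) \<in> generate G U" using par_part[of ?w U] c assms by simp
  ultimately show 1: "min_rep U ?w = v" using min_unique[OF assms(1) min_rep(1)[of ?w U] assms(3)] c assms by simp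
  show "par_part U ?w = u" unfolding par_part_def 1 using c by (simp flip: m_assoc)
qed

lemma min_rep_mult: assumes "w \<in> W" "U \<subseteq> S" "u \<in> generate G U" shows "min_rep U (w \<otimes> u) = min_rep U w" "par_part U (w \<otimes> u) = par_part U w \<otimes> u"
proof -
  have "w \<otimes> u = min_rep U w \<otimes> (par_part U w \<otimes> u)" using par_part(2)[OF assms(1,2)] assms par_part min_rep by (metis m_assoc par_mem)
  then show "min_rep U (w \<otimes> u) = min_rep U w" "par_part U (w \<otimes> u) = par_part U w \<otimes> u"
    using min_rep_unique[OF min_rep(1)[OF assms(1,2)], of "par_part U w \<otimes> u"] par_part(1)[OF assms(1,2)] assms by auto
qed

text \<open>The inversions of the inverse are the walls that separate the identity from
  \<open>w\<close>; a lengthening letter crosses exactly one further wall.\<close>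

lemma inversions_inv_Suc:
  assumes "w \<in> W" "s \<in> S" "len w < len (w \<otimes> s)"
  shows "inversions (inv (w \<otimes> s)) = insert (act w (simple_root s)) (inversions (inv w))" "act w (simple_root s) \<notin> inversions (inv w)"
proof -
  let ?b = "act w (simple_root s)"
  have b: "?b \<in> pos_roots" using act_of_nonneg assms by (simp add: pos_roots_def)
  have e: "act (inv (w \<otimes> s)) \<beta> = reflect s (act (inv w) \<beta>)" for \<beta>
    using assms by (simp add: inv_mult_group act_mult)
  show "?b \<notin> inversions (inv w)" using assms by (auto simp: inversions_def)
  show "inversions (inv (w \<otimes> s)) = insert ?b (inversions (inv w))"
  proof (rule Set.set_eqI)
    fix \<beta>
    show "\<beta> \<in> inversions (inv (w \<otimes> s)) \<longleftrightarrow> \<beta> \<in> insert ?b (inversions (inv w))"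
    proof (cases "\<beta> \<in> pos_roots")
      case False
      then show ?thesis using b by (auto simp: inversions_def)
    next
      case B: True
      let ?g = "act (inv w) \<beta>"
      have g: "?g \<in> roots" using B assms by (simp add: pos_roots_def)
      have wg: "\<beta> = act w ?g" using assms by simp
      show ?thesis
      proof (cases "?g \<in> pos_roots")
        case True
        then have "\<not> nonpos ?g" using root_not_both by (auto simp: pos_roots_def)
        moreover have "nonpos (reflect s ?g) \<longleftrightarrow> ?g = simple_root s"
          using reflect_proot[OF True assms(2)] root_not_both[of "reflect s ?g"] assms by (auto simp: pos_roots_def)
        moreover have "?g = simple_root s \<longleftrightarrow> \<beta> = ?b" using wg act_inv(1)[OF assms(1)] by metis
        ultimately show ?thesis using B e by (simp add: inversions_def)
      next
        case False
        let ?m = "\<lambda>r. - ?g r"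
        have m: "?m \<in> pos_roots" using root_pm[OF g] False by simp
        then have "nonpos ?g" by (simp add: pos_roots_def)
        moreover have "?m \<noteq> simple_root s"
        proof
          assume "?m = simple_root s"
          then have "?g = (\<lambda>r. - simple_root s r)" by (metis minus_minus fun_eq_iff)
          then have "\<beta> = (\<lambda>r. - ?b r)" using wg act_uminus[OF assms(1)] by simp
          then have "nonpos \<beta>" using b by (simp add: pos_roots_def)
          then show False using B root_not_both by (auto simp: pos_roots_def)
        qed
        then have "reflect s ?m \<in> pos_roots" using reflect_proot m assms by blast
        then have "nonpos (reflect s ?g)" by (simp add: reflect_uminus pos_roots_def)
        ultimately show ?thesis using B e by (simp add: inversions_def)
      qed
    qed
  qed
qed

subsection \<open>Weights\<close>

context
  fixes q :: "'a \<Rightarrow> real"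
  assumes q: "multiparameter G S q"
begin

text \<open>The weight of a wall. Two presentations of one root give the same reflection, hence
  conjugate generators, on which a multiparameter is constant.\<close>

definition root_weight :: "'a vec \<Rightarrow> real" where
  "root_weight \<beta> = (SOME x. \<exists>w\<in>W. \<exists>s\<in>S. act w (simple_root s) = \<beta> \<and> x = q s)"

lemma root_weight: assumes "w \<in> W" "s \<in> S" shows "root_weight (act w (simple_root s)) = q s"
proof -
  have "\<exists>x. \<exists>w'\<in>W. \<exists>s'\<in>S. act w' (simple_root s') = act w (simple_root s) \<and> x = q s'" using assms by blast
  from someI_ex[OF this] obtain w' s' where w': "w' \<in> W" "s' \<in> S" "act w' (simple_root s') = act w (simple_root s)"
    "root_weight (act w (simple_root s)) = q s'" unfolding root_weight_def by blast
  have "w' \<otimes> s' \<otimes> inv w' = w \<otimes> s \<otimes> inv w" using root_refl_eq w' assms by metis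
  then have "s' = inv w' \<otimes> (w \<otimes> s \<otimes> inv w) \<otimes> w'"
    using w' assms by (simp flip: \<open>w' \<otimes> s' \<otimes> inv w' = _\<close>) (simp add: m_assoc, simp flip: m_assoc)
  also have "\<dots> = (inv w' \<otimes> w) \<otimes> s \<otimes> inv (inv w' \<otimes> w)" using w' assms by (simp add: inv_mult_group m_assoc)
  finally have "\<exists>g\<in>W. s' = g \<otimes> s \<otimes> inv g" using w' assms by blast
  then have "q s = q s'" using q w' assms unfolding multiparameter_def by blast
  then show ?thesis using w' by simp
qed

text \<open>The left-hand side depends on the group element alone, so the weight of a reduced word
  does not depend on the word. This stands in for Matsumoto's theorem on reduced words.\<close>

lemma prod_reduced:
  assumes "set ss \<subseteq> S" "len (wp ss) = length ss"
  shows "(\<Prod>\<beta>\<in>inversions (inv (wp ss)). root_weight \<beta>) = prod_list (map q ss)"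
  using assms
proof (induction ss rule: rev_induct)
  case Nil
  have "inversions \<one> = {}" using root_not_both by (auto simp: inversions_def pos_roots_def)
  then show ?case by simp
next
  case (snoc s a)
  have S: "set a \<subseteq> S" "s \<in> S" using snoc.prems by auto
  have l: "len (wp a) = length a" using reduced_take[of a "[s]"] snoc.prems by auto
  then have "len (wp a) < len (wp a \<otimes> s)" using snoc.prems S by simp
  note N = inversions_inv_Suc[OF wp_closed[OF S(1)] S(2) this]
  show ?case using N snoc.IH[OF S(1) l] finite_inversions[of "inv (wp a)"] root_weight S by (simp add: mult.commute)
qed

lemma qw_word:
  assumes "set ss \<subseteq> S" "len (wp ss) = length ss" shows "qw G S q (wp ss) = prod_list (map q ss)"
proof -
  have ex: "\<exists>x. \<exists>ss'. set ss' \<subseteq> S \<and> wp ss' = wp ss \<and> length ss' = len (wp ss) \<and> x = prod_list (map q ss')"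
    using assms by metis
  obtain ss' where "set ss' \<subseteq> S" "wp ss' = wp ss" "length ss' = len (wp ss)"
    "qw G S q (wp ss) = prod_list (map q ss')"
    using someI_ex[OF ex] unfolding qw_def by blast
  then show ?thesis using prod_reduced[of ss'] prod_reduced[OF assms] by simp
qed

lemma qw_mult:
  assumes "x \<in> W" "y \<in> W" "len (x \<otimes> y) = len x + len y"
  shows "qw G S q (x \<otimes> y) = qw G S q x * qw G S q y"
proof -
  obtain a b where "set a \<subseteq> S" "length a = len x" "wp a = x" "set b \<subseteq> S" "length b = len y" "wp b = y"
    using assms len_word by metis
  then show ?thesis using qw_word[of "a @ b"] qw_word[of a] qw_word[of b] assms by (auto simp: wp_append)
qed

lemma q_pos: "s \<in> S \<Longrightarrow> 0 < q s" using q by (simp add: multiparameter_def)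

lemma qw_S [simp]: "s \<in> S \<Longrightarrow> qw G S q s = q s" using qw_word[of "[s]"] by simp

lemma qw_pos: assumes "w \<in> W" shows "0 < qw G S q w"
proof -
  obtain a where "set a \<subseteq> S" "length a = len w" "wp a = w" using assms len_word by metis
  moreover have "0 < prod_list (map q a)" if "set a \<subseteq> S" for a
    using that by (induction a) (auto simp: q_pos)
  ultimately show ?thesis using qw_word[of a] by auto
qed

lemma qw_up: "w \<in> W \<Longrightarrow> s \<in> S \<Longrightarrow> len w < len (w \<otimes> s) \<Longrightarrow> qw G S q (w \<otimes> s) = qw G S q w * q s"
  using qw_mult[of w s] len_up[of w s] by simp

end

end

section \<open>Form values of absolute value below one: only finitely many occur\<close>

lemma no_positive_rotation:
  fixes f :: "nat \<Rightarrow> real"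
  assumes k: "k < 1" and rec: "\<And>n. f (Suc (Suc n)) = 2 * k * f (Suc n) - f n" and pos: "\<And>n. N \<le> n \<Longrightarrow> 0 < f n"
  shows False
proof -
  \<comment> \<open>The ratio of neighbouring terms falls by at least \<open>2 - 2 * k\<close> in
    every step, because x + 1/x is at least 2 for positive x; so it cannot stay positive.\<close>
  define g where "g n = f (Suc (N + n)) / f (N + n)" for n
  have gp: "0 < g n" for n using pos[of "N + n"] pos[of "Suc (N + n)"] by (simp add: g_def)
  have step: "g (Suc n) \<le> g n - (2 - 2 * k)" for n
  proof -
    have "g (Suc n) = 2 * k - 1 / g n"
      using pos[of "N + n"] pos[of "Suc (N + n)"] by (simp add: g_def rec field_simps)
    moreover have "2 \<le> g n + 1 / g n"
    proof -
      have "0 \<le> (g n - 1)\<^sup>2 / g n" using gp[of n] by simp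
      also have "\<dots> = g n + 1 / g n - 2" using gp[of n] by (simp add: field_simps power2_eq_square)
      finally show ?thesis by simp
    qed
    ultimately show ?thesis by linarith
  qed
  have "g n \<le> g 0 - real n * (2 - 2 * k)" for n
  proof (induction n)
    case (Suc n)
    have "real (Suc n) * (2 - 2 * k) = real n * (2 - 2 * k) + (2 - 2 * k)" by (simp add: algebra_simps)
    then show ?case using Suc step[of n] by linarith
  qed simp
  moreover obtain n :: nat where "g 0 / (2 - 2 * k) < real n" using reals_Archimedean2 by blast
  then have "g 0 - real n * (2 - 2 * k) < 0" using k by (simp add: field_simps)
  ultimately show False using gp[of n] by (meson less_trans not_less)
qed

context cox
begin

lemma act_pow: "x \<in> W \<Longrightarrow> act (x [^] Suc n) v = act x (act (x [^] n) v)"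
  using act_mult[of x "x [^] n" v] nat_pow_Suc2[of x n] by simp

definition height :: "'a vec \<Rightarrow> real" where "height v = (\<Sum>r\<in>S. v r)"

lemma height_lin: "height (\<lambda>r. a * u r + b * v r) = a * height u + b * height v"
  by (simp add: height_def sum.distrib sum_distrib_left)

lemma height_uminus: "height (\<lambda>r. - v r) = - height v" by (simp add: height_def sum_negf)

lemma height_pos: assumes "\<beta> \<in> pos_roots" shows "0 < height \<beta>"
proof -
  have R: "\<beta> \<in> roots" "nonneg \<beta>" using assms by (auto simp: pos_roots_def)
  then obtain r where "\<beta> r \<noteq> 0" using root_not_both[OF R] by (auto simp: nonpos_def) (metis le_less)
  then have "r \<in> S" "0 < \<beta> r" using root_out[OF R(1)] R(2) by (auto simp: nonneg_def less_le)
  then show ?thesis unfolding height_def using R(2) finS by (intro sum_pos2[of _ r]) (auto simp: nonneg_def)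
qed

text \<open>The product of the two reflections acts as a rotation on the plane of the roots, so
  heights along the orbit of \<open>\<beta>\<close> satisfy a rotation recurrence. An infinite orbit
  would leave the finitely many inversions for good, its roots would keep one sign from then on, and
  \<open>no_positive_rotation\<close> forbids this. So a power fixes \<open>\<beta>\<close>, then
  also \<open>\<gamma>\<close>; the orthogonal complement is fixed anyway.\<close>

lemma finite_order:
  assumes R: "\<beta> \<in> roots" "\<gamma> \<in> roots" and B: "\<bar>form \<beta> \<gamma>\<bar> < 1"
  shows "\<exists>n>0. (root_refl \<beta> \<otimes> root_refl \<gamma>) [^] (n::nat) = \<one>"
proof -
  define b where "b = form \<beta> \<gamma>"
  define \<rho> where "\<rho> = root_refl \<beta> \<otimes> root_refl \<gamma>"
  have rW: "\<rho> \<in> W" "root_refl \<beta> \<in> W" "root_refl \<gamma> \<in> W" using R by (auto simp: \<rho>_def)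
  have b2: "b\<^sup>2 < 1" using B by (simp add: b_def abs_square_less_1)
  have Bs: "form \<beta> \<beta> = 1" "form \<gamma> \<gamma> = 1" "form \<gamma> \<beta> = b" "form \<beta> \<gamma> = b" using form_root R form_sym by (auto simp: b_def)
  have ag: "act (root_refl \<gamma>) v = (\<lambda>r. 1 * v r + (- 2 * form v \<gamma>) * \<gamma> r)" and ab: "act (root_refl \<beta>) v = (\<lambda>r. 1 * v r + (- 2 * form v \<beta>) * \<beta> r)" for v
    using R by (simp_all add: act_root_refl)
  have r1: "act \<rho> \<beta> = (\<lambda>r. (4 * b\<^sup>2 - 1) * \<beta> r + (- 2 * b) * \<gamma> r)"
    unfolding \<rho>_def act_mult[OF rW(2,3)] ag[of \<beta>] act_lin[OF rW(2)] ab[of \<beta>] ab[of \<gamma>]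
    by (simp add: Bs algebra_simps power2_eq_square)
  have r2: "act \<rho> (act \<rho> \<beta>) = (\<lambda>r. (4 * b\<^sup>2 - 2) * act \<rho> \<beta> r + (-1) * \<beta> r)"
  proof -
    have "act \<rho> \<gamma> = (\<lambda>r. (2 * b) * \<beta> r + (-1) * \<gamma> r)"
      unfolding \<rho>_def act_mult[OF rW(2,3)] ag[of \<gamma>] act_lin[OF rW(2)] ab[of \<gamma>]
      by (simp add: Bs algebra_simps)
    then show ?thesis unfolding r1 act_lin[OF rW(1)] unfolding r1
      by (simp add: algebra_simps power2_eq_square)
  qed
  define v where "v n = act (\<rho> [^] n) \<beta>" for n :: nat
  have v0: "v 0 = \<beta>" by (simp add: v_def)
  have vS: "v (Suc n) = act \<rho> (v n)" for n unfolding v_def by (rule act_pow[OF rW(1)])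
  have vR: "v n \<in> roots" for n using R rW by (simp add: v_def)
  have rec: "v (Suc (Suc n)) = (\<lambda>r. (4 * b\<^sup>2 - 2) * v (Suc n) r + (-1) * v n r)" for n
  proof (induction n)
    case 0 then show ?case using r2 by (simp add: vS v0)
  next
    case (Suc n)
    have "v (Suc (Suc (Suc n))) = act \<rho> (v (Suc (Suc n)))" by (rule vS)
    also have "\<dots> = (\<lambda>r. (4 * b\<^sup>2 - 2) * v (Suc (Suc n)) r + (-1) * v (Suc n) r)"
      unfolding Suc act_lin[OF rW(1)] vS[symmetric] by (simp add: Suc)
    finally show ?case .
  qed
  have rech: "height (v (Suc (Suc n))) = 2 * (2 * b\<^sup>2 - 1) * height (v (Suc n)) - height (v n)" for n
    unfolding rec height_lin by (simp add: algebra_simps)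
  have k: "2 * b\<^sup>2 - 1 < 1" using b2 by simp
  have "\<not> inj v"
  proof
    assume inj: "inj v"
    have "finite {n. v n \<in> inversions \<rho>}"
      using finite_vimageI[OF finite_inversions[OF rW(1)] inj] by (simp add: vimage_def)
    then obtain N where N: "\<And>n. v n \<in> inversions \<rho> \<Longrightarrow> n < N" by (meson finite_nat_set_iff_bounded mem_Collect_eq)
    have step: "v (Suc n) \<in> pos_roots" if n: "N \<le> n" "v n \<in> pos_roots" for n
    proof -
      have "\<not> nonpos (act \<rho> (v n))" using N[of n] n by (auto simp: inversions_def)
      then show ?thesis using root_cases[OF vR[of "Suc n"]] vR[of "Suc n"] by (auto simp: pos_roots_def vS)
    qed
    show False
    proof (cases "\<exists>n\<ge>N. v n \<in> pos_roots")
      case True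
      then obtain M where M: "N \<le> M" "v M \<in> pos_roots" by blast
      have "v n \<in> pos_roots" if "M \<le> n" for n
        using that by (induction n rule: dec_induct) (use M step in auto)
      then show False using no_positive_rotation[OF k, of "\<lambda>n. height (v n)" M] rech height_pos by blast
    next
      case False
      have "0 < - height (v n)" if "N \<le> n" for n
      proof -
        have "(\<lambda>r. - v n r) \<in> pos_roots" using False root_pm[OF vR[of n]] that by blast
        then show ?thesis using height_pos height_uminus by metis
      qed
      then show False
        using no_positive_rotation[OF k, of "\<lambda>n. - height (v n)" N] rech by simp
    qed
  qed
  then obtain m n where mn: "m < n" "v m = v n" by (metis injI linorder_neqE_nat)
  define j where "j = n - m"
  have j: "0 < j" "n = m + j" using mn by (auto simp: j_def)
  have fixb: "act (\<rho> [^] j) \<beta> = \<beta>"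
  proof -
    have "act (\<rho> [^] m) (act (\<rho> [^] j) \<beta>) = act (\<rho> [^] m) \<beta>"
      using mn(2) rW act_mult[of "\<rho> [^] m" "\<rho> [^] j" \<beta>] by (simp add: v_def j nat_pow_mult)
    then have "act (inv (\<rho> [^] m)) (act (\<rho> [^] m) (act (\<rho> [^] j) \<beta>)) = act (inv (\<rho> [^] m)) (act (\<rho> [^] m) \<beta>)" by simp
    then show ?thesis using rW by simp
  qed
  \<comment> \<open>For orthogonal roots a power that fixes \<open>\<beta>\<close> says nothing
    about \<open>\<gamma>\<close>; there the square of the product is computed to be
    trivial.\<close>
  show ?thesis
  proof (cases "b = 0")
    case True
    have "act (\<rho> \<otimes> \<rho>) u = u" for u
    proof -
      have e: "act \<rho> v = (\<lambda>r. 1 * (1 * v r + (- 2 * form v \<gamma>) * \<gamma> r) + (- 2 * form v \<beta>) * \<beta> r)" for v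
        unfolding \<rho>_def act_mult[OF rW(2,3)] ag[of v] unfolding ab form_lin by (simp add: Bs True)
      show ?thesis
        unfolding act_mult[OF rW(1,1)] e[of "act \<rho> u"] unfolding e[of u] form_lin by (simp add: Bs True)
    qed
    then have "\<rho> \<otimes> \<rho> = \<one>" using rW by (intro act_inj) auto
    then show ?thesis using rW by (intro exI[of _ 2]) (simp add: numeral_2_eq_2 flip: \<rho>_def)
  next
    case False
    have "act (\<rho> [^] j) (act \<rho> \<beta>) = act \<rho> \<beta>"
    proof -
      have "\<rho> [^] j \<otimes> \<rho> = \<rho> \<otimes> \<rho> [^] j" using rW nat_pow_Suc2[of \<rho> j] by simp
      then show ?thesis using fixb rW act_mult[of "\<rho> [^] j" \<rho> \<beta>] act_mult[of \<rho> "\<rho> [^] j" \<beta>] by simp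
    qed
    then have "(\<lambda>r. (4 * b\<^sup>2 - 1) * \<beta> r + (- 2 * b) * act (\<rho> [^] j) \<gamma> r) = (\<lambda>r. (4 * b\<^sup>2 - 1) * \<beta> r + (- 2 * b) * \<gamma> r)"
      unfolding r1 using act_lin[of "\<rho> [^] j" "4 * b\<^sup>2 - 1" \<beta> "- 2 * b" \<gamma>] rW fixb by simp
    then have fixg: "act (\<rho> [^] j) \<gamma> = \<gamma>" using False by (auto simp: fun_eq_iff)
    have "act (\<rho> [^] j) u = u" for u
    proof -
      define p where "p = form u \<beta>" define q where "q = form u \<gamma>"
      \<comment> \<open>The solution of the Gram system that makes \<open>u'\<close> orthogonal to
        both roots; its determinant is positive because \<open>b\<close> has absolute value below
        1.\<close>
      define a where "a = (p - b * q) / (1 - b\<^sup>2)" define c where "c = (q - b * p) / (1 - b\<^sup>2)"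
      define u' where "u' = (\<lambda>r. 1 * (1 * u r + (- a) * \<beta> r) + (- c) * \<gamma> r)"
      have "form u' \<beta> = p - a - c * b" "form u' \<gamma> = q - a * b - c"
        unfolding u'_def form_lin by (simp_all add: Bs p_def q_def)
      moreover have "a + c * b = p" "a * b + c = q"
      proof -
        have D: "1 - b\<^sup>2 \<noteq> 0" using b2 by simp
        have "a + c * b = (p * (1 - b\<^sup>2)) / (1 - b\<^sup>2)" "a * b + c = (q * (1 - b\<^sup>2)) / (1 - b\<^sup>2)"
          unfolding a_def c_def times_divide_eq_left add_divide_distrib[symmetric]
          by (simp_all add: algebra_simps power2_eq_square)
        then show "a + c * b = p" "a * b + c = q" using D by simp_all
      qed
      ultimately have "form u' \<beta> = 0" "form u' \<gamma> = 0" by linarith+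
      then have f1: "act \<rho> u' = u'" unfolding \<rho>_def act_mult[OF rW(2,3)] by (simp add: ag ab)
      have f2: "act (\<rho> [^] i) u' = u'" for i :: nat
      proof (induction i)
        case (Suc i) then show ?case using act_pow[OF rW(1), of i u'] f1 by simp
      qed simp
      have u: "u = (\<lambda>r. 1 * (1 * u' r + a * \<beta> r) + c * \<gamma> r)" by (simp add: u'_def)
      have "act (\<rho> [^] j) (\<lambda>r. 1 * (1 * u' r + a * \<beta> r) + c * \<gamma> r) = (\<lambda>r. 1 * (1 * u' r + a * \<beta> r) + c * \<gamma> r)"
        unfolding act_lin[OF nat_pow_closed[OF rW(1)]] fixb fixg f2 ..
      then show ?thesis using u by simp
    qed
    then have "\<rho> [^] j = \<one>" using rW by (intro act_inj) auto
    then show ?thesis using j by (auto simp: \<rho>_def)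
  qed
qed

definition roots_in :: "'a set \<Rightarrow> 'a vec set" where "roots_in U = {\<beta> \<in> roots. \<forall>r. r \<notin> U \<longrightarrow> \<beta> r = 0}"

text \<open>Values of the form on finite standard parabolic root systems, chosen as a visibly finite
  set that will contain every value strictly between -1 and 1.\<close>

definition form_vals :: "real set" where
  "form_vals = (\<Union>U \<in> {U. U \<subseteq> S \<and> finite (roots_in U)}. (\<lambda>(a, c). form a c) ` (roots_in U \<times> roots_in U))"

lemma finite_form_vals: "finite form_vals"
  unfolding form_vals_def using finS by auto

lemma sum_eq_0_sign:
  assumes "(\<Sum>s\<in>S. c s * z s) = (0::real)" "\<And>s. s \<in> S \<Longrightarrow> 0 \<le> z s" "(\<forall>s. 0 \<le> c s) \<or> (\<forall>s. c s \<le> 0)" "s \<in> S"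
  shows "c s * z s = 0"
proof (cases "\<forall>s. 0 \<le> c s")
  case True
  then show ?thesis using sum_nonneg_eq_0_iff[OF finS, of "\<lambda>s. c s * z s"] assms by auto
next
  case False
  then have "(\<Sum>s\<in>S. - (c s * z s)) = 0" "\<And>s. s \<in> S \<Longrightarrow> 0 \<le> - (c s * z s)"
    using assms by (auto simp: sum_negf mult_nonpos_nonneg)
  then show ?thesis using sum_nonneg_eq_0_iff[OF finS, of "\<lambda>s. - (c s * z s)"] assms by auto
qed

text \<open>The two reflections generate a finite group; averaging the height over it gives an
  invariant functional that is positive on all but finitely many positive roots. Translating by a
  suitable \<open>w\<close> makes it nonnegative on all simple roots, so that its zeros among the
  roots are those supported on a set \<open>U\<close> of simple roots, and these are finitely many.
  Both given roots are zeros, as their own reflections negate them while preserving the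
  functional.\<close>

lemma form_form_vals:
  assumes R: "\<beta> \<in> roots" "\<gamma> \<in> roots" and B: "\<bar>form \<beta> \<gamma>\<bar> < 1"
  shows "form \<beta> \<gamma> \<in> form_vals"
proof -
  define \<rho> where "\<rho> = root_refl \<beta> \<otimes> root_refl \<gamma>"
  have rW: "\<rho> \<in> W" "root_refl \<beta> \<in> W" "root_refl \<gamma> \<in> W" using R by (auto simp: \<rho>_def)
  obtain n :: nat where n: "0 < n" "\<rho> [^] n = \<one>" using finite_order[OF assms] by (auto simp: \<rho>_def)
  define y1 where "y1 v = (\<Sum>i<n. height (act (\<rho> [^] i) v))" for v
  \<comment> \<open>\<open>y1\<close> is invariant under the rotation only; adding its reflected
    copy makes \<open>y\<close> invariant under both reflections.\<close>
  define y where "y v = y1 v + y1 (act (root_refl \<beta>) v)" for v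
  have y1r: "y1 (act \<rho> v) = y1 v" for v
  proof -
    have "y1 (act \<rho> v) = (\<Sum>i<n. height (act (\<rho> [^] Suc i) v))"
      unfolding y1_def using rW by (simp add: act_mult)
    also have "\<dots> = y1 v"
      using sum.lessThan_Suc_shift[of "\<lambda>i. height (act (\<rho> [^] i) v)" n] n by (simp add: y1_def)
    finally show ?thesis .
  qed
  have rr: "act (root_refl \<delta>) (act (root_refl \<delta>) v) = v" if "\<delta> \<in> roots" for \<delta> v
    using act_mult[of "root_refl \<delta>" "root_refl \<delta>" v] that by simp
  have ar: "act \<rho> v = act (root_refl \<beta>) (act (root_refl \<gamma>) v)" for v using rW by (simp add: \<rho>_def act_mult)
  have yb: "y (act (root_refl \<beta>) v) = y v" for v by (simp add: y_def rr R)
  have y1g: "y1 (act (root_refl \<gamma>) v) = y1 (act (root_refl \<beta>) v)" for v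
    using y1r[of "act (root_refl \<gamma>) v"] by (simp add: ar rr R)
  have yg: "y (act (root_refl \<gamma>) v) = y v" for v
    using y1r[of v] by (simp add: y_def y1g ar[symmetric])
  have y1_lin: "y1 (\<lambda>r. a * u r + c * v r) = a * y1 u + c * y1 v" for a u c v
    unfolding y1_def act_lin[OF nat_pow_closed[OF rW(1)]] height_lin by (simp add: sum.distrib sum_distrib_left)
  have y_lin: "y (\<lambda>r. a * u r + c * v r) = a * y u + c * y v" for a u c v
    unfolding y_def act_lin[OF rW(2)] y1_lin by (simp add: algebra_simps)
  have y_uminus: "y (\<lambda>r. - v r) = - y v" for v using y_lin[of "-1" v 0 v] by simp
  have y_sum: "y (\<lambda>r. \<Sum>s\<in>U. c s * v s r) = (\<Sum>s\<in>U. c s * y (v s))" if "finite U" for U c v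
    using that
  proof (induction U rule: finite_induct)
    case empty show ?case using y_lin[of 0 "\<lambda>r. 0" 0 "\<lambda>r. 0"] by simp
  next
    case (insert x F) then show ?case using y_lin[of "c x" "v x" 1 "\<lambda>r. \<Sum>s\<in>F. c s * v s r"] by simp
  qed
  have yfix: "y \<delta> = 0" if d: "\<delta> \<in> roots" "\<And>v. y (act (root_refl \<delta>) v) = y v" for \<delta>
  proof -
    have "act (root_refl \<delta>) \<delta> = (\<lambda>r. - \<delta> r)" using d by (simp add: act_root_refl form_root)
    then show ?thesis using d(2)[of \<delta>] y_uminus by simp
  qed
  define z where "z w v = y (act w v)" for w v
  define Fin where "Fin w = (\<Union>i<n. inversions (\<rho> [^] i \<otimes> w) \<union> inversions (\<rho> [^] i \<otimes> root_refl \<beta> \<otimes> w))" for w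
  have finFin: "finite (Fin w)" if "w \<in> W" for w
    unfolding Fin_def using that rW by (auto intro!: finite_inversions)
  have zpos: "0 < z w \<delta>" if d: "\<delta> \<in> pos_roots" "\<delta> \<notin> Fin w" "w \<in> W" for \<delta> w
  proof -
    have pos: "0 < height (act g \<delta>)" if "\<delta> \<notin> inversions g" "g \<in> W" for g
      using that d height_pos[of "act g \<delta>"] root_cases[of "act g \<delta>"] by (auto simp: inversions_def pos_roots_def)
    have 1: "0 < height (act (\<rho> [^] i) (act w \<delta>))" "0 < height (act (\<rho> [^] i) (act (root_refl \<beta>) (act w \<delta>)))" if "i < n" for i
    proof -
      show "0 < height (act (\<rho> [^] i) (act w \<delta>))"
        using pos[of "\<rho> [^] i \<otimes> w"] d rW that by (auto simp: Fin_def act_mult)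
      show "0 < height (act (\<rho> [^] i) (act (root_refl \<beta>) (act w \<delta>)))"
        using pos[of "\<rho> [^] i \<otimes> root_refl \<beta> \<otimes> w"] d rW that by (auto simp: Fin_def act_mult)
    qed
    have "0 < y1 (act w \<delta>)" "0 < y1 (act (root_refl \<beta>) (act w \<delta>))"
      unfolding y1_def using n 1 by (auto intro!: sum_pos)
    then show ?thesis by (simp add: z_def y_def)
  qed
  define Neg where "Neg w = {\<delta> \<in> pos_roots. z w \<delta> < 0}" for w
  have finNeg: "finite (Neg w)" if "w \<in> W" for w
    by (rule finite_subset[OF _ finFin[OF that]]) (use zpos that in \<open>force simp: Neg_def\<close>)
  obtain w where w: "w \<in> W" "\<And>w'. w' \<in> W \<Longrightarrow> card (Neg w) \<le> card (Neg w')"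
    using ex_has_least_nat[of "\<lambda>w. w \<in> W" \<one> "\<lambda>w. card (Neg w)"] by auto
  \<comment> \<open>\<open>w\<close> minimises the number of positive roots of negative value. If a
    simple root were among them, passing to \<open>w \<otimes> s\<close> would lower the number,
    since \<open>reflect s\<close> permutes the other positive roots.\<close>
  have dominates: "0 \<le> z w (simple_root s)" if s: "s \<in> S" for s
  proof (rule ccontr)
    assume "\<not> 0 \<le> z w (simple_root s)"
    then have neg: "z w (simple_root s) < 0" by simp
    have zs: "z (w \<otimes> s) \<delta> = z w (reflect s \<delta>)" for \<delta> using w s by (simp add: z_def act_mult)
    have "z (w \<otimes> s) (simple_root s) = - z w (simple_root s)"
      unfolding zs using s by (simp add: z_def act_uminus w(1) y_uminus)
    then have "z (w \<otimes> s) (simple_root s) > 0" using neg by simp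
    have "reflect s ` Neg (w \<otimes> s) \<subseteq> Neg w - {simple_root s}"
    proof
      fix \<delta> assume "\<delta> \<in> reflect s ` Neg (w \<otimes> s)"
      then obtain \<epsilon> where e: "\<epsilon> \<in> pos_roots" "z (w \<otimes> s) \<epsilon> < 0" "\<delta> = reflect s \<epsilon>" by (auto simp: Neg_def)
      have "\<epsilon> \<noteq> simple_root s" using e \<open>z (w \<otimes> s) (simple_root s) > 0\<close> by auto
      then have "\<delta> \<in> pos_roots" using reflect_proot e s by simp
      moreover have "\<delta> \<noteq> simple_root s"
      proof
        assume "\<delta> = simple_root s"
        then have "reflect s \<delta> = (\<lambda>r. - simple_root s r)" using s by simp
        then have "\<epsilon> = (\<lambda>r. - simple_root s r)" using e s by simp
        then have "nonpos \<epsilon>" by simp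
        then show False using e root_not_both by (auto simp: pos_roots_def)
      qed
      ultimately show "\<delta> \<in> Neg w - {simple_root s}" using e by (simp add: Neg_def zs)
    qed
    moreover have "inj_on (reflect s) (Neg (w \<otimes> s))" by (rule inj_onI) (metis s reflect_refl)
    ultimately have "card (Neg (w \<otimes> s)) \<le> card (Neg w - {simple_root s})"
      using finNeg[OF w(1)] by (metis card_image card_mono finite_Diff)
    also have "\<dots> < card (Neg w)"
      using neg s finNeg[OF w(1)] by (intro card_Diff1_less) (auto simp: Neg_def)
    finally show False using w(2)[of "w \<otimes> s"] w(1) s by simp
  qed
  have zsum: "z w \<delta> = (\<Sum>s\<in>S. \<delta> s * z w (simple_root s))" if "\<delta> \<in> roots" for \<delta>
  proof -
    have "act w \<delta> = (\<lambda>r. \<Sum>s\<in>S. \<delta> s * act w (simple_root s) r)"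
      by (rule act_expand[OF w(1) order_refl root_out[OF that]])
    then show ?thesis using y_sum[OF finS, of \<delta> "\<lambda>s. act w (simple_root s)"] by (simp add: z_def)
  qed
  define U where "U = {s \<in> S. z w (simple_root s) = 0}"
  have mem: "\<delta> \<in> roots_in U" if d: "\<delta> \<in> roots" "z w \<delta> = 0" for \<delta>
  proof -
    have "\<delta> r = 0" if r: "r \<notin> U" for r
    proof (cases "r \<in> S")
      case True
      have "\<delta> r * z w (simple_root r) = 0"
        by (rule sum_eq_0_sign) (use d zsum[OF d(1)] dominates True root_cases[OF d(1)] in \<open>auto simp: nonneg_def nonpos_def\<close>)
      then show ?thesis using r True by (auto simp: U_def)
    qed (use root_out d in auto)
    then show ?thesis using d by (auto simp: roots_in_def)
  qed
  have "roots_in U \<subseteq> Fin w \<union> (\<lambda>\<delta> r. - \<delta> r) ` Fin w"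
  proof
    fix \<delta> assume d: "\<delta> \<in> roots_in U"
    have R': "\<delta> \<in> roots" using d by (simp add: roots_in_def)
    have "\<delta> s * z w (simple_root s) = 0" for s using d by (cases "s \<in> U") (auto simp: roots_in_def U_def)
    then have z0: "z w \<delta> = 0" unfolding zsum[OF R'] by (intro sum.neutral) blast
    then have z0': "z w (\<lambda>r. - \<delta> r) = 0" by (simp add: z_def act_uminus w y_uminus)
    show "\<delta> \<in> Fin w \<union> (\<lambda>\<delta> r. - \<delta> r) ` Fin w"
    proof (cases "\<delta> \<in> pos_roots")
      case True then show ?thesis using zpos[of \<delta> w] z0 w by auto
    next
      case False
      then have "(\<lambda>r. - \<delta> r) \<in> Fin w" using root_pm[OF R'] zpos[of "\<lambda>r. - \<delta> r" w] z0' w by auto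
      then show ?thesis by (intro UnI2 image_eqI[of _ _ "\<lambda>r. - \<delta> r"]) auto
    qed
  qed
  then have finU: "finite (roots_in U)" using finFin[OF w(1)] by (auto intro: finite_subset)
  let ?b = "act (inv w) \<beta>" and ?g = "act (inv w) \<gamma>"
  have "?b \<in> roots_in U" "?g \<in> roots_in U"
    using mem[of ?b] mem[of ?g] R w yfix[OF R(1) yb] yfix[OF R(2) yg] by (auto simp: z_def)
  moreover have "form ?b ?g = form \<beta> \<gamma>" using form_act w by simp
  moreover have "U \<subseteq> S" by (auto simp: U_def)
  ultimately show ?thesis unfolding form_vals_def using finU
    by (intro UN_I[of U]) (auto intro!: image_eqI[of _ _ "(?b, ?g)"])
qed

subsection \<open>Dominance and elementary roots\<close>

text \<open>The dominance relation of Brink and Howlett, phrased with group elements in place of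
  half-spaces.\<close>

definition dominates :: "'a vec \<Rightarrow> 'a vec \<Rightarrow> bool" where
  "dominates \<beta> \<gamma> \<longleftrightarrow> (\<forall>x\<in>W. nonpos (act x \<beta>) \<longrightarrow> nonpos (act x \<gamma>))"

text \<open>The reflections generate an infinite dihedral group, and the vectors \<open>d n\<close>
  are, up to sign, roots in its orbits of \<open>a\<close> and \<open>c\<close>. All of them stay
  nonnegative under \<open>x\<close>, while their coordinate at \<open>r\<close> falls strictly and
  becomes negative; so the negatives of infinitely many of them would be inversions of
  \<open>x\<close>. The two alternatives for \<open>r\<close> are the two situations in which the
  coordinate is known to fall.\<close>

lemma dominates_aux:
  assumes R: "a \<in> roots" "c \<in> roots" and b: "form a c = b" "1 \<le> b" and x: "x \<in> W" "nonneg (act x a)" "nonpos (act x c)"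
    and r: "b = 1 \<and> a r < c r \<or> a r = 0 \<and> 0 < c r"
  shows False
proof -
  define d where "d n = (\<lambda>t. cheb b (Suc n) * a t + (- cheb b n) * c t)" for n
  have Bs: "form a a = 1" "form c c = 1" "form c a = b" "form a c = b" using form_root R form_sym b by auto
  have aa: "act (root_refl a) v = (\<lambda>r. 1 * v r + (- 2 * form v a) * a r)" and ac: "act (root_refl c) v = (\<lambda>r. 1 * v r + (- 2 * form v c) * c r)" for v
    using R by (simp_all add: act_root_refl)
  have dR: "d n \<in> roots" for n
  proof (induction n rule: induct_nat_012)
    case 0 then show ?case using R by (simp add: d_def)
  next
    case 1
    have "d (Suc 0) = (\<lambda>r. - act (root_refl a) c r)" by (simp add: d_def aa Bs)
    then show ?case using R uminus_root by simp
  next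
    case (ge2 n)
    have "d (Suc (Suc n)) = act (root_refl a) (act (root_refl c) (d n))"
      unfolding ac[of "d n"] aa form_lin unfolding d_def form_lin
      by (simp add: Bs algebra_simps)
    then show ?case using ge2 R by simp
  qed
  have nnd: "nonneg (act x (d n))" for n
    unfolding d_def act_lin[OF x(1)] using x(2,3) cheb_nonneg[OF b(2)]
    by (auto simp: nonneg_def nonpos_def intro!: order_trans[OF mult_nonneg_nonpos mult_nonneg_nonneg])
  have dec: "d (Suc n) r < d n r" for n
  proof (cases "b = 1 \<and> a r < c r")
    case True then show ?thesis by (simp add: d_def cheb_1 algebra_simps)
  next
    case False
    then have "a r = 0" "0 < c r" using r by auto
    then show ?thesis using cheb_Suc_ge[OF b(2), of n] by (simp add: d_def del: cheb.simps(3))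
  qed
  obtain N where N: "d N r < 0"
  proof (cases "b = 1 \<and> a r < c r")
    case True
    obtain n :: nat where "a r / (c r - a r) < n" using reals_Archimedean2 by blast
    then have "d n r < 0" using True by (simp add: d_def cheb_1 field_simps)
    then show ?thesis using that by blast
  next
    case False
    then have "a r = 0" "0 < c r" using r by auto
    then have "d 1 r < 0" by (simp add: d_def)
    then show ?thesis using that by blast
  qed
  have mono: "d n r < d m r" if "m < n" for m n
    using lift_Suc_mono_less[of "\<lambda>n. - d n r" m n] dec that by simp
  have "(\<lambda>t. - d n t) \<in> inversions x" if n: "N \<le> n" for n
  proof -
    have "d n r < 0" using N mono[of N n] n by (cases "n = N") auto
    then have "nonpos (d n)" using root_cases[OF dR[of n]] by (auto simp: nonneg_def not_le[symmetric])
    then show ?thesis using nnd[of n] uminus_root[OF dR[of n]] x by (simp add: inversions_def pos_roots_def act_uminus)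
  qed
  then have "(\<lambda>n t. - d n t) ` {N..} \<subseteq> inversions x" by auto
  then have "finite ((\<lambda>n t. - d n t) ` {N..})" using finite_inversions[OF x(1)] finite_subset by blast
  moreover have "inj_on (\<lambda>n t. - d n t) {N..}"
  proof (rule inj_onI)
    fix m n assume "(\<lambda>t. - d m t) = (\<lambda>t. - d n t)"
    then have "d m r = d n r" by (metis neg_equal_iff_equal)
    then show "m = n" using mono[of m n] mono[of n m] by (metis less_irrefl linorder_neqE_nat)
  qed
  ultimately have "finite {N..}" by (rule finite_imageD)
  then show False using infinite_Ici by blast
qed

lemma dominates_simple:
  assumes "\<beta> \<in> pos_roots" "s \<in> S" "\<beta> \<noteq> simple_root s" "1 \<le> form_at \<beta> s" shows "dominates \<beta> (simple_root s)"
  unfolding dominates_def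
proof (intro ballI impI)
  fix x assume x: "x \<in> W" "nonpos (act x \<beta>)"
  show "nonpos (act x (simple_root s))"
  proof (rule ccontr)
    assume "\<not> nonpos (act x (simple_root s))"
    then have "nonneg (act x (simple_root s))" using root_cases[of "act x (simple_root s)"] x assms by auto
    moreover obtain r where "r \<noteq> s" "\<beta> r \<noteq> 0" using proot_only[of \<beta> s] assms by blast
    then have "simple_root s r = 0" "0 < \<beta> r" using assms by (auto simp: pos_roots_def nonneg_def less_le)
    ultimately show False
      using dominates_aux[of "simple_root s" \<beta> "form_at \<beta> s" x r] assms x form_ax' by (auto simp: pos_roots_def)
  qed
qed

lemma dominates_eq_1:
  assumes "\<beta> \<in> pos_roots" "\<gamma> \<in> pos_roots" "form \<gamma> \<beta> = 1" "\<And>t. \<gamma> t \<le> \<beta> t" "\<gamma> \<noteq> \<beta>" shows "dominates \<beta> \<gamma>"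
  unfolding dominates_def
proof (intro ballI impI)
  fix x assume x: "x \<in> W" "nonpos (act x \<beta>)"
  show "nonpos (act x \<gamma>)"
  proof (rule ccontr)
    assume "\<not> nonpos (act x \<gamma>)"
    then have "nonneg (act x \<gamma>)" using root_cases[of "act x \<gamma>"] x assms by (auto simp: pos_roots_def)
    moreover obtain r where "\<gamma> r \<noteq> \<beta> r" using assms by (auto simp: fun_eq_iff)
    then have "\<gamma> r < \<beta> r" using assms(4)[of r] by simp
    ultimately show False
      using dominates_aux[of \<gamma> \<beta> 1 x r] assms x by (auto simp: pos_roots_def)
  qed
qed

text \<open>Also called small roots: no other wall separates their wall from the identity
  chamber.\<close>

definition elementary :: "'a vec set" where
  "elementary = {\<beta> \<in> pos_roots. \<forall>\<gamma>\<in>pos_roots. dominates \<beta> \<gamma> \<longrightarrow> \<gamma> = \<beta>}"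

text \<open>Otherwise the form value of the root with itself, which is 1, would be a sum of
  nonpositive terms.\<close>

lemma proot_form_at: assumes "\<beta> \<in> pos_roots" shows "\<exists>r\<in>S. 0 < form_at \<beta> r"
proof (rule ccontr)
  assume "\<not> ?thesis"
  then have "(\<Sum>t\<in>S. \<beta> t * form_at \<beta> t) \<le> 0"
    using assms by (intro sum_nonpos mult_nonneg_nonpos) (auto simp: pos_roots_def nonneg_def not_less)
  then show False using assms form_root[of \<beta>] by (auto simp: pos_roots_def form_form_at)
qed

text \<open>With a form value of at least 1 the root would dominate \<open>simple_root r\<close>.
  Below that, the reflection lowers the depth of the root, measured here by the length of its
  reflection, and a root dominated by the image reflects back to one dominated by
  \<open>\<beta>\<close>.\<close>

lemma elementary_down:
  assumes e: "\<beta> \<in> elementary" and r: "r \<in> S" "\<beta> \<noteq> simple_root r" "0 < form_at \<beta> r"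
  shows "form_at \<beta> r < 1" "reflect r \<beta> \<in> elementary" "len (root_refl (reflect r \<beta>)) < len (root_refl \<beta>)"
proof -
  have bp: "\<beta> \<in> pos_roots" "\<beta> \<in> roots" using e by (auto simp: elementary_def pos_roots_def)
  show "form_at \<beta> r < 1"
  proof (rule ccontr)
    assume "\<not> form_at \<beta> r < 1"
    then have "dominates \<beta> (simple_root r)" using dominates_simple bp r by simp
    then show False using e r by (auto simp: elementary_def)
  qed
  let ?b = "reflect r \<beta>"
  have b': "?b \<in> pos_roots" "?b \<in> roots" using reflect_proot[OF bp(1) r(1,2)] by (auto simp: pos_roots_def)
  show "?b \<in> elementary"
  proof -
    have "\<gamma> = ?b" if g: "\<gamma> \<in> pos_roots" "dominates ?b \<gamma>" for \<gamma>
    proof (cases "\<gamma> = simple_root r")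
      \<comment> \<open>Here reflecting back would not give a positive root. Instead the reflection
        in \<open>?b\<close> itself is used: it makes \<open>?b\<close> negative but keeps
        \<open>simple_root r\<close> nonnegative.\<close>
      case True
      have "act (root_refl ?b) ?b = (\<lambda>t. - ?b t)" using b' by (simp add: act_root_refl form_root)
      then have "nonpos (act (root_refl ?b) ?b)" using b' by (simp add: pos_roots_def)
      then have n: "nonpos (act (root_refl ?b) (simple_root r))" using g True b' by (auto simp: dominates_def)
      have "form (simple_root r) ?b = - form_at \<beta> r" using r by (simp add: form_ax' form_at_refl)
      then have "act (root_refl ?b) (simple_root r) = (\<lambda>t. simple_root r t + 2 * form_at \<beta> r * ?b t)" using b' by (simp add: act_root_refl)
      then have "nonneg (act (root_refl ?b) (simple_root r))" using b' r by (auto simp: nonneg_def pos_roots_def)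
      then show ?thesis using n root_not_both[of "act (root_refl ?b) (simple_root r)"] b' r by auto
    next
      case False
      then have g': "reflect r \<gamma> \<in> pos_roots" using reflect_proot g r by blast
      have "dominates \<beta> (reflect r \<gamma>)"
        unfolding dominates_def
      proof (intro ballI impI)
        fix x assume x: "x \<in> W" "nonpos (act x \<beta>)"
        then have "nonpos (act (x \<otimes> r) ?b)" using r by (simp add: act_mult)
        then have "nonpos (act (x \<otimes> r) \<gamma>)" using g x r by (auto simp: dominates_def)
        then show "nonpos (act x (reflect r \<gamma>))" using x r by (simp add: act_mult)
      qed
      then have "reflect r \<gamma> = \<beta>" using e g' by (auto simp: elementary_def)
      then show ?thesis using r by (metis reflect_refl)
    qed
    then show ?thesis using b' by (auto simp: elementary_def)
  qed
  obtain t where "t \<noteq> r" "\<beta> t \<noteq> 0" using proot_only[of \<beta> r] bp r by blast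
  then have t: "t \<noteq> r" "0 < \<beta> t" using bp by (auto simp: pos_roots_def nonneg_def less_le)
  have a: "act (root_refl \<beta>) (simple_root r) = (\<lambda>u. simple_root r u - 2 * form_at \<beta> r * \<beta> u)" using bp r by (simp add: act_root_refl form_ax')
  then have "act (root_refl \<beta>) (simple_root r) t < 0" using t r by simp
  then have "nonpos (act (root_refl \<beta>) (simple_root r))"
    using root_cases[of "act (root_refl \<beta>) (simple_root r)"] bp r by (auto simp: nonneg_def not_le[symmetric])
  then have 1: "len (root_refl \<beta> \<otimes> r) < len (root_refl \<beta>)" using len_less_iff(2)[of "root_refl \<beta>" r] bp r by simp
  have e2: "act (r \<otimes> root_refl \<beta>) (simple_root r) = (\<lambda>u. - simple_root r u - 2 * form_at \<beta> r * ?b u)"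
    using bp r a reflect_lin[of r 1 "simple_root r" "- 2 * form_at \<beta> r" \<beta>] by (simp add: act_mult)
  have "nonpos (act (r \<otimes> root_refl \<beta>) (simple_root r))"
    unfolding nonpos_def e2
  proof
    fix u
    have "0 \<le> 2 * form_at \<beta> r * ?b u" using b' r by (simp add: nonneg_def pos_roots_def)
    then show "- simple_root r u - 2 * form_at \<beta> r * ?b u \<le> 0" using simple_root_nonneg[of r u] by linarith
  qed
  then have 2: "len (r \<otimes> root_refl \<beta> \<otimes> r) < len (r \<otimes> root_refl \<beta>)"
    using len_less_iff(2)[of "r \<otimes> root_refl \<beta>" r] bp r by simp
  have "inv (r \<otimes> root_refl \<beta>) = root_refl \<beta> \<otimes> r"
    using bp r inv_equality[OF root_refl_root_refl[OF bp(2)]] by (simp add: inv_mult_group)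
  then have "len (r \<otimes> root_refl \<beta>) = len (root_refl \<beta> \<otimes> r)" using len_inv[of "r \<otimes> root_refl \<beta>"] bp r by simp
  moreover have "root_refl ?b = r \<otimes> root_refl \<beta> \<otimes> r" using root_refl_act[of r \<beta>] bp r by simp
  ultimately show "len (root_refl ?b) < len (root_refl \<beta>)" using 1 2 by simp
qed

definition elem_path :: "(nat \<Rightarrow> 'a vec) \<Rightarrow> nat \<Rightarrow> bool" where
  "elem_path p n \<longleftrightarrow> (\<exists>s\<in>S. p 0 = simple_root s) \<and> (\<forall>i\<le>n. p i \<in> elementary) \<and>
     (\<forall>i<n. \<exists>r\<in>S. -1 < form_at (p i) r \<and> form_at (p i) r < 0 \<and> p (Suc i) = reflect r (p i))"

text \<open>Descend by \<open>elementary_down\<close> until a simple root is reached. Read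
  backwards, each step reflects at a form value strictly between -1 and 0.\<close>

lemma elementary_path: "\<beta> \<in> elementary \<Longrightarrow> \<exists>p n. elem_path p n \<and> p n = \<beta>"
proof (induction "len (root_refl \<beta>)" arbitrary: \<beta> rule: less_induct)
  case less
  have bp: "\<beta> \<in> pos_roots" using less.prems by (auto simp: elementary_def)
  obtain r where r: "r \<in> S" "0 < form_at \<beta> r" using proot_form_at[OF bp] by blast
  show ?case
  proof (cases "\<beta> = simple_root r")
    case True
    then show ?thesis using r less.prems
      by (intro exI[of _ "\<lambda>_. \<beta>"] exI[of _ 0]) (auto simp: elem_path_def)
  next
    case False
    note d = elementary_down[OF less.prems r(1) False r(2)]
    obtain p n where p: "elem_path p n" "p n = reflect r \<beta>" using less.hyps[OF d(3,2)] by blast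
    have "form_at (p n) r = - form_at \<beta> r" "reflect r (p n) = \<beta>" using p r by (auto simp: form_at_refl)
    then have "elem_path (p(Suc n := \<beta>)) (Suc n)"
      using p r d less.prems unfolding elem_path_def by (auto simp: less_Suc_eq le_Suc_eq intro!: bexI[of _ r])
    then show ?thesis by (intro exI[of _ "p(Suc n := \<beta>)"] exI[of _ "Suc n"]) simp
  qed
qed

text \<open>All values up to -1 are merged into -2. This leaves finitely many signatures: values
  strictly between -1 and 1 lie in \<open>form_vals\<close>, and for an elementary root a larger
  value occurs only as the 1 of a simple root with itself.\<close>

definition form_sig :: "'a vec \<Rightarrow> 'a \<Rightarrow> real" where
  "form_sig \<beta> = (\<lambda>r\<in>S. if -1 < form_at \<beta> r then form_at \<beta> r else -2)"

lemma form_sig_mem: assumes "\<beta> \<in> elementary" shows "form_sig \<beta> \<in> S \<rightarrow>\<^sub>E insert (-2) (insert 1 form_vals)"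
proof -
  have bp: "\<beta> \<in> pos_roots" "\<beta> \<in> roots" using assms by (auto simp: elementary_def pos_roots_def)
  have "form_at \<beta> r \<in> insert 1 form_vals" if r: "r \<in> S" "-1 < form_at \<beta> r" for r
  proof (cases "\<beta> = simple_root r")
    case True then show ?thesis using r by (simp add: form_at_simple_root)
  next
    case False
    have "form_at \<beta> r < 1" using elementary_down(1)[OF assms r(1) False] by (cases "0 < form_at \<beta> r") auto
    then show ?thesis using form_form_vals[of \<beta> "simple_root r"] bp r by (simp add: form_simple_root)
  qed
  then show ?thesis by (auto simp: form_sig_def)
qed

text \<open>A path raises coordinates only at letters with form value above -1, and a value that has
  reached -1 never rises above it again. If two signatures agreed, the difference of the roots would
  be supported where their form values agree, hence isotropic; so the two roots would have form
  value 1. Then \<open>dominates_eq_1\<close> makes the later root dominate the earlier one, against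
  elementarity.\<close>

lemma form_sig_inj:
  assumes p: "elem_path p n" and ij: "i < j" "j \<le> n" shows "form_sig (p i) \<noteq> form_sig (p j)"
proof
  assume eq: "form_sig (p i) = form_sig (p j)"
  have E: "p k \<in> elementary" if "k \<le> n" for k using p that by (simp add: elem_path_def)
  have st: "\<exists>r\<in>S. -1 < form_at (p k) r \<and> form_at (p k) r < 0 \<and> p (Suc k) = reflect r (p k)" if "k < n" for k
    using p that by (auto simp: elem_path_def)
  define R where "R = {r \<in> S. -1 < form_at (p i) r}"
  have mono1: "form_at (p (Suc k)) r \<le> -1" if k: "k < n" "r \<in> S" "form_at (p k) r \<le> -1" for k r
  proof -
    obtain u where u: "u \<in> S" "-1 < form_at (p k) u" "form_at (p k) u < 0" "p (Suc k) = reflect u (p k)" using st k by blast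
    then have "u \<noteq> r" using k by auto
    then have "cos_mat u r \<le> 0" using cos_mat_le_0 u k by simp
    then have "0 \<le> form_at (p k) u * cos_mat u r" using u by (simp add: mult_nonpos_nonpos)
    then show ?thesis using u k by (simp add: form_at_refl)
  qed
  have mono: "form_at (p k) r \<le> -1" if k: "i \<le> k" "k \<le> n" "r \<in> S" "r \<notin> R" for k r
    using k(1,2)
  proof (induction k rule: dec_induct)
    case base then show ?case using k by (auto simp: R_def)
  next
    case (step m) then show ?case using mono1[of m r] k by simp
  qed
  have grow: "(\<forall>t. p i t \<le> p k t) \<and> (\<forall>t. t \<notin> R \<longrightarrow> p k t = p i t) \<and> (i < k \<longrightarrow> p k \<noteq> p i)"
    if k: "i \<le> k" "k \<le> n" for k
    using k
  proof (induction k rule: dec_induct)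
    case (step m)
    obtain u where u: "u \<in> S" "-1 < form_at (p m) u" "form_at (p m) u < 0" "p (Suc m) = reflect u (p m)"
      using st[of m] step by auto
    have uR: "u \<in> R" using mono[of m u] u step by fastforce
    have IH: "\<forall>t. p i t \<le> p m t" "\<forall>t. t \<notin> R \<longrightarrow> p m t = p i t" using step by auto
    have v: "p (Suc m) t = p m t + (- 2 * form_at (p m) u) * simple_root u t" for t using u by (simp add: reflect_def)
    have "p m t \<le> p (Suc m) t" for t using v[of t] u by (simp add: mult_nonpos_nonneg)
    moreover have "p (Suc m) t = p m t" if "t \<notin> R" for t using v[of t] uR that by (cases "t = u") auto
    moreover have "p i u < p (Suc m) u" using v[of u] u IH(1)[rule_format, of u] by simp
    ultimately show ?case using IH by (metis less_irrefl order_trans)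
  qed auto
  have ge: "p i t \<le> p j t" and out: "t \<notin> R \<Longrightarrow> p j t = p i t" and ne: "p j \<noteq> p i" for t
    using grow[of j] ij by auto
  have same: "form_at (p j) r = form_at (p i) r" if "r \<in> R" for r
  proof -
    have "form_sig (p i) r = form_sig (p j) r" using eq by simp
    then show ?thesis using that by (auto simp: form_sig_def R_def split: if_splits)
  qed
  define g where "g = (\<lambda>t. 1 * p j t + (-1) * p i t)"
  have prg: "form_at g t = form_at (p j) t - form_at (p i) t" for t unfolding g_def form_at_lin by simp
  have "form g g = (\<Sum>t\<in>S. g t * form_at g t)" by (rule form_form_at)
  also have "\<dots> = 0"
  proof (intro sum.neutral ballI)
    fix t assume "t \<in> S"
    show "g t * form_at g t = 0"
      using out[of t] same[of t] by (cases "t \<in> R") (auto simp: prg, simp add: g_def)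
  qed
  finally have "form (p j) (p j) - 2 * form (p i) (p j) + form (p i) (p i) = 0"
    unfolding g_def form_lin form_lin2 by (simp add: form_sym[of "p j" "p i"])
  moreover have PR: "p i \<in> pos_roots" "p j \<in> pos_roots" using E ij by (auto simp: elementary_def)
  ultimately have "form (p i) (p j) = 1" using form_root[of "p i"] form_root[of "p j"] by (auto simp: pos_roots_def)
  then have "dominates (p j) (p i)" using dominates_eq_1[OF PR(2,1)] ge ne by auto
  then show False using E[of j] ij PR ne by (auto simp: elementary_def)
qed

lemma elem_path_word: assumes "elem_path p n" "k \<le> n"
  shows "\<exists>w s. set w \<subseteq> S \<and> length w = k \<and> s \<in> S \<and> p k = foldr reflect w (simple_root s)"
  using assms(2)
proof (induction k)
  case 0 then show ?case using assms by (auto simp: elem_path_def)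
next
  case (Suc k)
  then obtain w s where w: "set w \<subseteq> S" "length w = k" "s \<in> S" "p k = foldr reflect w (simple_root s)" by auto
  obtain r where "r \<in> S" "p (Suc k) = reflect r (p k)" using assms Suc.prems by (auto simp: elem_path_def Suc_le_eq)
  then show ?case using w by (intro exI[of _ "r # w"] exI[of _ s]) auto
qed

text \<open>Signatures along a path are distinct, so the number of signatures bounds the length of a
  path, and every elementary root is the end of one.\<close>

theorem finite_elementary: "finite elementary"
proof -
  let ?T = "S \<rightarrow>\<^sub>E insert (-2) (insert 1 form_vals)"
  have fT: "finite ?T" using finS finite_form_vals by (intro finite_PiE) auto
  have bound: "n \<le> card ?T" if p: "elem_path p n" for p n
  proof -
    have "inj_on (\<lambda>i. form_sig (p i)) {..n}"
    proof (rule inj_onI)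
      fix i j assume "i \<in> {..n}" "j \<in> {..n}" "form_sig (p i) = form_sig (p j)"
      then show "i = j" using form_sig_inj[OF p, of i j] form_sig_inj[OF p, of j i] by (metis atMost_iff linorder_neqE_nat)
    qed
    moreover have "(\<lambda>i. form_sig (p i)) ` {..n} \<subseteq> ?T" using form_sig_mem p by (auto simp: elem_path_def)
    ultimately have "card {..n} \<le> card ?T" using fT by (metis card_image card_mono)
    then show ?thesis by simp
  qed
  have "elementary \<subseteq> (\<lambda>(w, s). foldr reflect w (simple_root s)) ` ({w. set w \<subseteq> S \<and> length w \<le> card ?T} \<times> S)"
  proof
    fix \<beta> assume "\<beta> \<in> elementary"
    then obtain p n where p: "elem_path p n" "p n = \<beta>" using elementary_path by blast
    then obtain w s where "set w \<subseteq> S" "length w = n" "s \<in> S" "\<beta> = foldr reflect w (simple_root s)"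
      using elem_path_word[OF p(1), of n] by auto
    then show "\<beta> \<in> (\<lambda>(w, s). foldr reflect w (simple_root s)) ` ({w. set w \<subseteq> S \<and> length w \<le> card ?T} \<times> S)"
      using bound[OF p(1)] by (intro image_eqI[of _ _ "(w, s)"]) auto
  qed
  then show ?thesis using finite_lists_length_le[OF finS] finS by (auto intro: finite_subset)
qed

lemma inversions_mono:
  assumes "set a \<subseteq> S" "set b \<subseteq> S" "len (wp (a @ b)) = length (a @ b)"
  shows "inversions (inv (wp a)) \<subseteq> inversions (inv (wp (a @ b)))"
  using assms(2,3)
proof (induction b rule: rev_induct)
  case (snoc s b)
  have l: "len (wp (a @ b)) = length (a @ b)" using reduced_take[of "a @ b" "[s]"] snoc.prems assms by auto
  have "wp (a @ b @ [s]) = wp (a @ b) \<otimes> s" using wp_snoc[of "a @ b" s] snoc.prems assms by simp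
  moreover have "len (wp (a @ b)) < len (wp (a @ b) \<otimes> s)" using l snoc.prems calculation by simp
  ultimately show ?case using inversions_inv_Suc(1)[of "wp (a @ b)" s] snoc l assms by auto
qed simp

lemma nonpos_reflect: assumes "\<epsilon> \<in> roots" "s \<in> S" "nonpos (reflect s \<epsilon>)" shows "nonpos \<epsilon> \<or> \<epsilon> = simple_root s"
  using assms reflect_proot[of \<epsilon> s] root_not_both[of "reflect s \<epsilon>"] root_cases[of \<epsilon>] by (auto simp: pos_roots_def)

text \<open>A wall adjacent to both ends of a geodesic is, seen from any chamber on it, elementary: a wall
  separating it from that chamber would be crossed twice.\<close>

lemma elementary_between:
  assumes uvw: "u \<in> W" "v \<in> W" "w \<in> W" and N: "inversions (inv u) \<subseteq> inversions (inv v)" "inversions (inv v) \<subseteq> inversions (inv w)"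
    and ts: "t \<in> S" "s \<in> S" and eq: "act u (simple_root t) = act w (simple_root s)" and up: "len w < len (w \<otimes> s)"
  shows "act (inv v) (act w (simple_root s)) \<in> elementary"
proof -
  let ?b = "act w (simple_root s)" let ?bj = "act (inv v) ?b"
  have b: "?b \<in> pos_roots" using act_of_nonneg[OF uvw(3) ts(2) up] uvw ts by (auto simp: pos_roots_def)
  have "?b \<notin> inversions (inv w)" using uvw by (auto simp: inversions_def)
  then have "\<not> nonpos ?bj" using N b by (auto simp: inversions_def)
  then have bj: "?bj \<in> pos_roots" using root_cases[of ?bj] uvw ts by (auto simp: pos_roots_def)
  have "\<gamma> = ?bj" if g: "\<gamma> \<in> pos_roots" "dominates ?bj \<gamma>" for \<gamma>
  proof (rule ccontr)
    assume ne: "\<gamma> \<noteq> ?bj"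
    let ?d = "act v \<gamma>"
    have gR: "\<gamma> \<in> roots" "\<not> nonpos \<gamma>" using g root_not_both by (auto simp: pos_roots_def)
    \<comment> \<open>Across the wall of \<open>?b\<close> from \<open>z\<close> that wall is seen
      as negative, and so is the dominated one. Stepping back over the wall of \<open>?b\<close>
      does not change this, as the two walls differ.\<close>
    have far: "nonpos (act (inv z) ?d)" if z: "z \<in> W" "r \<in> S" "act z (simple_root r) = ?b" for z r
    proof -
      have "act (r \<otimes> inv z \<otimes> v) ?bj = reflect r (act (inv z) ?b)" using uvw z by (simp add: act_mult)
      also have "\<dots> = (\<lambda>t. - simple_root r t)" using z by (simp flip: z(3))
      finally have "nonpos (act (r \<otimes> inv z \<otimes> v) ?bj)" by simp
      then have "nonpos (act (r \<otimes> inv z \<otimes> v) \<gamma>)" using g uvw z by (auto simp: dominates_def)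
      then have "nonpos (reflect r (act (inv z) ?d))" using uvw z by (simp add: act_mult)
      then consider "nonpos (act (inv z) ?d)" | "act (inv z) ?d = simple_root r" using nonpos_reflect[of "act (inv z) ?d" r] gR uvw z by auto
      then show ?thesis
      proof cases
        case 2
        then have "act z (act (inv z) ?d) = ?b" using z by simp
        then have "act (inv v) ?d = ?bj" using z by simp
        then show ?thesis using ne uvw by simp
      qed
    qed
    have fu: "nonpos (act (inv u) ?d)" using far[of u t] uvw ts eq by simp
    have fw: "nonpos (act (inv w) ?d)" using far[of w s] uvw ts by simp
    show False
    proof (cases "?d \<in> pos_roots")
      case True
      then have "?d \<in> inversions (inv v)" using fu N by (auto simp: inversions_def)
      then show False using gR uvw by (simp add: inversions_def)
    next
      case False
      let ?m = "\<lambda>r. - ?d r"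
      have m: "?m \<in> pos_roots" using root_pm[of ?d] False gR uvw by auto
      have "act (inv v) ?m = (\<lambda>r. - \<gamma> r)" using act_uminus[of "inv v" ?d] uvw by simp
      then have "?m \<in> inversions (inv v)" using m g by (simp add: inversions_def pos_roots_def)
      then have "nonpos (act (inv w) ?m)" using N by (auto simp: inversions_def)
      then have "nonneg (act (inv w) ?d)" using act_uminus[of "inv w" ?d] uvw by simp
      then show False using fw root_not_both[of "act (inv w) ?d"] gR uvw by simp
    qed
  qed
  then show ?thesis using bj by (auto simp: elementary_def)
qed

lemma root_refl_inj: assumes "\<beta> \<in> pos_roots" "\<gamma> \<in> pos_roots" "root_refl \<beta> = root_refl \<gamma>" shows "\<beta> = \<gamma>"
proof -
  have R: "\<beta> \<in> roots" "\<gamma> \<in> roots" using assms by (auto simp: pos_roots_def)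
  define c where "c = form \<beta> \<gamma>"
  have "(\<lambda>r. \<beta> r - 2 * form \<beta> \<beta> * \<beta> r) = (\<lambda>r. \<beta> r - 2 * form \<beta> \<gamma> * \<gamma> r)"
    using act_root_refl[OF R(1), of \<beta>] act_root_refl[OF R(2), of \<beta>] assms(3) by simp
  then have e: "\<beta> r = c * \<gamma> r" for r by (simp add: fun_eq_iff form_root[OF R(1)] c_def)
  have "form \<beta> \<gamma> = c" by (simp add: c_def)
  have "(\<lambda>r. c * \<gamma> r + 0 * \<gamma> r) = \<beta>" using e by auto
  then have "1 = c * c"
    using form_lin[of c \<gamma> 0 \<gamma> \<beta>] form_root[OF R(1)] form_sym[of \<gamma> \<beta>] by (simp add: c_def)
  moreover have "0 \<le> c"
  proof (rule ccontr)
    assume "\<not> 0 \<le> c"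
    then have "nonpos \<beta>" using e assms by (auto simp: nonpos_def nonneg_def pos_roots_def mult_nonpos_nonneg)
    then show False using assms root_not_both by (auto simp: pos_roots_def)
  qed
  ultimately have "c = 1" by (metis abs_of_nonneg abs_square_eq_1 power2_eq_square)
  then show ?thesis using e by auto
qed

subsection \<open>The lexicographically least reduced word\<close>

definition gen_rank :: "'a \<Rightarrow> nat" where "gen_rank = cox_enum S"

lemma inj_gen_rank: "inj_on gen_rank S"
proof -
  have "\<exists>r :: 'a \<Rightarrow> nat. inj_on r S" using finite_imp_inj_to_nat_seg[OF finS] by blast
  from someI_ex[OF this] show ?thesis unfolding gen_rank_def cox_enum_def .
qed

definition red_word :: "'a set \<Rightarrow> 'a \<Rightarrow> 'a list \<Rightarrow> bool" where
  "red_word V x a \<longleftrightarrow> set a \<subseteq> V \<and> wp a = x \<and> length a = len x"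

definition lex_less :: "'a list \<Rightarrow> 'a list \<Rightarrow> bool" where
  "lex_less a b \<longleftrightarrow> length a = length b \<and> (\<exists>p x y a' b'. a = p @ x # a' \<and> b = p @ y # b' \<and> gen_rank x < gen_rank y)"

lemma wfP_lex_less: "wf {(a, b). lex_less a b}"
proof -
  have "{(a, b). lex_less a b} \<subseteq> lex (inv_image less_than gen_rank)"
    by (auto simp: lex_less_def lex_conv)
  then show ?thesis using wf_lex[OF wf_inv_image[OF wf_less_than]] wf_subset by blast
qed

lemma lltI: "length a = length b \<Longrightarrow> gen_rank x < gen_rank y \<Longrightarrow> lex_less (p @ x # a) (p @ y # b)"
  unfolding lex_less_def by auto

lemma lex_less_Cons: assumes "lex_less a b" shows "lex_less (x # a) (x # b)"
proof -
  obtain p u v a' b' where "a = p @ u # a'" "b = p @ v # b'" "gen_rank u < gen_rank v" "length a' = length b'"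
    using assms by (auto simp: lex_less_def)
  then show ?thesis using lltI[of a' b' u v "x # p"] by simp
qed

lemma lex_less_total:
  assumes "length a = length b" "set a \<subseteq> S" "set b \<subseteq> S" "a \<noteq> b" shows "lex_less a b \<or> lex_less b a"
  using assms
proof (induction a b rule: list_induct2)
  case (Cons x a y b)
  show ?case
  proof (cases "x = y")
    case True
    then have "lex_less a b \<or> lex_less b a" using Cons by auto
    then show ?thesis using lex_less_Cons True by blast
  next
    case False
    then have "gen_rank x \<noteq> gen_rank y" using Cons.prems inj_gen_rank by (auto simp: inj_on_def)
    then show ?thesis using Cons.hyps lltI[of a b x y "[]"] lltI[of b a y x "[]"] by (cases "gen_rank x < gen_rank y") auto
  qed
qed simp

definition norm_form :: "'a set \<Rightarrow> 'a \<Rightarrow> 'a list" where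
  "norm_form V x = (SOME a. red_word V x a \<and> (\<forall>b. red_word V x b \<longrightarrow> \<not> lex_less b a))"

lemma norm_form: assumes "V \<subseteq> S" "x \<in> generate G V"
  shows "red_word V x (norm_form V x)" "\<And>b. red_word V x b \<Longrightarrow> \<not> lex_less b (norm_form V x)"
proof -
  obtain a where "set a \<subseteq> V" "length a = len x" "wp a = x" by (rule par_word[OF assms])
  then have "red_word V x a" by (simp add: red_word_def)
  then obtain m where "red_word V x m" "\<And>b. lex_less b m \<Longrightarrow> \<not> red_word V x b"
    using wfE_min[OF wfP_lex_less, of a "Collect (red_word V x)"] by auto
  then have "\<exists>a. red_word V x a \<and> (\<forall>b. red_word V x b \<longrightarrow> \<not> lex_less b a)" by blast
  from someI_ex[OF this] show "red_word V x (norm_form V x)" "\<And>b. red_word V x b \<Longrightarrow> \<not> lex_less b (norm_form V x)"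
    unfolding norm_form_def by auto
qed

lemma norm_form_unique: assumes "V \<subseteq> S" "x \<in> generate G V" "red_word V x a" "\<And>b. red_word V x b \<Longrightarrow> \<not> lex_less b a" shows "a = norm_form V x"
proof (rule ccontr)
  assume "a \<noteq> norm_form V x"
  moreover have "length a = length (norm_form V x)" "set a \<subseteq> S" "set (norm_form V x) \<subseteq> S"
    using norm_form(1)[OF assms(1,2)] assms(1,3) by (auto simp: red_word_def)
  ultimately show False using lex_less_total norm_form[OF assms(1,2)] assms(3,4) by blast
qed

text \<open>Delete from the normal form of \<open>x \<otimes> s\<close> the letter found by
  \<open>exchange\<close>. The rest is the normal form of \<open>x\<close>: a smaller reduced word
  for \<open>x\<close> that differs before the deleted place could be extended by \<open>s\<close>,
  one that differs after it could have the letter put back, and either would beat the normal form of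
  \<open>x \<otimes> s\<close>.\<close>

lemma norm_form_insert:
  assumes V: "V \<subseteq> S" and x: "x \<in> generate G V" and s: "s \<in> V" and up: "len x < len (x \<otimes> s)"
  obtains a t b where "norm_form V x = a @ b" "norm_form V (x \<otimes> s) = a @ t # b"
proof -
  have xs: "x \<otimes> s \<in> generate G V" "x \<in> W" "s \<in> S" using V x s by auto
  define z where "z = norm_form V (x \<otimes> s)"
  have z: "set z \<subseteq> V" "wp z = x \<otimes> s" "length z = Suc (len x)" "\<And>b. red_word V (x \<otimes> s) b \<Longrightarrow> \<not> lex_less b z"
    using norm_form[OF V xs(1)] len_up[OF xs(2,3) up] by (auto simp: red_word_def z_def)
  have "nonpos (act (wp z) (simple_root s))" using act_nonpos[of "x \<otimes> s" s] z xs up by simp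
  moreover have "set z \<subseteq> S" using z V by auto
  ultimately obtain k where k: "k < length z" "wp (take k z @ drop (Suc k) z) = wp z \<otimes> s"
    using exchange xs by blast
  define a where "a = take k z" define t where "t = z ! k" define b where "b = drop (Suc k) z"
  have zab: "z = a @ t # b" using k by (simp add: a_def b_def t_def id_take_nth_drop)
  have ab: "wp (a @ b) = x" using k z xs by (simp add: a_def b_def)
  have cl: "set a \<subseteq> V" "t \<in> V" "set b \<subseteq> V" using z(1) zab by auto
  have S: "set a \<subseteq> S" "t \<in> S" "set b \<subseteq> S" using cl V by auto
  have "a @ b = norm_form V x"
  proof (rule norm_form_unique[OF V x])
    show "red_word V x (a @ b)" using cl ab z zab by (auto simp: red_word_def)
    fix c assume c: "red_word V x c"
    show "\<not> lex_less c (a @ b)"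
    proof
      assume "lex_less c (a @ b)"
      then obtain p u v c' d' where l: "c = p @ u # c'" "a @ b = p @ v # d'" "gen_rank u < gen_rank v" "length c = length (a @ b)"
        unfolding lex_less_def by blast
      have cS: "set c \<subseteq> S" using c V by (auto simp: red_word_def)
      show False
      proof (cases "length p < length a")
        case True
        then obtain a' where a': "a = p @ v # a'" using l(2) by (auto simp: append_eq_append_conv2 append_eq_Cons_conv)
        have "red_word V (x \<otimes> s) (c @ [s])"
          using c s cS xs len_up[OF xs(2,3) up] by (auto simp: red_word_def)
        moreover have "lex_less (c @ [s]) z" using l zab a' lltI[of "c' @ [s]" "a' @ t # b" u v p] by auto
        ultimately show False using z(4) by blast
      next
        case False
        then obtain p' where p': "p = a @ p'" "b = p' @ v # d'" using l(2) by (auto simp: append_eq_append_conv2 append_eq_Cons_conv)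
        define e where "e = p' @ u # c'"
        have ce: "c = a @ e" using l p' by (simp add: e_def)
        have eS: "set e \<subseteq> S" using cS ce by auto
        have "wp a \<otimes> wp e = wp a \<otimes> wp b" using ab c ce S eS by (simp add: wp_append red_word_def)
        then have "wp e = wp b" using S eS by simp
        then have "wp (a @ t # e) = x \<otimes> s" using z(2) zab S eS by (simp add: wp_append)
        then have "red_word V (x \<otimes> s) (a @ t # e)"
          using c ce cl l(4) len_up[OF xs(2,3) up] by (auto simp: red_word_def)
        moreover have "lex_less (a @ t # e) z" using l zab p' lltI[of c' d' u v "a @ t # p'"] by (auto simp: e_def)
        ultimately show False using z(4) by blast
      qed
    qed
  qed
  then show thesis using that[of a b t] zab by (simp add: z_def)
qed

text \<open>The possible differences between simultaneous points of neighbouring combing paths;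
  finite because the elementary roots are.\<close>

definition near :: "'a set" where "near = insert \<one> S \<union> root_refl ` elementary"

lemma finite_near: "finite near" unfolding near_def using finS finite_elementary by auto

lemma near_inv: "g \<in> near \<Longrightarrow> inv g \<in> near"
proof -
  assume "g \<in> near"
  moreover have "inv (root_refl \<beta>) = root_refl \<beta>" if "\<beta> \<in> elementary" for \<beta>
    using that by (intro inv_equality) (auto simp: elementary_def pos_roots_def)
  ultimately show ?thesis by (auto simp: near_def)
qed

lemma wp_take_near:
  assumes "set a \<subseteq> S" "j' = j \<or> j' = Suc j" shows "inv (wp (take j a)) \<otimes> wp (take j' a) \<in> insert \<one> S"
proof (cases "j' = Suc j \<and> j < length a")
  case True
  then have "take j' a = take j a @ [a ! j]" by (simp add: take_Suc_conv_app_nth)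
  moreover have "a ! j \<in> S" "set (take j a) \<subseteq> S" using assms True by (auto dest: in_set_takeD)
  ultimately show ?thesis by (simp flip: m_assoc)
next
  case False
  then have "take j' a = take j a" using assms by auto
  moreover have "set (take j a) \<subseteq> S" using assms by (auto dest: in_set_takeD)
  ultimately show ?thesis by simp
qed

section \<open>The combing of the cosets of \<open>W_V\<close> by normal forms\<close>

context
  fixes V :: "'a set" assumes V: "V \<subseteq> S"
begin

definition comb_len :: "'a \<Rightarrow> nat" where "comb_len w = len (par_part V w)"

text \<open>Steps are counted backwards from \<open>w\<close> and not from the coset representative:
  normal forms of neighbours differ by one inserted letter, so words truncated from the right stay
  parallel until they pass that letter. Truncated subtraction lets the path rest at its end after
  \<open>comb_len w\<close> steps.\<close>

definition comb :: "nat \<Rightarrow> 'a \<Rightarrow> 'a" where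
  "comb n w = min_rep V w \<otimes> wp (take (comb_len w - n) (norm_form V (par_part V w)))"

lemma nfw: assumes "w \<in> W"
  shows "set (norm_form V (par_part V w)) \<subseteq> V" "set (norm_form V (par_part V w)) \<subseteq> S" "wp (norm_form V (par_part V w)) = par_part V w" "length (norm_form V (par_part V w)) = comb_len w"
  using norm_form(1)[OF V par_part(1)[OF assms V]] V by (auto simp: red_word_def comb_len_def)

lemma set_take_norm_form: "w \<in> W \<Longrightarrow> set (take n (norm_form V (par_part V w))) \<subseteq> S" "w \<in> W \<Longrightarrow> set (drop n (norm_form V (par_part V w))) \<subseteq> S"
  "w \<in> W \<Longrightarrow> set (drop n (norm_form V (par_part V w))) \<subseteq> V"
  using nfw by (blast dest: in_set_takeD in_set_dropD)+

lemma comb_W [simp]: "w \<in> W \<Longrightarrow> comb n w \<in> W"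
  using set_take_norm_form min_rep(3)[OF _ V] by (simp add: comb_def)

lemma comb_0 [simp]: "w \<in> W \<Longrightarrow> comb 0 w = w"
  using nfw[of w] par_part(2)[OF _ V] by (simp add: comb_def)

lemma comb_big: "w \<in> W \<Longrightarrow> comb_len w \<le> n \<Longrightarrow> comb n w = min_rep V w"
  using min_rep(3)[OF _ V] by (simp add: comb_def)

lemma comb_suffix:
  assumes "w \<in> W"
  obtains u where "u \<in> generate G V" "w = comb n w \<otimes> u" "len u = min n (comb_len w)" "len w = len (comb n w) + len u"
proof -
  let ?a = "norm_form V (par_part V w)"
  define a where "a = take (comb_len w - n) ?a" define b where "b = drop (comb_len w - n) ?a"
  have cl: "set a \<subseteq> S" "set b \<subseteq> S" "set b \<subseteq> V" "set a \<subseteq> V"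
    using set_take_norm_form[OF assms] nfw[OF assms] by (auto simp: a_def b_def dest: in_set_takeD)
  have ab: "a @ b = ?a" by (simp add: a_def b_def)
  have red: "len (wp (a @ b)) = length (a @ b)" using nfw[OF assms] ab by (simp add: comb_len_def)
  note r = reduced_take[OF _ red]
  have l: "len (wp a) = length a" "len (wp b) = length b" using r cl by auto
  have m: "min_rep V w \<in> W" using min_rep(3)[OF assms V] .
  have wa: "wp a \<in> generate G V" "wp b \<in> generate G V" using cl generate_words[OF V] by blast+
  have pwa: "comb n w = min_rep V w \<otimes> wp a" by (simp add: comb_def a_def)
  have "par_part V w = wp a \<otimes> wp b" using nfw(3)[OF assms] cl by (simp add: wp_append flip: ab)
  then have w: "w = comb n w \<otimes> wp b" using par_part(2)[OF assms V] m cl by (simp add: pwa m_assoc)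
  have "len (comb n w) = len (min_rep V w) + length a"
    using is_min_len[OF min_rep(1)[OF assms V] V wa(1)] l by (simp add: pwa)
  moreover have "len w = len (min_rep V w) + comb_len w" using par_part(3)[OF assms V] by (simp add: comb_len_def)
  moreover have "length a + length b = comb_len w" using ab nfw(4)[OF assms] by (metis length_append)
  moreover have "length b = min n (comb_len w)" using nfw(4)[OF assms] by (simp add: b_def)
  ultimately show thesis using that[of "wp b"] wa w l by simp
qed

lemma len_comb: "w \<in> W \<Longrightarrow> len (comb n w) + min n (comb_len w) = len w"
  by (metis comb_suffix)

lemma comb_Suc_near: "w \<in> W \<Longrightarrow> inv (comb n w) \<otimes> comb (Suc n) w \<in> near"
proof -
  assume w: "w \<in> W"
  let ?a = "norm_form V (par_part V w)"
  have "inv (wp (take (comb_len w - Suc n) ?a)) \<otimes> wp (take (comb_len w - n) ?a) \<in> insert \<one> S"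
    using nfw[OF w] by (intro wp_take_near) auto
  moreover have "inv (comb (Suc n) w) \<otimes> comb n w = inv (wp (take (comb_len w - Suc n) ?a)) \<otimes> wp (take (comb_len w - n) ?a)"
    using set_take_norm_form[OF w] min_rep(3)[OF w V] by (simp add: comb_def inv_mult_group m_assoc) (simp flip: m_assoc)
  ultimately have "inv (inv (comb (Suc n) w) \<otimes> comb n w) \<in> near" by (intro near_inv) (auto simp: near_def)
  then show ?thesis using w by (simp add: inv_mult_group)
qed

lemma comb_near_up:
  assumes w: "w \<in> W" and s: "s \<in> V" and up: "len (par_part V w) < len (par_part V w \<otimes> s)"
  shows "inv (comb n w) \<otimes> comb n (w \<otimes> s) \<in> near"
proof -
  have sS: "s \<in> S" using s V by auto
  define x where "x = par_part V w"
  have x: "x \<in> generate G V" "x \<in> W" using par_part[OF w V] by (auto simp: x_def)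
  have mv: "min_rep V (w \<otimes> s) = min_rep V w" "par_part V (w \<otimes> s) = x \<otimes> s" using min_rep_mult[OF w V, of s] s by (auto simp: x_def)
  obtain a t b where nfx: "norm_form V x = a @ b" "norm_form V (x \<otimes> s) = a @ t # b"
    by (rule norm_form_insert[OF V x(1) s up[folded x_def]])
  have xs: "x \<otimes> s \<in> generate G V" using x s V by simp
  have r1: "set (a @ b) \<subseteq> V" "wp (a @ b) = x" "length (a @ b) = len x" using norm_form(1)[OF V x(1)] nfx by (auto simp: red_word_def)
  have r2: "set (a @ t # b) \<subseteq> V" "wp (a @ t # b) = x \<otimes> s" "length (a @ t # b) = len (x \<otimes> s)"
    using norm_form(1)[OF V xs] nfx by (auto simp: red_word_def)
  have S: "set a \<subseteq> S" "set b \<subseteq> S" "t \<in> S" using r2 V by auto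
  have l1: "comb_len w = length a + length b" using r1 by (simp add: comb_len_def x_def)
  have l2: "comb_len (w \<otimes> s) = Suc (length a + length b)" using r2 by (simp add: comb_len_def mv)
  have m: "min_rep V w \<in> W" using min_rep(3)[OF w V] .
  let ?A = "take (length a + length b - n) (a @ b)" and ?B = "take (Suc (length a + length b) - n) (a @ t # b)"
  have "set (a @ b) \<subseteq> S" "set (a @ t # b) \<subseteq> S" using S by auto
  then have SAB: "set ?A \<subseteq> S" "set ?B \<subseteq> S" by (blast dest: in_set_takeD)+
  have "inv (comb n w) \<otimes> comb n (w \<otimes> s) = inv (wp ?A) \<otimes> wp ?B"
    using m SAB by (simp add: comb_def l1 l2 mv nfx flip: x_def)
      (simp add: inv_mult_group m_assoc, simp flip: m_assoc)
  also have "\<dots> \<in> near"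
  proof (cases "n \<le> length b")
    case False
    then have "?A = take (length a + length b - n) a" "?B = take (Suc (length a + length b) - n) a" by auto
    moreover have "inv (wp (take (length a + length b - n) a)) \<otimes> wp (take (Suc (length a + length b) - n) a) \<in> insert \<one> S"
      using S by (intro wp_take_near) auto
    ultimately show ?thesis by (auto simp: near_def)
  next
    case True
    define b1 where "b1 = take (length b - n) b" define b2 where "b2 = drop (length b - n) b"
    have bb: "b = b1 @ b2" by (simp add: b1_def b2_def)
    have S1: "set b1 \<subseteq> S" "set b2 \<subseteq> S" using S bb by auto
    have e1: "?A = a @ b1" using True by (simp add: b1_def)
    have e2: "?B = a @ t # b1" using True by (simp add: b1_def Suc_diff_le)
    have "inv (wp ?A) \<otimes> wp ?B = inv (wp b1) \<otimes> t \<otimes> inv (inv (wp b1))"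
      unfolding e1 e2 using S S1 by (simp add: wp_append inv_mult_group m_assoc) (simp flip: m_assoc)
    also have "\<dots> = root_refl (act (inv (wp b1)) (simple_root t))" using root_refl_eq[of "inv (wp b1)" t] S S1 by simp
    also have "\<dots> \<in> near"
    proof -
      \<comment> \<open>The inserted letter and the appended generator cross the same wall.\<close>
      have tb: "t \<otimes> wp b = wp b \<otimes> s"
      proof -
        have "wp a \<otimes> (t \<otimes> wp b) = wp a \<otimes> (wp b \<otimes> s)"
          using r1(2) r2(2) S sS by (simp add: wp_append m_assoc flip: r1(2))
        then show ?thesis using S sS by simp
      qed
      have red2: "len (wp (t # b)) = length (t # b)" using reduced_take(2)[of a "t # b"] r2 S by simp
      have red1: "len (wp b) = length b" using reduced_take(2)[of a b] r1 S by simp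
      have "len (wp b) < len (wp b \<otimes> s)" using red1 red2 tb by simp
      then have bp: "act (wp b) (simple_root s) \<in> pos_roots" using act_of_nonneg[of "wp b" s] S sS by (auto simp: pos_roots_def)
      have "root_refl (act (wp b) (simple_root s)) = wp b \<otimes> s \<otimes> inv (wp b)" using root_refl_eq S sS by simp
      also have "\<dots> = t" using S by (simp add: m_assoc flip: tb)
      finally have "act (wp b) (simple_root s) = simple_root t" using root_refl_inj[OF bp, of "simple_root t"] S by simp
      then have eq: "act (wp a) (simple_root t) = act x (simple_root s)"
        using S sS by (simp add: wp_append act_mult flip: r1(2))
      have "act (inv (wp (a @ b1))) (act x (simple_root s)) \<in> elementary"
      proof (rule elementary_between[OF _ _ x(2) _ _ S(3) sS eq])
        show "wp a \<in> W" "wp (a @ b1) \<in> W" using S S1 by auto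
        have rb: "len (wp ((a @ b1) @ b2)) = length ((a @ b1) @ b2)" using r1 bb by simp
        show "inversions (inv (wp a)) \<subseteq> inversions (inv (wp (a @ b1)))"
          using reduced_take(1)[OF _ rb] S S1 by (intro inversions_mono) auto
        show "inversions (inv (wp (a @ b1))) \<subseteq> inversions (inv x)"
          using inversions_mono[of "a @ b1" b2] rb S S1 r1 bb by simp
        show "len x < len (x \<otimes> s)" using up by (simp add: x_def)
      qed
      moreover have "act (inv (wp (a @ b1))) (act x (simple_root s)) = act (inv (wp b1)) (simple_root t)"
        using S S1 by (simp add: wp_append inv_mult_group act_mult flip: eq)
      ultimately show ?thesis by (auto simp: near_def)
    qed
    finally show ?thesis .
  qed
  finally show ?thesis .
qed

lemma comb_near: assumes w: "w \<in> W" and s: "s \<in> V" shows "inv (comb n w) \<otimes> comb n (w \<otimes> s) \<in> near"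
proof (cases "len (par_part V w) < len (par_part V w \<otimes> s)")
  case True then show ?thesis using comb_near_up assms by blast
next
  case False
  have sS: "s \<in> S" using s V by auto
  have "par_part V (w \<otimes> s) = par_part V w \<otimes> s" using min_rep_mult[OF w V, of s] s by simp
  then have "len (par_part V (w \<otimes> s)) < len (par_part V (w \<otimes> s) \<otimes> s)"
    using False len_mult_S[of "par_part V w" s] par_part(4)[OF w V] sS by auto
  then have "inv (comb n (w \<otimes> s)) \<otimes> comb n (w \<otimes> s \<otimes> s) \<in> near" using comb_near_up[of "w \<otimes> s" s] w s sS by simp
  then have "inv (inv (comb n (w \<otimes> s)) \<otimes> comb n w) \<in> near" using w sS near_inv by simp
  then show ?thesis using w sS by (simp add: inv_mult_group)
qed

end

end

section \<open>Alternating chains\<close>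

type_synonym 'a chain = "'a set \<Rightarrow> 'a \<Rightarrow> real"

lemma antisym_sum:
  fixes h :: "'b \<Rightarrow> 'b \<Rightarrow> real"
  assumes "finite A" "\<And>s t. s \<in> A \<Longrightarrow> t \<in> A \<Longrightarrow> s \<noteq> t \<Longrightarrow> h s t = - h t s"
  shows "(\<Sum>s\<in>A. \<Sum>t\<in>A - {s}. h s t) = 0"
proof -
  define k where "k s t = (if s = t then 0 else h s t)" for s t
  have e: "(\<Sum>s\<in>A. \<Sum>t\<in>A - {s}. h s t) = (\<Sum>s\<in>A. \<Sum>t\<in>A. k s t)"
  proof (rule sum.cong)
    fix s assume s: "s \<in> A"
    have "(\<Sum>t\<in>A. k s t) = k s s + (\<Sum>t\<in>A - {s}. k s t)" using assms(1) s by (rule sum.remove)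
    also have "\<dots> = (\<Sum>t\<in>A - {s}. h s t)" by (auto simp: k_def intro!: sum.cong split: if_splits)
    finally show "(\<Sum>t\<in>A - {s}. h s t) = (\<Sum>t\<in>A. k s t)" ..
  qed simp
  have "(\<Sum>s\<in>A. \<Sum>t\<in>A. k s t) = (\<Sum>s\<in>A. \<Sum>t\<in>A. k t s)" by (rule sum.swap)
  also have "\<dots> = (\<Sum>s\<in>A. \<Sum>t\<in>A. - k s t)" 
  proof (intro sum.cong refl)
    fix s t assume "s \<in> A" "t \<in> A"
    then show "k t s = - k s t" using assms(2)[of t s] by (simp add: k_def)
  qed
  also have "\<dots> = - (\<Sum>s\<in>A. \<Sum>t\<in>A. k s t)" by (simp add: sum_negf)
  finally show ?thesis using e by simp
qed

context cox
begin

definition inc_sign :: "'a \<Rightarrow> 'a set \<Rightarrow> real" where "inc_sign s R = (-1) ^ card {t \<in> R. gen_rank t < gen_rank s}"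

lemma inc_sign_sq [simp]: "inc_sign s R * inc_sign s R = 1" by (simp add: inc_sign_def flip: power_mult_distrib)

lemma inc_sign_sq' [simp]: "inc_sign s R * (inc_sign s R * x) = x" by (simp flip: mult.assoc)

lemma inc_sign_insert: assumes "finite R" "s \<notin> R" "s \<in> S" "t \<in> S" "s \<noteq> t"
  shows "inc_sign t (insert s R) = (if gen_rank s < gen_rank t then - inc_sign t R else inc_sign t R)"
proof -
  have "{r \<in> insert s R. gen_rank r < gen_rank t} = (if gen_rank s < gen_rank t then insert s {r \<in> R. gen_rank r < gen_rank t} else {r \<in> R. gen_rank r < gen_rank t})"
    using assms by auto
  then show ?thesis using assms by (simp add: inc_sign_def)
qed

lemma inc_sign_anti: assumes "R \<subseteq> S" "s \<in> S - R" "t \<in> S - R" "s \<noteq> t"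
  shows "inc_sign s R * inc_sign t (insert s R) = - (inc_sign t R * inc_sign s (insert t R))"
proof -
  have "finite R" using assms finS finite_subset by blast
  moreover have "gen_rank s \<noteq> gen_rank t" using inj_gen_rank assms by (auto simp: inj_on_def)
  ultimately show ?thesis using assms inc_sign_insert[of R s t] inc_sign_insert[of R t s] by auto
qed

text \<open>A function that alternates on the cosets of a parabolic subgroup also alternates on
  those of a smaller one, so restriction already performs the signed sum over the faces of one
  type.\<close>

definition cbdry :: "'a chain \<Rightarrow> 'a chain" where
  "cbdry x = (\<lambda>R w. \<Sum>s\<in>S - R. inc_sign s R * x (insert s R) w)"

lemma cbdry_sum: "cbdry (\<lambda>R z. \<Sum>i\<in>I. c i * D i R z) = (\<lambda>R z. \<Sum>i\<in>I. c i * cbdry (D i) R z)"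
  unfolding cbdry_def by (intro ext) (simp add: sum_distrib_left mult.left_commute, rule sum.swap)

lemma cbdry_lin: "cbdry (\<lambda>R z. a * x R z + b * y R z) = (\<lambda>R z. a * cbdry x R z + b * cbdry y R z)"
  unfolding cbdry_def by (intro ext) (simp add: ring_distribs sum.distrib sum_distrib_left mult.left_commute)

lemma cbdry_diff: "cbdry (\<lambda>R z. x R z - y R z) = (\<lambda>R z. cbdry x R z - cbdry y R z)"
  using cbdry_lin[of 1 x "-1" y] by simp

lemma cbdry_add: "cbdry (\<lambda>R z. x R z + y R z) = (\<lambda>R z. cbdry x R z + cbdry y R z)"
  using cbdry_lin[of 1 x 1 y] by simp

lemma cbdry_0 [simp]: "cbdry (\<lambda>R z. 0) = (\<lambda>R z. 0)" by (simp add: cbdry_def)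

lemma cbdry_cbdry:
  assumes "\<And>R w. x R w \<noteq> 0 \<Longrightarrow> R \<subseteq> S" shows "cbdry (cbdry x) = (\<lambda>R w. 0)"
proof (intro ext)
  fix R w
  show "cbdry (cbdry x) R w = 0"
  proof (cases "R \<subseteq> S")
    case True
    have "cbdry (cbdry x) R w = (\<Sum>s\<in>S - R. \<Sum>t\<in>S - R - {s}. inc_sign s R * inc_sign t (insert s R) * x (insert t (insert s R)) w)"
      unfolding cbdry_def by (auto simp: sum_distrib_left mult.assoc intro!: sum.cong)
    also have "\<dots> = 0"
    proof (rule antisym_sum)
      fix s t assume "s \<in> S - R" "t \<in> S - R" "s \<noteq> t"
      then show "inc_sign s R * inc_sign t (insert s R) * x (insert t (insert s R)) w = - (inc_sign t R * inc_sign s (insert t R) * x (insert s (insert t R)) w)"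
        using inc_sign_anti[OF True, of s t] by (simp add: insert_commute)
    qed (use finS in simp)
    finally show ?thesis .
  next
    case False
    then have "x (insert t (insert s R)) w = 0" for s t using assms by blast
    then show ?thesis by (simp add: cbdry_def)
  qed
qed

text \<open>The oriented cell \<open>w c\<^sub>U\<close> is the function \<open>cell_chain w U\<close>, supported on \<open>w W\<^sub>U\<close>. The sets \<open>T\<close> and \<open>V\<close>
  restrict to cells of type between \<open>T\<close> and \<open>V\<close>; for \<open>T \<noteq> {}\<close> these chains form a quotient complex,
  whose boundary is \<open>cbdry\<close> with the components outside \<open>{R. T \<subseteq> R}\<close> dropped.\<close>

definition alt_chain :: "'a set \<Rightarrow> 'a set \<Rightarrow> nat \<Rightarrow> 'a chain \<Rightarrow> bool" where
  "alt_chain T V j x \<longleftrightarrow> (\<forall>U w. x U w \<noteq> 0 \<longrightarrow> T \<subseteq> U \<and> U \<subseteq> V \<and> spherical G S U \<and> card U = j \<and> w \<in> W) \<and>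
     (\<forall>U w u. U \<subseteq> S \<longrightarrow> w \<in> W \<longrightarrow> u \<in> generate G U \<longrightarrow> x U (w \<otimes> u) = eps u * x U w)"

lemma alt_chain_chain_supp: "alt_chain T V j x \<Longrightarrow> x U w \<noteq> 0 \<Longrightarrow> T \<subseteq> U \<and> U \<subseteq> V \<and> U \<subseteq> S \<and> spherical G S U \<and> card U = j \<and> w \<in> W"
  unfolding alt_chain_def spherical_def by blast

lemma alt_chain_alt: "alt_chain T V j x \<Longrightarrow> U \<subseteq> S \<Longrightarrow> w \<in> W \<Longrightarrow> u \<in> generate G U \<Longrightarrow> x U (w \<otimes> u) = eps u * x U w"
  unfolding alt_chain_def by blast

lemma alt_chain_sum: assumes "\<And>i. i \<in> I \<Longrightarrow> alt_chain T V j (D i)" shows "alt_chain T V j (\<lambda>R z. \<Sum>i\<in>I. c i * D i R z)"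
  unfolding alt_chain_def
proof (intro conjI allI impI)
  fix U w
  assume "(\<Sum>i\<in>I. c i * D i U w) \<noteq> 0"
  then obtain i where "i \<in> I" "c i * D i U w \<noteq> 0" by (rule sum.not_neutral_contains_not_neutral)
  then have "i \<in> I" "D i U w \<noteq> 0" by auto
  then show "T \<subseteq> U" "U \<subseteq> V" "spherical G S U" "card U = j" "w \<in> W" using alt_chain_chain_supp assms by blast+
next
  fix U w u assume "U \<subseteq> S" "w \<in> W" "u \<in> generate G U"
  then show "(\<Sum>i\<in>I. c i * D i U (w \<otimes> u)) = eps u * (\<Sum>i\<in>I. c i * D i U w)"
    using alt_chain_alt[OF assms] by (simp add: sum_distrib_left mult.left_commute)
qed

lemma alt_chain_lin: "alt_chain T V j x \<Longrightarrow> alt_chain T V j y \<Longrightarrow> alt_chain T V j (\<lambda>R z. a * x R z + b * y R z)"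
  using alt_chain_sum[of "{True, False}" T V j "\<lambda>i. if i then x else y" "\<lambda>i. if i then a else b"] by simp

lemma alt_chain_diff: "alt_chain T V j x \<Longrightarrow> alt_chain T V j y \<Longrightarrow> alt_chain T V j (\<lambda>R z. x R z - y R z)"
  using alt_chain_lin[of T V j x y 1 "-1"] by simp

lemma alt_chain_add: "alt_chain T V j x \<Longrightarrow> alt_chain T V j y \<Longrightarrow> alt_chain T V j (\<lambda>R z. x R z + y R z)"
  using alt_chain_lin[of T V j x y 1 1] by simp

lemma alt_chain_0: "alt_chain T V j (\<lambda>R z. 0)" by (simp add: alt_chain_def)

lemma spherical_mono: "spherical G S U \<Longrightarrow> R \<subseteq> U \<Longrightarrow> spherical G S R"
  unfolding spherical_def using finite_subset[OF par_mono[of R U]] by auto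

lemma sph_fin: "spherical G S U \<Longrightarrow> U \<subseteq> S \<and> finite U \<and> finite (generate G U)"
  unfolding spherical_def using finS finite_subset by blast

lemma alt_chain_cbdry: assumes "alt_chain T V (Suc j) x" shows "alt_chain {} V j (cbdry x)"
  unfolding alt_chain_def
proof (intro conjI allI impI)
  fix U w
  assume "cbdry x U w \<noteq> 0"
  then obtain s where s: "s \<in> S - U" "inc_sign s U * x (insert s U) w \<noteq> 0"
    unfolding cbdry_def by (rule sum.not_neutral_contains_not_neutral)
  then have s: "s \<in> S - U" "x (insert s U) w \<noteq> 0" by auto
  note c = alt_chain_chain_supp[OF assms s(2)]
  have "finite U" using c finS by (meson finite_subset insert_subset)
  then show "card U = j" using c s by simp
  show "{} \<subseteq> U" "U \<subseteq> V" "spherical G S U" "w \<in> W" using c spherical_mono[of "insert s U" U] by auto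
next
  fix U w u assume u: "U \<subseteq> S" "w \<in> W" "u \<in> generate G U"
  have "x (insert s U) (w \<otimes> u) = eps u * x (insert s U) w" if "s \<in> S - U" for s
    using alt_chain_alt[OF assms, of "insert s U" w u] u that par_mono[of U "insert s U"] by auto
  then show "cbdry x U (w \<otimes> u) = eps u * cbdry x U w" unfolding cbdry_def by (simp add: sum_distrib_left mult.left_commute)
qed

section \<open>Translation, finite supports, and the chains of single cells\<close>

definition translate :: "'a \<Rightarrow> 'a chain \<Rightarrow> 'a chain" where
  "translate g x = (\<lambda>U w. if w \<in> W then x U (inv g \<otimes> w) else 0)"

lemma cbdry_translate: "cbdry (translate g x) = translate g (cbdry x)"
  unfolding cbdry_def translate_def by (intro ext) auto

lemma translate_sum: "translate g (\<lambda>R z. \<Sum>i\<in>I. c i * D i R z) = (\<lambda>R z. \<Sum>i\<in>I. c i * translate g (D i) R z)"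
  by (intro ext) (simp add: translate_def)

lemma translate_diff: "translate g (\<lambda>R z. x R z - y R z) = (\<lambda>R z. translate g x R z - translate g y R z)"
  by (intro ext) (simp add: translate_def)

lemma translate_0 [simp]: "translate g (\<lambda>R z. 0) = (\<lambda>R z. 0)" by (auto simp: translate_def)

lemma translate_translate: "g \<in> W \<Longrightarrow> h \<in> W \<Longrightarrow> translate g (translate h x) = translate (g \<otimes> h) x"
  unfolding translate_def by (intro ext) (auto simp: inv_mult_group m_assoc)

lemma translate_one: "(\<And>R z. x R z \<noteq> 0 \<Longrightarrow> z \<in> W) \<Longrightarrow> translate \<one> x = x"
  unfolding translate_def by (intro ext) auto

lemma alt_chain_translate: assumes "alt_chain T V j x" "g \<in> W" shows "alt_chain T V j (translate g x)"
  unfolding alt_chain_def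
proof (intro conjI allI impI)
  fix U w assume "translate g x U w \<noteq> 0"
  then show "T \<subseteq> U" "U \<subseteq> V" "spherical G S U" "card U = j" "w \<in> W"
    using alt_chain_chain_supp[OF assms(1), of U "inv g \<otimes> w"] by (auto simp: translate_def split: if_splits)
next
  fix U w u assume "U \<subseteq> S" "w \<in> W" "u \<in> generate G U"
  then show "translate g x U (w \<otimes> u) = eps u * translate g x U w"
    using alt_chain_alt[OF assms(1), of U "inv g \<otimes> w" u] assms(2) by (auto simp: translate_def m_assoc)
qed

definition chain_supp :: "'a chain \<Rightarrow> ('a set \<times> 'a) set" where "chain_supp x = {(U, w). x U w \<noteq> 0}"

definition fin_chain :: "'a set \<Rightarrow> nat \<Rightarrow> 'a chain \<Rightarrow> bool" where
  "fin_chain V j x \<longleftrightarrow> alt_chain {} V j x \<and> finite (chain_supp x)"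

lemma fin_chain_alt_chain: "fin_chain V j x \<Longrightarrow> alt_chain {} V j x" by (simp add: fin_chain_def)

lemma fin_chain_sum: assumes "finite I" "\<And>i. i \<in> I \<Longrightarrow> fin_chain V j (D i)" shows "fin_chain V j (\<lambda>R z. \<Sum>i\<in>I. c i * D i R z)"
proof -
  have "chain_supp (\<lambda>R z. \<Sum>i\<in>I. c i * D i R z) \<subseteq> (\<Union>i\<in>I. chain_supp (D i))"
    unfolding chain_supp_def by (auto elim!: sum.not_neutral_contains_not_neutral)
  then have "finite (chain_supp (\<lambda>R z. \<Sum>i\<in>I. c i * D i R z))"
    by (rule finite_subset) (use assms in \<open>simp add: fin_chain_def\<close>)
  then show ?thesis using alt_chain_sum[of I "{}" V j D c] assms by (auto simp: fin_chain_def)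
qed

lemma fin_chain_lin: "fin_chain V j x \<Longrightarrow> fin_chain V j y \<Longrightarrow> fin_chain V j (\<lambda>R z. a * x R z + b * y R z)"
  using fin_chain_sum[of "{True, False}" V j "\<lambda>i. if i then x else y" "\<lambda>i. if i then a else b"] by simp

lemma fin_chain_diff: "fin_chain V j x \<Longrightarrow> fin_chain V j y \<Longrightarrow> fin_chain V j (\<lambda>R z. x R z - y R z)"
  using fin_chain_lin[of V j x y 1 "-1"] by simp

lemma fin_chain_add: "fin_chain V j x \<Longrightarrow> fin_chain V j y \<Longrightarrow> fin_chain V j (\<lambda>R z. x R z + y R z)"
  using fin_chain_lin[of V j x y 1 1] by simp

lemma fin_chain_0: "fin_chain V j (\<lambda>R z. 0)" by (simp add: fin_chain_def alt_chain_0 chain_supp_def)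

lemma fin_chain_translate: assumes "fin_chain V j x" "g \<in> W" shows "fin_chain V j (translate g x)"
proof -
  have "chain_supp (translate g x) \<subseteq> (\<lambda>(U, w). (U, g \<otimes> w)) ` chain_supp x"
  proof
    fix p assume "p \<in> chain_supp (translate g x)"
    then obtain U w where p: "p = (U, w)" "w \<in> W" "x U (inv g \<otimes> w) \<noteq> 0"
      by (auto simp: chain_supp_def translate_def split: if_splits)
    then have "p = (U, g \<otimes> (inv g \<otimes> w))" using assms by (simp flip: m_assoc)
    then show "p \<in> (\<lambda>(U, w). (U, g \<otimes> w)) ` chain_supp x"
      using p by (intro image_eqI[of _ _ "(U, inv g \<otimes> w)"]) (auto simp: chain_supp_def)
  qed
  moreover have "finite ((\<lambda>(U, w). (U, g \<otimes> w)) ` chain_supp x)" using assms by (simp add: fin_chain_def)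
  ultimately have "finite (chain_supp (translate g x))" by (rule finite_subset)
  then show ?thesis using assms alt_chain_translate by (simp add: fin_chain_def)
qed

lemma chain_supp_cbdry: "chain_supp (cbdry x) \<subseteq> (\<lambda>((U, w), s). (U - {s}, w)) ` (chain_supp x \<times> S)"
proof
  fix p assume "p \<in> chain_supp (cbdry x)"
  then obtain R w where p: "p = (R, w)" "cbdry x R w \<noteq> 0" by (auto simp: chain_supp_def)
  from p(2) obtain s where "s \<in> S - R" "inc_sign s R * x (insert s R) w \<noteq> 0"
    unfolding cbdry_def by (rule sum.not_neutral_contains_not_neutral)
  then have s: "s \<in> S - R" "x (insert s R) w \<noteq> 0" by auto
  then show "p \<in> (\<lambda>((U, w), s). (U - {s}, w)) ` (chain_supp x \<times> S)"
    using p by (intro image_eqI[of _ _ "((insert s R, w), s)"]) (auto simp: chain_supp_def)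
qed

lemma fin_chain_cbdry: "fin_chain V (Suc j) x \<Longrightarrow> fin_chain V j (cbdry x)"
  unfolding fin_chain_def using alt_chain_cbdry finite_subset[OF chain_supp_cbdry[of x]] finS by blast

definition cell_chain :: "'a \<Rightarrow> 'a set \<Rightarrow> 'a chain" where
  "cell_chain w U = (\<lambda>R z. if R = U \<and> z \<in> W \<and> inv w \<otimes> z \<in> generate G U then eps (inv w \<otimes> z) else 0)"

lemma cell_chain_alt_chain: assumes "w \<in> W" "U \<subseteq> V" "spherical G S U" shows "fin_chain V (card U) (cell_chain w U)"
proof -
  have US: "U \<subseteq> S" and fU: "finite (generate G U)" using assms by (auto simp: spherical_def)
  have "chain_supp (cell_chain w U) \<subseteq> {U} \<times> (\<lambda>u. w \<otimes> u) ` generate G U"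
  proof
    fix p assume "p \<in> chain_supp (cell_chain w U)"
    then obtain z where z: "p = (U, z)" "z \<in> W" "inv w \<otimes> z \<in> generate G U" by (auto simp: chain_supp_def cell_chain_def split: if_splits)
    then have "z = w \<otimes> (inv w \<otimes> z)" using assms by (simp flip: m_assoc)
    then show "p \<in> {U} \<times> (\<lambda>u. w \<otimes> u) ` generate G U" using z by blast
  qed
  then have "finite (chain_supp (cell_chain w U))" by (rule finite_subset) (use fU in simp)
  moreover have "alt_chain {} V (card U) (cell_chain w U)"
    unfolding alt_chain_def
  proof (intro conjI allI impI)
    fix R z u assume u: "R \<subseteq> S" "z \<in> W" "u \<in> generate G R"
    show "cell_chain w U R (z \<otimes> u) = eps u * cell_chain w U R z"
    proof (cases "R = U")
      case True
      have uW: "u \<in> W" using u by simp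
      have e: "inv w \<otimes> (z \<otimes> u) = inv w \<otimes> z \<otimes> u" using assms u uW by (simp add: m_assoc)
      have "inv w \<otimes> z = (inv w \<otimes> z \<otimes> u) \<otimes> inv u" using assms u uW by (simp add: m_assoc)
      then have "inv w \<otimes> z \<otimes> u \<in> generate G U \<longleftrightarrow> inv w \<otimes> z \<in> generate G U"
        using u True US par_mult par_inv by metis
      then show ?thesis using True u uW assms e by (auto simp: cell_chain_def eps_mult)
    qed (simp add: cell_chain_def)
  qed (use assms in \<open>auto simp: cell_chain_def split: if_splits\<close>)
  ultimately show ?thesis by (simp add: fin_chain_def)
qed

lemma translate_cell_chain: "g \<in> W \<Longrightarrow> w \<in> W \<Longrightarrow> translate g (cell_chain w U) = cell_chain (g \<otimes> w) U"
  unfolding translate_def cell_chain_def by (intro ext) (auto simp: inv_mult_group m_assoc)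

lemma par_bij: assumes "U \<subseteq> S" "u \<in> generate G U"
  shows "bij_betw (\<lambda>x. u \<otimes> x) (generate G U) (generate G U)" "bij_betw (\<lambda>x. x \<otimes> u) (generate G U) (generate G U)"
proof -
  have uW: "u \<in> W" using assms by simp
  show "bij_betw (\<lambda>x. u \<otimes> x) (generate G U) (generate G U)"
    by (rule bij_betw_byWitness[of _ "\<lambda>x. inv u \<otimes> x"])
      (use assms uW in \<open>auto simp flip: m_assoc\<close>)
  show "bij_betw (\<lambda>x. x \<otimes> u) (generate G U) (generate G U)"
    by (rule bij_betw_byWitness[of _ "\<lambda>x. x \<otimes> inv u"])
      (use assms uW in \<open>auto simp: m_assoc\<close>)
qed

lemma par_sum_left: "U \<subseteq> S \<Longrightarrow> u \<in> generate G U \<Longrightarrow> (\<Sum>x\<in>generate G U. g (u \<otimes> x)) = (\<Sum>x\<in>generate G U. g x)"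
  by (rule sum.reindex_bij_betw[OF par_bij(1)])

lemma par_sum_right: "U \<subseteq> S \<Longrightarrow> u \<in> generate G U \<Longrightarrow> (\<Sum>x\<in>generate G U. g (x \<otimes> u)) = (\<Sum>x\<in>generate G U. g x)"
  by (rule sum.reindex_bij_betw[OF par_bij(2)])

abbreviation par_card :: "'a set \<Rightarrow> real" where "par_card U \<equiv> real (card (generate G U))"

lemma par_card_pos: "spherical G S U \<Longrightarrow> 0 < par_card U"
  using ex_in_conv[of "generate G U"] par_one[of U] unfolding spherical_def of_nat_0_less_iff card_gt_0_iff by blast

text \<open>The cellular boundary of the cell of \<open>w\<close> and \<open>U\<close> with its
  faces replaced by chains \<open>D\<close>. The sum runs over all of \<open>W_U\<close> and not
  over coset representatives, because \<open>D\<close> need not be alternating; hence the division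
  by the number of times that each face is counted.\<close>

definition comp_bdry :: "('a \<Rightarrow> 'a set \<Rightarrow> 'a chain) \<Rightarrow> 'a \<Rightarrow> 'a set \<Rightarrow> 'a chain" where
  "comp_bdry D w U = (\<lambda>R z. \<Sum>(s, u)\<in>U \<times> generate G U. (inc_sign s (U - {s}) * eps u / par_card (U - {s})) * D (w \<otimes> u) (U - {s}) R z)"

text \<open>The projection to families that alternate under right multiplication by
  \<open>W_U\<close>; it leaves \<open>cell_chain\<close> unchanged.\<close>

definition alt_avg :: "('a \<Rightarrow> 'a set \<Rightarrow> 'a chain) \<Rightarrow> 'a \<Rightarrow> 'a set \<Rightarrow> 'a chain" where
  "alt_avg D w U = (\<lambda>R z. \<Sum>u\<in>generate G U. (eps u / par_card U) * D (w \<otimes> u) U R z)"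

lemma comp_bdry_eq: assumes "spherical G S U"
  shows "comp_bdry D w U R z = (\<Sum>s\<in>U. inc_sign s (U - {s}) / par_card (U - {s}) * (\<Sum>u\<in>generate G U. eps u * D (w \<otimes> u) (U - {s}) R z))"
proof -
  have "finite U" "finite (generate G U)" using assms finS finite_subset by (auto simp: spherical_def)
  then show ?thesis unfolding comp_bdry_def
    by (simp add: sum.cartesian_product[symmetric] sum_distrib_left mult.assoc divide_inverse mult.left_commute)
qed

lemma alt_avg_eq: "alt_avg D w U R z = (\<Sum>u\<in>generate G U. eps u * D (w \<otimes> u) U R z) / par_card U"
  by (simp add: alt_avg_def sum_divide_distrib)

lemma alt_sum_right:
  assumes "U \<subseteq> S" "u' \<in> generate G U" "w \<in> W"
  shows "(\<Sum>u\<in>generate G U. eps u * (eps u' * g (w \<otimes> u \<otimes> u'))) = (\<Sum>u\<in>generate G U. eps u * g (w \<otimes> u))"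
proof -
  have "(\<Sum>u\<in>generate G U. eps u * (eps u' * g (w \<otimes> u \<otimes> u'))) = (\<Sum>u\<in>generate G U. eps (u \<otimes> u') * g (w \<otimes> (u \<otimes> u')))"
    using assms by (intro sum.cong refl) (auto simp: eps_mult m_assoc)
  also have "\<dots> = (\<Sum>u\<in>generate G U. eps u * g (w \<otimes> u))"
    using par_sum_right[OF assms(1,2), of "\<lambda>u. eps u * g (w \<otimes> u)"] .
  finally show ?thesis .
qed

lemma alt_sum_left:
  assumes "U \<subseteq> S" "u' \<in> generate G U" "w \<in> W"
  shows "(\<Sum>u\<in>generate G U. eps u * g (w \<otimes> u' \<otimes> u)) = eps u' * (\<Sum>u\<in>generate G U. eps u * g (w \<otimes> u))"
proof -
  have "(\<Sum>u\<in>generate G U. eps u * g (w \<otimes> u)) = (\<Sum>u\<in>generate G U. eps (u' \<otimes> u) * g (w \<otimes> (u' \<otimes> u)))"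
    using par_sum_left[OF assms(1,2), of "\<lambda>u. eps u * g (w \<otimes> u)"] by simp
  also have "\<dots> = (\<Sum>u\<in>generate G U. eps u' * (eps u * g (w \<otimes> u' \<otimes> u)))"
    using assms by (intro sum.cong refl) (auto simp: eps_mult m_assoc)
  also have "\<dots> = eps u' * (\<Sum>u\<in>generate G U. eps u * g (w \<otimes> u' \<otimes> u))" by (simp add: sum_distrib_left)
  finally show ?thesis by (simp flip: mult.assoc)
qed

text \<open>Reindexing by the right factor turns every term of the inner sum into a copy of the
  outer one, so antisymmetrising over a smaller parabolic subgroup first only multiplies by its
  order.\<close>

lemma double_alt:
  assumes "spherical G S U" "R \<subseteq> U" "w \<in> W"
  shows "(\<Sum>u\<in>generate G U. eps u * (\<Sum>u'\<in>generate G R. eps u' * g (w \<otimes> u \<otimes> u'))) = par_card R * (\<Sum>u\<in>generate G U. eps u * g (w \<otimes> u))"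
proof -
  have US: "U \<subseteq> S" using assms by (simp add: spherical_def)
  have "(\<Sum>u\<in>generate G U. eps u * (\<Sum>u'\<in>generate G R. eps u' * g (w \<otimes> u \<otimes> u'))) =
      (\<Sum>u'\<in>generate G R. \<Sum>u\<in>generate G U. eps u * (eps u' * g (w \<otimes> u \<otimes> u')))"
    unfolding sum_distrib_left by (rule sum.swap)
  also have "\<dots> = (\<Sum>u'\<in>generate G R. \<Sum>u\<in>generate G U. eps u * g (w \<otimes> u))"
  proof (rule sum.cong[OF refl])
    fix u' assume "u' \<in> generate G R"
    then have "u' \<in> generate G U" using par_mono[OF assms(2)] by auto
    then show "(\<Sum>u\<in>generate G U. eps u * (eps u' * g (w \<otimes> u \<otimes> u'))) = (\<Sum>u\<in>generate G U. eps u * g (w \<otimes> u))"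
      by (rule alt_sum_right[OF US _ assms(3)])
  qed
  finally show ?thesis by simp
qed

lemma comp_bdry_alt_avg: assumes "spherical G S U" "w \<in> W" shows "comp_bdry (alt_avg D) w U = comp_bdry D w U"
proof (intro ext)
  fix R z
  show "comp_bdry (alt_avg D) w U R z = comp_bdry D w U R z"
    unfolding comp_bdry_eq[OF assms(1)]
  proof (intro sum.cong refl)
    fix s assume "s \<in> U"
    have p: "0 < par_card (U - {s})" by (rule par_card_pos[OF spherical_mono[OF assms(1)]]) auto
    have "(\<Sum>u\<in>generate G U. eps u * alt_avg D (w \<otimes> u) (U - {s}) R z) =
       (\<Sum>u\<in>generate G U. eps u * (\<Sum>u'\<in>generate G (U - {s}). eps u' * D (w \<otimes> u \<otimes> u') (U - {s}) R z)) / par_card (U - {s})"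
      unfolding alt_avg_eq times_divide_eq_right by (rule sum_divide_distrib[symmetric])
    also have "\<dots> = (\<Sum>u\<in>generate G U. eps u * D (w \<otimes> u) (U - {s}) R z)"
      unfolding double_alt[OF assms(1) Diff_subset assms(2), of "\<lambda>w. D w (U - {s}) R z"] using p by simp
    finally show "inc_sign s (U - {s}) / par_card (U - {s}) * (\<Sum>u\<in>generate G U. eps u * alt_avg D (w \<otimes> u) (U - {s}) R z) =
       inc_sign s (U - {s}) / par_card (U - {s}) * (\<Sum>u\<in>generate G U. eps u * D (w \<otimes> u) (U - {s}) R z)" by simp
  qed
qed

lemma alt_avg_comp_bdry: assumes "spherical G S U" "w \<in> W" shows "alt_avg (comp_bdry D) w U = comp_bdry D w U"
proof (intro ext)
  fix R z
  have US: "U \<subseteq> S" using assms by (simp add: spherical_def)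
  have "comp_bdry D (w \<otimes> u) U R z = eps u * comp_bdry D w U R z" if u: "u \<in> generate G U" for u
    unfolding comp_bdry_eq[OF assms(1)] alt_sum_left[OF US u assms(2), of "\<lambda>w. D w _ R z"]
    by (simp add: sum_distrib_left mult.left_commute)
  then have "(\<Sum>u\<in>generate G U. eps u * comp_bdry D (w \<otimes> u) U R z) = (\<Sum>u\<in>generate G U. comp_bdry D w U R z)"
    by (intro sum.cong refl) (simp flip: mult.assoc)
  then show "alt_avg (comp_bdry D) w U R z = comp_bdry D w U R z" unfolding alt_avg_eq using par_card_pos[OF assms(1)] by simp
qed

lemma comp_bdry_comp_bdry: assumes "spherical G S U" "w \<in> W" shows "comp_bdry (comp_bdry D) w U = (\<lambda>R z. 0)"
proof (intro ext)
  fix R z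
  have US: "U \<subseteq> S" using assms by (simp add: spherical_def)
  have fU: "finite U" using US finS finite_subset by blast
  define h where "h s t = inc_sign s (U - {s}) * inc_sign t (U - {s} - {t}) / par_card (U - {s} - {t}) *
      (\<Sum>u\<in>generate G U. eps u * D (w \<otimes> u) (U - {s} - {t}) R z)" for s t
  have "comp_bdry (comp_bdry D) w U R z = (\<Sum>s\<in>U. \<Sum>t\<in>U - {s}. h s t)"
    unfolding comp_bdry_eq[OF assms(1), of "comp_bdry D"]
  proof (intro sum.cong refl)
    fix s assume "s \<in> U"
    have sp: "spherical G S (U - {s})" by (rule spherical_mono[OF assms(1)]) auto
    have p: "0 < par_card (U - {s})" by (rule par_card_pos[OF sp])
    have "(\<Sum>u\<in>generate G U. eps u * comp_bdry D (w \<otimes> u) (U - {s}) R z) =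
       (\<Sum>t\<in>U - {s}. inc_sign t (U - {s} - {t}) / par_card (U - {s} - {t}) *
         (\<Sum>u\<in>generate G U. eps u * (\<Sum>u'\<in>generate G (U - {s}). eps u' * D (w \<otimes> u \<otimes> u') (U - {s} - {t}) R z)))"
      unfolding comp_bdry_eq[OF sp] sum_distrib_left by (subst sum.swap) (simp add: mult.left_commute)
    also have "\<dots> = (\<Sum>t\<in>U - {s}. inc_sign t (U - {s} - {t}) / par_card (U - {s} - {t}) *
         (par_card (U - {s}) * (\<Sum>u\<in>generate G U. eps u * D (w \<otimes> u) (U - {s} - {t}) R z)))"
      unfolding double_alt[OF assms(1) Diff_subset assms(2), of "\<lambda>w. D w _ R z"] ..
    finally have e: "(\<Sum>u\<in>generate G U. eps u * comp_bdry D (w \<otimes> u) (U - {s}) R z) = (\<Sum>t\<in>U - {s}. inc_sign t (U - {s} - {t}) / par_card (U - {s} - {t}) *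
         (par_card (U - {s}) * (\<Sum>u\<in>generate G U. eps u * D (w \<otimes> u) (U - {s} - {t}) R z)))" .
    show "inc_sign s (U - {s}) / par_card (U - {s}) * (\<Sum>u\<in>generate G U. eps u * comp_bdry D (w \<otimes> u) (U - {s}) R z) = (\<Sum>t\<in>U - {s}. h s t)"
      unfolding e
    proof (subst sum_distrib_left, rule sum.cong[OF refl])
      fix t
      show "inc_sign s (U - {s}) / par_card (U - {s}) * (inc_sign t (U - {s} - {t}) / par_card (U - {s} - {t}) *
         (par_card (U - {s}) * (\<Sum>u\<in>generate G U. eps u * D (w \<otimes> u) (U - {s} - {t}) R z))) = h s t"
        using p by (simp add: h_def)
    qed
  qed
  also have "\<dots> = 0"
  proof (rule antisym_sum[OF fU])
    fix s t assume st: "s \<in> U" "t \<in> U" "s \<noteq> t"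
    define R' where "R' = U - {s} - {t}"
    have e: "U - {s} = insert t R'" "U - {t} = insert s R'" "U - {t} - {s} = R'" using st by (auto simp: R'_def)
    have "inc_sign t R' * inc_sign s (insert t R') = - (inc_sign s R' * inc_sign t (insert s R'))"
      by (rule inc_sign_anti) (use st US in \<open>auto simp: R'_def\<close>)
    then have "inc_sign s (U - {s}) * inc_sign t R' = - (inc_sign t (U - {t}) * inc_sign s R')" unfolding e by (simp add: mult.commute)
    then show "h s t = - h t s" unfolding h_def R'_def[symmetric] e(3) by simp
  qed
  finally show "comp_bdry (comp_bdry D) w U R z = 0" .
qed

lemma cbdry_comp_bdry:
  assumes "\<And>s u. s \<in> U \<Longrightarrow> u \<in> generate G U \<Longrightarrow> cbdry (D (w \<otimes> u) (U - {s})) = E (w \<otimes> u) (U - {s})"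
  shows "cbdry (comp_bdry D w U) = comp_bdry E w U"
proof -
  have "cbdry (comp_bdry D w U) = (\<lambda>R z. \<Sum>p\<in>U \<times> generate G U. (inc_sign (fst p) (U - {fst p}) * eps (snd p) / par_card (U - {fst p})) *
      cbdry (D (w \<otimes> snd p) (U - {fst p})) R z)"
    unfolding comp_bdry_def case_prod_unfold by (rule cbdry_sum)
  also have "\<dots> = comp_bdry E w U"
    unfolding comp_bdry_def case_prod_unfold using assms by (intro ext sum.cong refl) auto
  finally show ?thesis .
qed

lemma cbdry_alt_avg:
  assumes "\<And>u. u \<in> generate G U \<Longrightarrow> cbdry (D (w \<otimes> u) U) = E (w \<otimes> u) U"
  shows "cbdry (alt_avg D w U) = alt_avg E w U"
  unfolding alt_avg_def cbdry_sum using assms by (intro ext sum.cong refl) simp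

lemma fin_chain_comp_bdry:
  assumes "spherical G S U" "\<And>s u. s \<in> U \<Longrightarrow> u \<in> generate G U \<Longrightarrow> fin_chain V i (D (w \<otimes> u) (U - {s}))"
  shows "fin_chain V i (comp_bdry D w U)"
  unfolding comp_bdry_def case_prod_unfold
  by (rule fin_chain_sum) (use assms(2) sph_fin[OF assms(1)] in auto)

lemma fin_chain_alt_avg:
  assumes "spherical G S U" "\<And>u. u \<in> generate G U \<Longrightarrow> fin_chain V i (D (w \<otimes> u) U)"
  shows "fin_chain V i (alt_avg D w U)"
  unfolding alt_avg_def by (rule fin_chain_sum) (use assms in \<open>auto simp: spherical_def\<close>)

text \<open>For a point of the coset of \<open>w\<close>, the elements \<open>u\<close> whose face
  contains it form a coset of \<open>W_Q\<close>, and the product of the two signs is the same for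
  all of them.\<close>

lemma alt_cell_chain:
  assumes "spherical G S U" "Q \<subseteq> U" "w \<in> W"
  shows "(\<Sum>u\<in>generate G U. eps u * cell_chain (w \<otimes> u) Q R z) = (if R = Q then par_card Q * cell_chain w U U z else 0)"
proof (cases "R = Q \<and> z \<in> W")
  case True
  have US: "U \<subseteq> S" and fU: "finite (generate G U)" using assms by (auto simp: spherical_def)
  have QS: "Q \<subseteq> S" using US assms by auto
  let ?y = "inv w \<otimes> z"
  have y: "?y \<in> W" using True assms by simp
  have i: "inv (w \<otimes> u) \<otimes> z = inv u \<otimes> ?y" if "u \<in> generate G U" for u
    using that US assms True by (simp add: inv_mult_group m_assoc)
  show ?thesis
  proof (cases "?y \<in> generate G U")
    case yU: True
    let ?A = "{u \<in> generate G U. inv u \<otimes> ?y \<in> generate G Q}"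
    have "(\<Sum>u\<in>generate G U. eps u * cell_chain (w \<otimes> u) Q R z) = (\<Sum>u\<in>generate G U. if inv u \<otimes> ?y \<in> generate G Q then eps ?y else 0)"
    proof (intro sum.cong refl)
      fix u assume u: "u \<in> generate G U"
      then have "eps u * eps (inv u \<otimes> ?y) = eps ?y" using US y by (simp add: eps_mult flip: mult.assoc)
      then show "eps u * cell_chain (w \<otimes> u) Q R z = (if inv u \<otimes> ?y \<in> generate G Q then eps ?y else 0)"
        using True i[OF u] by (simp add: cell_chain_def)
    qed
    also have "\<dots> = real (card ?A) * eps ?y" using fU by (simp add: sum.If_cases Int_def)
    also have "card ?A = card (generate G Q)"
    proof (rule bij_betw_same_card[of "\<lambda>u. inv u \<otimes> ?y"])
      show "bij_betw (\<lambda>u. inv u \<otimes> ?y) ?A (generate G Q)"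
      proof (rule bij_betw_byWitness[of _ "\<lambda>v. ?y \<otimes> inv v"])
        show "\<forall>a\<in>?A. ?y \<otimes> inv (inv a \<otimes> ?y) = a"
          using US y by (auto simp: inv_mult_group m_assoc simp flip: m_assoc[of "inv w \<otimes> z"])
        show v: "\<forall>a'\<in>generate G Q. inv (?y \<otimes> inv a') \<otimes> ?y = a'"
          using QS y by (auto simp: inv_mult_group m_assoc)
        show "(\<lambda>u. inv u \<otimes> ?y) ` ?A \<subseteq> generate G Q" by auto
        show "(\<lambda>v. ?y \<otimes> inv v) ` generate G Q \<subseteq> ?A"
          using v US QS yU par_mono[OF assms(2)] by auto
      qed
    qed
    finally show ?thesis using True yU by (simp add: cell_chain_def)
  next
    case yU: False
    have "inv u \<otimes> ?y \<notin> generate G Q" if u: "u \<in> generate G U" for u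
    proof
      assume "inv u \<otimes> ?y \<in> generate G Q"
      then have "u \<otimes> (inv u \<otimes> ?y) \<in> generate G U" using u par_mono[OF assms(2)] US by auto
      moreover have "u \<otimes> (inv u \<otimes> ?y) = ?y" using u US y by (simp flip: m_assoc)
      ultimately show False using yU by simp
    qed
    then show ?thesis using True i yU by (simp add: cell_chain_def)
  qed
qed (auto simp: cell_chain_def)

lemma cbdry_cell_chain: assumes "spherical G S U" "w \<in> W" shows "cbdry (cell_chain w U) = comp_bdry cell_chain w U"
proof (intro ext)
  fix R z
  have US: "U \<subseteq> S" using assms by (simp add: spherical_def)
  have fU: "finite U" using US finS finite_subset by blast
  have "cbdry (cell_chain w U) R z = (\<Sum>s\<in>S - R. if insert s R = U then inc_sign s R * cell_chain w U U z else 0)"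
    unfolding cbdry_def by (intro sum.cong refl) (auto simp: cell_chain_def)
  also have "\<dots> = (\<Sum>s\<in>{s \<in> S - R. insert s R = U}. inc_sign s R * cell_chain w U U z)"
    by (rule sum.inter_filter[symmetric]) (use finS in simp)
  also have "{s \<in> S - R. insert s R = U} = {s \<in> U. R = U - {s}}" using US by auto
  also have "(\<Sum>s\<in>{s \<in> U. R = U - {s}}. inc_sign s R * cell_chain w U U z) = (\<Sum>s\<in>U. if R = U - {s} then inc_sign s R * cell_chain w U U z else 0)"
    by (rule sum.inter_filter[OF fU])
  also have "\<dots> = comp_bdry cell_chain w U R z"
    unfolding comp_bdry_eq[OF assms(1)] alt_cell_chain[OF assms(1) Diff_subset assms(2)]
    using par_card_pos spherical_mono[OF assms(1)] by (intro sum.cong refl) (auto simp: less_imp_neq[symmetric])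
  finally show "cbdry (cell_chain w U) R z = comp_bdry cell_chain w U R z" .
qed

lemma alt_avg_cell_chain: assumes "spherical G S U" "w \<in> W" shows "alt_avg cell_chain w U = cell_chain w U"
proof (intro ext)
  fix R z
  show "alt_avg cell_chain w U R z = cell_chain w U R z"
    unfolding alt_avg_eq alt_cell_chain[OF assms(1) order_refl assms(2)] using par_card_pos[OF assms(1)] by (auto simp: cell_chain_def)
qed

lemma sum_eps: assumes "spherical G S U" "U \<noteq> {}" shows "(\<Sum>u\<in>generate G U. eps u) = 0"
proof -
  obtain s where s: "s \<in> U" using assms by auto
  have US: "U \<subseteq> S" using assms by (simp add: spherical_def)
  have "(\<Sum>u\<in>generate G U. eps u) = (\<Sum>u\<in>generate G U. eps (s \<otimes> u))"
    using par_sum_left[OF US, of s eps] s by simp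
  also have "\<dots> = (\<Sum>u\<in>generate G U. - eps u)" using s US by (intro sum.cong refl) (auto simp: eps_mult)
  finally show ?thesis by (simp add: sum_negf)
qed

subsection \<open>Acyclicity of the finitely supported complex\<close>

text \<open>The support is peeled off from the outside. At an element \<open>w\<close> of length
  \<open>n\<close>, an alternating chain involves only types inside the descent set of
  \<open>w\<close>, and that set is spherical. So all faces of a simplex are available there, and
  coning from the vertex \<open>s0 w\<close> removes the values at \<open>w\<close>. Besides
  \<open>w\<close> the cells used reach only shorter elements.\<close>

lemma fill_step:
  assumes VS: "V \<subseteq> S" and x: "fin_chain V (Suc j) x" "cbdry x = (\<lambda>R z. 0)" and n: "\<And>U w. x U w \<noteq> 0 \<Longrightarrow> len w < Suc n"
  shows "\<exists>y. fin_chain V (Suc (Suc j)) y \<and> (\<forall>U w. x U w - cbdry y U w \<noteq> 0 \<longrightarrow> len w < n)"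
proof -
  note xs = alt_chain_chain_supp[OF fin_chain_alt_chain[OF x(1)]]
  define T where "T = {w. len w = n \<and> (\<exists>U. x U w \<noteq> 0)}"
  define D where "D w = {s \<in> V. len (w \<otimes> s) < len w}" for w
  have "T \<subseteq> snd ` chain_supp x" by (force simp: T_def chain_supp_def)
  then have fT: "finite T" using x by (auto simp: fin_chain_def intro: finite_subset)
  have TW: "T \<subseteq> W" using xs by (auto simp: T_def)
  \<comment> \<open>By alternation \<open>w \<otimes> s\<close> lies in the support as well, so it
    cannot be longer than \<open>w\<close>.\<close>
  have UD: "U \<subseteq> D w" if w: "w \<in> T" "x U w \<noteq> 0" for U w
  proof
    fix s assume s: "s \<in> U"
    have c: "U \<subseteq> V" "U \<subseteq> S" "w \<in> W" using xs[OF w(2)] by auto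
    have "x U (w \<otimes> s) = - x U w" using alt_chain_alt[OF fin_chain_alt_chain[OF x(1)], of U w s] c s by auto
    then have "len (w \<otimes> s) < Suc n" using n[of U "w \<otimes> s"] w by simp
    then show "s \<in> D w" using w c s len_mult_S[of w s] by (auto simp: D_def T_def)
  qed
  have Dsph: "spherical G S (D w)" if "w \<in> T" for w
    by (rule desc_spherical[of w]) (use that TW VS in \<open>auto simp: D_def\<close>)
  define s0 where "s0 w = (SOME s. s \<in> D w)" for w
  have s0: "s0 w \<in> D w" if w: "w \<in> T" for w
  proof -
    obtain U where U: "x U w \<noteq> 0" using w by (auto simp: T_def)
    then have "U \<noteq> {}" using xs[OF U] by auto
    then have "\<exists>s. s \<in> D w" using UD[OF w U] by auto
    then show ?thesis unfolding s0_def by (rule someI_ex)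
  qed
  \<comment> \<open>The cone operator with apex \<open>s0 w\<close>; the sign cancels the one that
    \<open>cbdry\<close> puts on the face opposite to the apex.\<close>
  define b where "b w R = (if s0 w \<in> R \<and> R \<subseteq> D w \<and> card R = Suc (Suc j) then inc_sign (s0 w) (R - {s0 w}) * x (R - {s0 w}) w else 0)" for w R
  define P where "P = Pow S"
  define y where "y = (\<lambda>R z. \<Sum>w\<in>T. \<Sum>Q\<in>P. b w Q * cell_chain w Q R z)"
  have ycalc: "y R z = (\<Sum>w\<in>T. b w R * cell_chain w R R z)" if "R \<in> P" for R z
    unfolding y_def
  proof (intro sum.cong refl)
    fix w assume "w \<in> T"
    show "(\<Sum>Q\<in>P. b w Q * cell_chain w Q R z) = b w R * cell_chain w R R z"
      using finS that by (subst sum.remove[of P R]) (auto simp: P_def cell_chain_def intro!: sum.neutral split: if_splits)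
  qed
  have yf: "fin_chain V (Suc (Suc j)) y"
  proof -
    have "fin_chain V (Suc (Suc j)) (\<lambda>R z. \<Sum>p\<in>T \<times> P. b (fst p) (snd p) * (if b (fst p) (snd p) = 0 then 0 else cell_chain (fst p) (snd p) R z))"
    proof (rule fin_chain_sum)
      show "finite (T \<times> P)" using fT finS by (simp add: P_def)
      fix p assume p: "p \<in> T \<times> P"
      show "fin_chain V (Suc (Suc j)) (\<lambda>R z. if b (fst p) (snd p) = 0 then 0 else cell_chain (fst p) (snd p) R z)"
      proof (cases "b (fst p) (snd p) = 0")
        case False
        then have "snd p \<subseteq> D (fst p)" "card (snd p) = Suc (Suc j)" by (auto simp: b_def split: if_splits)
        moreover have "fst p \<in> T" "fst p \<in> W" using p TW by auto
        moreover have "spherical G S (snd p)" using spherical_mono[OF Dsph] calculation by blast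
        moreover have "snd p \<subseteq> V" using calculation by (auto simp: D_def)
        ultimately have "fin_chain V (Suc (Suc j)) (cell_chain (fst p) (snd p))"
          using cell_chain_alt_chain[of "fst p" "snd p" V] by simp
        then show ?thesis using False by simp
      qed (simp add: fin_chain_0)
    qed
    moreover have "y = (\<lambda>R z. \<Sum>p\<in>T \<times> P. b (fst p) (snd p) * (if b (fst p) (snd p) = 0 then 0 else cell_chain (fst p) (snd p) R z))"
      unfolding y_def sum.cartesian_product case_prod_unfold by (intro ext sum.cong refl) auto
    ultimately show ?thesis by simp
  qed
  have top: "z = w \<or> len z < n" if w: "w \<in> T" "b w R \<noteq> 0" "cell_chain w R R z \<noteq> 0" for w R z
  proof -
    have R: "R \<subseteq> D w" using w(2) by (auto simp: b_def split: if_splits)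
    have wW: "w \<in> W" "len w = n" using w TW by (auto simp: T_def)
    have z: "z \<in> W" "inv w \<otimes> z \<in> generate G R" using w(3) by (auto simp: cell_chain_def split: if_splits)
    define u where "u = inv w \<otimes> z"
    have u: "u \<in> generate G (D w)" "z = w \<otimes> u" using z par_mono[OF R] wW by (auto simp: u_def simp flip: m_assoc)
    have "len z + len u = n" using len_sub[of w "D w" u] u wW VS by (auto simp: D_def)
    moreover have "u \<in> W" using z wW by (simp add: u_def)
    ultimately show ?thesis using len_0[of u] u wW by (cases "len u = 0") auto
  qed
  have cone: "(\<Sum>s\<in>S - U. inc_sign s U * b z (insert s U)) = x U z" if z: "z \<in> T" and US: "U \<subseteq> S" for z U
  proof -
    let ?t = "s0 z"
    have t: "?t \<in> D z" "?t \<in> S" using s0[OF z] VS by (auto simp: D_def)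
    have fU: "finite U" using US finS finite_subset by blast
    show ?thesis
    proof (cases "?t \<in> U")
      case False
      have "(\<Sum>s\<in>S - U. inc_sign s U * b z (insert s U)) = inc_sign ?t U * b z (insert ?t U) + (\<Sum>s\<in>S - U - {?t}. inc_sign s U * b z (insert s U))"
        using finS t False by (subst sum.remove[of _ ?t]) auto
      also have "(\<Sum>s\<in>S - U - {?t}. inc_sign s U * b z (insert s U)) = 0"
        using False by (intro sum.neutral) (auto simp: b_def)
      also have "inc_sign ?t U * b z (insert ?t U) = x U z"
      proof (cases "x U z = 0")
        case False
        then have "U \<subseteq> D z" "card U = Suc j" using UD[OF z False] xs[OF False] by auto
        then show ?thesis using \<open>?t \<notin> U\<close> t fU by (simp add: b_def)
      qed (use False in \<open>simp add: b_def\<close>)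
      finally show ?thesis by simp
    next
      \<comment> \<open>For a simplex through the apex the cone does not give the value directly;
        the vanishing of \<open>cbdry x\<close> at the opposite face supplies it.\<close>
      case True
      define R where "R = U - {?t}"
      have U: "U = insert ?t R" "?t \<notin> R" "R \<subseteq> S" using True US by (auto simp: R_def)
      have "inc_sign s U * b z (insert s U) = - inc_sign ?t R * (inc_sign s R * x (insert s R) z)" if s: "s \<in> S - U" for s
      proof -
        have st: "s \<noteq> ?t" "s \<notin> R" using s U by auto
        have "insert s U - {?t} = insert s R" using U st by auto
        moreover have "s0 z \<in> insert s U \<and> insert s U \<subseteq> D z \<and> card (insert s U) = Suc (Suc j)" if nz: "x (insert s R) z \<noteq> 0"
          using UD[OF z nz] xs[OF nz] True t U fU s st by (auto simp: card_insert_if)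
        ultimately have bz: "b z (insert s U) = inc_sign ?t (insert s R) * x (insert s R) z" by (auto simp: b_def)
        have "inc_sign ?t R * inc_sign s U = - (inc_sign s R * inc_sign ?t (insert s R))"
          unfolding U(1) by (rule inc_sign_anti) (use U t s st in auto)
        then have "inc_sign s U = - inc_sign ?t R * inc_sign s R * inc_sign ?t (insert s R)"
          by (metis mult.assoc mult_minus_left mult_minus_right inc_sign_sq')
        then show ?thesis unfolding bz by (simp add: mult.assoc)
      qed
      then have "(\<Sum>s\<in>S - U. inc_sign s U * b z (insert s U)) = - inc_sign ?t R * (\<Sum>s\<in>S - U. inc_sign s R * x (insert s R) z)"
        by (simp add: sum_distrib_left sum_negf)
      also have "(\<Sum>s\<in>S - U. inc_sign s R * x (insert s R) z) = - inc_sign ?t R * x U z"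
      proof -
        have "0 = cbdry x R z" using x(2) by simp
        also have "\<dots> = inc_sign ?t R * x (insert ?t R) z + (\<Sum>s\<in>S - R - {?t}. inc_sign s R * x (insert s R) z)"
          unfolding cbdry_def using finS t U by (subst sum.remove[of _ ?t]) auto
        also have "S - R - {?t} = S - U" using U by auto
        finally show ?thesis using U by simp
      qed
      finally show ?thesis by simp
    qed
  qed
  have "x U z - cbdry y U z = 0" if nl: "\<not> len z < n" for U z
  proof (cases "U \<subseteq> S")
    case False
    then have "x U z = 0" using xs by blast
    moreover have "cbdry y U z = 0"
    proof -
      have "y (insert s U) z = 0" for s using alt_chain_chain_supp[OF fin_chain_alt_chain[OF yf], of "insert s U" z] False by auto
      then show ?thesis by (simp add: cbdry_def)
    qed
    ultimately show ?thesis by simp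
  next
    case US: True
    have d: "cbdry y U z = (\<Sum>s\<in>S - U. inc_sign s U * (\<Sum>w\<in>T. b w (insert s U) * cell_chain w (insert s U) (insert s U) z))"
      unfolding cbdry_def using ycalc US by (intro sum.cong refl) (auto simp: P_def)
    show ?thesis
    proof (cases "z \<in> T")
      case True
      have zW: "z \<in> W" using True TW by auto
      have "(\<Sum>w\<in>T. b w R * cell_chain w R R z) = b z R" for R
      proof -
        have "(\<Sum>w\<in>T. b w R * cell_chain w R R z) = b z R * cell_chain z R R z + (\<Sum>w\<in>T - {z}. b w R * cell_chain w R R z)"
          by (rule sum.remove[OF fT True])
        also have "(\<Sum>w\<in>T - {z}. b w R * cell_chain w R R z) = 0"
          using top nl by (intro sum.neutral) force
        also have "cell_chain z R R z = 1" using zW by (simp add: cell_chain_def)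
        finally show ?thesis by simp
      qed
      then show ?thesis unfolding d using cone[OF True US] by simp
    next
      case False
      have "b w R * cell_chain w R R z = 0" if "w \<in> T" for w R
        using top[of w R z] nl that False by auto
      then have "cbdry y U z = 0" unfolding d by (simp add: sum.neutral)
      moreover have "x U z = 0" using n[of U z] nl False by (force simp: T_def)
      ultimately show ?thesis by simp
    qed
  qed
  then show ?thesis using yf by blast
qed

lemma fill_exists:
  assumes VS: "V \<subseteq> S" and x: "fin_chain V (Suc j) x" "cbdry x = (\<lambda>R z. 0)"
  shows "\<exists>y. fin_chain V (Suc (Suc j)) y \<and> cbdry y = x"
proof -
  have main: "\<exists>y. fin_chain V (Suc (Suc j)) y \<and> cbdry y = x"
    if "fin_chain V (Suc j) x" "cbdry x = (\<lambda>R z. 0)" "\<And>U w. x U w \<noteq> 0 \<Longrightarrow> len w < n" for x n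
    using that
  proof (induction n arbitrary: x)
    case 0
    then have "x = (\<lambda>R z. 0)" by (intro ext) auto
    then show ?case using fin_chain_0 by (intro exI[of _ "\<lambda>R z. 0"]) auto
  next
    case (Suc n)
    obtain y where y: "fin_chain V (Suc (Suc j)) y" "\<And>U w. x U w - cbdry y U w \<noteq> 0 \<Longrightarrow> len w < n"
      using fill_step[OF VS Suc.prems(1,2), of n] Suc.prems(3) by blast
    let ?x = "\<lambda>R z. x R z - cbdry y R z"
    have "cbdry ?x = (\<lambda>R z. 0)"
      unfolding cbdry_diff Suc.prems(2) using cbdry_cbdry[of y] alt_chain_chain_supp[OF fin_chain_alt_chain[OF y(1)]] by auto
    moreover have "fin_chain V (Suc j) ?x" using fin_chain_diff[OF Suc.prems(1) fin_chain_cbdry[OF y(1)]] .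
    ultimately obtain y' where y': "fin_chain V (Suc (Suc j)) y'" "cbdry y' = ?x" using Suc.IH[of ?x] y(2) by blast
    have "cbdry (\<lambda>R z. y R z + y' R z) = x" unfolding cbdry_add y'(2) by simp
    then show ?case using fin_chain_add[OF y(1) y'(1)] by blast
  qed
  have "finite (snd ` chain_supp x)" using x by (auto simp: fin_chain_def)
  then obtain n where "\<And>w. w \<in> snd ` chain_supp x \<Longrightarrow> len w < n"
    by (metis finite_imageI finite_nat_set_iff_bounded image_eqI)
  then have "\<And>U w. x U w \<noteq> 0 \<Longrightarrow> len w < n" by (force simp: chain_supp_def)
  then show ?thesis using main x by blast
qed

lemma generate_single: "s \<in> S \<Longrightarrow> generate G {s} = {\<one>, s}"
proof -
  assume s: "s \<in> S"
  have "wp a \<in> {\<one>, s}" if "set a \<subseteq> {s}" for a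
    using that by (induction a) (use s S_involution[OF s] in auto)
  then have "generate G {s} \<subseteq> {\<one>, s}" using generate_words[of "{s}"] s by (metis empty_subsetI insert_subset subsetI)
  then show ?thesis using par_one[of "{s}"] par_gen[of s "{s}"] by blast
qed

text \<open>In degree zero a cycle need not bound, but a difference of two vertices of one coset of
  \<open>W_V\<close> does, along the edges of a word for \<open>g\<close>.\<close>

lemma fill_path:
  assumes VS: "V \<subseteq> S" and p: "p \<in> W" and g: "g \<in> generate G V"
  shows "\<exists>y. fin_chain V (Suc 0) y \<and> cbdry y = (\<lambda>R z. cell_chain p {} R z - cell_chain (p \<otimes> g) {} R z)"
proof -
  obtain a where a: "set a \<subseteq> V" "wp a = g" using generate_words[OF VS] g by blast
  have "\<exists>y. fin_chain V (Suc 0) y \<and> cbdry y = (\<lambda>R z. cell_chain p {} R z - cell_chain (p \<otimes> wp a) {} R z)" using a(1)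
  proof (induction a rule: rev_induct)
    case Nil then show ?case using p fin_chain_0 by (intro exI[of _ "\<lambda>R z. 0"]) auto
  next
    case (snoc s a)
    then obtain y where y: "fin_chain V (Suc 0) y" "cbdry y = (\<lambda>R z. cell_chain p {} R z - cell_chain (p \<otimes> wp a) {} R z)" by auto
    have S: "s \<in> S" "set a \<subseteq> S" using snoc.prems VS by auto
    define r where "r = p \<otimes> wp a"
    have r: "r \<in> W" using p S by (simp add: r_def)
    have sph: "spherical G S {s}" using S by (simp add: spherical_def generate_single)
    have f: "fin_chain V (Suc 0) (cell_chain r {s})" using cell_chain_alt_chain[OF r _ sph, of V] snoc.prems by simp
    have "cbdry (cell_chain r {s}) = (\<lambda>R z. cell_chain r {} R z - cell_chain (r \<otimes> s) {} R z)"
    proof (intro ext)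
      fix R z
      have "\<one> \<noteq> s" using S one_notin_S by auto
      then show "cbdry (cell_chain r {s}) R z = cell_chain r {} R z - cell_chain (r \<otimes> s) {} R z"
        unfolding cbdry_cell_chain[OF sph r] comp_bdry_eq[OF sph] using S r
        by (simp add: generate_single generate_empty inc_sign_def)
    qed
    then have "cbdry (\<lambda>R z. y R z + cell_chain r {s} R z) = (\<lambda>R z. cell_chain p {} R z - cell_chain (p \<otimes> wp (a @ [s])) {} R z)"
      unfolding cbdry_add y(2) using S p by (simp add: r_def m_assoc)
    then show ?case using fin_chain_add[OF y(1) f] by blast
  qed
  then show ?thesis using a by simp
qed

end

section \<open>Chain maps and homotopies along the combing\<close>

context cox
begin

lemma spherical_empty: "spherical G S {}" by (simp add: spherical_def generate_empty)

lemma comp_bdry_cong: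
  assumes "\<And>s u. s \<in> U \<Longrightarrow> u \<in> generate G U \<Longrightarrow> D (w \<otimes> u) (U - {s}) = E (w \<otimes> u) (U - {s})"
  shows "comp_bdry D w U = comp_bdry E w U"
  unfolding comp_bdry_def case_prod_unfold using assms by (intro ext sum.cong refl) auto

lemma alt_avg_cong:
  assumes "\<And>u. u \<in> generate G U \<Longrightarrow> D (w \<otimes> u) U = E (w \<otimes> u) U" shows "alt_avg D w U = alt_avg E w U"
  unfolding alt_avg_def using assms by (intro ext sum.cong refl) auto

lemma comp_bdry_diff: "comp_bdry (\<lambda>w U R z. A w U R z - B w U R z) w U = (\<lambda>R z. comp_bdry A w U R z - comp_bdry B w U R z)"
  unfolding comp_bdry_def case_prod_unfold by (simp add: right_diff_distrib sum_subtractf)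

lemma comp_bdry_sum: "comp_bdry (\<lambda>w U R z. \<Sum>n\<in>I. A n w U R z) w U = (\<lambda>R z. \<Sum>n\<in>I. comp_bdry (A n) w U R z)"
  unfolding comp_bdry_def case_prod_unfold sum_distrib_left by (intro ext) (rule sum.swap)

lemma comp_bdry_zero: "comp_bdry (\<lambda>w U R z. 0) w U = (\<lambda>R z. 0)" by (simp add: comp_bdry_def case_prod_unfold)

lemma alt_avg_zero: "alt_avg (\<lambda>w U R z. 0) w U = (\<lambda>R z. 0)" by (simp add: alt_avg_def)

text \<open>The shapes \<open>U\<close> are finitely many, and for each of them only a map from a
  finite index set into \<open>Y\<close> varies. This is how finiteness of local patterns passes
  through \<open>comp_bdry\<close> and \<open>alt_avg\<close>.\<close>

lemma fin_comb:
  fixes I :: "'c \<Rightarrow> 'd set" and c :: "'c \<Rightarrow> 'd \<Rightarrow> real" and Y :: "'a chain set"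
  assumes "finite K" "\<And>U. U \<in> K \<Longrightarrow> finite (I U)" "finite Y"
  shows "finite {(\<lambda>R z. \<Sum>i\<in>I U. c U i * \<phi> i R z) | U \<phi>. U \<in> K \<and> (\<forall>i\<in>I U. \<phi> i \<in> Y)}" (is "finite ?A")
proof -
  have "?A \<subseteq> (\<Union>U\<in>K. (\<lambda>\<phi> R z. \<Sum>i\<in>I U. c U i * \<phi> i R z) ` (I U \<rightarrow>\<^sub>E Y))"
  proof
    fix x assume "x \<in> ?A"
    then obtain U \<phi> where x: "x = (\<lambda>R z. \<Sum>i\<in>I U. c U i * \<phi> i R z)" "U \<in> K" "\<forall>i\<in>I U. \<phi> i \<in> Y" by blast
    have "x = (\<lambda>R z. \<Sum>i\<in>I U. c U i * (restrict \<phi> (I U)) i R z)" unfolding x(1) by (intro ext sum.cong refl) simp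
    moreover have "restrict \<phi> (I U) \<in> I U \<rightarrow>\<^sub>E Y" using x(3) by auto
    ultimately show "x \<in> (\<Union>U\<in>K. (\<lambda>\<phi> R z. \<Sum>i\<in>I U. c U i * \<phi> i R z) ` (I U \<rightarrow>\<^sub>E Y))" using x(2) by blast
  qed
  moreover have "finite (\<Union>U\<in>K. (\<lambda>\<phi> R z. \<Sum>i\<in>I U. c U i * \<phi> i R z) ` (I U \<rightarrow>\<^sub>E Y))"
    using assms by (intro finite_UN_I finite_imageI finite_PiE) auto
  ultimately show ?thesis by (rule finite_subset)
qed

context
  fixes V :: "'a set" assumes VS: "V \<subseteq> S"
begin

definition sph_card :: "nat \<Rightarrow> 'a set \<Rightarrow> bool" where "sph_card i U \<longleftrightarrow> U \<subseteq> V \<and> spherical G S U \<and> card U = i"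

lemma sph_card_sph: "sph_card i U \<Longrightarrow> spherical G S U" and sph_card_V: "sph_card i U \<Longrightarrow> U \<subseteq> V" and sph_card_S: "sph_card i U \<Longrightarrow> U \<subseteq> S"
  and sph_card_card: "sph_card i U \<Longrightarrow> card U = i"
  unfolding sph_card_def using VS by auto

lemma sph_card_W: "sph_card i U \<Longrightarrow> u \<in> generate G U \<Longrightarrow> u \<in> W" using sph_card_S par_mem by blast

lemma sph_card_diff: assumes "sph_card (Suc i) U" "s \<in> U" shows "sph_card i (U - {s})"
  using assms spherical_mono[of U "U - {s}"] sph_fin[of U] unfolding sph_card_def by auto

lemma sph_card_0: "sph_card 0 U \<longleftrightarrow> U = {}"
  using sph_fin[of U] spherical_empty unfolding sph_card_def by auto

lemma finite_sph_card: "finite {U. sph_card i U}"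
  by (rule finite_subset[of _ "Pow S"]) (use sph_card_S finS in auto)

text \<open>The zero boundary gets the zero filling; with an arbitrary choice the homotopies need
  not stop when the combing has reached its end.\<close>

definition filling :: "nat \<Rightarrow> 'a chain \<Rightarrow> 'a chain" where
  "filling j z = (if z = (\<lambda>R w. 0) then (\<lambda>R w. 0) else (SOME y. fin_chain V (Suc j) y \<and> cbdry y = z))"

lemma filling: assumes "\<exists>y. fin_chain V (Suc j) y \<and> cbdry y = z" shows "fin_chain V (Suc j) (filling j z)" "cbdry (filling j z) = z"
  using someI_ex[OF assms] fin_chain_0[of V "Suc j"] unfolding filling_def by auto

text \<open>Filling after translating the base point \<open>p\<close> to \<open>\<one>\<close> makes the choice equivariant, so that finitely many
  boundaries up to translation have finitely many fillings up to translation.\<close>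

definition filling_at :: "nat \<Rightarrow> 'a \<Rightarrow> 'a chain \<Rightarrow> 'a chain" where
  "filling_at j p z = translate p (filling j (translate (inv p) z))"

lemma filling_at_0: "filling_at j p (\<lambda>R w. 0) = (\<lambda>R w. 0)" by (simp add: filling_at_def filling_def)

lemma fin_chain_W: "fin_chain V j y \<Longrightarrow> y R z \<noteq> 0 \<Longrightarrow> z \<in> W" using alt_chain_chain_supp[OF fin_chain_alt_chain] by blast

lemma filling_at:
  assumes p: "p \<in> W" and e: "\<exists>y. fin_chain V (Suc j) y \<and> cbdry y = z"
  shows "fin_chain V (Suc j) (filling_at j p z)" "cbdry (filling_at j p z) = z" "translate (inv p) (filling_at j p z) = filling j (translate (inv p) z)"
proof -
  obtain y where y: "fin_chain V (Suc j) y" "cbdry y = z" using e by blast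
  have "fin_chain V (Suc j) (translate (inv p) y)" "cbdry (translate (inv p) y) = translate (inv p) z" using fin_chain_translate[OF y(1)] p y(2) cbdry_translate by auto
  then have f: "fin_chain V (Suc j) (filling j (translate (inv p) z))" "cbdry (filling j (translate (inv p) z)) = translate (inv p) z" using filling[of j "translate (inv p) z"] by blast+
  show "fin_chain V (Suc j) (filling_at j p z)" unfolding filling_at_def using fin_chain_translate f p by blast
  have zW: "z R w \<noteq> 0 \<Longrightarrow> w \<in> W" for R w using fin_chain_W[OF fin_chain_cbdry[OF y(1)]] y(2) by auto
  show "cbdry (filling_at j p z) = z"
    unfolding filling_at_def cbdry_translate f(2) translate_translate[OF p inv_closed[OF p]] using translate_one[of z] zW p by simp
  show "translate (inv p) (filling_at j p z) = filling j (translate (inv p) z)"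
    unfolding filling_at_def translate_translate[OF inv_closed[OF p] p] using translate_one[of "filling j (translate (inv p) z)"] fin_chain_W[OF f(1)] p by simp
qed

text \<open>\<open>comb_map i n\<close> moves an \<open>i\<close>-cell \<open>n\<close> steps along the combing, and \<open>comb_homot i n\<close> is a homotopy
  between \<open>comb_map i n\<close> and \<open>comb_map i (Suc n)\<close>. Averaging over \<open>W\<^sub>U\<close> is needed since the combing
  is not compatible with the right action of \<open>W\<^sub>U\<close>.\<close>

primrec comb_map :: "nat \<Rightarrow> nat \<Rightarrow> 'a \<Rightarrow> 'a set \<Rightarrow> 'a chain" where
  "comb_map 0 = (\<lambda>n w U. cell_chain (comb V n w) {})"
| "comb_map (Suc i) = (\<lambda>n w U. if n = 0 then cell_chain w U else filling_at i (comb V n w) (comp_bdry (comb_map i n) w U))"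

primrec comb_homot :: "nat \<Rightarrow> nat \<Rightarrow> 'a \<Rightarrow> 'a set \<Rightarrow> 'a chain" where
  "comb_homot 0 = (\<lambda>n w U. filling_at 0 (comb V n w) (\<lambda>R z. cell_chain (comb V (Suc n) w) {} R z - cell_chain (comb V n w) {} R z))"
| "comb_homot (Suc i) = (\<lambda>n w U. filling_at (Suc i) (comb V n w)
     (\<lambda>R z. (alt_avg (comb_map (Suc i) (Suc n)) w U R z - alt_avg (comb_map (Suc i) n) w U R z) - comp_bdry (comb_homot i n) w U R z))"

lemma comb_coset:
  assumes "w \<in> W" "u \<in> generate G V" shows "inv (comb V m w) \<otimes> comb V n (w \<otimes> u) \<in> generate G V"
proof -
  have uW: "u \<in> W" using assms VS by simp
  obtain a where a: "a \<in> generate G V" "w = comb V m w \<otimes> a" using comb_suffix[OF VS assms(1), of m] by blast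
  obtain b where b: "b \<in> generate G V" "w \<otimes> u = comb V n (w \<otimes> u) \<otimes> b"
    using comb_suffix[OF VS m_closed[OF assms(1) uW], of n] by blast
  have W: "a \<in> W" "b \<in> W" "comb V m w \<in> W" "comb V n (w \<otimes> u) \<in> W" using a b VS assms uW comb_W by auto
  have "inv (comb V m w) = a \<otimes> inv w"
    using W a(2) assms(1) by (metis inv_equality inv_mult_group inv_closed inv_inv r_inv m_assoc l_inv r_one)
  moreover have "comb V n (w \<otimes> u) = w \<otimes> u \<otimes> inv b" using W b(2) assms(1) uW by (metis inv_solve_right m_closed)
  ultimately have "inv (comb V m w) \<otimes> comb V n (w \<otimes> u) = a \<otimes> (u \<otimes> inv b)"
    using W assms(1) uW by (simp add: m_assoc) (simp flip: m_assoc)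
  then show ?thesis using a b assms VS by simp
qed

lemma comb_map_0: "sph_card i U \<Longrightarrow> w \<in> W \<Longrightarrow> comb_map i 0 w U = cell_chain w U"
  by (cases i) (simp_all add: comb_0[OF VS] sph_card_0)

text \<open>The boundary prescribed by the degree below is a cycle because \<open>comp_bdry\<close>
  squares to zero, and so it can be filled. In degree one it is a difference of two vertices, for
  which \<open>fill_path\<close> is needed. Time 0 is set to the identity so that the homotopies
  later telescope from it.\<close>

lemma comb_map_props:
  assumes "sph_card i U" "w \<in> W"
  shows "fin_chain V i (comb_map i n w U) \<and> (\<forall>i'. i = Suc i' \<longrightarrow> cbdry (comb_map i n w U) = comp_bdry (comb_map i' n) w U)"
  using assms
proof (induction i arbitrary: U w)
  case 0
  then show ?case using cell_chain_alt_chain[of "comb V n w" "{}" V] spherical_empty comb_W[OF VS] by simp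
next
  case (Suc i)
  have sp: "spherical G S U" "U \<subseteq> V" "U \<subseteq> S" "card U = Suc i" using Suc.prems sph_card_sph sph_card_V sph_card_S sph_card_card by auto
  have uW: "w \<otimes> u \<in> W" if "u \<in> generate G U" for u using that sp Suc.prems by simp
  have IH: "fin_chain V i (comb_map i n (w \<otimes> u) (U - {s}))" "i = Suc i' \<Longrightarrow> cbdry (comb_map i n (w \<otimes> u) (U - {s})) = comp_bdry (comb_map i' n) (w \<otimes> u) (U - {s})"
    if "s \<in> U" "u \<in> generate G U" for s u i'
    using Suc.IH[OF sph_card_diff[OF Suc.prems(1) that(1)] uW[OF that(2)]] by auto
  have fb: "fin_chain V i (comp_bdry (comb_map i n) w U)" by (rule fin_chain_comp_bdry[OF sp(1)]) (rule IH(1))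
  show ?case
  proof (cases "n = 0")
    case True
    have "comp_bdry cell_chain w U = comp_bdry (comb_map i 0) w U"
      using comb_map_0 sph_card_diff[OF Suc.prems(1)] uW by (intro comp_bdry_cong) metis
    then show ?thesis using True cell_chain_alt_chain[OF Suc.prems(2) sp(2,1)] cbdry_cell_chain[OF sp(1) Suc.prems(2)] sp by simp
  next
    case False
    have "\<exists>y. fin_chain V (Suc i) y \<and> cbdry y = comp_bdry (comb_map i n) w U"
    proof (cases i)
      case 0
      then obtain s where s: "U = {s}" using sp by (auto simp: card_Suc_eq)
      have sS: "s \<in> S" "s \<in> V" using s sp by auto
      have "\<one> \<noteq> s" using sS one_notin_S by auto
      then have e: "comp_bdry (comb_map i n) w U = (\<lambda>R z. cell_chain (comb V n w) {} R z - cell_chain (comb V n (w \<otimes> s)) {} R z)"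
        unfolding s using 0 sS Suc.prems sp(1)
        by (intro ext, subst comp_bdry_eq) (auto simp: s generate_single generate_empty inc_sign_def)
      have "comb V n w \<otimes> (inv (comb V n w) \<otimes> comb V n (w \<otimes> s)) = comb V n (w \<otimes> s)"
        using comb_W[OF VS] Suc.prems sS by (simp flip: m_assoc)
      then show ?thesis
        using fill_path[OF VS, of "comb V n w" "inv (comb V n w) \<otimes> comb V n (w \<otimes> s)"] comb_W[OF VS Suc.prems(2)]
          comb_coset[OF Suc.prems(2), of s n n] sS 0 e by simp
    next
      case (Suc i')
      have "cbdry (comp_bdry (comb_map i n) w U) = comp_bdry (comp_bdry (comb_map i' n)) w U" by (rule cbdry_comp_bdry) (rule IH(2)[OF _ _ Suc])
      also have "\<dots> = (\<lambda>R z. 0)" by (rule comp_bdry_comp_bdry[OF sp(1) Suc.prems(2)])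
      finally show ?thesis using fill_exists[OF VS, of i'] fb Suc by simp
    qed
    from filling_at[OF comb_W[OF VS Suc.prems(2)] this, of n] False show ?thesis by simp
  qed
qed

lemma comb_map_fin_chain: "sph_card i U \<Longrightarrow> w \<in> W \<Longrightarrow> fin_chain V i (comb_map i n w U)"
  and comb_map_cbdry: "sph_card (Suc i) U \<Longrightarrow> w \<in> W \<Longrightarrow> cbdry (comb_map (Suc i) n w U) = comp_bdry (comb_map i n) w U"
  using comb_map_props by blast+

lemma comb_map_fillable:
  assumes "sph_card (Suc i) U" "w \<in> W" shows "\<exists>y. fin_chain V (Suc i) y \<and> cbdry y = comp_bdry (comb_map i n) w U"
  using comb_map_fin_chain[OF assms] comb_map_cbdry[OF assms] by blast

lemma alt_avg_empty: "w \<in> W \<Longrightarrow> alt_avg D w {} = D w {}"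
  by (intro ext) (simp add: alt_avg_def generate_empty)

text \<open>The case distinction lets degree zero, where no lower homotopy exists, share its
  statements with the other degrees.\<close>

definition homot_bdry :: "nat \<Rightarrow> nat \<Rightarrow> 'a \<Rightarrow> 'a set \<Rightarrow> 'a chain" where
  "homot_bdry i n w U = (case i of 0 \<Rightarrow> (\<lambda>R z. 0) | Suc i' \<Rightarrow> comp_bdry (comb_homot i' n) w U)"

lemma comb_homot_eq: assumes "sph_card i U" "w \<in> W"
  shows "comb_homot i n w U = filling_at i (comb V n w) (\<lambda>R z. (alt_avg (comb_map i (Suc n)) w U R z - alt_avg (comb_map i n) w U R z) - homot_bdry i n w U R z)"
  using assms by (cases i) (simp_all add: homot_bdry_def sph_card_0 alt_avg_empty)

text \<open>The usual chain homotopy computation shows that the prescribed boundary is a cycle: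
  \<open>comp_bdry\<close> does not see the averaging, and in the boundary formula of the degree
  below it kills the term \<open>homot_bdry\<close>.\<close>

lemma comb_homot_fillable:
  assumes "sph_card i U" "w \<in> W"
  shows "\<exists>y. fin_chain V (Suc i) y \<and> cbdry y = (\<lambda>R z. (alt_avg (comb_map i (Suc n)) w U R z - alt_avg (comb_map i n) w U R z) - homot_bdry i n w U R z)"
  using assms
proof (induction i arbitrary: U w)
  case 0
  let ?p = "comb V (Suc n) w"
  have e: "?p \<otimes> (inv ?p \<otimes> comb V n w) = comb V n w" using comb_W[OF VS] 0 by (simp flip: m_assoc)
  have "inv ?p \<otimes> comb V n w \<in> generate G V" using comb_coset[of w \<one> "Suc n" n] 0 by simp
  from fill_path[OF VS comb_W[OF VS 0(2), of "Suc n"] this] 0 e show ?case by (simp add: homot_bdry_def sph_card_0 alt_avg_empty)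
next
  case (Suc i)
  have sp: "spherical G S U" using sph_card_sph Suc.prems by blast
  have uW: "w \<otimes> u \<in> W" if "u \<in> generate G U" for u using that sph_card_W Suc.prems by simp
  have HHp: "fin_chain V (Suc i) (comb_homot i n (w \<otimes> u) (U - {s}))"
    "cbdry (comb_homot i n (w \<otimes> u) (U - {s})) = (\<lambda>R z. (alt_avg (comb_map i (Suc n)) (w \<otimes> u) (U - {s}) R z - alt_avg (comb_map i n) (w \<otimes> u) (U - {s}) R z) - homot_bdry i n (w \<otimes> u) (U - {s}) R z)"
    if su: "s \<in> U" "u \<in> generate G U" for s u
  proof -
    note g = sph_card_diff[OF Suc.prems(1) su(1)] uW[OF su(2)]
    note f = filling_at[OF comb_W[OF VS g(2)] Suc.IH[OF g], of n]
    show "fin_chain V (Suc i) (comb_homot i n (w \<otimes> u) (U - {s}))"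
      "cbdry (comb_homot i n (w \<otimes> u) (U - {s})) = (\<lambda>R z. (alt_avg (comb_map i (Suc n)) (w \<otimes> u) (U - {s}) R z - alt_avg (comb_map i n) (w \<otimes> u) (U - {s}) R z) - homot_bdry i n (w \<otimes> u) (U - {s}) R z)"
      unfolding comb_homot_eq[OF g] using f(1,2) by auto
  qed
  let ?z = "\<lambda>R z. (alt_avg (comb_map (Suc i) (Suc n)) w U R z - alt_avg (comb_map (Suc i) n) w U R z) - comp_bdry (comb_homot i n) w U R z"
  have "fin_chain V (Suc i) ?z"
    by (intro fin_chain_diff fin_chain_alt_avg[OF sp] fin_chain_comp_bdry[OF sp] HHp(1)) (use comb_map_fin_chain Suc.prems(1) uW in blast)+
  moreover have "cbdry ?z = (\<lambda>R z. 0)"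
  proof -
    have a: "cbdry (alt_avg (comb_map (Suc i) m) w U) = comp_bdry (comb_map i m) w U" for m
    proof -
      have "cbdry (alt_avg (comb_map (Suc i) m) w U) = alt_avg (comp_bdry (comb_map i m)) w U"
        by (rule cbdry_alt_avg) (use comb_map_cbdry Suc.prems(1) uW in blast)
      then show ?thesis using alt_avg_comp_bdry[OF sp Suc.prems(2)] by simp
    qed
    have hb0: "comp_bdry (homot_bdry i n) w U = (\<lambda>R z. 0)"
    proof (cases i)
      case 0
      have "homot_bdry i n = (\<lambda>w U R z. 0)" using 0 by (intro ext) (simp add: homot_bdry_def)
      then show ?thesis by (simp add: comp_bdry_zero)
    next
      case (Suc i')
      have "homot_bdry i n = comp_bdry (comb_homot i' n)" using Suc by (intro ext) (simp add: homot_bdry_def)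
      then show ?thesis using comp_bdry_comp_bdry[OF sp Suc.prems(2)] by simp
    qed
    have "cbdry (comp_bdry (comb_homot i n) w U) = comp_bdry (\<lambda>w U R z. (alt_avg (comb_map i (Suc n)) w U R z - alt_avg (comb_map i n) w U R z) - homot_bdry i n w U R z) w U"
      by (rule cbdry_comp_bdry) (rule HHp(2))
    also have "\<dots> = (\<lambda>R z. (comp_bdry (comb_map i (Suc n)) w U R z - comp_bdry (comb_map i n) w U R z) - 0)"
      unfolding comp_bdry_diff[of "\<lambda>w U R z. alt_avg (comb_map i (Suc n)) w U R z - alt_avg (comb_map i n) w U R z" "homot_bdry i n"]
        comp_bdry_diff[of "alt_avg (comb_map i (Suc n))" "alt_avg (comb_map i n)"] comp_bdry_alt_avg[OF sp Suc.prems(2)] hb0 ..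
    finally show ?thesis unfolding cbdry_diff a by simp
  qed
  ultimately show ?case using fill_exists[OF VS, of i ?z] by (simp add: homot_bdry_def)
qed

lemma comb_homot_fin_chain: "sph_card i U \<Longrightarrow> w \<in> W \<Longrightarrow> fin_chain V (Suc i) (comb_homot i n w U)"
  and comb_homot_cbdry: "sph_card i U \<Longrightarrow> w \<in> W \<Longrightarrow> cbdry (comb_homot i n w U) = (\<lambda>R z. (alt_avg (comb_map i (Suc n)) w U R z - alt_avg (comb_map i n) w U R z) - homot_bdry i n w U R z)"
  using filling_at(1,2)[OF comb_W[OF VS] comb_homot_fillable] comb_homot_eq by auto

text \<open>If all vertices of a cell sit at one point, the signed sums cancel because the signs on
  \<open>W_U\<close> add up to zero, and the zero filling carries this to higher degrees. Degree
  zero has no such cancellation, which confines the contraction to positive degrees.\<close>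

lemma comb_map_van:
  assumes "sph_card (Suc i) U" "w \<in> W" "0 < n" "\<And>u. u \<in> generate G U \<Longrightarrow> comb V n (w \<otimes> u) = comb V n w"
  shows "comb_map (Suc i) n w U = (\<lambda>R z. 0)"
  using assms
proof (induction i arbitrary: U w)
  case 0
  have sp: "spherical G S U" "U \<noteq> {}" using sph_card_sph 0 sph_card_card[OF 0(1)] by auto
  have "comp_bdry (comb_map 0 n) w U = (\<lambda>R z. 0)"
  proof (intro ext)
    fix R z
    have "(\<Sum>u\<in>generate G U. eps u * comb_map 0 n (w \<otimes> u) Q R z) = (\<Sum>u\<in>generate G U. eps u) * cell_chain (comb V n w) {} R z" for Q
      using 0(4) by (simp add: sum_distrib_right)
    then show "comp_bdry (comb_map 0 n) w U R z = 0" unfolding comp_bdry_eq[OF sp(1)] using sum_eps[OF sp] by simp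
  qed
  then show ?case using 0 filling_at_0 by simp
next
  case (Suc i)
  have "comp_bdry (comb_map (Suc i) n) w U = comp_bdry (\<lambda>w U R z. 0) w U"
  proof (rule comp_bdry_cong)
    fix s u assume su: "s \<in> U" "u \<in> generate G U"
    show "comb_map (Suc i) n (w \<otimes> u) (U - {s}) = (\<lambda>R z. 0)"
    proof (rule Suc.IH[OF sph_card_diff[OF Suc.prems(1) su(1)]])
      show "w \<otimes> u \<in> W" using su sph_card_W Suc.prems by simp
      fix v assume v: "v \<in> generate G (U - {s})"
      have vU: "v \<in> generate G U" using v par_mono[of "U - {s}" U] by auto
      have "u \<otimes> v \<in> generate G U" using su vU sph_card_S[OF Suc.prems(1)] by simp
      then show "comb V n (w \<otimes> u \<otimes> v) = comb V n (w \<otimes> u)"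
        using Suc.prems(4)[of "u \<otimes> v"] Suc.prems(4)[OF su(2)] sph_card_W[OF Suc.prems(1)] vU su Suc.prems(2) by (simp add: m_assoc)
    qed (use Suc.prems in auto)
  qed
  then show ?case using Suc.prems filling_at_0 by (simp add: comp_bdry_zero del: comb_map.simps(2)) (simp add: comb_map.simps(2)[of "Suc i"] del: comb_map.simps(2))
qed

text \<open>Once all vertices of a cell rest at a common point, both chain maps vanish there in
  positive degree and so do the lower homotopies; hence each cell needs finitely many time
  steps.\<close>

lemma comb_homot_van:
  assumes "sph_card i U" "w \<in> W" "0 < n"
    "\<And>u. u \<in> generate G U \<Longrightarrow> comb V n (w \<otimes> u) = comb V n w" "\<And>u. u \<in> generate G U \<Longrightarrow> comb V (Suc n) (w \<otimes> u) = comb V n w"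
  shows "comb_homot i n w U = (\<lambda>R z. 0)"
  using assms
proof (induction i arbitrary: U w)
  case 0
  then show ?case using 0(5)[of \<one>] filling_at_0 by simp
next
  case (Suc i)
  have uW: "w \<otimes> u \<in> W" if "u \<in> generate G U" for u using that sph_card_W Suc.prems by simp
  have c: "comb V m (w \<otimes> u \<otimes> v) = comb V n w" if "u \<in> generate G U" "v \<in> generate G U" "m = n \<or> m = Suc n" for m u v
  proof -
    have "u \<otimes> v \<in> generate G U" using that sph_card_S[OF Suc.prems(1)] by simp
    then show ?thesis using Suc.prems(4)[of "u \<otimes> v"] Suc.prems(5)[of "u \<otimes> v"] that sph_card_W[OF Suc.prems(1)] Suc.prems(2)
      by (auto simp: m_assoc)
  qed
  have F: "comb_map (Suc i) m (w \<otimes> u) U = (\<lambda>R z. 0)" if "u \<in> generate G U" "m = n \<or> m = Suc n" for m u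
  proof (rule comb_map_van[OF Suc.prems(1) uW[OF that(1)]])
    fix v assume "v \<in> generate G U"
    then show "comb V m (w \<otimes> u \<otimes> v) = comb V m (w \<otimes> u)"
      using c[OF that(1) _ that(2)] Suc.prems(4,5) that by auto
  qed (use Suc.prems that in auto)
  have A: "alt_avg (comb_map (Suc i) m) w U = (\<lambda>R z. 0)" if "m = n \<or> m = Suc n" for m
    using alt_avg_cong[of U "comb_map (Suc i) m" w "\<lambda>w U R z. 0"] F that by (simp add: alt_avg_zero del: comb_map.simps)
  have "comp_bdry (comb_homot i n) w U = comp_bdry (\<lambda>w U R z. 0) w U"
  proof (rule comp_bdry_cong)
    fix s u assume su: "s \<in> U" "u \<in> generate G U"
    have sub: "v \<in> generate G U" if "v \<in> generate G (U - {s})" for v using that par_mono[of "U - {s}" U] by auto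
    show "comb_homot i n (w \<otimes> u) (U - {s}) = (\<lambda>R z. 0)"
      by (rule Suc.IH[OF sph_card_diff[OF Suc.prems(1) su(1)] uW[OF su(2)] Suc.prems(3)])
        (use c[OF su(2) sub] Suc.prems(4)[OF su(2)] in auto)
  qed
  then show ?case using A filling_at_0 by (simp add: comp_bdry_zero del: comb_map.simps)
qed

subsection \<open>Uniform locality\<close>

lemma sph_len_bound: "\<exists>L. \<forall>U u. U \<subseteq> S \<longrightarrow> spherical G S U \<longrightarrow> u \<in> generate G U \<longrightarrow> len u \<le> L"
proof -
  have "finite (\<Union>U\<in>{U. U \<subseteq> S \<and> spherical G S U}. generate G U)"
    using finS by (intro finite_UN_I) (auto simp: spherical_def)
  then have "finite (len ` (\<Union>U\<in>{U. U \<subseteq> S \<and> spherical G S U}. generate G U))" by simp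
  then obtain L where "\<And>n. n \<in> len ` (\<Union>U\<in>{U. U \<subseteq> S \<and> spherical G S U}. generate G U) \<Longrightarrow> n \<le> L"
    by (meson finite_nat_set_iff_bounded_le)
  then show ?thesis by (intro exI[of _ L]) blast
qed

definition sph_len_max :: nat where "sph_len_max = (SOME L. \<forall>U u. U \<subseteq> S \<longrightarrow> spherical G S U \<longrightarrow> u \<in> generate G U \<longrightarrow> len u \<le> L)"

lemma sph_len_max: "sph_card i U \<Longrightarrow> u \<in> generate G U \<Longrightarrow> len u \<le> sph_len_max"
  using someI_ex[OF sph_len_bound] sph_card_S sph_card_sph unfolding sph_len_max_def by blast

lemma near_len: "\<exists>M. \<forall>g\<in>near. len g \<le> M"
  using finite_near by (meson finite_imageI finite_nat_set_iff_bounded_le image_eqI)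

text \<open>An element of \<open>W_U\<close> is a word of at most \<open>sph_len_max\<close> letters
  from \<open>V\<close>, and each letter moves the combing point by an element of
  \<open>near\<close>; so does one step of time.\<close>

lemma comb_move: "\<exists>M. \<forall>n w i U u. w \<in> W \<longrightarrow> sph_card i U \<longrightarrow> u \<in> generate G U \<longrightarrow>
   len (inv (comb V n w) \<otimes> comb V n (w \<otimes> u)) \<le> M \<and> len (inv (comb V n w) \<otimes> comb V (Suc n) (w \<otimes> u)) \<le> M"
proof -
  obtain M where M: "\<And>g. g \<in> near \<Longrightarrow> len g \<le> M" using near_len by blast
  have tri: "len (inv a \<otimes> c) \<le> len (inv a \<otimes> b) + len (inv b \<otimes> c)" if "a \<in> W" "b \<in> W" "c \<in> W" for a b c
  proof -
    have "inv a \<otimes> c = (inv a \<otimes> b) \<otimes> (inv b \<otimes> c)" using that by (simp add: m_assoc) (simp flip: m_assoc)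
    then show ?thesis using len_mult_le[of "inv a \<otimes> b" "inv b \<otimes> c"] that by simp
  qed
  have *: "len (inv (comb V n w) \<otimes> comb V n (w \<otimes> wp a)) \<le> M * length a" if w: "w \<in> W" and a: "set a \<subseteq> V" for n w a
    using a
  proof (induction a rule: rev_induct)
    case Nil then show ?case using w comb_W[OF VS w] by simp
  next
    case (snoc s a)
    have S: "s \<in> V" "s \<in> S" "set a \<subseteq> S" "set a \<subseteq> V" using snoc.prems VS by auto
    have aW: "w \<otimes> wp a \<in> W" "w \<otimes> wp a \<otimes> s \<in> W" using w S by auto
    have "len (inv (comb V n (w \<otimes> wp a)) \<otimes> comb V n (w \<otimes> wp a \<otimes> s)) \<le> M" using M[OF comb_near[OF VS aW(1) S(1)]] .
    then show ?case using tri[of "comb V n w" "comb V n (w \<otimes> wp a)" "comb V n (w \<otimes> wp a \<otimes> s)"]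
        comb_W[OF VS w] comb_W[OF VS aW(1)] comb_W[OF VS aW(2)] snoc.IH S w by (simp add: m_assoc)
  qed
  have "len (inv (comb V n w) \<otimes> comb V n (w \<otimes> u)) \<le> M * sph_len_max + M \<and> len (inv (comb V n w) \<otimes> comb V (Suc n) (w \<otimes> u)) \<le> M * sph_len_max + M"
    if h: "w \<in> W" "sph_card i U" "u \<in> generate G U" for n w i U u
  proof -
    obtain a where a: "set a \<subseteq> U" "length a = len u" "wp a = u" using par_word[OF sph_card_S[OF h(2)] h(3)] .
    have aV: "set a \<subseteq> V" using a sph_card_V[OF h(2)] by auto
    have uW: "w \<otimes> u \<in> W" using h sph_card_W by simp
    have "M * length a \<le> M * sph_len_max" using sph_len_max[OF h(2,3)] a(2) by (intro mult_le_mono2) simp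
    then have 1: "len (inv (comb V n w) \<otimes> comb V n (w \<otimes> u)) \<le> M * sph_len_max" using order_trans[OF *[OF h(1) aV, of n]] a(3) by simp
    have "len (inv (comb V n (w \<otimes> u)) \<otimes> comb V (Suc n) (w \<otimes> u)) \<le> M" using M[OF comb_Suc_near[OF VS uW]] .
    then show ?thesis using 1 tri[of "comb V n w" "comb V n (w \<otimes> u)" "comb V (Suc n) (w \<otimes> u)"] comb_W[OF VS h(1)] comb_W[OF VS uW] by simp
  qed
  then show ?thesis by blast
qed

text \<open>The base point is the current combing point and not \<open>w\<close>, since the path
  leads arbitrarily far away from \<open>w\<close>.\<close>

definition unif_local :: "nat \<Rightarrow> (nat \<Rightarrow> 'a \<Rightarrow> 'a set \<Rightarrow> 'a chain) \<Rightarrow> bool" where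
  "unif_local i D \<longleftrightarrow> (\<exists>X. finite X \<and> (\<forall>n w U. w \<in> W \<longrightarrow> sph_card i U \<longrightarrow> translate (inv (comb V n w)) (D n w U) \<in> X))"

lemma locI: "finite X \<Longrightarrow> (\<And>n w U. w \<in> W \<Longrightarrow> sph_card i U \<Longrightarrow> translate (inv (comb V n w)) (D n w U) \<in> X) \<Longrightarrow> unif_local i D"
  unfolding unif_local_def by (intro exI[of _ X]) simp

lemma locE: assumes "unif_local i D"
  obtains X where "finite X" "\<forall>n w U. w \<in> W \<longrightarrow> sph_card i U \<longrightarrow> translate (inv (comb V n w)) (D n w U) \<in> X"
  using assms unfolding unif_local_def by (elim exE conjE) (rule that)

lemma translate_change: "p \<in> W \<Longrightarrow> p' \<in> W \<Longrightarrow> translate (inv p) x = translate (inv p \<otimes> p') (translate (inv p') x)"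
  by (simp add: translate_translate m_assoc)

text \<open>Changing the base point multiplies by an element of bounded length, by
  \<open>comb_move\<close>, and balls are finite.\<close>

lemma unif_local_move:
  assumes "unif_local i D"
  obtains Y where "finite Y" "\<forall>n m w k U u Q. w \<in> W \<longrightarrow> sph_card k U \<longrightarrow> u \<in> generate G U \<longrightarrow> sph_card i Q \<longrightarrow>
      m = n \<or> m = Suc n \<longrightarrow> translate (inv (comb V n w)) (D m (w \<otimes> u) Q) \<in> Y"
proof -
  obtain X where X: "finite X" "\<forall>n w U. w \<in> W \<longrightarrow> sph_card i U \<longrightarrow> translate (inv (comb V n w)) (D n w U) \<in> X"
    by (rule locE[OF assms])
  obtain M where M: "\<And>n w i U u. w \<in> W \<Longrightarrow> sph_card i U \<Longrightarrow> u \<in> generate G U \<Longrightarrow>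
     len (inv (comb V n w) \<otimes> comb V n (w \<otimes> u)) \<le> M \<and> len (inv (comb V n w) \<otimes> comb V (Suc n) (w \<otimes> u)) \<le> M"
    using comb_move by blast
  define Y where "Y = (\<lambda>(g, x). translate g x) ` ({g \<in> W. len g \<le> M} \<times> X)"
  have "finite Y" unfolding Y_def using finite_ball X(1) by simp
  moreover have "translate (inv (comb V n w)) (D m (w \<otimes> u) Q) \<in> Y"
    if h: "w \<in> W" "sph_card k U" "u \<in> generate G U" "sph_card i Q" "m = n \<or> m = Suc n" for n m w k U u Q
  proof -
    have uW: "w \<otimes> u \<in> W" using h sph_card_W by simp
    let ?p = "comb V n w" and ?p' = "comb V m (w \<otimes> u)"
    have pW: "?p \<in> W" "?p' \<in> W" using comb_W[OF VS] h uW by auto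
    have "len (inv ?p \<otimes> ?p') \<le> M" using M[OF h(1-3), of n] h(5) by auto
    moreover have "translate (inv ?p') (D m (w \<otimes> u) Q) \<in> X" using X(2)[rule_format, OF uW h(4)] .
    ultimately show ?thesis unfolding translate_change[OF pW] Y_def using pW
      by (intro image_eqI[of _ _ "(inv ?p \<otimes> ?p', translate (inv ?p') (D m (w \<otimes> u) Q))"]) auto
  qed
  ultimately show thesis by (intro that allI impI) auto
qed

lemma unif_local_comp_bdry:
  assumes "unif_local i D"
  obtains X where "finite X" "\<forall>n w U. w \<in> W \<longrightarrow> sph_card (Suc i) U \<longrightarrow> translate (inv (comb V n w)) (comp_bdry (D n) w U) \<in> X"
proof -
  obtain Y where Y: "finite Y" "\<forall>n m w k U u Q. w \<in> W \<longrightarrow> sph_card k U \<longrightarrow> u \<in> generate G U \<longrightarrow> sph_card i Q \<longrightarrow>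
      m = n \<or> m = Suc n \<longrightarrow> translate (inv (comb V n w)) (D m (w \<otimes> u) Q) \<in> Y" by (rule unif_local_move[OF assms])
  let ?c = "\<lambda>U p. inc_sign (fst p) (U - {fst p}) * eps (snd p) / par_card (U - {fst p})"
  let ?X = "{(\<lambda>R z. \<Sum>p\<in>U \<times> generate G U. ?c U p * \<phi> p R z) | U \<phi>. U \<in> {U. sph_card (Suc i) U} \<and> (\<forall>p\<in>U \<times> generate G U. \<phi> p \<in> Y)}"
  have "finite ?X"
    using fin_comb[where K = "{U. sph_card (Suc i) U}" and I = "\<lambda>U. U \<times> generate G U" and Y = Y and c = ?c] finite_sph_card sph_fin sph_card_sph Y(1) by auto
  moreover have "translate (inv (comb V n w)) (comp_bdry (D n) w U) \<in> ?X" if h: "w \<in> W" "sph_card (Suc i) U" for n w U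
  proof -
    have "translate (inv (comb V n w)) (comp_bdry (D n) w U) = (\<lambda>R z. \<Sum>p\<in>U \<times> generate G U. ?c U p * translate (inv (comb V n w)) (D n (w \<otimes> snd p) (U - {fst p})) R z)"
      unfolding comp_bdry_def case_prod_unfold by (rule translate_sum)
    moreover have "\<forall>p\<in>U \<times> generate G U. translate (inv (comb V n w)) (D n (w \<otimes> snd p) (U - {fst p})) \<in> Y"
      using Y(2)[rule_format, OF h(1,2)] sph_card_diff[OF h(2)] by auto
    ultimately show ?thesis using h(2)
      by (intro CollectI exI[of _ U] exI[of _ "\<lambda>p. translate (inv (comb V n w)) (D n (w \<otimes> snd p) (U - {fst p}))"]) auto
  qed
  ultimately show thesis by (intro that allI impI) auto
qed

lemma unif_local_alt_avg:
  assumes "unif_local i D"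
  obtains X where "finite X" "\<forall>n m w U. w \<in> W \<longrightarrow> sph_card i U \<longrightarrow> m = n \<or> m = Suc n \<longrightarrow>
     translate (inv (comb V n w)) (alt_avg (D m) w U) \<in> X"
proof -
  obtain Y where Y: "finite Y" "\<forall>n m w k U u Q. w \<in> W \<longrightarrow> sph_card k U \<longrightarrow> u \<in> generate G U \<longrightarrow> sph_card i Q \<longrightarrow>
      m = n \<or> m = Suc n \<longrightarrow> translate (inv (comb V n w)) (D m (w \<otimes> u) Q) \<in> Y" by (rule unif_local_move[OF assms])
  let ?c = "\<lambda>U u. eps u / par_card U"
  let ?X = "{(\<lambda>R z. \<Sum>u\<in>generate G U. ?c U u * \<phi> u R z) | U \<phi>. U \<in> {U. sph_card i U} \<and> (\<forall>u\<in>generate G U. \<phi> u \<in> Y)}"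
  have "finite ?X"
    using fin_comb[where K = "{U. sph_card i U}" and I = "\<lambda>U. generate G U" and Y = Y and c = ?c] finite_sph_card sph_fin sph_card_sph Y(1) by auto
  moreover have "translate (inv (comb V n w)) (alt_avg (D m) w U) \<in> ?X" if h: "w \<in> W" "sph_card i U" "m = n \<or> m = Suc n" for n m w U
  proof -
    have "translate (inv (comb V n w)) (alt_avg (D m) w U) = (\<lambda>R z. \<Sum>u\<in>generate G U. ?c U u * translate (inv (comb V n w)) (D m (w \<otimes> u) U) R z)"
      unfolding alt_avg_def by (rule translate_sum)
    moreover have "\<forall>u\<in>generate G U. translate (inv (comb V n w)) (D m (w \<otimes> u) U) \<in> Y"
      using Y(2)[rule_format, OF h(1,2)] h(2,3) by auto
    ultimately show ?thesis using h(2)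
      by (intro CollectI exI[of _ U] exI[of _ "\<lambda>u. translate (inv (comb V n w)) (D m (w \<otimes> u) U)"]) auto
  qed
  ultimately show thesis by (intro that allI impI) auto
qed

text \<open>The translated boundaries form a finite set by the degree below, and the translated
  filling depends on the translated boundary alone.\<close>

lemma unif_local_comb_map: "unif_local i (comb_map i)"
proof (induction i)
  case 0
  have "translate (inv (comb V n w)) (cell_chain (comb V n w) {}) = cell_chain \<one> {}" if "w \<in> W" for n w
    using translate_cell_chain[of "inv (comb V n w)" "comb V n w"] comb_W[OF VS that] by simp
  then show ?case by (intro locI[of "{cell_chain \<one> {}}"]) simp_all
next
  case (Suc i)
  obtain X where X: "finite X" "\<forall>n w U. w \<in> W \<longrightarrow> sph_card (Suc i) U \<longrightarrow> translate (inv (comb V n w)) (comp_bdry (comb_map i n) w U) \<in> X"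
    by (rule unif_local_comp_bdry[OF Suc])
  have "translate (inv (comb V n w)) (comb_map (Suc i) n w U) \<in> filling i ` X \<union> cell_chain \<one> ` {U. sph_card (Suc i) U}" if h: "w \<in> W" "sph_card (Suc i) U" for n w U
  proof (cases "n = 0")
    case True
    then show ?thesis using translate_cell_chain[of "inv w" w U] h comb_0[OF VS h(1)] by simp
  next
    case False
    then show ?thesis
      using filling_at(3)[OF comb_W[OF VS h(1)] comb_map_fillable[OF h(2,1)], of n n] X(2)[rule_format, OF h, of n] by simp
  qed
  moreover have "finite (filling i ` X \<union> cell_chain \<one> ` {U. sph_card (Suc i) U})" using X(1) finite_sph_card by simp
  ultimately show ?case by (intro locI)
qed

lemma unif_local_comb_homot: "unif_local i (comb_homot i)"
proof (induction i)
  case 0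
  let ?X = "(\<lambda>g R z. cell_chain g {} R z - cell_chain \<one> {} R z) ` near"
  have "translate (inv (comb V n w)) (comb_homot 0 n w U) \<in> filling 0 ` ?X" if h: "w \<in> W" "sph_card 0 U" for n w U
  proof -
    let ?p = "comb V n w" and ?p' = "comb V (Suc n) w"
    have pW: "?p \<in> W" "?p' \<in> W" using comb_W[OF VS h(1)] by auto
    have "translate (inv ?p) (\<lambda>R z. cell_chain ?p' {} R z - cell_chain ?p {} R z) = (\<lambda>R z. cell_chain (inv ?p \<otimes> ?p') {} R z - cell_chain \<one> {} R z)"
      unfolding translate_diff using translate_cell_chain[of "inv ?p" ?p'] translate_cell_chain[of "inv ?p" ?p] pW by simp
    moreover have "\<exists>y. fin_chain V (Suc 0) y \<and> cbdry y = (\<lambda>R z. cell_chain ?p' {} R z - cell_chain ?p {} R z)"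
      using comb_homot_fillable[OF h(2,1), of n] h by (simp add: homot_bdry_def sph_card_0 alt_avg_empty)
    ultimately show ?thesis using filling_at(3)[OF pW(1)] comb_Suc_near[OF VS h(1), of n] by auto
  qed
  moreover have "finite (filling 0 ` ?X)" using finite_near by simp
  ultimately show ?case by (intro locI)
next
  case (Suc i)
  obtain X where X: "finite X" "\<forall>n w U. w \<in> W \<longrightarrow> sph_card (Suc i) U \<longrightarrow> translate (inv (comb V n w)) (comp_bdry (comb_homot i n) w U) \<in> X"
    by (rule unif_local_comp_bdry[OF Suc])
  obtain Z where Z: "finite Z" "\<forall>n m w U. w \<in> W \<longrightarrow> sph_card (Suc i) U \<longrightarrow> m = n \<or> m = Suc n \<longrightarrow>
     translate (inv (comb V n w)) (alt_avg (comb_map (Suc i) m) w U) \<in> Z"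
    by (rule unif_local_alt_avg[OF unif_local_comb_map[of "Suc i"]])
  let ?X = "(\<lambda>(a, b, c) R z. (a R z - b R z) - c R z) ` (Z \<times> Z \<times> X)"
  have "translate (inv (comb V n w)) (comb_homot (Suc i) n w U) \<in> filling (Suc i) ` ?X" if h: "w \<in> W" "sph_card (Suc i) U" for n w U
  proof -
    let ?p = "comb V n w"
    let ?z = "\<lambda>R z. (alt_avg (comb_map (Suc i) (Suc n)) w U R z - alt_avg (comb_map (Suc i) n) w U R z) - comp_bdry (comb_homot i n) w U R z"
    have "translate (inv ?p) ?z = (\<lambda>R z. (translate (inv ?p) (alt_avg (comb_map (Suc i) (Suc n)) w U) R z - translate (inv ?p) (alt_avg (comb_map (Suc i) n) w U) R z) - translate (inv ?p) (comp_bdry (comb_homot i n) w U) R z)"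
      unfolding translate_diff ..
    also have "\<dots> \<in> ?X" using X(2)[rule_format, OF h, of n] Z(2)[rule_format, OF h, of n n] Z(2)[rule_format, OF h, of "Suc n" n]
      by (intro image_eqI[of _ _ "(translate (inv ?p) (alt_avg (comb_map (Suc i) (Suc n)) w U), translate (inv ?p) (alt_avg (comb_map (Suc i) n) w U), translate (inv ?p) (comp_bdry (comb_homot i n) w U))"]) auto
    finally have m: "translate (inv ?p) ?z \<in> ?X" .
    have e: "\<exists>y. fin_chain V (Suc (Suc i)) y \<and> cbdry y = ?z" using comb_homot_fillable[OF h(2,1), of n] by (simp add: homot_bdry_def)
    have "translate (inv ?p) (comb_homot (Suc i) n w U) = filling (Suc i) (translate (inv ?p) ?z)"
      using filling_at(3)[OF comb_W[OF VS h(1)] e] by simp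
    then show ?thesis using m by blast
  qed
  moreover have "finite (filling (Suc i) ` ?X)" using X(1) Z(1) by simp
  ultimately show ?case by (intro locI)
qed

text \<open>Finitely many finitely supported patterns have a common bound for their coefficients and
  for the radius of their supports, independent of time.\<close>

lemma comb_homot_bound: "\<exists>C M. \<forall>n w U R z. w \<in> W \<longrightarrow> sph_card i U \<longrightarrow> comb_homot i n w U R z \<noteq> 0 \<longrightarrow>
    \<bar>comb_homot i n w U R z\<bar> \<le> C \<and> len (inv (comb V n w) \<otimes> z) \<le> M"
proof -
  obtain X where X: "finite X" "\<forall>n w U. w \<in> W \<longrightarrow> sph_card i U \<longrightarrow> translate (inv (comb V n w)) (comb_homot i n w U) \<in> X"
    by (rule locE[OF unif_local_comb_homot[of i]])
  define Y where "Y = (\<Union>x\<in>{x \<in> X. fin_chain V (Suc i) x}. (\<lambda>p. (x, p)) ` chain_supp x)"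
  have fY: "finite Y" unfolding Y_def using X(1) by (auto simp: fin_chain_def)
  obtain M where M: "\<And>y. y \<in> Y \<Longrightarrow> len (snd (snd y)) \<le> M"
    using finite_imageI[OF fY, of "\<lambda>y. len (snd (snd y))"] by (meson finite_nat_set_iff_bounded_le image_eqI)
  define C where "C = (\<Sum>y\<in>Y. \<bar>fst y (fst (snd y)) (snd (snd y))\<bar>)"
  have C: "\<bar>fst y (fst (snd y)) (snd (snd y))\<bar> \<le> C" if "y \<in> Y" for y
    unfolding C_def using fY that by (intro member_le_sum) auto
  have "\<bar>comb_homot i n w U R z\<bar> \<le> C \<and> len (inv (comb V n w) \<otimes> z) \<le> M"
    if h: "w \<in> W" "sph_card i U" "comb_homot i n w U R z \<noteq> 0" for n w U R z
  proof -
    let ?p = "comb V n w"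
    let ?x = "translate (inv ?p) (comb_homot i n w U)"
    have pW: "?p \<in> W" using comb_W[OF VS h(1)] .
    have zW: "z \<in> W" using fin_chain_W[OF comb_homot_fin_chain[OF h(2,1)] h(3)] .
    have e: "?x R (inv ?p \<otimes> z) = comb_homot i n w U R z" using pW zW by (simp add: translate_def flip: m_assoc)
    have "fin_chain V (Suc i) ?x" using fin_chain_translate[OF comb_homot_fin_chain[OF h(2,1)]] pW by simp
    then have "(?x, R, inv ?p \<otimes> z) \<in> Y" using X(2)[rule_format, OF h(1,2), of n] e h(3) unfolding Y_def by (auto simp: chain_supp_def)
    from M[OF this] C[OF this] e show ?thesis by simp
  qed
  then show ?thesis by blast
qed

end

end

section \<open>Weighted square-summable chains\<close>

lemma summable_on_nonnegI:
  fixes f :: "'b \<Rightarrow> real"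
  assumes "\<And>x. x \<in> A \<Longrightarrow> 0 \<le> f x" "\<And>F. finite F \<Longrightarrow> F \<subseteq> A \<Longrightarrow> sum f F \<le> b"
  shows "f summable_on A"
  by (rule nonneg_bdd_above_summable_on) (use assms in \<open>auto intro!: bdd_aboveI[of _ b]\<close>)

lemma finite_sum_summable:
  fixes f :: "'i \<Rightarrow> 'b \<Rightarrow> real"
  assumes "finite I" "\<And>i. i \<in> I \<Longrightarrow> f i summable_on A"
  shows "(\<lambda>x. \<Sum>i\<in>I. f i x) summable_on A" "infsum (\<lambda>x. \<Sum>i\<in>I. f i x) A = (\<Sum>i\<in>I. infsum (f i) A)"
proof -
  have "(\<lambda>x. \<Sum>i\<in>I. f i x) summable_on A \<and> infsum (\<lambda>x. \<Sum>i\<in>I. f i x) A = (\<Sum>i\<in>I. infsum (f i) A)"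
    using assms by (induction I rule: finite_induct) (auto intro: summable_on_add simp: infsum_add)
  then show "(\<lambda>x. \<Sum>i\<in>I. f i x) summable_on A" "infsum (\<lambda>x. \<Sum>i\<in>I. f i x) A = (\<Sum>i\<in>I. infsum (f i) A)" by auto
qed

lemma sum_sq_le: fixes a :: "'b \<Rightarrow> real" shows "(\<Sum>i\<in>I. a i)\<^sup>2 \<le> real (card I) * (\<Sum>i\<in>I. (a i)\<^sup>2)"
  using Cauchy_Schwarz_ineq_sum[of a "\<lambda>_. 1" I] by (simp add: mult.commute)

context cox
begin

text \<open>The weight is the reciprocal of \<open>qw\<close> because \<open>group_chain\<close>
  multiplies cellular chains by the weight; \<open>l2_group_chain\<close> and
  \<open>group_chain_l2\<close> compare the two conditions.\<close>

definition wgt_l2 :: "('a \<Rightarrow> real) \<Rightarrow> ('a \<Rightarrow> real) \<Rightarrow> bool" where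
  "wgt_l2 q f \<longleftrightarrow> (\<lambda>w. (f w)\<^sup>2 / qw G S q w) summable_on W"

lemma wgt_l2_le:
  assumes q: "multiparameter G S q" and "wgt_l2 q f" "\<And>w. w \<in> W \<Longrightarrow> \<bar>g w\<bar> \<le> \<bar>f w\<bar>" shows "wgt_l2 q g"
  unfolding wgt_l2_def
proof (rule summable_on_comparison_test[OF assms(2)[unfolded wgt_l2_def]])
  fix w assume w: "w \<in> W"
  have "(g w)\<^sup>2 \<le> (f w)\<^sup>2" using assms(3)[OF w] by (simp add: abs_le_square_iff)
  then show "(g w)\<^sup>2 / qw G S q w \<le> (f w)\<^sup>2 / qw G S q w" using qw_pos[OF q w] by (simp add: divide_right_mono)
  show "0 \<le> (g w)\<^sup>2 / qw G S q w" using qw_pos[OF q w] by simp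
qed

lemma wgt_l2_sum:
  assumes q: "multiparameter G S q" and I: "finite I" "\<And>i. i \<in> I \<Longrightarrow> wgt_l2 q (f i)"
  shows "wgt_l2 q (\<lambda>w. \<Sum>i\<in>I. c i * f i w)"
  unfolding wgt_l2_def
proof (rule summable_on_comparison_test)
  show "(\<lambda>w. real (card I) * (\<Sum>i\<in>I. (c i)\<^sup>2 * ((f i w)\<^sup>2 / qw G S q w))) summable_on W"
    using I by (intro summable_on_cmult_right finite_sum_summable) (auto simp: wgt_l2_def)
  fix w assume w: "w \<in> W"
  have "(\<Sum>i\<in>I. c i * f i w)\<^sup>2 / qw G S q w \<le> real (card I) * (\<Sum>i\<in>I. (c i * f i w)\<^sup>2) / qw G S q w"
    using sum_sq_le[of "\<lambda>i. c i * f i w" I] qw_pos[OF q w] by (simp add: divide_right_mono)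
  then show "(\<Sum>i\<in>I. c i * f i w)\<^sup>2 / qw G S q w \<le> real (card I) * (\<Sum>i\<in>I. (c i)\<^sup>2 * ((f i w)\<^sup>2 / qw G S q w))"
    by (simp add: power_mult_distrib flip: sum_divide_distrib)
  show "0 \<le> (\<Sum>i\<in>I. c i * f i w)\<^sup>2 / qw G S q w" using qw_pos[OF q w] by simp
qed

text \<open>One generator changes the weight by a factor \<open>q s\<close> or
  \<open>1 / q s\<close>, and the generators are finitely many.\<close>

lemma qw_ratio:
  assumes q: "multiparameter G S q"
  shows "\<exists>\<kappa>\<ge>0. \<forall>z\<in>W. \<forall>g\<in>W. len g \<le> M \<longrightarrow> qw G S q (z \<otimes> g) \<le> \<kappa> * qw G S q z"
proof -
  define b where "b = (\<Sum>s\<in>S. q s + 1 / q s)"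
  have qp: "0 < q s" if "s \<in> S" for s using q that by (simp add: multiparameter_def)
  have b0: "0 \<le> b" unfolding b_def by (rule sum_nonneg) (use qp in \<open>force simp: less_imp_le\<close>)
  have bs: "q s + 1 / q s \<le> b" if "s \<in> S" for s
    unfolding b_def using that finS qp by (intro member_le_sum) (auto simp: less_imp_le intro!: add_nonneg_nonneg)
  have step: "qw G S q (z \<otimes> s) \<le> b * qw G S q z" if z: "z \<in> W" and s: "s \<in> S" for z s
  proof -
    have sW: "s \<in> W" using s S_carrier by blast
    note p = qw_pos[OF q z] qp[OF s]
    consider "len z < len (z \<otimes> s)" | "len (z \<otimes> s) < len z" using len_mult_S[OF z s] by linarith
    then have "qw G S q (z \<otimes> s) = qw G S q z * q s \<or> qw G S q (z \<otimes> s) = qw G S q z * (1 / q s)"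
    proof cases
      case 1 then show ?thesis using qw_up[OF q z s] by simp
    next
      case 2
      have e: "z \<otimes> s \<otimes> s = z" using z sW S_involution[OF s] by (simp add: m_assoc)
      have "qw G S q (z \<otimes> s \<otimes> s) = qw G S q (z \<otimes> s) * q s" by (rule qw_up[OF q]) (use 2 z s sW e in auto)
      then show ?thesis using p unfolding e by (simp add: field_simps)
    qed
    moreover have "q s \<le> b" "1 / q s \<le> b" using bs[OF s] p by (auto intro: order_trans[rotated])
    ultimately obtain c where "c \<le> b" "qw G S q (z \<otimes> s) = qw G S q z * c" by blast
    then show ?thesis using p(1) by (simp add: mult.commute mult_left_mono)
  qed
  have wb: "qw G S q (z \<otimes> wp a) \<le> b ^ length a * qw G S q z" if "set a \<subseteq> S" "z \<in> W" for z a
    using that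
  proof (induction a arbitrary: z)
    case (Cons s a)
    have sW: "s \<in> W" "wp a \<in> W" using Cons.prems S_carrier by auto
    have "qw G S q (z \<otimes> wp (s # a)) = qw G S q (z \<otimes> s \<otimes> wp a)" using Cons.prems sW by (simp add: m_assoc)
    also have "\<dots> \<le> b ^ length a * qw G S q (z \<otimes> s)" using Cons.prems sW by (intro Cons.IH) auto
    also have "\<dots> \<le> b ^ length a * (b * qw G S q z)" using Cons.prems b0 by (intro mult_left_mono step) auto
    finally show ?case by (simp add: mult_ac)
  qed simp
  have bp: "b ^ n \<le> (1 + b) ^ M" if "n \<le> M" for n
  proof -
    have "b ^ n \<le> (1 + b) ^ n" using b0 by (intro power_mono) auto
    also have "\<dots> \<le> (1 + b) ^ M" using that b0 by (intro power_increasing) auto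
    finally show ?thesis .
  qed
  have "qw G S q (z \<otimes> g) \<le> (1 + b) ^ M * qw G S q z" if z: "z \<in> W" and g: "g \<in> W" and M: "len g \<le> M" for z g
  proof -
    obtain a where a: "set a \<subseteq> S" "length a = len g" "wp a = g" using len_word[OF g] by metis
    have "qw G S q (z \<otimes> g) \<le> b ^ length a * qw G S q z" using wb[OF a(1) z] a(3) by simp
    also have "\<dots> \<le> (1 + b) ^ M * qw G S q z" using bp[of "length a"] a M qw_pos[OF q z] by (intro mult_right_mono) auto
    finally show ?thesis .
  qed
  then show ?thesis using b0 by (intro exI[of _ "(1 + b) ^ M"]) auto
qed

context
  fixes V :: "'a set" and q :: "'a \<Rightarrow> real"
  assumes VS: "V \<subseteq> S" and q: "multiparameter G S q" and sm: "qw G S q summable_on generate G V"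
begin

abbreviation mu :: "'a \<Rightarrow> real" where "mu \<equiv> qw G S q"

lemma mu_pos: "w \<in> W \<Longrightarrow> 0 < mu w" by (rule qw_pos[OF q])

text \<open>Cut a reduced word after \<open>m\<close> letters: the element is recovered from its two
  parts, and the weight is multiplicative on them.\<close>

lemma sphere_submult:
  defines "B n \<equiv> {u \<in> generate G V. len u = n}"
  shows "sum mu (B (m + n)) \<le> sum mu (B m) * sum mu (B n)"
proof -
  have BW: "B k \<subseteq> W" for k using VS by (auto simp: B_def)
  have fB: "finite (B k)" for k by (rule finite_subset[OF _ finite_ball[of k]]) (use VS in \<open>auto simp: B_def\<close>)
  have "\<exists>p. fst p \<in> B m \<and> snd p \<in> B n \<and> fst p \<otimes> snd p = u \<and> mu u = mu (fst p) * mu (snd p)" if u: "u \<in> B (m + n)" for u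
  proof -
    obtain a where a: "set a \<subseteq> V" "length a = len u" "wp a = u" using par_word[OF VS, of u] u by (auto simp: B_def)
    let ?a = "take m a" and ?b = "drop m a"
    have cl: "set ?a \<subseteq> V" "set ?b \<subseteq> V" using a by (auto dest: in_set_takeD in_set_dropD)
    then have S: "set ?a \<subseteq> S" "set ?b \<subseteq> S" using VS by auto
    have l: "length ?a = m" "length ?b = n" using a u by (auto simp: B_def)
    have red: "len (wp (?a @ ?b)) = length (?a @ ?b)" using a by simp
    have "len (wp ?a) = m" "len (wp ?b) = n" using reduced_take[OF _ red] S l a VS by auto
    moreover have g: "wp ?a \<in> generate G V" "wp ?b \<in> generate G V" unfolding generate_words[OF VS] using cl by auto
    moreover have e: "wp ?a \<otimes> wp ?b = u" unfolding wp_append[OF S, symmetric] using a(3) by simp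
    moreover have "mu u = mu (wp ?a) * mu (wp ?b)"
      using qw_mult[OF q, of "wp ?a" "wp ?b"] par_mem[OF VS g(1)] par_mem[OF VS g(2)] u calculation(1,2) unfolding e by (auto simp: B_def)
    ultimately have "wp ?a \<in> B m" "wp ?b \<in> B n" "wp ?a \<otimes> wp ?b = u" "mu u = mu (wp ?a) * mu (wp ?b)"
      by (auto simp: B_def)
    then show ?thesis by (intro exI[of _ "(wp ?a, wp ?b)"]) simp
  qed
  then obtain g where g: "\<And>u. u \<in> B (m + n) \<Longrightarrow> fst (g u) \<in> B m \<and> snd (g u) \<in> B n \<and> fst (g u) \<otimes> snd (g u) = u \<and> mu u = mu (fst (g u)) * mu (snd (g u))"
    by metis
  have "inj_on g (B (m + n))" by (rule inj_onI) (metis g)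
  then have "sum mu (B (m + n)) = (\<Sum>p\<in>g ` B (m + n). mu (fst p) * mu (snd p))"
    using g by (simp add: sum.reindex)
  also have "\<dots> \<le> (\<Sum>p\<in>B m \<times> B n. mu (fst p) * mu (snd p))"
  proof (rule sum_mono2)
    show "finite (B m \<times> B n)" using fB by simp
    show "g ` B (m + n) \<subseteq> B m \<times> B n" 
    proof (rule image_subsetI)
      show "g u \<in> B m \<times> B n" if "u \<in> B (m + n)" for u using g[OF that] by (simp add: mem_Times_iff)
    qed
    fix p assume "p \<in> B m \<times> B n - g ` B (m + n)"
    then have "fst p \<in> W" "snd p \<in> W" using subsetD[OF BW] by auto
    then show "0 \<le> mu (fst p) * mu (snd p)" using mu_pos by (simp add: less_imp_le)
  qed
  also have "\<dots> = sum mu (B m) * sum mu (B n)"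
    by (simp add: sum_product sum.cartesian_product case_prod_unfold)
  finally show ?thesis .
qed

text \<open>If every sphere of positive radius had weight at least 1, the series would diverge. So
  some sphere, of radius \<open>N\<close>, has weight below 1; by submultiplicativity the weights
  decay geometrically in blocks of \<open>N\<close>, which leaves room for the factor
  \<open>l ^ len u\<close>.\<close>

lemma growth_slack: "\<exists>l \<Lambda>. 1 < l \<and> 0 \<le> \<Lambda> \<and> (\<forall>F. finite F \<longrightarrow> F \<subseteq> generate G V \<longrightarrow> (\<Sum>u\<in>F. mu u * l ^ len u) \<le> \<Lambda>)"
proof -
  define B where "B n = {u \<in> generate G V. len u = n}" for n
  define A where "A n = sum mu (B n)" for n
  have BW: "B k \<subseteq> W" for k using VS by (auto simp: B_def)
  have fB: "finite (B k)" for k by (rule finite_subset[OF _ finite_ball[of k]]) (use VS in \<open>auto simp: B_def\<close>)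
  have mu0: "0 \<le> mu u" if "u \<in> generate G V" for u using mu_pos[of u] VS that by simp
  have A0: "0 \<le> A n" for n unfolding A_def by (rule sum_nonneg) (use mu0 in \<open>auto simp: B_def\<close>)
  have sub: "A (m + n) \<le> A m * A n" for m n unfolding A_def B_def by (rule sphere_submult)
  have union: "(\<Sum>n<K. \<Sum>u\<in>B n. f u) = sum f (\<Union>n<K. B n)" for K and f :: "'a \<Rightarrow> real"
    by (rule sum.UNION_disjoint[symmetric]) (use fB in \<open>auto simp: B_def\<close>)
  have "\<exists>N>0. A N < 1"
  proof (rule ccontr)
    assume "\<not> ?thesis"
    then have ge: "1 \<le> A n" if "0 < n" for n using that by (meson not_less)
    obtain K :: nat where K: "infsum mu (generate G V) + 1 < K" using reals_Archimedean2 by blast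
    have "real K - 1 \<le> (\<Sum>n<K. A n)"
    proof (induction K)
      case (Suc K) then show ?case using ge[of K] A0[of K] by (cases "K = 0") auto
    qed simp
    also have "\<dots> = sum mu (\<Union>n<K. B n)" unfolding A_def by (rule union)
    also have "\<dots> \<le> infsum mu (generate G V)"
      by (rule finite_sum_le_infsum[OF sm]) (use fB mu0 in \<open>auto simp: B_def\<close>)
    finally show False using K by simp
  qed
  then obtain N where N: "0 < N" "A N < 1" by blast
  \<comment> \<open>Chosen so that \<open>l ^ N * A N\<close> equals
    \<open>2 * A N / (1 + A N)\<close>, which is still below 1.\<close>
  define l where "l = root N (2 / (1 + A N))"
  have l1: "1 < l" using N A0[of N] by (simp add: l_def)
  have lN: "l ^ N = 2 / (1 + A N)" using N A0[of N] by (simp add: l_def)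
  define c where "c = l ^ N * A N"
  have c: "c < 1" using N A0[of N] by (simp add: c_def lN field_simps)
  define Q where "Q K = (\<Sum>n<K. A n * l ^ n)" for K
  have Q0: "0 \<le> A n * l ^ n" for n using A0[of n] l1 by simp
  \<comment> \<open>Shifting by one block bounds \<open>Q K\<close> by \<open>Q N + c * Q K\<close>,
    and \<open>c < 1\<close> makes this a bound independent of \<open>K\<close>.\<close>
  have Qb: "Q K \<le> Q N / (1 - c)" for K
  proof -
    have "Q K \<le> Q (K + N)" unfolding Q_def by (rule sum_mono2) (use Q0 in auto)
    also have "Q (K + N) = Q N + (\<Sum>n<K. A (N + n) * l ^ (N + n))"
      unfolding Q_def by (induction K) (simp_all add: add.commute)
    also have "(\<Sum>n<K. A (N + n) * l ^ (N + n)) \<le> (\<Sum>n<K. c * (A n * l ^ n))"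
    proof (rule sum_mono)
      fix n
      have "A (N + n) * l ^ (N + n) \<le> (A N * A n) * l ^ (N + n)" using sub[of N n] l1 by (intro mult_right_mono) auto
      then show "A (N + n) * l ^ (N + n) \<le> c * (A n * l ^ n)" by (simp add: c_def power_add mult_ac)
    qed
    also have "(\<Sum>n<K. c * (A n * l ^ n)) = c * Q K" by (simp add: Q_def sum_distrib_left)
    finally have "Q K * (1 - c) \<le> Q N" by (simp add: algebra_simps)
    then show ?thesis using c by (simp add: field_simps)
  qed
  have "(\<Sum>u\<in>F. mu u * l ^ len u) \<le> Q N / (1 - c)" if F: "finite F" "F \<subseteq> generate G V" for F
  proof -
    obtain K where K: "\<And>n. n \<in> len ` F \<Longrightarrow> n < K" using F(1) by (meson finite_imageI finite_nat_set_iff_bounded)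
    have "(\<Sum>u\<in>F. mu u * l ^ len u) \<le> (\<Sum>u\<in>(\<Union>n<K. B n). mu u * l ^ len u)"
      by (rule sum_mono2) (use fB F K mu0 l1 in \<open>auto simp: B_def\<close>)
    also have "\<dots> = (\<Sum>n<K. \<Sum>u\<in>B n. mu u * l ^ len u)" by (rule union[symmetric])
    also have "\<dots> = Q K" unfolding Q_def A_def sum_distrib_right by (intro sum.cong refl) (auto simp: B_def)
    finally show ?thesis using Qb[of K] by simp
  qed
  moreover have "0 \<le> Q N / (1 - c)" using c sum_nonneg[of "{..<N}", OF Q0] by (simp add: Q_def)
  ultimately show ?thesis using l1 by blast
qed

section \<open>The mass of a chain along combing paths\<close>

definition comb_path :: "'a \<Rightarrow> 'a set" where "comb_path w = (\<lambda>n. comb V n w) ` {..comb_len V w}"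

lemma comb_path_props: assumes "w \<in> W" "p \<in> comb_path w"
  shows "p \<in> W" "\<exists>u\<in>generate G V. w = p \<otimes> u \<and> len w = len p + len u \<and> mu w = mu p * mu u"
proof -
  obtain n where n: "p = comb V n w" using assms by (auto simp: comb_path_def)
  show pW: "p \<in> W" using n comb_W[OF VS assms(1)] by simp
  obtain u where u: "u \<in> generate G V" "w = p \<otimes> u" "len w = len p + len u"
    using comb_suffix[OF VS assms(1), of n] n by blast
  have "mu (p \<otimes> u) = mu p * mu u" using qw_mult[OF q pW, of u] u VS by simp
  then show "\<exists>u\<in>generate G V. w = p \<otimes> u \<and> len w = len p + len u \<and> mu w = mu p * mu u" using u by (metis (no_types))
qed

lemma inj_comb: "w \<in> W \<Longrightarrow> inj_on (\<lambda>n. comb V n w) {..comb_len V w}"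
proof (rule inj_onI)
  fix m n assume "w \<in> W" "m \<in> {..comb_len V w}" "n \<in> {..comb_len V w}" "comb V m w = comb V n w"
  then show "m = n" using len_comb[OF VS, of w m] len_comb[OF VS, of w n] by simp
qed

lemma finite_comb_path: "finite (comb_path w)" by (simp add: comb_path_def)

text \<open>This controls what the contraction can bring to within bounded distance of
  \<open>p\<close>; absolute values make it independent of the coefficients of the
  homotopies.\<close>

definition path_sum :: "('a \<Rightarrow> real) \<Rightarrow> 'a \<Rightarrow> real" where
  "path_sum f p = (\<Sum>\<^sub>\<infinity>w\<in>W. if p \<in> comb_path w then \<bar>f w\<bar> else 0)"

text \<open>The weight \<open>l ^ (len w - len p)\<close>, available since the growth series converges with some slack,
  balances the two sums of the Cauchy-Schwarz inequality.\<close>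

lemma path_sum_bounded:
  assumes f: "(\<lambda>w. (f w)\<^sup>2 / mu w) summable_on W"
  shows "p \<in> W \<Longrightarrow> (\<lambda>w. if p \<in> comb_path w then \<bar>f w\<bar> else 0) summable_on W"
    and "(\<lambda>p. (path_sum f p)\<^sup>2 / mu p) summable_on W"
proof -
  obtain l \<Lambda> where l: "1 < l" "0 \<le> \<Lambda>" "\<And>F. finite F \<Longrightarrow> F \<subseteq> generate G V \<Longrightarrow> (\<Sum>u\<in>F. mu u * l ^ len u) \<le> \<Lambda>"
    using growth_slack by blast
  define d where "d p w = len w - len p" for p w
  \<comment> \<open>The share of the mass at \<open>w\<close> charged to the path point
    \<open>p\<close>, discounted geometrically in the distance; summed over the path of
    \<open>w\<close> it stays below a constant multiple of that mass.\<close>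
  define g where "g p w = (if p \<in> comb_path w then (f w)\<^sup>2 / mu w / l ^ d p w else 0)" for p w
  have g0: "0 \<le> g p w" if "w \<in> W" for p w using mu_pos[OF that] l(1) by (simp add: g_def)
  have gle: "g p w \<le> (f w)\<^sup>2 / mu w" if "w \<in> W" for p w
  proof -
    have "1 \<le> l ^ d p w" using l(1) by (simp add: one_le_power)
    moreover have "0 \<le> (f w)\<^sup>2 / mu w" using mu_pos[OF that] by simp
    ultimately have "(f w)\<^sup>2 / mu w / l ^ d p w \<le> (f w)\<^sup>2 / mu w / 1" by (intro divide_left_mono) auto
    then show ?thesis using \<open>0 \<le> (f w)\<^sup>2 / mu w\<close> by (simp add: g_def)
  qed
  have gs: "g p summable_on W" for p
    by (rule summable_on_comparison_test[OF f]) (use g0 gle in auto)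
  define E where "E p = infsum (g p) W" for p
  have E0: "0 \<le> E p" for p unfolding E_def using g0 by (intro infsum_nonneg) auto
  have key: "(\<Sum>w\<in>F. if p \<in> comb_path w then \<bar>f w\<bar> else 0)\<^sup>2 \<le> E p * (mu p * \<Lambda>)" if p: "p \<in> W" and F: "finite F" "F \<subseteq> W" for p F
  proof -
    define F' where "F' = {w \<in> F. p \<in> comb_path w}"
    have F'W: "F' \<subseteq> W" "finite F'" using F by (auto simp: F'_def)
    have pos: "0 < mu w * l ^ d p w" if "w \<in> W" for w using mu_pos[OF that] l(1) by simp
    have "(\<Sum>w\<in>F. if p \<in> comb_path w then \<bar>f w\<bar> else 0) = (\<Sum>w\<in>F'. \<bar>f w\<bar>)"
      unfolding F'_def by (rule sum.inter_filter[symmetric, OF F(1)])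
    also have "\<dots> = (\<Sum>w\<in>F'. (\<bar>f w\<bar> / sqrt (mu w * l ^ d p w)) * sqrt (mu w * l ^ d p w))"
    proof (rule sum.cong[OF refl])
      fix w assume "w \<in> F'"
      then have "0 < sqrt (mu w * l ^ d p w)" using pos[of w] F'W(1) unfolding real_sqrt_gt_0_iff by blast
      then have "sqrt (mu w * l ^ d p w) \<noteq> 0" by linarith
      then show "\<bar>f w\<bar> = (\<bar>f w\<bar> / sqrt (mu w * l ^ d p w)) * sqrt (mu w * l ^ d p w)" by simp
    qed
    also have "\<dots>\<^sup>2 \<le> (\<Sum>w\<in>F'. (\<bar>f w\<bar> / sqrt (mu w * l ^ d p w))\<^sup>2) * (\<Sum>w\<in>F'. (sqrt (mu w * l ^ d p w))\<^sup>2)"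
      by (rule Cauchy_Schwarz_ineq_sum)
    also have "(\<Sum>w\<in>F'. (\<bar>f w\<bar> / sqrt (mu w * l ^ d p w))\<^sup>2) = (\<Sum>w\<in>F'. g p w)"
      using pos F'W by (intro sum.cong refl) (auto simp: g_def F'_def power_divide less_imp_le)
    also have "(\<Sum>w\<in>F'. (sqrt (mu w * l ^ d p w))\<^sup>2) = (\<Sum>w\<in>F'. mu w * l ^ d p w)"
      using pos F'W by (intro sum.cong refl) (auto simp: less_imp_le)
    also have "(\<Sum>w\<in>F'. g p w) * (\<Sum>w\<in>F'. mu w * l ^ d p w) \<le> E p * (mu p * \<Lambda>)"
    proof (rule mult_mono)
      show "(\<Sum>w\<in>F'. g p w) \<le> E p" unfolding E_def by (rule finite_sum_le_infsum[OF gs]) (use F'W g0 in auto)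
      have ex: "\<exists>u\<in>generate G V. w = p \<otimes> u \<and> len w = len p + len u \<and> mu w = mu p * mu u" if "w \<in> F'" for w
        using comb_path_props[of w p] that F'W by (auto simp: F'_def)
      \<comment> \<open>Points whose paths pass through \<open>p\<close> are products
        \<open>p \<otimes> u\<close> with \<open>u\<close> in \<open>W_V\<close> and additive
        lengths, so the second factor is at most \<open>mu p\<close> times the growth series of
        \<open>W_V\<close> with slack.\<close>
      define h where "h w = inv p \<otimes> w" for w
      have h: "h w \<in> generate G V" "mu w * l ^ d p w = mu p * (mu (h w) * l ^ len (h w))" if w: "w \<in> F'" for w
      proof -
        obtain u where u: "u \<in> generate G V" "w = p \<otimes> u" "len w = len p + len u" "mu w = mu p * mu u" using ex[OF w] by blast
        have "h w = u" using u p VS by (simp add: h_def flip: m_assoc)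
        then show "h w \<in> generate G V" "mu w * l ^ d p w = mu p * (mu (h w) * l ^ len (h w))" using u by (auto simp: d_def)
      qed
      have inj: "inj_on h F'" using F'W p by (intro inj_onI) (auto simp: h_def subset_iff)
      have "(\<Sum>w\<in>F'. mu w * l ^ d p w) = (\<Sum>w\<in>F'. mu p * (mu (h w) * l ^ len (h w)))" using h by (intro sum.cong) auto
      also have "\<dots> = mu p * (\<Sum>u\<in>h ` F'. mu u * l ^ len u)" by (simp add: sum_distrib_left sum.reindex[OF inj])
      also have "\<dots> \<le> mu p * \<Lambda>" using l(3)[of "h ` F'"] h F'W mu_pos[OF p] by (intro mult_left_mono) auto
      finally show "(\<Sum>w\<in>F'. mu w * l ^ d p w) \<le> mu p * \<Lambda>" .
      show "0 \<le> (\<Sum>w\<in>F'. mu w * l ^ d p w)" using pos F'W by (intro sum_nonneg) (auto simp: less_imp_le)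
      show "0 \<le> E p" by (rule E0)
    qed
    finally show ?thesis .
  qed
  have b: "(\<Sum>w\<in>F. if p \<in> comb_path w then \<bar>f w\<bar> else 0) \<le> sqrt (E p * (mu p * \<Lambda>))" if "p \<in> W" "finite F" "F \<subseteq> W" for p F
    using key[OF that] by (rule real_le_rsqrt)
  show s: "(\<lambda>w. if p \<in> comb_path w then \<bar>f w\<bar> else 0) summable_on W" if p: "p \<in> W" for p
    by (rule summable_on_nonnegI[where b = "sqrt (E p * (mu p * \<Lambda>))"]) (use b[OF p] in auto)
  have T: "(path_sum f p)\<^sup>2 / mu p \<le> \<Lambda> * E p" if p: "p \<in> W" for p
  proof -
    have "0 \<le> path_sum f p" unfolding path_sum_def by (rule infsum_nonneg) auto
    moreover have "path_sum f p \<le> sqrt (E p * (mu p * \<Lambda>))" unfolding path_sum_def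
      by (rule infsum_le_finite_sums[OF s[OF p]]) (use b[OF p] in auto)
    ultimately have "(path_sum f p)\<^sup>2 \<le> (sqrt (E p * (mu p * \<Lambda>)))\<^sup>2" by (intro power_mono)
    also have "\<dots> = E p * (mu p * \<Lambda>)" using E0[of p] mu_pos[OF p] l(2) by simp
    finally show ?thesis using mu_pos[OF p] by (simp add: field_simps)
  qed
  define \<kappa> where "\<kappa> = 1 / (1 - 1 / l)"
  have geo: "(\<Sum>n<N. 1 / l ^ n) \<le> \<kappa>" for N
  proof -
    have "(\<Sum>n<N. (1 / l) ^ n) \<le> (\<Sum>n. (1 / l) ^ n)"
      using l(1) by (intro sum_le_suminf summable_geometric) auto
    also have "\<dots> = \<kappa>" unfolding \<kappa>_def using l(1) by (intro suminf_geometric) auto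
    finally show ?thesis by (simp add: power_one_over)
  qed
  have \<kappa>0: "0 \<le> \<kappa>" using geo[of 0] by simp
  show "(\<lambda>p. (path_sum f p)\<^sup>2 / mu p) summable_on W"
  proof (rule summable_on_nonnegI[where b = "\<Lambda> * (\<kappa> * infsum (\<lambda>w. (f w)\<^sup>2 / mu w) W)"])
    fix P assume P: "finite P" "P \<subseteq> W"
    have "(\<Sum>p\<in>P. (path_sum f p)\<^sup>2 / mu p) \<le> (\<Sum>p\<in>P. \<Lambda> * E p)" using T P by (intro sum_mono) auto
    also have "\<dots> = \<Lambda> * infsum (\<lambda>w. \<Sum>p\<in>P. g p w) W"
      using finite_sum_summable(2)[OF P(1), of g W] gs by (simp add: sum_distrib_left E_def)
    also have "infsum (\<lambda>w. \<Sum>p\<in>P. g p w) W \<le> infsum (\<lambda>w. \<kappa> * ((f w)\<^sup>2 / mu w)) W"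
    proof (rule infsum_mono)
      show "(\<lambda>w. \<Sum>p\<in>P. g p w) summable_on W" by (rule finite_sum_summable(1)[OF P(1) gs])
      show "(\<lambda>w. \<kappa> * ((f w)\<^sup>2 / mu w)) summable_on W" by (rule summable_on_cmult_right[OF f])
      fix w assume w: "w \<in> W"
      have nonneg: "0 \<le> (f w)\<^sup>2 / mu w" using mu_pos[OF w] by simp
      have "(\<Sum>p\<in>P. g p w) \<le> (\<Sum>p\<in>comb_path w. (f w)\<^sup>2 / mu w / l ^ d p w)"
      proof -
        have "(\<Sum>p\<in>P. g p w) = (\<Sum>p\<in>{p \<in> P. p \<in> comb_path w}. (f w)\<^sup>2 / mu w / l ^ d p w)"
          unfolding g_def by (rule sum.inter_filter[symmetric, OF P(1)])
        also have "\<dots> \<le> (\<Sum>p\<in>comb_path w. (f w)\<^sup>2 / mu w / l ^ d p w)"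
        proof (rule sum_mono2[OF finite_comb_path])
          show "0 \<le> (f w)\<^sup>2 / mu w / l ^ d b w" for b by (rule divide_nonneg_nonneg[OF nonneg]) (use l(1) in simp)
        qed auto
        finally show ?thesis .
      qed
      also have "\<dots> = (\<Sum>n\<le>comb_len V w. (f w)\<^sup>2 / mu w / l ^ n)"
      proof -
        have "d (comb V n w) w = n" if "n \<le> comb_len V w" for n using len_comb[OF VS w, of n] that by (simp add: d_def)
        then show ?thesis unfolding comb_path_def sum.reindex[OF inj_comb[OF w]] by (intro sum.cong) auto
      qed
      also have "\<dots> = (f w)\<^sup>2 / mu w * (\<Sum>n<Suc (comb_len V w). 1 / l ^ n)"
        by (simp add: sum_distrib_left lessThan_Suc_atMost)
      also have "\<dots> \<le> (f w)\<^sup>2 / mu w * \<kappa>" using geo nonneg by (intro mult_left_mono)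
      finally show "(\<Sum>p\<in>P. g p w) \<le> \<kappa> * ((f w)\<^sup>2 / mu w)" by (simp add: mult.commute)
    qed
    also have "infsum (\<lambda>w. \<kappa> * ((f w)\<^sup>2 / mu w)) W = \<kappa> * infsum (\<lambda>w. (f w)\<^sup>2 / mu w) W"
      using f by (rule infsum_cmult_right)
    finally show "(\<Sum>p\<in>P. (path_sum f p)\<^sup>2 / mu p) \<le> \<Lambda> * (\<kappa> * infsum (\<lambda>w. (f w)\<^sup>2 / mu w) W)"
      using l(2) by (simp add: mult_left_mono)
  qed (use mu_pos in \<open>auto simp: less_imp_le\<close>)
qed

subsection \<open>The contracting homotopy\<close>

text \<open>The homotopies summed over time. The path of \<open>w\<close> ends after
  \<open>comb_len V w\<close> steps, those of the other vertices of the cell at most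
  \<open>sph_len_max\<close> steps later, and from then on all terms vanish.\<close>

definition contraction :: "'a \<Rightarrow> 'a set \<Rightarrow> 'a chain" where
  "contraction w U = (\<lambda>R z. \<Sum>n<comb_len V w + sph_len_max + 1. comb_homot V (card U) n w U R z)"

lemma comb_const:
  assumes g: "sph_card V i U" and w: "w \<in> W" and n: "comb_len V w + sph_len_max \<le> n" and u: "u \<in> generate G U"
  shows "comb V n (w \<otimes> u) = min_rep V w"
proof -
  have uV: "u \<in> generate G V" using u par_mono[OF sph_card_V[OF VS g]] by auto
  have uW: "u \<in> W" using uV VS by simp
  have "comb_len V (w \<otimes> u) = len (par_part V w \<otimes> u)" unfolding comb_len_def[OF VS] using min_rep_mult(2)[OF w VS uV] by simp
  also have "\<dots> \<le> comb_len V w + sph_len_max" using len_mult_le[OF par_part(4)[OF w VS] uW] sph_len_max[OF VS g u] unfolding comb_len_def[OF VS] by simp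
  finally have "comb_len V (w \<otimes> u) \<le> n" using n by simp
  then show ?thesis using comb_big[OF VS, of "w \<otimes> u" n] min_rep_mult(1)[OF w VS uV] w uW by simp
qed

lemma contraction_ext: assumes g: "sph_card V i U" and w: "w \<in> W" and N: "comb_len V w + sph_len_max + 1 \<le> N"
  shows "contraction w U = (\<lambda>R z. \<Sum>n<N. comb_homot V i n w U R z)"
proof -
  have "comb_homot V i n w U R z = 0" if n: "comb_len V w + sph_len_max + 1 \<le> n" for n R z
  proof -
    have "comb_homot V i n w U = (\<lambda>R z. 0)"
      by (rule comb_homot_van[OF VS g w]) (use comb_const[OF g w] comb_const[OF g w _ par_one] n w in auto)
    then show ?thesis by simp
  qed
  then have "(\<Sum>n<N. comb_homot V i n w U R z) = (\<Sum>n<comb_len V w + sph_len_max + 1. comb_homot V i n w U R z)" for R z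
    using N by (intro sum.mono_neutral_right) auto
  then show ?thesis using sph_card_card[OF VS g] by (simp add: contraction_def)
qed

lemma contraction_fin_chain: assumes "sph_card V i U" "w \<in> W" shows "fin_chain V (Suc i) (contraction w U)"
  using fin_chain_sum[of "{..<comb_len V w + sph_len_max + 1}" V "Suc i" "\<lambda>n. comb_homot V i n w U" "\<lambda>_. 1"] comb_homot_fin_chain[OF VS assms] contraction_ext[OF assms order_refl] by simp

text \<open>The boundary formulas telescope from the identity at time 0 to zero at time
  \<open>N\<close>, so the summed homotopies contract the complex up to sign.\<close>

lemma contraction_cbdry: assumes g: "sph_card V (Suc i) U" and w: "w \<in> W"
  shows "cbdry (contraction w U) = (\<lambda>R z. - cell_chain w U R z - comp_bdry contraction w U R z)"
proof -
  \<comment> \<open>Large enough for all vertices \<open>w \<otimes> u\<close> at once: their paths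
    may be longer by up to \<open>sph_len_max\<close>, whence the second such summand.\<close>
  define N where "N = comb_len V w + sph_len_max + sph_len_max + 1"
  have sp: "spherical G S U" using sph_card_sph[OF VS g] .
  have uW: "w \<otimes> u \<in> W" if "u \<in> generate G U" for u using that sph_card_W[OF VS g] w by simp
  have ku: "contraction (w \<otimes> u) (U - {s}) = (\<lambda>R z. \<Sum>n<N. comb_homot V i n (w \<otimes> u) (U - {s}) R z)" if su: "s \<in> U" "u \<in> generate G U" for s u
  proof (rule contraction_ext[OF sph_card_diff[OF VS g su(1)] uW[OF su(2)]])
    have uV: "u \<in> generate G V" using su par_mono[OF sph_card_V[OF VS g]] by auto
    have "comb_len V (w \<otimes> u) = len (par_part V w \<otimes> u)" unfolding comb_len_def[OF VS] using min_rep_mult(2)[OF w VS uV] by simp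
    also have "\<dots> \<le> comb_len V w + sph_len_max"
      using len_mult_le[OF par_part(4)[OF w VS] sph_card_W[OF VS g su(2)]] sph_len_max[OF VS g su(2)] unfolding comb_len_def[OF VS] by simp
    finally show "comb_len V (w \<otimes> u) + sph_len_max + 1 \<le> N" by (simp add: N_def)
  qed
  have k: "contraction w U = (\<lambda>R z. \<Sum>n<N. 1 * comb_homot V (Suc i) n w U R z)" using contraction_ext[OF g w, of N] by (simp add: N_def)
  have FN: "comb_map V (Suc i) N (w \<otimes> u) U = (\<lambda>R z. 0)" if u: "u \<in> generate G U" for u
  proof (rule comb_map_van[OF VS g uW[OF u]])
    show "0 < N" by (simp add: N_def)
    fix v assume v: "v \<in> generate G U"
    have "u \<otimes> v \<in> generate G U" using u v sph_card_S[OF VS g] by simp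
    then show "comb V N (w \<otimes> u \<otimes> v) = comb V N (w \<otimes> u)"
      using comb_const[OF g w, of N] u v w sph_card_W[OF VS g] by (simp add: N_def m_assoc)
  qed
  have aN: "alt_avg (comb_map V (Suc i) N) w U = (\<lambda>R z. 0)"
    using alt_avg_cong[of U "comb_map V (Suc i) N" w "\<lambda>w U R z. 0"] FN by (simp add: alt_avg_zero)
  have a0: "alt_avg (comb_map V (Suc i) 0) w U = cell_chain w U"
    using alt_avg_cong[of U "comb_map V (Suc i) 0" w cell_chain] comb_map_0[OF VS g] uW alt_avg_cell_chain[OF sp w] by simp
  have "cbdry (contraction w U) = (\<lambda>R z. \<Sum>n<N. 1 * cbdry (comb_homot V (Suc i) n w U) R z)" unfolding k by (rule cbdry_sum)
  also have "\<dots> = (\<lambda>R z. (\<Sum>n<N. alt_avg (comb_map V (Suc i) (Suc n)) w U R z - alt_avg (comb_map V (Suc i) n) w U R z) - (\<Sum>n<N. comp_bdry (comb_homot V i n) w U R z))"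
    unfolding comb_homot_cbdry[OF VS g w] by (simp add: sum_subtractf homot_bdry_def[OF VS])
  also have "\<dots> = (\<lambda>R z. - cell_chain w U R z - (\<Sum>n<N. comp_bdry (comb_homot V i n) w U R z))"
    by (simp add: sum_lessThan_telescope[of "\<lambda>n. alt_avg (comb_map V (Suc i) n) w U _ _"] aN a0)
  also have "(\<lambda>R z. \<Sum>n<N. comp_bdry (comb_homot V i n) w U R z) = comp_bdry contraction w U"
    unfolding comp_bdry_sum[symmetric] by (rule comp_bdry_cong) (use ku in simp)
  finally show ?thesis by (simp add: fun_eq_iff)
qed

text \<open>Each term of the sum is bounded and lives near the current path point, so the
  coefficient at \<open>z\<close> is controlled by the number of times at which the path is near
  \<open>z\<close>. As the points of a path are distinct, these times can be traded for elements
  \<open>g\<close> of a ball with \<open>z \<otimes> g\<close> on the path.\<close>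

lemma contraction_bound: "\<exists>C M. 0 \<le> C \<and> (\<forall>w U R z. w \<in> W \<longrightarrow> sph_card V i U \<longrightarrow> z \<in> W \<longrightarrow>
    \<bar>contraction w U R z\<bar> \<le> C * (\<Sum>g\<in>{g \<in> W. len g \<le> M}. if z \<otimes> g \<in> comb_path w then 1 else 0))"
proof -
  obtain C M where CM: "\<And>n w U R z. w \<in> W \<Longrightarrow> sph_card V i U \<Longrightarrow> comb_homot V i n w U R z \<noteq> 0 \<Longrightarrow>
    \<bar>comb_homot V i n w U R z\<bar> \<le> C \<and> len (inv (comb V n w) \<otimes> z) \<le> M" using comb_homot_bound[OF VS, of i] by blast
  let ?C = "max C 0"
  let ?B = "{g \<in> W. len g \<le> M}"
  have "\<bar>contraction w U R z\<bar> \<le> (?C * real (Suc sph_len_max)) * (\<Sum>g\<in>?B. if z \<otimes> g \<in> comb_path w then 1 else 0)"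
    if w: "w \<in> W" and g: "sph_card V i U" and z: "z \<in> W" for w U R z
  proof -
    define I where "I n = (if len (inv (comb V n w) \<otimes> z) \<le> M then 1 else 0 :: real)" for n
    define L where "L = comb_len V w"
    have I0: "0 \<le> I n" for n by (simp add: I_def)
    have "\<bar>contraction w U R z\<bar> \<le> (\<Sum>n<L + sph_len_max + 1. \<bar>comb_homot V i n w U R z\<bar>)"
      unfolding contraction_ext[OF g w order_refl] L_def by (rule sum_abs)
    also have "\<dots> \<le> (\<Sum>n<L + sph_len_max + 1. ?C * I n)"
    proof (rule sum_mono)
      fix n
      show "\<bar>comb_homot V i n w U R z\<bar> \<le> ?C * I n"
        using CM[OF w g, of n R z] I0[of n] by (cases "comb_homot V i n w U R z = 0") (auto simp: I_def)
    qed
    also have "\<dots> = ?C * (\<Sum>n<L + sph_len_max + 1. I n)" by (rule sum_distrib_left[symmetric])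
    \<comment> \<open>From time \<open>L\<close> on the path rests at its end, so the last
      \<open>sph_len_max\<close> terms are copies of the term at \<open>L\<close>.\<close>
    also have "(\<Sum>n<L + sph_len_max + 1. I n) \<le> real (Suc sph_len_max) * (\<Sum>n\<le>L. I n)"
    proof -
      have e: "{..<L + sph_len_max + 1} = {..L} \<union> {Suc L..<Suc L + sph_len_max}" by auto
      have "(\<Sum>n<L + sph_len_max + 1. I n) = (\<Sum>n\<le>L. I n) + (\<Sum>n\<in>{Suc L..<Suc L + sph_len_max}. I n)"
        unfolding e by (rule sum.union_disjoint) auto
      also have "(\<Sum>n\<in>{Suc L..<Suc L + sph_len_max}. I n) = real sph_len_max * I L"
      proof -
        have "I n = I L" if "L \<le> n" for n using comb_big[OF VS w, of n] comb_big[OF VS w, of L] that by (simp add: I_def L_def)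
        then have "(\<Sum>n\<in>{Suc L..<Suc L + sph_len_max}. I n) = (\<Sum>n\<in>{Suc L..<Suc L + sph_len_max}. I L)"
          by (rule sum.cong[OF refl]) (metis Suc_leD atLeastLessThan_iff)
        then show ?thesis by simp
      qed
      also have "real sph_len_max * I L \<le> real sph_len_max * (\<Sum>n\<le>L. I n)"
        using I0 by (intro mult_left_mono member_le_sum) auto
      finally show ?thesis by (simp add: algebra_simps)
    qed
    also have "(\<Sum>n\<le>L. I n) = real (card {n \<in> {..L}. len (inv (comb V n w) \<otimes> z) \<le> M})"
      unfolding I_def by (simp add: sum.inter_filter[symmetric])
    also have "\<dots> \<le> real (card {g \<in> ?B. z \<otimes> g \<in> comb_path w})"
    proof -
      have pW: "comb V n w \<in> W" for n using comb_W[OF VS w] .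
      let ?A = "{n \<in> {..L}. len (inv (comb V n w) \<otimes> z) \<le> M}"
      have "inj_on (\<lambda>n. inv z \<otimes> comb V n w) ?A"
      proof (rule inj_onI)
        fix m n assume "m \<in> ?A" "n \<in> ?A" "inv z \<otimes> comb V m w = inv z \<otimes> comb V n w"
        then have "comb V m w = comb V n w" using pW z by simp
        then show "m = n" using inj_comb[OF w] \<open>m \<in> ?A\<close> \<open>n \<in> ?A\<close> by (auto simp: inj_on_def L_def)
      qed
      moreover have "(\<lambda>n. inv z \<otimes> comb V n w) ` ?A \<subseteq> {g \<in> ?B. z \<otimes> g \<in> comb_path w}"
      proof
        fix y assume "y \<in> (\<lambda>n. inv z \<otimes> comb V n w) ` ?A"
        then obtain n where n: "n \<le> L" "len (inv (comb V n w) \<otimes> z) \<le> M" "y = inv z \<otimes> comb V n w" by auto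
        have "inv y = inv (comb V n w) \<otimes> z" using n(3) pW z by (simp add: inv_mult_group)
        then have "len y \<le> M" using len_inv[of y] n pW z by simp
        moreover have "z \<otimes> y = comb V n w" using n(3) pW z by (simp flip: m_assoc)
        ultimately show "y \<in> {g \<in> ?B. z \<otimes> g \<in> comb_path w}" using n pW z by (auto simp: comb_path_def L_def)
      qed
      moreover have "finite {g \<in> ?B. z \<otimes> g \<in> comb_path w}" by (rule finite_subset[OF _ finite_ball[of M]]) auto
      ultimately show ?thesis by (metis (no_types, lifting) card_image card_mono of_nat_mono)
    qed
    also have "real (card {g \<in> ?B. z \<otimes> g \<in> comb_path w}) = (\<Sum>g\<in>?B. if z \<otimes> g \<in> comb_path w then 1 else 0)"
      using finite_ball[of M] by (simp add: sum.inter_filter[symmetric])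
    finally show ?thesis by (simp add: mult_left_mono mult.assoc)
  qed
  then show ?thesis by (intro exI[of _ "?C * real (Suc sph_len_max)"] exI[of _ M]) simp
qed

definition contract :: "('a \<Rightarrow> real) \<Rightarrow> 'a set \<Rightarrow> 'a chain" where
  "contract f U = (\<lambda>R z. \<Sum>\<^sub>\<infinity>w\<in>W. f w * contraction w U R z)"

lemma rmult_bij: "g \<in> W \<Longrightarrow> bij_betw (\<lambda>z. z \<otimes> g) W W"
  by (rule bij_betw_byWitness[of _ "\<lambda>z. z \<otimes> inv g"]) (auto simp: m_assoc)

text \<open>By \<open>contraction_bound\<close> the sum is dominated by finitely many right
  translates of \<open>path_sum\<close>, and right translation by a bounded element changes the
  weight by a bounded factor.\<close>

lemma contract_summable:
  assumes f: "wgt_l2 q f" and g: "sph_card V i U"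
  shows "(\<lambda>w. f w * contraction w U R z) summable_on W" and "wgt_l2 q (contract f U R)"
proof -
  obtain C M where C: "0 \<le> C" and CM: "\<And>w U R z. w \<in> W \<Longrightarrow> sph_card V i U \<Longrightarrow> z \<in> W \<Longrightarrow>
    \<bar>contraction w U R z\<bar> \<le> C * (\<Sum>g\<in>{g \<in> W. len g \<le> M}. if z \<otimes> g \<in> comb_path w then 1 else 0)" using contraction_bound[of i] by blast
  define B where "B = {g \<in> W. len g \<le> M}"
  have B: "finite B" "B \<subseteq> W" using finite_ball by (auto simp: B_def)
  note T = path_sum_bounded[OF f[unfolded wgt_l2_def]]
  define h where "h z w = C * (\<Sum>g\<in>B. if z \<otimes> g \<in> comb_path w then \<bar>f w\<bar> else 0)" for z w
  have hs: "h z summable_on W" and hi: "infsum (h z) W = C * (\<Sum>g\<in>B. path_sum f (z \<otimes> g))" if z: "z \<in> W" for z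
  proof -
    have s: "(\<lambda>w. if z \<otimes> g \<in> comb_path w then \<bar>f w\<bar> else 0) summable_on W" if "g \<in> B" for g
      using T(1)[of "z \<otimes> g"] z that B by auto
    show "h z summable_on W" unfolding h_def
      by (rule summable_on_cmult_right[OF finite_sum_summable(1)[OF B(1) s]])
    show "infsum (h z) W = C * (\<Sum>g\<in>B. path_sum f (z \<otimes> g))" unfolding h_def path_sum_def
      using finite_sum_summable(2)[OF B(1) s] by (simp add: infsum_cmult_right')
  qed
  have homot_bdry: "norm (f w * contraction w U R z) \<le> h z w" if "w \<in> W" "z \<in> W" for w z
  proof -
    have "\<bar>f w\<bar> * \<bar>contraction w U R z\<bar> \<le> \<bar>f w\<bar> * (C * (\<Sum>g\<in>B. if z \<otimes> g \<in> comb_path w then 1 else 0))"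
      using CM[OF that(1) g that(2)] unfolding B_def by (intro mult_left_mono) auto
    also have "\<dots> = h z w" unfolding h_def sum_distrib_left by (intro sum.cong refl) auto
    finally show ?thesis by (simp add: abs_mult)
  qed
  have zW: "contraction w U R z = 0" if "z \<notin> W" "w \<in> W" for w z
    using alt_chain_chain_supp[OF fin_chain_alt_chain[OF contraction_fin_chain[OF g that(2)]], of R z] that by blast
  show s: "(\<lambda>w. f w * contraction w U R z) summable_on W" for z
  proof (cases "z \<in> W")
    case True
    show ?thesis by (rule abs_summable_summable, rule Infinite_Sum.abs_summable_on_comparison_test'[OF hs[OF True]]) (use homot_bdry True in auto)
  next
    case False
    then show ?thesis using zW by (intro summable_on_0) auto
  qed
  have le: "\<bar>contract f U R z\<bar> \<le> C * (\<Sum>g\<in>B. path_sum f (z \<otimes> g))" if z: "z \<in> W" for z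
  proof -
    have "norm (\<Sum>\<^sub>\<infinity>w\<in>W. f w * contraction w U R z) \<le> infsum (h z) W"
      by (rule norm_infsum_le[OF has_sum_infsum[OF s] has_sum_infsum[OF hs[OF z]]]) (use homot_bdry z in auto)
    then show ?thesis unfolding contract_def hi[OF z] by simp
  qed
  have T0: "0 \<le> path_sum f p" for p unfolding path_sum_def by (rule infsum_nonneg) auto
  have "wgt_l2 q (\<lambda>z. path_sum f (z \<otimes> g))" if "g \<in> B" for g
  proof -
    have gW: "g \<in> W" using that B by auto
    obtain \<kappa> where \<kappa>: "0 \<le> \<kappa>" "\<And>z g. z \<in> W \<Longrightarrow> g \<in> W \<Longrightarrow> len g \<le> M \<Longrightarrow> mu (z \<otimes> g) \<le> \<kappa> * mu z"
      using qw_ratio[OF q, of M] by blast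
    show ?thesis unfolding wgt_l2_def
    proof (rule summable_on_comparison_test)
      have "(\<lambda>z. (path_sum f (z \<otimes> g))\<^sup>2 / mu (z \<otimes> g)) summable_on W"
        using summable_on_reindex_bij_betw[OF rmult_bij[OF gW], of "\<lambda>p. (path_sum f p)\<^sup>2 / mu p"] T(2) by simp
      then show "(\<lambda>z. \<kappa> * ((path_sum f (z \<otimes> g))\<^sup>2 / mu (z \<otimes> g))) summable_on W" by (rule summable_on_cmult_right)
      fix z assume z: "z \<in> W"
      have p: "0 < mu z" "0 < mu (z \<otimes> g)" using mu_pos z gW by auto
      have "mu (z \<otimes> g) \<le> \<kappa> * mu z" using \<kappa>(2)[OF z gW] that by (simp add: B_def)
      then have "(path_sum f (z \<otimes> g))\<^sup>2 * mu (z \<otimes> g) \<le> (path_sum f (z \<otimes> g))\<^sup>2 * (\<kappa> * mu z)" by (rule mult_left_mono) simp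
      then show "(path_sum f (z \<otimes> g))\<^sup>2 / mu z \<le> \<kappa> * ((path_sum f (z \<otimes> g))\<^sup>2 / mu (z \<otimes> g))"
        using p by (simp add: field_simps)
      show "0 \<le> (path_sum f (z \<otimes> g))\<^sup>2 / mu z" using p by simp
    qed
  qed
  then have "wgt_l2 q (\<lambda>z. \<Sum>g\<in>B. C * path_sum f (z \<otimes> g))" using wgt_l2_sum[OF q B(1), of "\<lambda>g z. path_sum f (z \<otimes> g)"] by simp
  then show "wgt_l2 q (contract f U R)"
    by (rule wgt_l2_le[OF q]) (use le C T0 in \<open>auto simp: sum_distrib_left[symmetric] abs_mult intro!: order_trans[OF le] mult_left_mono\<close>)
qed

lemma contract_alt_chain: assumes f: "wgt_l2 q f" and g: "sph_card V i U" shows "alt_chain {} V (Suc i) (contract f U)"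
  unfolding alt_chain_def
proof (intro conjI allI impI)
  fix R z assume "contract f U R z \<noteq> 0"
  then obtain w where w: "w \<in> W" "f w * contraction w U R z \<noteq> 0" unfolding contract_def by (metis (mono_tags, lifting) infsum_0)
  then show "{} \<subseteq> R" "R \<subseteq> V" "spherical G S R" "card R = Suc i" "z \<in> W"
    using alt_chain_chain_supp[OF fin_chain_alt_chain[OF contraction_fin_chain[OF g w(1)]], of R z] by auto
next
  fix R z u assume u: "R \<subseteq> S" "z \<in> W" "u \<in> generate G R"
  have "(\<Sum>\<^sub>\<infinity>w\<in>W. f w * contraction w U R (z \<otimes> u)) = (\<Sum>\<^sub>\<infinity>w\<in>W. eps u * (f w * contraction w U R z))"
    using alt_chain_alt[OF fin_chain_alt_chain[OF contraction_fin_chain[OF g]] u] by (intro infsum_cong) simp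
  then show "contract f U R (z \<otimes> u) = eps u * contract f U R z" unfolding contract_def by (simp add: infsum_cmult_right')
qed

text \<open>The only cell of type \<open>U\<close> through \<open>z\<close> is named by every
  \<open>w\<close> in the coset of \<open>z\<close>. The signs of \<open>x\<close> and of
  \<open>cell_chain\<close> cancel, so it is counted once for each element of
  \<open>W_U\<close>.\<close>

lemma infsum_cell_chain:
  assumes x: "alt_chain {} V i x" and g: "sph_card V i U"
  shows "(\<lambda>w. x U w * cell_chain w U R z) summable_on W" "(\<Sum>\<^sub>\<infinity>w\<in>W. x U w * cell_chain w U R z) = (if R = U then par_card U * x U z else 0)"
proof -
  note US = sph_card_S[OF VS g]
  have fU: "finite (generate G U)" using sph_card_sph[OF VS g] by (simp add: spherical_def)
  have "(\<lambda>w. x U w * cell_chain w U R z) summable_on W \<and> (\<Sum>\<^sub>\<infinity>w\<in>W. x U w * cell_chain w U R z) = (if R = U then par_card U * x U z else 0)"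
  proof (cases "R = U \<and> z \<in> W")
    case False
    then have "(\<lambda>w. x U w * cell_chain w U R z) = (\<lambda>w. 0)" by (auto simp: cell_chain_def)
    moreover have "R = U \<Longrightarrow> x U z = 0" using False alt_chain_chain_supp[OF x, of U z] by auto
    ultimately show ?thesis by simp
  next
    case True
    let ?F = "(\<lambda>u. z \<otimes> u) ` generate G U"
    have FW: "?F \<subseteq> W" using True US by auto
    have inj: "inj_on (\<lambda>u. z \<otimes> u) (generate G U)" using True US by (intro inj_onI) simp
    have z0: "x U w * cell_chain w U R z = 0" if "w \<in> W - ?F" for w
    proof (rule ccontr)
      assume "x U w * cell_chain w U R z \<noteq> 0"
      then have h: "inv w \<otimes> z \<in> generate G U" by (auto simp: cell_chain_def split: if_splits)
      have "w = z \<otimes> inv (inv w \<otimes> z)" using that True by (simp add: inv_mult_group flip: m_assoc)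
      then have "w \<in> ?F" using par_inv[OF US h] by blast
      then show False using that by blast
    qed
    have "(\<lambda>w. x U w * cell_chain w U R z) summable_on W \<longleftrightarrow> (\<lambda>w. x U w * cell_chain w U R z) summable_on ?F"
      by (rule summable_on_cong_neutral) (use z0 FW in auto)
    moreover have "infsum (\<lambda>w. x U w * cell_chain w U R z) W = infsum (\<lambda>w. x U w * cell_chain w U R z) ?F"
      by (rule infsum_cong_neutral) (use z0 FW in auto)
    moreover have "(\<Sum>w\<in>?F. x U w * cell_chain w U R z) = (\<Sum>u\<in>generate G U. x U z)"
      unfolding sum.reindex[OF inj] comp_def
    proof (rule sum.cong[OF refl])
      fix u assume u: "u \<in> generate G U"
      have uW: "u \<in> W" using u US by simp
      have "inv (z \<otimes> u) \<otimes> z = inv u" using True uW by (simp add: inv_mult_group m_assoc)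
      then have "cell_chain (z \<otimes> u) U R z = eps u" using True u uW US by (simp add: cell_chain_def)
      then show "x U (z \<otimes> u) * cell_chain (z \<otimes> u) U R z = x U z" using alt_chain_alt[OF x US _ u, of z] True by (simp add: mult.commute mult.left_commute flip: mult.assoc)
    qed
    ultimately show ?thesis using True fU by simp
  qed
  then show "(\<lambda>w. x U w * cell_chain w U R z) summable_on W" "(\<Sum>\<^sub>\<infinity>w\<in>W. x U w * cell_chain w U R z) = (if R = U then par_card U * x U z else 0)" by auto
qed

text \<open>The sign of \<open>u\<close> is absorbed by the alternating \<open>x\<close>; reindexing
  by right multiplication with \<open>u\<close> then turns every inner sum into the same
  \<open>contract\<close>.\<close>

lemma infsum_comp_bdry:
  assumes x: "alt_chain {} V (Suc i) x" and l: "\<And>U. wgt_l2 q (x U)" and g: "sph_card V (Suc i) U"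
  shows "(\<lambda>w. x U w * comp_bdry contraction w U R z) summable_on W"
    "(\<Sum>\<^sub>\<infinity>w\<in>W. x U w * comp_bdry contraction w U R z) = par_card U * (\<Sum>s\<in>U. inc_sign s (U - {s}) / par_card (U - {s}) * contract (x U) (U - {s}) R z)"
proof -
  note US = sph_card_S[OF VS g] and sp = sph_card_sph[OF VS g]
  have fU: "finite (generate G U)" "finite U" using sph_fin[OF sp] by auto
  define c where "c s = inc_sign s (U - {s}) / par_card (U - {s})" for s
  define a where "a s u w = x U (w \<otimes> u) * contraction (w \<otimes> u) (U - {s}) R z" for s u w
  have e: "x U w * comp_bdry contraction w U R z = (\<Sum>s\<in>U. \<Sum>u\<in>generate G U. c s * a s u w)" if w: "w \<in> W" for w
  proof -
    have "x U w * (inc_sign s (U - {s}) / par_card (U - {s}) * (\<Sum>u\<in>generate G U. eps u * contraction (w \<otimes> u) (U - {s}) R z)) = (\<Sum>u\<in>generate G U. c s * a s u w)" for s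
      unfolding sum_distrib_left using alt_chain_alt[OF x US w] by (intro sum.cong refl) (simp add: c_def a_def mult_ac)
    then show ?thesis unfolding comp_bdry_eq[OF sp] by (simp add: sum_distrib_left)
  qed
  have as: "a s u summable_on W" and ai: "infsum (a s u) W = contract (x U) (U - {s}) R z" if s: "s \<in> U" and u: "u \<in> generate G U" for s u
  proof -
    note b = rmult_bij[OF sph_card_W[OF VS g u]]
    note K = contract_summable(1)[OF l[of U] sph_card_diff[OF VS g s], of R z]
    show "a s u summable_on W" unfolding a_def
      using summable_on_reindex_bij_betw[OF b, of "\<lambda>w. x U w * contraction w (U - {s}) R z"] K by simp
    show "infsum (a s u) W = contract (x U) (U - {s}) R z" unfolding a_def contract_def
      by (rule infsum_reindex_bij_betw[OF b, of "\<lambda>w. x U w * contraction w (U - {s}) R z"])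
  qed
  have s2: "(\<lambda>w. \<Sum>u\<in>generate G U. c s * a s u w) summable_on W"
    and i2: "infsum (\<lambda>w. \<Sum>u\<in>generate G U. c s * a s u w) W = par_card U * (c s * contract (x U) (U - {s}) R z)" if s: "s \<in> U" for s
  proof -
    have s1: "(\<lambda>w. c s * a s u w) summable_on W" if "u \<in> generate G U" for u by (rule summable_on_cmult_right[OF as[OF s that]])
    show "(\<lambda>w. \<Sum>u\<in>generate G U. c s * a s u w) summable_on W" by (rule finite_sum_summable(1)[OF fU(1) s1])
    show "infsum (\<lambda>w. \<Sum>u\<in>generate G U. c s * a s u w) W = par_card U * (c s * contract (x U) (U - {s}) R z)"
      using finite_sum_summable(2)[OF fU(1) s1] ai[OF s] by (simp add: infsum_cmult_right')
  qed
  have "(\<lambda>w. x U w * comp_bdry contraction w U R z) summable_on W \<longleftrightarrow> (\<lambda>w. \<Sum>s\<in>U. \<Sum>u\<in>generate G U. c s * a s u w) summable_on W"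
    by (rule summable_on_cong) (rule e)
  then show "(\<lambda>w. x U w * comp_bdry contraction w U R z) summable_on W" using finite_sum_summable(1)[OF fU(2) s2] by simp
  have "infsum (\<lambda>w. x U w * comp_bdry contraction w U R z) W = infsum (\<lambda>w. \<Sum>s\<in>U. \<Sum>u\<in>generate G U. c s * a s u w) W"
    by (rule infsum_cong) (rule e)
  also have "\<dots> = (\<Sum>s\<in>U. par_card U * (c s * contract (x U) (U - {s}) R z))"
    using finite_sum_summable(2)[OF fU(2) s2] i2 by simp
  finally show "(\<Sum>\<^sub>\<infinity>w\<in>W. x U w * comp_bdry contraction w U R z) = par_card U * (\<Sum>s\<in>U. inc_sign s (U - {s}) / par_card (U - {s}) * contract (x U) (U - {s}) R z)"
    by (simp add: sum_distrib_left c_def)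
qed

lemma cbdry_contract:
  assumes x: "alt_chain {} V (Suc i) x" and l: "\<And>U. wgt_l2 q (x U)" and g: "sph_card V (Suc i) U"
  shows "cbdry (contract (x U) U) R z = - (if R = U then par_card U * x U z else 0)
      - par_card U * (\<Sum>s\<in>U. inc_sign s (U - {s}) / par_card (U - {s}) * contract (x U) (U - {s}) R z)"
proof -
  have s1: "(\<lambda>w. inc_sign s R * (x U w * contraction w U (insert s R) z)) summable_on W" for s
    by (rule summable_on_cmult_right[OF contract_summable(1)[OF l g]])
  have "cbdry (contract (x U) U) R z = infsum (\<lambda>w. \<Sum>s\<in>S - R. inc_sign s R * (x U w * contraction w U (insert s R) z)) W"
    using finite_sum_summable(2)[OF _ s1, of "S - R" "\<lambda>s. s"] finS by (simp add: cbdry_def contract_def infsum_cmult_right')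
  also have "\<dots> = infsum (\<lambda>w. - (x U w * cell_chain w U R z) + - (x U w * comp_bdry contraction w U R z)) W"
  proof (rule infsum_cong)
    fix w assume w: "w \<in> W"
    have "(\<Sum>s\<in>S - R. inc_sign s R * (x U w * contraction w U (insert s R) z)) = x U w * cbdry (contraction w U) R z"
      by (simp add: cbdry_def sum_distrib_left mult.left_commute)
    then show "(\<Sum>s\<in>S - R. inc_sign s R * (x U w * contraction w U (insert s R) z)) = - (x U w * cell_chain w U R z) + - (x U w * comp_bdry contraction w U R z)"
      unfolding contraction_cbdry[OF g w] by (simp add: algebra_simps)
  qed
  also have "\<dots> = infsum (\<lambda>w. - (x U w * cell_chain w U R z)) W + infsum (\<lambda>w. - (x U w * comp_bdry contraction w U R z)) W"
    by (intro infsum_add) (simp_all add: summable_on_uminus infsum_cell_chain(1)[OF x g] infsum_comp_bdry(1)[OF x l g])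
  finally show ?thesis unfolding infsum_uminus infsum_cell_chain(2)[OF x g] infsum_comp_bdry(2)[OF x l g] by simp
qed

text \<open>The filling is the contraction of \<open>x\<close>, corrected by the sign in
  \<open>contraction_cbdry\<close> and divided by the multiplicity with which each cell is counted.
  Its boundary is \<open>x\<close> plus the contraction of \<open>cbdry x\<close>, which is
  zero.\<close>

theorem absolute_exact:
  assumes x: "alt_chain {} V (Suc j) x" and l: "\<And>U. wgt_l2 q (x U)" and z0: "cbdry x = (\<lambda>R z. 0)"
  shows "\<exists>y. alt_chain {} V (Suc (Suc j)) y \<and> (\<forall>U. wgt_l2 q (y U)) \<and> cbdry y = x"
proof -
  let ?A = "{U. sph_card V (Suc j) U}" and ?A' = "{U. sph_card V j U}"
  define y where "y = (\<lambda>R z. \<Sum>U\<in>?A. (- 1 / par_card U) * contract (x U) U R z)"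
  have fA: "finite ?A" "finite ?A'" by (rule finite_sph_card[OF VS])+
  have "alt_chain {} V (Suc (Suc j)) y" unfolding y_def by (rule alt_chain_sum) (use contract_alt_chain l in auto)
  moreover have "wgt_l2 q (y U)" for U
    using wgt_l2_sum[OF q fA(1), of "\<lambda>U'. contract (x U') U' U" "\<lambda>U'. - 1 / par_card U'"] contract_summable(2)[OF l] by (simp add: y_def)
  moreover have "cbdry y = x"
  proof (intro ext)
    fix R z
    define k where "k U U' = contract (x U) U' R z / par_card U'" for U U'
    have pos: "par_card U \<noteq> 0" if "sph_card V i U" for U i using par_card_pos[OF sph_card_sph[OF VS that]] by simp
    have "cbdry y R z = (\<Sum>U\<in>?A. (- 1 / par_card U) * cbdry (contract (x U) U) R z)" unfolding y_def cbdry_sum ..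
    also have "\<dots> = (\<Sum>U\<in>?A. (if R = U then x U z else 0) + (\<Sum>s\<in>U. inc_sign s (U - {s}) * k U (U - {s})))"
    proof (rule sum.cong[OF refl])
      fix U assume "U \<in> ?A"
      then have g: "sph_card V (Suc j) U" by simp
      show "(- 1 / par_card U) * cbdry (contract (x U) U) R z = (if R = U then x U z else 0) + (\<Sum>s\<in>U. inc_sign s (U - {s}) * k U (U - {s}))"
        unfolding cbdry_contract[OF x l g] using pos[OF g] by (simp add: k_def field_simps)
    qed
    also have "\<dots> = (\<Sum>U\<in>?A. if R = U then x U z else 0) + (\<Sum>U\<in>?A. \<Sum>s\<in>U. inc_sign s (U - {s}) * k U (U - {s}))" by (rule sum.distrib)
    also have "(\<Sum>U\<in>?A. if R = U then x U z else 0) = x R z"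
    proof (cases "R \<in> ?A")
      case False
      then have "x R z = 0" using alt_chain_chain_supp[OF x, of R z] by (auto simp: sph_card_def[OF VS])
      then show ?thesis using fA by simp
    qed (use fA in simp)
    \<comment> \<open>Summing over the faces first lets the terms at one face combine to the
      contraction of \<open>cbdry x\<close> there.\<close>
    also have "(\<Sum>U\<in>?A. \<Sum>s\<in>U. inc_sign s (U - {s}) * k U (U - {s})) = (\<Sum>U\<in>?A'. \<Sum>s\<in>S - U. inc_sign s U * k (insert s U) U)"
    proof -
      have fin: "finite U" if "sph_card V i U" for U i using sph_fin[OF sph_card_sph[OF VS that]] by simp
      let ?B = "SIGMA U:?A'. S - U"
      let ?B' = "{p \<in> ?B. sph_card V (Suc j) (insert (snd p) (fst p))}"
      have fB: "finite ?B" using fA finS by auto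
      have k0: "k (insert s U) U = 0" if "\<not> sph_card V (Suc j) (insert s U)" for s U
      proof -
        have "x (insert s U) w = 0" for w using that alt_chain_chain_supp[OF x, of "insert s U" w] by (auto simp: sph_card_def[OF VS])
        then show ?thesis by (simp add: k_def contract_def)
      qed
      have "(\<Sum>U\<in>?A. \<Sum>s\<in>U. inc_sign s (U - {s}) * k U (U - {s})) = (\<Sum>p\<in>(SIGMA U:?A. U). inc_sign (snd p) (fst p - {snd p}) * k (fst p) (fst p - {snd p}))"
        using fin by (subst sum.Sigma[OF fA(1)]) (auto simp: case_prod_unfold)
      also have "\<dots> = (\<Sum>p\<in>?B'. inc_sign (snd p) (fst p) * k (insert (snd p) (fst p)) (fst p))"
        by (rule sum.reindex_bij_witness[of _ "\<lambda>p. (insert (snd p) (fst p), snd p)" "\<lambda>p. (fst p - {snd p}, snd p)"])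
          (use sph_card_diff[OF VS] subsetD[OF sph_card_S[OF VS]] in \<open>auto simp: insert_absorb\<close>)
      also have "\<dots> = (\<Sum>p\<in>?B. inc_sign (snd p) (fst p) * k (insert (snd p) (fst p)) (fst p))"
        by (rule sum.mono_neutral_left[OF fB]) (use k0 in auto)
      also have "\<dots> = (\<Sum>U\<in>?A'. \<Sum>s\<in>S - U. inc_sign s U * k (insert s U) U)"
        using finS by (subst sum.Sigma[OF fA(2)]) (auto simp: case_prod_unfold)
      finally show ?thesis .
    qed
    also have "\<dots> = 0"
    proof (rule sum.neutral, rule ballI)
      fix U assume "U \<in> ?A'"
      then have g: "sph_card V j U" by simp
      have s1: "(\<lambda>w. inc_sign s U * (x (insert s U) w * contraction w U R z)) summable_on W" for s
        by (rule summable_on_cmult_right[OF contract_summable(1)[OF l g]])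
      have "(\<Sum>s\<in>S - U. inc_sign s U * contract (x (insert s U)) U R z) = infsum (\<lambda>w. \<Sum>s\<in>S - U. inc_sign s U * (x (insert s U) w * contraction w U R z)) W"
        using finite_sum_summable(2)[OF _ s1, of "S - U" "\<lambda>s. s"] finS by (simp add: contract_def infsum_cmult_right')
      also have "\<dots> = infsum (\<lambda>w. cbdry x U w * contraction w U R z) W"
        by (intro infsum_cong) (simp add: cbdry_def sum_distrib_right mult.assoc)
      finally show "(\<Sum>s\<in>S - U. inc_sign s U * k (insert s U) U) = 0"
        unfolding z0 by (simp add: k_def flip: sum_divide_distrib)
    qed
    finally show "cbdry y R z = x R z" by simp
  qed
  ultimately show ?thesis by blast
qed

end

end

section \<open>Relative complexes\<close>

context cox
begin

text \<open>Exactness in degree \<open>j\<close> of the quotient complex with types between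
  \<open>T\<close> and \<open>V\<close>, without any closure. Components at types that do not
  contain \<open>T\<close> are zero in the quotient and so are not compared.\<close>

definition exact :: "('a \<Rightarrow> real) \<Rightarrow> 'a set \<Rightarrow> 'a set \<Rightarrow> nat \<Rightarrow> bool" where
  "exact q T V j \<longleftrightarrow> (\<forall>x. alt_chain T V j x \<longrightarrow> (\<forall>U. wgt_l2 q (x U)) \<longrightarrow> (\<forall>R w. T \<subseteq> R \<longrightarrow> cbdry x R w = 0) \<longrightarrow>
     (\<exists>y. alt_chain T V (Suc j) y \<and> (\<forall>U. wgt_l2 q (y U)) \<and> (\<forall>R w. T \<subseteq> R \<longrightarrow> cbdry y R w = x R w)))"

definition restrict_to :: "'a set \<Rightarrow> 'a chain \<Rightarrow> 'a chain" where
  "restrict_to T x = (\<lambda>R z. if T \<subseteq> R then x R z else 0)"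

lemma restrict_to_sub [simp]: "T \<subseteq> R \<Longrightarrow> restrict_to T x R z = x R z" by (simp add: restrict_to_def)

lemma cbdry_restrict_to: "T \<subseteq> R \<Longrightarrow> cbdry (restrict_to T x) R w = cbdry x R w"
  unfolding cbdry_def by (intro sum.cong refl) (simp add: subset_insertI2)

lemma alt_chain_restrict_to: "alt_chain T' V j x \<Longrightarrow> alt_chain T V j (restrict_to T x)"
  unfolding alt_chain_def restrict_to_def by auto

lemma alt_chain_mono: "alt_chain T V j x \<Longrightarrow> T' \<subseteq> T \<Longrightarrow> V \<subseteq> V' \<Longrightarrow> alt_chain T' V' j x"
  unfolding alt_chain_def by (meson order_trans)

lemma alt_chain_restrict: assumes "alt_chain T V j x" "\<And>U w. x U w \<noteq> 0 \<Longrightarrow> U \<subseteq> V'" shows "alt_chain T V' j x"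
  using assms(1) unfolding alt_chain_def using assms(2) by simp

context
  fixes q :: "'a \<Rightarrow> real" assumes q: "multiparameter G S q"
begin

lemma wgt_l2_0: "wgt_l2 q (\<lambda>w. 0)" by (simp add: wgt_l2_def)

lemma wgt_l2_restrict_to: "(\<And>U. wgt_l2 q (x U)) \<Longrightarrow> wgt_l2 q (restrict_to T x U)"
  by (cases "T \<subseteq> U") (simp_all add: restrict_to_def wgt_l2_0)

lemma wgt_l2_diff: assumes "wgt_l2 q f" "wgt_l2 q g" shows "wgt_l2 q (\<lambda>w. f w - g w)"
  using wgt_l2_sum[OF q, of "{True, False}" "\<lambda>b. if b then f else g" "\<lambda>b. if b then 1 else - 1"] assms by simp

lemma wgt_l2_add: assumes "wgt_l2 q f" "wgt_l2 q g" shows "wgt_l2 q (\<lambda>w. f w + g w)"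
  using wgt_l2_sum[OF q, of "{True, False}" "\<lambda>b. if b then f else g" "\<lambda>b. 1"] assms by simp

lemma wgt_l2_cbdry: assumes "\<And>U. wgt_l2 q (x U)" shows "wgt_l2 q (cbdry x U)"
  unfolding cbdry_def using wgt_l2_sum[OF q, of "S - U" "\<lambda>s. x (insert s U)" "\<lambda>s. inc_sign s U"] assms finS by simp

lemma exactD:
  assumes "exact q T V j" "alt_chain T V j x" "\<And>U. wgt_l2 q (x U)" "\<And>R w. T \<subseteq> R \<Longrightarrow> cbdry x R w = 0"
  obtains y where "alt_chain T V (Suc j) y" "\<And>U. wgt_l2 q (y U)" "\<And>R w. T \<subseteq> R \<Longrightarrow> cbdry y R w = x R w"
  using assms unfolding exact_def by metis

lemma cbdry_cbdry_alt_chain: "alt_chain T V j x \<Longrightarrow> cbdry (cbdry x) R w = 0"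
  using cbdry_cbdry[of x] alt_chain_chain_supp[of T V j x] by metis

text \<open>Chains whose types avoid \<open>s\<close> form a subcomplex of the complex for
  \<open>T\<close>, with quotient the complex for \<open>insert s T\<close>. A cycle
  \<open>x\<close> of the quotient has a boundary avoiding \<open>s\<close>, one degree lower; fill
  it by \<open>y\<close> there, fill the cycle \<open>x - y\<close> by \<open>z\<close>, and drop
  from \<open>z\<close> the types without \<open>s\<close>. Each element of \<open>T\<close> thus
  costs one degree, whence \<open>card T < j\<close>.\<close>

lemma exact_convergent:
  assumes "finite T" "V \<subseteq> S" "qw G S q summable_on generate G V" "T \<subseteq> V" "card T < j"
  shows "exact q T V j"
  using assms
proof (induction T arbitrary: V j rule: finite_induct)
  case empty
  then obtain j' where j: "j = Suc j'" by (cases j) auto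
  show ?case unfolding exact_def
  proof (intro allI impI)
    fix x assume x: "alt_chain {} V j x" "\<forall>U. wgt_l2 q (x U)" "\<forall>R w. {} \<subseteq> R \<longrightarrow> cbdry x R w = 0"
    have "cbdry x = (\<lambda>R z. 0)" using x(3) by (intro ext) simp
    then obtain y where y: "alt_chain {} V (Suc (Suc j')) y" "\<forall>U. wgt_l2 q (y U)" "cbdry y = x"
      using absolute_exact[OF empty.prems(1) q empty.prems(2), of j' x] x(1,2) unfolding j by metis
    then show "\<exists>y. alt_chain {} V (Suc j) y \<and> (\<forall>U. wgt_l2 q (y U)) \<and> (\<forall>R w. {} \<subseteq> R \<longrightarrow> cbdry y R w = x R w)"
      unfolding j by (intro exI[of _ y]) simp
  qed
next
  case (insert s T)
  then obtain j' where j: "j = Suc j'" "card T < j'" by (cases j) auto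
  have sm': "qw G S q summable_on generate G (V - {s})"
    by (rule summable_on_subset[OF insert.prems(2)]) (rule par_mono, blast)
  show ?case unfolding exact_def
  proof (intro allI impI)
    fix x assume x: "alt_chain (insert s T) V j x" "\<forall>U. wgt_l2 q (x U)" "\<forall>R w. insert s T \<subseteq> R \<longrightarrow> cbdry x R w = 0"
    let ?w = "restrict_to T (cbdry x)"
    have wc: "alt_chain T (V - {s}) j' ?w"
    proof (rule alt_chain_restrict)
      show c: "alt_chain T V j' ?w" by (rule alt_chain_restrict_to[OF alt_chain_cbdry]) (use x(1) j in simp)
      fix U w assume nz: "?w U w \<noteq> 0"
      then have "s \<notin> U" using x(3) by (auto simp: restrict_to_def split: if_splits)
      then show "U \<subseteq> V - {s}" using alt_chain_chain_supp[OF c nz] by auto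
    qed
    obtain y where y: "alt_chain T (V - {s}) (Suc j') y" "\<And>U. wgt_l2 q (y U)" "\<And>R w. T \<subseteq> R \<Longrightarrow> cbdry y R w = ?w R w"
    proof (rule exactD[OF insert.IH[of "V - {s}" j'] wc])
      show "wgt_l2 q (?w U)" for U using x(2) by (intro wgt_l2_restrict_to wgt_l2_cbdry) auto
      show "cbdry ?w R w = 0" if "T \<subseteq> R" for R w using cbdry_restrict_to[OF that] cbdry_cbdry_alt_chain[OF x(1)] by simp
    qed (use insert.prems insert.hyps sm' j in auto)
    obtain z where z: "alt_chain T V (Suc (Suc j')) z" "\<And>U. wgt_l2 q (z U)" "\<And>R w. T \<subseteq> R \<Longrightarrow> cbdry z R w = x R w - y R w"
    proof (rule exactD[OF insert.IH[of V "Suc j'"]])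
      show "alt_chain T V (Suc j') (\<lambda>R w. x R w - y R w)"
        using x(1) y(1) j by (intro alt_chain_diff) (auto intro: alt_chain_mono)
      show "wgt_l2 q ((\<lambda>R w. x R w - y R w) U)" for U using x(2) y(2) by (simp add: wgt_l2_diff)
      show "cbdry (\<lambda>R w. x R w - y R w) R w = 0" if "T \<subseteq> R" for R w
        unfolding cbdry_diff using y(3)[OF that] that by simp
    qed (use insert.prems insert.hyps j in auto)
    show "\<exists>y. alt_chain (insert s T) V (Suc j) y \<and> (\<forall>U. wgt_l2 q (y U)) \<and> (\<forall>R w. insert s T \<subseteq> R \<longrightarrow> cbdry y R w = x R w)"
    proof (intro exI[of _ "restrict_to (insert s T) z"] conjI allI impI)
      show "alt_chain (insert s T) V (Suc j) (restrict_to (insert s T) z)" using alt_chain_restrict_to[OF z(1)] j by simp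
      show "wgt_l2 q (restrict_to (insert s T) z U)" for U by (rule wgt_l2_restrict_to[OF z(2)])
      fix R w assume R: "insert s T \<subseteq> R"
      have "y R w = 0" using alt_chain_chain_supp[OF y(1), of R w] R by auto
      then show "cbdry (restrict_to (insert s T) z) R w = x R w" using cbdry_restrict_to[OF R] z(3)[of R w] R by simp
    qed
  qed
qed

lemma exact_zero: assumes "\<And>x U w. alt_chain T V j x \<Longrightarrow> x U w = 0" shows "exact q T V j"
  unfolding exact_def
proof (intro allI impI)
  fix x assume "alt_chain T V j x"
  then have "x = (\<lambda>R z. 0)" using assms by (intro ext) blast
  then show "\<exists>y. alt_chain T V (Suc j) y \<and> (\<forall>U. wgt_l2 q (y U)) \<and> (\<forall>R w. T \<subseteq> R \<longrightarrow> cbdry y R w = x R w)"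
    by (intro exI[of _ "\<lambda>R z. 0"]) (simp add: alt_chain_0 wgt_l2_0)
qed

text \<open>The same short exact sequence, now used for its middle term: both neighbours are exact
  in degree \<open>j\<close>, so no degree is lost. \<open>k\<close> counts the elements still to be
  added to \<open>T\<close>; at \<open>k = 0\<close> all types lie in the star of \<open>T\<close>
  and \<open>exact_convergent\<close> applies.\<close>

lemma exact_star:
  assumes "V \<subseteq> S" "T \<subseteq> V" "card T + k < j"
    "\<And>T'. spherical G S T' \<Longrightarrow> T \<subseteq> T' \<Longrightarrow> T' \<subseteq> V \<Longrightarrow> card T' = card T + k \<Longrightarrow> qw G S q summable_on generate G (St G S T' \<inter> V)"
  shows "exact q T V j"
  using assms
proof (induction "card (V - T)" arbitrary: V T k rule: less_induct)
  case less
  have fin: "finite V" "finite T" using finite_subset[OF less.prems(1) finS] finite_subset[OF less.prems(2)] by auto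
  \<comment> \<open>Two further ends of the recursion: a nonspherical \<open>T\<close> admits no
    chains, and for \<open>V = T\<close> the only type has \<open>card T\<close> elements, too few
    for degree \<open>j\<close>.\<close>
  consider "\<not> spherical G S T" | "spherical G S T" "k = 0" | "V = T" | k' s where "k = Suc k'" "s \<in> V - T" "spherical G S T"
    using less.prems(2) not0_implies_Suc[of k] by (cases "V = T") auto
  then show ?case
  proof cases
    case 1
    show ?thesis
    proof (rule exact_zero, rule ccontr)
      fix x U w assume c: "alt_chain T V j x" "x U w \<noteq> 0"
      show False using alt_chain_chain_supp[OF c] spherical_mono[of U T] 1 by blast
    qed
  next
    case 2
    let ?V = "St G S T \<inter> V"
    have "T \<subseteq> St G S T" unfolding St_def using 2(1) sph_fin[OF 2(1)] by (intro Union_upper) simp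
    then have TS: "T \<subseteq> ?V" using less.prems(2) by simp
    have e: "exact q T ?V j"
      by (rule exact_convergent[OF fin(2)]) (use less.prems 2 TS in auto)
    show ?thesis unfolding exact_def
    proof (intro allI impI)
      fix x assume x: "alt_chain T V j x" "\<forall>U. wgt_l2 q (x U)" "\<forall>R w. T \<subseteq> R \<longrightarrow> cbdry x R w = 0"
      have x': "alt_chain T ?V j x"
      proof (rule alt_chain_restrict[OF x(1)])
        fix U w assume "x U w \<noteq> 0"
        note c = alt_chain_chain_supp[OF x(1) this]
        have "U \<union> T = U" using c by auto
        then have "U \<subseteq> St G S T" unfolding St_def using c by (intro Union_upper) simp
        then show "U \<subseteq> ?V" using c by simp
      qed
      obtain y where y: "alt_chain T ?V (Suc j) y" "\<And>U. wgt_l2 q (y U)" "\<And>R w. T \<subseteq> R \<Longrightarrow> cbdry y R w = x R w"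
        by (rule exactD[OF e x']) (use x(2,3) in auto)
      show "\<exists>y. alt_chain T V (Suc j) y \<and> (\<forall>U. wgt_l2 q (y U)) \<and> (\<forall>R w. T \<subseteq> R \<longrightarrow> cbdry y R w = x R w)"
        using alt_chain_mono[OF y(1), of T V] y(2,3) by (intro exI[of _ y]) simp
    qed
  next
    case 3
    show ?thesis
    proof (rule exact_zero, rule ccontr)
      fix x U w assume c: "alt_chain T V j x" "x U w \<noteq> 0"
      show False using alt_chain_chain_supp[OF c] 3 less.prems(3) by auto
    qed
  next
    case (4 k' s)
    let ?T = "insert s T"
    have sT: "s \<notin> T" "s \<in> V" using 4 by auto
    have cT: "card ?T = Suc (card T)" using sT fin by simp
    have cd: "card (V - ?T) < card (V - T)" "card (V - {s} - T) < card (V - T)"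
      using sT fin by (intro psubset_card_mono; blast)+
    have e1: "exact q ?T V j"
      by (rule less.hyps[OF cd(1), where k = k']) (use less.prems cT sT 4 in auto)
    have e2: "exact q T (V - {s}) j"
    proof (rule less.hyps[OF cd(2), where k = k])
      fix T' assume "spherical G S T'" "T \<subseteq> T'" "T' \<subseteq> V - {s}" "card T' = card T + k"
      then have "qw G S q summable_on generate G (St G S T' \<inter> V)" using less.prems(4) by blast
      then show "qw G S q summable_on generate G (St G S T' \<inter> (V - {s}))"
        by (rule summable_on_subset) (rule par_mono, blast)
    qed (use less.prems sT in auto)
    show ?thesis unfolding exact_def
    proof (intro allI impI)
      fix x assume x: "alt_chain T V j x" "\<forall>U. wgt_l2 q (x U)" "\<forall>R w. T \<subseteq> R \<longrightarrow> cbdry x R w = 0"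
      obtain y where y: "alt_chain ?T V (Suc j) y" "\<And>U. wgt_l2 q (y U)" "\<And>R w. ?T \<subseteq> R \<Longrightarrow> cbdry y R w = restrict_to ?T x R w"
      proof (rule exactD[OF e1 alt_chain_restrict_to[OF x(1)]])
        show "wgt_l2 q (restrict_to ?T x U)" for U using x(2) by (intro wgt_l2_restrict_to) simp
        show "cbdry (restrict_to ?T x) R w = 0" if "?T \<subseteq> R" for R w using cbdry_restrict_to[OF that] x(3) that by simp
      qed auto
      \<comment> \<open>Subtracting the boundary of \<open>y\<close> removes all types that contain
        \<open>s\<close>; the rest is a cycle of the subcomplex.\<close>
      let ?x = "\<lambda>R z. x R z - restrict_to T (cbdry y) R z"
      have cx: "alt_chain T (V - {s}) j ?x"
      proof (rule alt_chain_restrict)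
        show c: "alt_chain T V j ?x" by (rule alt_chain_diff[OF x(1) alt_chain_restrict_to[OF alt_chain_cbdry[OF y(1)]]])
        fix U w assume nz: "?x U w \<noteq> 0"
        note cs = alt_chain_chain_supp[OF c nz]
        have "s \<notin> U" using nz y(3)[of U w] cs by auto
        then show "U \<subseteq> V - {s}" using cs by auto
      qed
      obtain z where z: "alt_chain T (V - {s}) (Suc j) z" "\<And>U. wgt_l2 q (z U)" "\<And>R w. T \<subseteq> R \<Longrightarrow> cbdry z R w = ?x R w"
      proof (rule exactD[OF e2 cx])
        show "wgt_l2 q (?x U)" for U using x(2) y(2) by (intro wgt_l2_diff wgt_l2_restrict_to wgt_l2_cbdry) auto
        show "cbdry ?x R w = 0" if "T \<subseteq> R" for R w
          unfolding cbdry_diff cbdry_restrict_to[OF that] using x(3) cbdry_cbdry_alt_chain[OF y(1)] that by simp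
      qed auto
      show "\<exists>y. alt_chain T V (Suc j) y \<and> (\<forall>U. wgt_l2 q (y U)) \<and> (\<forall>R w. T \<subseteq> R \<longrightarrow> cbdry y R w = x R w)"
      proof (intro exI[of _ "\<lambda>R w. y R w + z R w"] conjI allI impI)
        show "alt_chain T V (Suc j) (\<lambda>R w. y R w + z R w)"
          using alt_chain_mono[OF y(1), of T V] alt_chain_mono[OF z(1), of T V] by (intro alt_chain_add) auto
        show "wgt_l2 q (\<lambda>w. y U w + z U w)" for U by (rule wgt_l2_add[OF y(2) z(2)])
        show "cbdry (\<lambda>R w. y R w + z R w) R w = x R w" if "T \<subseteq> R" for R w
          unfolding cbdry_add z(3)[OF that] using that by simp
      qed
    qed
  qed
qed

lemma summable_on_finite_UN:
  fixes f :: "'b \<Rightarrow> real"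
  assumes "finite I" "\<And>i. i \<in> I \<Longrightarrow> f summable_on A i" shows "f summable_on (\<Union>i\<in>I. A i)"
  using assms by (induction I rule: finite_induct) (auto intro: summable_on_union)

section \<open>Cellular chains\<close>

abbreviation par_coset :: "'a \<Rightarrow> 'a set \<Rightarrow> 'a set" where "par_coset w U \<equiv> l_coset G w (generate G U)"

lemma par_coset_iff: "v \<in> par_coset w U \<longleftrightarrow> (\<exists>u\<in>generate G U. v = w \<otimes> u)" by (auto simp: l_coset_def)

lemma par_coset_self: "w \<in> W \<Longrightarrow> w \<in> par_coset w U" unfolding par_coset_iff by (rule bexI[of _ \<one>]) auto

lemma par_coset_mult: assumes "w \<in> W" "U \<subseteq> S" "u \<in> generate G U" shows "par_coset (w \<otimes> u) U = par_coset w U"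
proof -
  have uW: "u \<in> W" using assms by simp
  have "v \<in> par_coset (w \<otimes> u) U \<longleftrightarrow> v \<in> par_coset w U" for v
  proof
    assume "v \<in> par_coset (w \<otimes> u) U"
    then obtain t where "t \<in> generate G U" "v = w \<otimes> u \<otimes> t" unfolding par_coset_iff by blast
    then show "v \<in> par_coset w U" unfolding par_coset_iff using assms uW by (intro bexI[of _ "u \<otimes> t"]) (auto simp: m_assoc)
  next
    assume "v \<in> par_coset w U"
    then obtain t where t: "t \<in> generate G U" "v = w \<otimes> t" unfolding par_coset_iff by blast
    have "t \<in> W" using t assms by simp
    then have "w \<otimes> u \<otimes> (inv u \<otimes> t) = v" using t assms uW by (simp add: m_assoc flip: m_assoc[of u "inv u" t])
    then show "v \<in> par_coset (w \<otimes> u) U" unfolding par_coset_iff using assms t by (intro bexI[of _ "inv u \<otimes> t"]) auto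
  qed
  then show ?thesis by blast
qed

lemma par_coset_min_rep: "w \<in> W \<Longrightarrow> U \<subseteq> S \<Longrightarrow> par_coset (min_rep U w) U = par_coset w U"
  using par_coset_mult[of "min_rep U w" U "par_part U w"] par_part[of w U] min_rep[of w U] by simp

text \<open>Lengths add over a coset of \<open>W_U\<close>, so an element as short as the
  representative has trivial component in \<open>W_U\<close>. Hence the choice by length in
  \<open>minrep\<close> has a unique outcome.\<close>

lemma minrep_cos: assumes w: "w \<in> W" and U: "U \<subseteq> S" shows "minrep G S (par_coset w U) = min_rep U w"
  unfolding minrep_def
proof (rule some_equality)
  have a: "len (min_rep U w) \<le> len v" if "v \<in> par_coset w U" for v
  proof -
    obtain u where u: "u \<in> generate G U" "v = w \<otimes> u" using \<open>v \<in> par_coset w U\<close> unfolding par_coset_iff by blast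
    then have "len v = len (min_rep U v) + len (par_part U v)" "min_rep U v = min_rep U w" using par_part(3)[of v U] min_rep_mult(1)[OF w U u(1)] w U by auto
    then show ?thesis by simp
  qed
  have b: "min_rep U w \<in> par_coset w U" using par_coset_min_rep[OF w U] par_coset_self[OF min_rep(3)[OF w U], of U] by simp
  show "min_rep U w \<in> par_coset w U \<and> (\<forall>v\<in>par_coset w U. len (min_rep U w) \<le> len v)" using a b by blast
  fix v assume v: "v \<in> par_coset w U \<and> (\<forall>t\<in>par_coset w U. len v \<le> len t)"
  then obtain u where u: "u \<in> generate G U" "v = w \<otimes> u" unfolding par_coset_iff by blast
  have vW: "v \<in> W" using u w U by simp
  have m: "min_rep U v = min_rep U w" using min_rep_mult(1)[OF w U u(1)] u by simp
  have "len v \<le> len (min_rep U w)" using v b by blast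
  then have "len (par_part U v) = 0" using par_part(3)[OF vW U] m by simp
  then have "par_part U v = \<one>" using len_0[OF par_part(4)[OF vW U]] by simp
  then show "v = min_rep U w" using par_part(2)[OF vW U] m min_rep(3)[OF w U] by simp
qed

lemma cells_iff: "(C, U) \<in> davis_cells G S i \<longleftrightarrow> spherical G S U \<and> card U = i \<and> (\<exists>w\<in>W. C = par_coset w U)"
  unfolding davis_cells_def by auto

lemma par_coset_cell: "w \<in> W \<Longrightarrow> spherical G S U \<Longrightarrow> (par_coset w U, U) \<in> davis_cells G S (card U)"
  unfolding cells_iff by blast

lemma cell_measure_cos: "w \<in> W \<Longrightarrow> U \<subseteq> S \<Longrightarrow> cell_measure G S q (par_coset w U, U) = qw G S q (min_rep U w)"
  by (simp add: cell_measure_def minrep_cos)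

definition cell_supp :: "nat \<Rightarrow> ('a cell \<Rightarrow> real) \<Rightarrow> bool" where
  "cell_supp j g \<longleftrightarrow> (\<forall>\<sigma>. \<sigma> \<notin> davis_cells G S j \<longrightarrow> g \<sigma> = 0)"

text \<open>The factor \<open>qw G S q (min_rep U w)\<close> absorbs the weights in the boundary map.\<close>

definition group_chain :: "('a cell \<Rightarrow> real) \<Rightarrow> 'a chain" where
  "group_chain g = (\<lambda>U w. if w \<in> W \<and> spherical G S U then eps (par_part U w) * qw G S q (min_rep U w) * g (par_coset w U, U) else 0)"

lemma group_chain_alt_chain: assumes g: "cell_supp j g" shows "alt_chain {} S j (group_chain g)"
  unfolding alt_chain_def
proof (intro conjI allI impI)
  fix U w assume nz: "group_chain g U w \<noteq> 0"
  then have a: "w \<in> W" "spherical G S U" "g (par_coset w U, U) \<noteq> 0" by (auto simp: group_chain_def split: if_splits)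
  then have "(par_coset w U, U) \<in> davis_cells G S j" using g unfolding cell_supp_def by blast
  then show "{} \<subseteq> U" "U \<subseteq> S" "spherical G S U" "card U = j" "w \<in> W" using a unfolding cells_iff by (auto simp: spherical_def)
next
  fix U w u assume u: "U \<subseteq> S" "w \<in> W" "u \<in> generate G U"
  have uW: "u \<in> W" using u by simp
  show "group_chain g U (w \<otimes> u) = eps u * group_chain g U w"
    using min_rep_mult[OF u(2,1,3)] par_coset_mult[OF u(2,1,3)] eps_mult[OF par_part(4)[OF u(2,1)] uW] u uW by (simp add: group_chain_def)
qed

text \<open>The cofaces of the cell at \<open>w\<close> correspond to the \<open>s\<close> that keep
  the type spherical. The length sign in the incidence number is the product of the signs of the two
  shortest representatives, which is exactly what exchanges the signs of the two components of
  \<open>w\<close>; the cell measures are absorbed by the factor in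
  \<open>group_chain\<close>.\<close>

lemma group_chain_bdry:
  assumes w: "w \<in> W" and R: "spherical G S R"
  shows "cbdry (group_chain g) R w = eps (par_part R w) * qw G S q (min_rep R w) * bdry_q G S q (Suc (card R)) g (par_coset w R, R)"
proof -
  have RS: "R \<subseteq> S" "finite R" using sph_fin[OF R] by auto
  let ?X = "{s \<in> S - R. spherical G S (insert s R)}"
  define f where "f s = (par_coset w (insert s R), insert s R)" for s
  have fX: "{\<sigma> \<in> davis_cells G S (Suc (card R)). par_coset w R \<subseteq> fst \<sigma> \<and> R \<subseteq> snd \<sigma>} = f ` ?X" (is "?L = _")
  proof (intro equalityI subsetI)
    fix \<sigma> assume "\<sigma> \<in> ?L"
    then obtain C U where \<sigma>: "\<sigma> = (C, U)" "(C, U) \<in> davis_cells G S (Suc (card R))" "par_coset w R \<subseteq> C" "R \<subseteq> U" by (cases \<sigma>) auto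
    then obtain v where v: "spherical G S U" "card U = Suc (card R)" "v \<in> W" "C = par_coset v U" unfolding cells_iff by blast
    have US: "U \<subseteq> S" "finite U" using sph_fin[OF v(1)] by auto
    have "card (U - R) = 1" using v(2) \<sigma>(4) RS by (simp add: card_Diff_subset)
    then obtain s where s: "U - R = {s}" using card_1_singletonE by blast
    then have U: "U = insert s R" "s \<in> S - R" using \<sigma>(4) US by auto
    have "w \<in> par_coset v U" using \<sigma>(3) v(4) par_coset_self[OF w] by blast
    then obtain u where "u \<in> generate G U" "w = v \<otimes> u" unfolding par_coset_iff by blast
    then have "C = par_coset w U" using par_coset_mult[OF v(3) US(1)] v(4) by simp
    then show "\<sigma> \<in> f ` ?X" using U \<sigma>(1) v(1) by (intro image_eqI[of _ _ s]) (auto simp: f_def)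
  next
    fix \<sigma> assume "\<sigma> \<in> f ` ?X"
    then obtain s where s: "s \<in> S - R" "spherical G S (insert s R)" "\<sigma> = f s" by auto
    have "par_coset w R \<subseteq> par_coset w (insert s R)" unfolding l_coset_def using par_mono[of R "insert s R"] by blast
    then show "\<sigma> \<in> ?L" using s RS par_coset_cell[OF w s(2)] by (auto simp: f_def)
  qed
  have inj: "inj_on f ?X" by (rule inj_onI) (auto simp: f_def)
  have t: "eps (par_part R w) * qw G S q (min_rep R w) * (incidence G S (f s) (par_coset w R, R) * g (f s) * cell_measure G S q (f s) / cell_measure G S q (par_coset w R, R))
       = inc_sign s R * group_chain g (insert s R) w" if s: "s \<in> ?X" for s
  proof -
    let ?U = "insert s R"
    have US: "?U \<subseteq> S" using s RS by auto
    have d: "?U - R = {s}" using s by auto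
    have sub: "par_coset w R \<subseteq> par_coset w ?U" unfolding l_coset_def using par_mono[of R ?U] by blast
    have "{t \<in> ?U. cox_enum S t < cox_enum S s} = {t \<in> R. gen_rank t < gen_rank s}" by (auto simp: gen_rank_def)
    then have inc: "incidence G S (f s) (par_coset w R, R) = inc_sign s R * eps (inv (min_rep ?U w) \<otimes> min_rep R w)"
      using sub d by (simp add: incidence_def f_def minrep_cos[OF w US] minrep_cos[OF w RS(1)] inc_sign_def eps_def subset_insertI)
    note c = min_rep(3)[OF w US] min_rep(3)[OF w RS(1)] par_part(4)[OF w US] par_part(4)[OF w RS(1)]
    have e1: "eps (inv (min_rep ?U w) \<otimes> min_rep R w) = eps (min_rep ?U w) * eps (min_rep R w)" using c by (simp add: eps_mult)
    have e2: "eps w = eps (min_rep ?U w) * eps (par_part ?U w)" using eps_mult[OF c(1,3)] par_part(2)[OF w US] by simp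
    have e3: "eps w = eps (min_rep R w) * eps (par_part R w)" using eps_mult[OF c(2,4)] par_part(2)[OF w RS(1)] by simp
    have "eps (min_rep R w) * eps (par_part R w) * eps (min_rep ?U w) = eps (min_rep ?U w) * eps (min_rep ?U w) * eps (par_part ?U w)" using e2 e3 by simp
    then have e: "eps (par_part R w) * (eps (min_rep ?U w) * eps (min_rep R w)) = eps (par_part ?U w)" by (simp add: mult_ac)
    have p: "qw G S q (min_rep R w) \<noteq> 0" using qw_pos[OF q c(2)] by simp
    have "eps (par_part R w) * qw G S q (min_rep R w) * (incidence G S (f s) (par_coset w R, R) * g (f s) * cell_measure G S q (f s) / cell_measure G S q (par_coset w R, R))
       = inc_sign s R * (eps (par_part R w) * (eps (min_rep ?U w) * eps (min_rep R w))) * g (f s) * qw G S q (min_rep ?U w)"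
      unfolding inc e1 using p by (simp add: f_def cell_measure_cos[OF w US] cell_measure_cos[OF w RS(1)])
    also have "\<dots> = inc_sign s R * group_chain g ?U w" unfolding e using s w by (simp add: group_chain_def f_def mult_ac)
    finally show ?thesis .
  qed
  have "bdry_q G S q (Suc (card R)) g (par_coset w R, R) =
      (\<Sum>s\<in>?X. incidence G S (f s) (par_coset w R, R) * g (f s) * cell_measure G S q (f s) / cell_measure G S q (par_coset w R, R))"
  proof -
    have "1 \<le> Suc (card R) \<and> (par_coset w R, R) \<in> davis_cells G S (Suc (card R) - 1)" using par_coset_cell[OF w R] by simp
    then show ?thesis unfolding bdry_q_def by (simp only: fX sum.reindex[OF inj] fst_conv snd_conv comp_def if_True simp_thms)
  qed
  then have "eps (par_part R w) * qw G S q (min_rep R w) * bdry_q G S q (Suc (card R)) g (par_coset w R, R) = (\<Sum>s\<in>?X. inc_sign s R * group_chain g (insert s R) w)"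
    using t by (simp add: sum_distrib_left)
  also have "\<dots> = (\<Sum>s\<in>S - R. inc_sign s R * group_chain g (insert s R) w)"
    by (rule sum.mono_neutral_left) (use finS in \<open>auto simp: group_chain_def\<close>)
  finally show ?thesis by (simp add: cbdry_def)
qed

lemma bdry_chain_supp: "cell_supp i (bdry_q G S q (Suc i) g)" by (simp add: cell_supp_def bdry_q_def)

lemma group_chain_bdry_q:
  assumes g: "cell_supp (Suc i) g" shows "group_chain (bdry_q G S q (Suc i) g) = cbdry (group_chain g)"
proof (intro ext)
  fix R w
  show "group_chain (bdry_q G S q (Suc i) g) R w = cbdry (group_chain g) R w"
  proof (cases "w \<in> W \<and> spherical G S R \<and> card R = i")
    case True
    then show ?thesis using group_chain_bdry[of w R g] by (auto simp: group_chain_def)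
  next
    case False
    have "cbdry (group_chain g) R w = 0" using alt_chain_chain_supp[OF alt_chain_cbdry[OF group_chain_alt_chain[OF g]], where U = R and w = w] False by blast
    moreover have "group_chain (bdry_q G S q (Suc i) g) R w = 0"
      using alt_chain_chain_supp[OF group_chain_alt_chain[OF bdry_chain_supp], where U = R and w = w] False by blast
    ultimately show ?thesis by simp
  qed
qed

lemma group_chain_inj:
  assumes "cell_supp i f" "cell_supp i g" "group_chain f = group_chain g"
  shows "f = g"
proof (intro ext)
  fix \<sigma>
  show "f \<sigma> = g \<sigma>"
  proof (cases "\<sigma> \<in> davis_cells G S i")
    case True
    then obtain w U where s: "\<sigma> = (par_coset w U, U)" "w \<in> W" "spherical G S U" by (cases \<sigma>) (auto simp: cells_iff)
    have "qw G S q (min_rep U w) \<noteq> 0" "eps (par_part U w) \<noteq> 0"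
      using qw_pos[OF q min_rep(3)[OF s(2)], of U] sph_fin[OF s(3)] by (auto simp: eps_def)
    then show ?thesis using fun_cong[OF fun_cong[OF assms(3)], of U w] s by (simp add: group_chain_def)
  qed (metis assms(1,2) cell_supp_def)
qed

lemma group_chain_surj:
  assumes x: "alt_chain {} S j x"
  shows "\<exists>g. cell_supp j g \<and> group_chain g = x"
proof -
  define g where "g \<sigma> = (if \<sigma> \<in> davis_cells G S j then x (snd \<sigma>) (minrep G S (fst \<sigma>)) / qw G S q (minrep G S (fst \<sigma>)) else 0)" for \<sigma>
  have "group_chain g = x"
  proof (intro ext)
    fix U w
    show "group_chain g U w = x U w"
    proof (cases "w \<in> W \<and> spherical G S U \<and> card U = j")
      case False
      have "cell_supp j g" by (simp add: g_def cell_supp_def)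
      from alt_chain_chain_supp[OF group_chain_alt_chain[OF this], where U = U and w = w] have "group_chain g U w = 0" using False by blast
      moreover have "x U w = 0" using alt_chain_chain_supp[OF x, of U w] False by blast
      ultimately show ?thesis by simp
    next
      case True
      then have wU: "w \<in> W" "U \<subseteq> S" using sph_fin by auto
      have p: "qw G S q (min_rep U w) \<noteq> 0" using qw_pos[OF q min_rep(3)[OF wU]] by simp
      have c: "(par_coset w U, U) \<in> davis_cells G S j" using True par_coset_cell[of w U] by blast
      have "group_chain g U w = eps (par_part U w) * x U (min_rep U w)"
        unfolding group_chain_def g_def using True c p by (simp add: minrep_cos[OF wU])
      also have "\<dots> = x U w" using alt_chain_alt[OF x wU(2) min_rep(3)[OF wU] par_part(1)[OF wU]] par_part(2)[OF wU] by simp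
      finally show ?thesis .
    qed
  qed
  then show ?thesis by (intro exI[of _ g]) (simp add: g_def cell_supp_def)
qed

lemma is_min_cos: assumes "is_min U m" "U \<subseteq> S" shows "min_rep U m = m" "par_part U m = \<one>" "m \<in> W"
  using min_rep_unique[OF assms(1) par_one assms(2)] assms by (auto simp: is_min_def)

lemma inj_min: assumes "U \<subseteq> S" shows "inj_on (\<lambda>m. (par_coset m U, U)) {m. is_min U m}"
proof (rule inj_onI)
  fix m n assume "m \<in> {m. is_min U m}" "n \<in> {m. is_min U m}" and e: "(par_coset m U, U) = (par_coset n U, U)"
  then have "is_min U m" "is_min U n" by auto
  note m = is_min_cos[OF this(1) assms] and n = is_min_cos[OF this(2) assms]
  have "minrep G S (par_coset m U) = minrep G S (par_coset n U)" using e by simp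
  then show "m = n" unfolding minrep_cos[OF m(3) assms] minrep_cos[OF n(3) assms] m(1) n(1) .
qed

text \<open>\<open>W\<close> is covered by the right translates, by elements \<open>u\<close> of
  \<open>W_U\<close>, of the set of shortest representatives \<open>m\<close>. On one translate the
  squared factor \<open>q_m\<close> divided by \<open>q_m q_u\<close> leaves the cell measure
  \<open>q_m\<close> up to the constant \<open>1 / q_u\<close>, and there are finitely many
  \<open>u\<close>.\<close>

lemma l2_group_chain: assumes "f \<in> l2_chains G S q j" shows "wgt_l2 q (group_chain f U)"
proof (cases "spherical G S U \<and> card U = j")
  case False
  have l2s: "cell_supp j f" using assms by (simp add: l2_chains_def cell_supp_def)
  have "group_chain f U = (\<lambda>w. 0)" using alt_chain_chain_supp[OF group_chain_alt_chain[OF l2s], where U = U] False by (intro ext) blast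
  then show ?thesis by (simp add: wgt_l2_0)
next
  case True
  have US: "U \<subseteq> S" and fU: "finite (generate G U)" using sph_fin True by auto
  let ?M = "{m. is_min U m}"
  let ?h = "\<lambda>w. (group_chain f U w)\<^sup>2 / qw G S q w"
  have W: "W \<subseteq> (\<Union>u\<in>generate G U. (\<lambda>m. m \<otimes> u) ` ?M)"
  proof
    fix w assume w: "w \<in> W"
    show "w \<in> (\<Union>u\<in>generate G U. (\<lambda>m. m \<otimes> u) ` ?M)"
      by (rule UN_I[OF par_part(1)[OF w US]], rule image_eqI[of _ _ "min_rep U w"]) (use par_part(2)[OF w US] min_rep(1)[OF w US] in auto)
  qed
  have "?h summable_on (\<Union>u\<in>generate G U. (\<lambda>m. m \<otimes> u) ` ?M)"
  proof (rule summable_on_finite_UN[OF fU])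
    fix u assume u: "u \<in> generate G U"
    have uW: "u \<in> W" using u US by simp
    have inj: "inj_on (\<lambda>m. m \<otimes> u) ?M" by (rule inj_onI) (use uW is_min_cos(3)[OF _ US] in auto)
    have "(\<lambda>\<sigma>. (f \<sigma>)\<^sup>2 * cell_measure G S q \<sigma>) summable_on (\<lambda>m. (par_coset m U, U)) ` ?M"
      by (rule summable_on_subset[of _ "davis_cells G S j"])
        (use assms True par_coset_cell is_min_cos(3)[OF _ US] in \<open>auto simp: l2_chains_def\<close>)
    then have "((\<lambda>\<sigma>. (f \<sigma>)\<^sup>2 * cell_measure G S q \<sigma>) \<circ> (\<lambda>m. (par_coset m U, U))) summable_on ?M"
      using summable_on_reindex[OF inj_min[OF US]] by blast
    then have "(\<lambda>m. (1 / qw G S q u) * ((\<lambda>\<sigma>. (f \<sigma>)\<^sup>2 * cell_measure G S q \<sigma>) \<circ> (\<lambda>m. (par_coset m U, U))) m) summable_on ?M"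
      by (rule summable_on_cmult_right)
    also have "?this \<longleftrightarrow> (?h \<circ> (\<lambda>m. m \<otimes> u)) summable_on ?M"
    proof (rule summable_on_cong)
      fix m assume "m \<in> ?M"
      then have m: "is_min U m" by simp
      note mm = is_min_cos[OF m US]
      have "min_rep U (m \<otimes> u) = m" "par_part U (m \<otimes> u) = u" using min_rep_unique[OF m u US] by auto
      then have P: "group_chain f U (m \<otimes> u) = eps u * qw G S q m * f (par_coset m U, U)"
        using True mm uW par_coset_mult[OF mm(3) US u] by (simp add: group_chain_def)
      have "(eps u)\<^sup>2 = 1" by (simp add: power2_eq_square)
      moreover have "qw G S q (m \<otimes> u) = qw G S q m * qw G S q u"
        using qw_mult[OF q mm(3) uW is_min_len[OF m US u]] .
      ultimately show "(1 / qw G S q u) * ((\<lambda>\<sigma>. (f \<sigma>)\<^sup>2 * cell_measure G S q \<sigma>) \<circ> (\<lambda>m. (par_coset m U, U))) m = (?h \<circ> (\<lambda>m. m \<otimes> u)) m"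
        using qw_pos[OF q mm(3)] qw_pos[OF q uW] unfolding comp_def P cell_measure_cos[OF mm(3) US] mm(1)
        by (simp add: power_mult_distrib power2_eq_square field_simps)
    qed
    finally show "?h summable_on (\<lambda>m. m \<otimes> u) ` ?M" using summable_on_reindex[OF inj] by blast
  qed
  then show ?thesis unfolding wgt_l2_def by (rule summable_on_subset[OF _ W])
qed

text \<open>On shortest representatives the two weighted squares coincide, and these represent all
  cells of the finitely many types.\<close>

lemma group_chain_l2:
  assumes "cell_supp j f" "\<And>U. wgt_l2 q (group_chain f U)" shows "f \<in> l2_chains G S q j"
proof -
  let ?I = "{U. spherical G S U \<and> card U = j}"
  let ?h = "\<lambda>\<sigma>. (f \<sigma>)\<^sup>2 * cell_measure G S q \<sigma>"
  have fI: "finite ?I" by (rule finite_subset[of _ "Pow S"]) (use finS in \<open>auto simp: spherical_def\<close>)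
  have sub: "davis_cells G S j \<subseteq> (\<Union>U\<in>?I. (\<lambda>m. (par_coset m U, U)) ` {m. is_min U m})"
  proof
    fix \<sigma> assume "\<sigma> \<in> davis_cells G S j"
    then obtain w U where s: "\<sigma> = (par_coset w U, U)" "w \<in> W" "spherical G S U" "card U = j" by (cases \<sigma>) (auto simp: cells_iff)
    have US: "U \<subseteq> S" using s sph_fin by blast
    show "\<sigma> \<in> (\<Union>U\<in>?I. (\<lambda>m. (par_coset m U, U)) ` {m. is_min U m})"
      by (rule UN_I[of U], use s in simp, rule image_eqI[of _ _ "min_rep U w"])
        (use s min_rep(1)[OF s(2) US] par_coset_min_rep[OF s(2) US] in auto)
  qed
  have "?h summable_on (\<Union>U\<in>?I. (\<lambda>m. (par_coset m U, U)) ` {m. is_min U m})"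
  proof (rule summable_on_finite_UN[OF fI])
    fix U assume U: "U \<in> ?I"
    then have US: "U \<subseteq> S" using sph_fin by auto
    have "(\<lambda>w. (group_chain f U w)\<^sup>2 / qw G S q w) summable_on {m. is_min U m}"
      by (rule summable_on_subset[OF assms(2)[unfolded wgt_l2_def]]) (auto simp: is_min_def)
    also have "?this \<longleftrightarrow> (?h \<circ> (\<lambda>m. (par_coset m U, U))) summable_on {m. is_min U m}"
    proof (rule summable_on_cong)
      fix m assume "m \<in> {m. is_min U m}"
      then have m: "is_min U m" by simp
      note mm = is_min_cos[OF m US]
      show "(group_chain f U m)\<^sup>2 / qw G S q m = (?h \<circ> (\<lambda>m. (par_coset m U, U))) m"
        using qw_pos[OF q mm(3)] U mm by (simp add: group_chain_def cell_measure_cos[OF mm(3) US] power2_eq_square)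
    qed
    finally show "?h summable_on (\<lambda>m. (par_coset m U, U)) ` {m. is_min U m}" using summable_on_reindex[OF inj_min[OF US]] by blast
  qed
  then have "?h summable_on davis_cells G S j" by (rule summable_on_subset[OF _ sub])
  then show ?thesis using assms(1) by (simp add: l2_chains_def cell_supp_def)
qed

section \<open>Boundaries and closures of square-summable chains\<close>

lemma l2_chain_supp: "f \<in> l2_chains G S q j \<Longrightarrow> cell_supp j f" by (simp add: l2_chains_def cell_supp_def)

lemma cell_measure_pos: "\<sigma> \<in> davis_cells G S j \<Longrightarrow> 0 < cell_measure G S q \<sigma>"
proof -
  assume "\<sigma> \<in> davis_cells G S j"
  then obtain w U where s: "\<sigma> = (par_coset w U, U)" "w \<in> W" "spherical G S U" by (cases \<sigma>) (auto simp: cells_iff)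
  have US: "U \<subseteq> S" using s sph_fin by blast
  show ?thesis unfolding s(1) cell_measure_cos[OF s(2) US] by (rule qw_pos[OF q min_rep(3)[OF s(2) US]])
qed

lemma l2_bdry: assumes "f \<in> l2_chains G S q (Suc j)" shows "bdry_q G S q (Suc j) f \<in> l2_chains G S q j"
proof (rule group_chain_l2[OF bdry_chain_supp])
  fix U show "wgt_l2 q (group_chain (bdry_q G S q (Suc j) f) U)"
    unfolding group_chain_bdry_q[OF l2_chain_supp[OF assms]] by (rule wgt_l2_cbdry[OF l2_group_chain[OF assms]])
qed

lemma l2_diff: assumes "f \<in> l2_chains G S q j" "g \<in> l2_chains G S q j" shows "(\<lambda>\<sigma>. f \<sigma> - g \<sigma>) \<in> l2_chains G S q j"
proof (rule group_chain_l2)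
  have "group_chain (\<lambda>\<sigma>. f \<sigma> - g \<sigma>) U = (\<lambda>w. group_chain f U w - group_chain g U w)" for U by (auto simp: group_chain_def algebra_simps)
  then show "wgt_l2 q (group_chain (\<lambda>\<sigma>. f \<sigma> - g \<sigma>) U)" for U using l2_group_chain[OF assms(1)] l2_group_chain[OF assms(2)] by (simp add: wgt_l2_diff)
qed (use l2_chain_supp[OF assms(1)] l2_chain_supp[OF assms(2)] in \<open>simp add: cell_supp_def\<close>)

lemma bdry_bdry: assumes "f \<in> l2_chains G S q (Suc (Suc j))"
  shows "bdry_q G S q (Suc j) (bdry_q G S q (Suc (Suc j)) f) = (\<lambda>_. 0)"
proof (rule group_chain_inj[of j])
  have "group_chain (bdry_q G S q (Suc j) (bdry_q G S q (Suc (Suc j)) f)) = cbdry (cbdry (group_chain f))"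
    using group_chain_bdry_q[OF bdry_chain_supp, of j] group_chain_bdry_q[OF l2_chain_supp[OF assms]] by simp
  also have "\<dots> = group_chain (\<lambda>_. 0)" using cbdry_cbdry_alt_chain[OF group_chain_alt_chain[OF l2_chain_supp[OF assms]]] by (intro ext) (simp add: group_chain_def)
  finally show "group_chain (bdry_q G S q (Suc j) (bdry_q G S q (Suc (Suc j)) f)) = group_chain (\<lambda>_. 0)" .
qed (simp_all add: bdry_chain_supp, simp add: cell_supp_def)

lemma bdry_diff: "bdry_q G S q i (\<lambda>\<sigma>. f \<sigma> - g \<sigma>) \<tau> = bdry_q G S q i f \<tau> - bdry_q G S q i g \<tau>"
  unfolding bdry_q_def by (auto simp: algebra_simps diff_divide_distrib sum_subtractf)

lemma l2_norm_coord: assumes "h \<in> l2_chains G S q i" "\<sigma> \<in> davis_cells G S i"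
  shows "\<bar>h \<sigma>\<bar> * sqrt (cell_measure G S q \<sigma>) \<le> l2_norm G S q i h"
proof -
  have "(\<Sum>\<sigma>\<in>{\<sigma>}. (h \<sigma>)\<^sup>2 * cell_measure G S q \<sigma>) \<le> (\<Sum>\<^sub>\<infinity>\<sigma>\<in>davis_cells G S i. (h \<sigma>)\<^sup>2 * cell_measure G S q \<sigma>)"
    by (rule finite_sum_le_infsum) (use assms cell_measure_pos in \<open>auto simp: l2_chains_def less_imp_le\<close>)
  then have "sqrt ((h \<sigma>)\<^sup>2 * cell_measure G S q \<sigma>) \<le> l2_norm G S q i h" unfolding l2_norm_def by (intro real_sqrt_le_mono) simp
  then show ?thesis by (simp add: real_sqrt_mult)
qed

text \<open>Every coordinate of the boundary is bounded by a constant \<open>K\<close> times the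
  norm. It vanishes on boundaries, hence on their closure, which gives the inclusion of the closure
  in the cycles.\<close>

lemma bdry_closed:
  assumes g: "g \<in> l2_chains G S q (Suc i)"
    and a: "\<And>e. 0 < e \<Longrightarrow> \<exists>b\<in>l2_chains G S q (Suc (Suc i)). l2_norm G S q (Suc i) (\<lambda>\<sigma>. g \<sigma> - bdry_q G S q (Suc (Suc i)) b \<sigma>) < e"
  shows "bdry_q G S q (Suc i) g = (\<lambda>_. 0)"
proof (intro ext)
  fix \<tau>
  show "bdry_q G S q (Suc i) g \<tau> = 0"
  proof (cases "\<tau> \<in> davis_cells G S i")
    case True
    let ?X = "{\<sigma> \<in> davis_cells G S (Suc i). fst \<tau> \<subseteq> fst \<sigma> \<and> snd \<tau> \<subseteq> snd \<sigma>}"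
    define K where "K = (\<Sum>\<sigma>\<in>?X. \<bar>incidence G S \<sigma> \<tau>\<bar> * sqrt (cell_measure G S q \<sigma>) / cell_measure G S q \<tau>)"
    have pt: "0 < cell_measure G S q \<tau>" by (rule cell_measure_pos[OF True])
    have K0: "0 \<le> K" unfolding K_def using pt cell_measure_pos by (intro sum_nonneg) (auto simp: less_imp_le)
    have bound: "\<bar>bdry_q G S q (Suc i) h \<tau>\<bar> \<le> K * l2_norm G S q (Suc i) h" if h: "h \<in> l2_chains G S q (Suc i)" for h
    proof -
      have "\<bar>bdry_q G S q (Suc i) h \<tau>\<bar> \<le> (\<Sum>\<sigma>\<in>?X. \<bar>incidence G S \<sigma> \<tau> * h \<sigma> * cell_measure G S q \<sigma> / cell_measure G S q \<tau>\<bar>)"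
        unfolding bdry_q_def using True sum_abs[of "\<lambda>\<sigma>. incidence G S \<sigma> \<tau> * h \<sigma> * cell_measure G S q \<sigma> / cell_measure G S q \<tau>" ?X] by simp
      also have "\<dots> \<le> (\<Sum>\<sigma>\<in>?X. (\<bar>incidence G S \<sigma> \<tau>\<bar> * sqrt (cell_measure G S q \<sigma>) / cell_measure G S q \<tau>) * l2_norm G S q (Suc i) h)"
      proof (rule sum_mono)
        fix \<sigma> assume "\<sigma> \<in> ?X"
        then have s: "\<sigma> \<in> davis_cells G S (Suc i)" by simp
        let ?m = "cell_measure G S q \<sigma>"
        have pm: "0 < ?m" by (rule cell_measure_pos[OF s])
        have "\<bar>incidence G S \<sigma> \<tau> * h \<sigma> * ?m / cell_measure G S q \<tau>\<bar> =
            (\<bar>incidence G S \<sigma> \<tau>\<bar> * sqrt ?m / cell_measure G S q \<tau>) * (\<bar>h \<sigma>\<bar> * sqrt ?m)"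
          using pm pt by (simp add: abs_mult)
        also have "\<dots> \<le> (\<bar>incidence G S \<sigma> \<tau>\<bar> * sqrt ?m / cell_measure G S q \<tau>) * l2_norm G S q (Suc i) h"
          using pm pt by (intro mult_left_mono l2_norm_coord[OF h s]) auto
        finally show "\<bar>incidence G S \<sigma> \<tau> * h \<sigma> * ?m / cell_measure G S q \<tau>\<bar> \<le>
          (\<bar>incidence G S \<sigma> \<tau>\<bar> * sqrt ?m / cell_measure G S q \<tau>) * l2_norm G S q (Suc i) h" .
      qed
      also have "\<dots> = K * l2_norm G S q (Suc i) h" unfolding K_def by (rule sum_distrib_right[symmetric])
      finally show ?thesis .
    qed
    have "\<bar>bdry_q G S q (Suc i) g \<tau>\<bar> \<le> 0 + e" if e: "0 < e" for e
    proof -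
      obtain b where b: "b \<in> l2_chains G S q (Suc (Suc i))"
        "l2_norm G S q (Suc i) (\<lambda>\<sigma>. g \<sigma> - bdry_q G S q (Suc (Suc i)) b \<sigma>) < e / (K + 1)"
        using a[of "e / (K + 1)"] e K0 by auto
      let ?h = "\<lambda>\<sigma>. g \<sigma> - bdry_q G S q (Suc (Suc i)) b \<sigma>"
      have "bdry_q G S q (Suc i) ?h \<tau> = bdry_q G S q (Suc i) g \<tau>" unfolding bdry_diff bdry_bdry[OF b(1)] by simp
      then have "\<bar>bdry_q G S q (Suc i) g \<tau>\<bar> \<le> K * l2_norm G S q (Suc i) ?h"
        using bound[OF l2_diff[OF g l2_bdry[OF b(1)]]] by simp
      also have "\<dots> \<le> K * (e / (K + 1))" using b(2) K0 by (intro mult_left_mono) auto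
      also have "\<dots> \<le> e" using e K0 by (simp add: field_simps)
      finally show ?thesis by simp
    qed
    then have "\<bar>bdry_q G S q (Suc i) g \<tau>\<bar> \<le> 0" by (rule field_le_epsilon)
    then show ?thesis by simp
  qed (simp add: bdry_q_def)
qed

text \<open>Exactness for alternating chains is carried over by \<open>group_chain\<close> and
  yields a genuine filling, so a cycle is a boundary and not merely a limit of boundaries.\<close>

lemma bdry_surj:
  assumes ex: "exact q {} S (Suc i)" and g: "g \<in> l2_chains G S q (Suc i)" "bdry_q G S q (Suc i) g = (\<lambda>_. 0)"
  shows "\<exists>b\<in>l2_chains G S q (Suc (Suc i)). bdry_q G S q (Suc (Suc i)) b = g"
proof -
  have "cbdry (group_chain g) = group_chain (\<lambda>_. 0)" using group_chain_bdry_q[OF l2_chain_supp[OF g(1)]] g(2) by simp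
  then have z: "cbdry (group_chain g) R w = 0" for R w by (simp add: group_chain_def)
  obtain y where y: "alt_chain {} S (Suc (Suc i)) y" "\<And>U. wgt_l2 q (y U)" "\<And>R w. {} \<subseteq> R \<Longrightarrow> cbdry y R w = group_chain g R w"
    by (rule exactD[OF ex group_chain_alt_chain[OF l2_chain_supp[OF g(1)]] l2_group_chain[OF g(1)]]) (use z in auto)
  obtain b where b: "cell_supp (Suc (Suc i)) b" "group_chain b = y" using group_chain_surj[OF y(1)] by blast
  have bl: "b \<in> l2_chains G S q (Suc (Suc i))" by (rule group_chain_l2) (use b y(2) in auto)
  have "group_chain (bdry_q G S q (Suc (Suc i)) b) = group_chain g"
    using group_chain_bdry_q[OF l2_chain_supp[OF bl]] b(2) y(3) by (intro ext) simp
  then have "bdry_q G S q (Suc (Suc i)) b = g" using group_chain_inj[OF bdry_chain_supp l2_chain_supp[OF g(1)]] by blast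
  then show ?thesis using bl by blast
qed

end

end

theorem theorem6p2:
  fixes G :: "'a monoid" and S :: "'a set" and q :: "'a \<Rightarrow> real" and k i :: nat
  assumes "coxeter_system G S"
    and "finite S"
    and "k \<ge> 1"
    and "multiparameter G S q"
    and "\<forall>T. spherical G S T \<and> card T = k \<longrightarrow> q \<in> growth_region G S (St G S T)"
    and "i \<noteq> k"
  shows "rel_L2_homology_vanishes G S q k i"
proof -
  interpret cox G S using assms(1,2) by unfold_locales
  note q = assms(4)
  consider "i < k" | i' where "i = Suc i'" "k < i" using assms(6) not0_implies_Suc[of i] by (cases "i < k") auto
  then show ?thesis
  proof cases
    case 1
    \<comment> \<open>Below degree \<open>k\<close> the relative chains are zero and the boundary
      into them is zero by definition, even from degree \<open>k\<close>; both sides then consist of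
      the zero chain.\<close>
    have b: "rel_bdry G S q k (Suc i) = (\<lambda>g \<tau>. 0)" "rel_bdry G S q k i = (\<lambda>g \<tau>. 0)"
      using 1 by (auto simp: rel_bdry_def fun_eq_iff)
    have "(\<lambda>_. 0) \<in> rel_chains G S q k (Suc i)" by (simp add: rel_chains_def l2_chains_def)
    then have im: "rel_bdry G S q k (Suc i) ` rel_chains G S q k (Suc i) = {\<lambda>_. 0}" unfolding b by auto
    have c: "rel_chains G S q k i = {\<lambda>_. 0}" using 1 by (simp add: rel_chains_def)
    show ?thesis unfolding rel_L2_homology_vanishes_def rel_closure_def im c unfolding b(2) by (auto simp: l2_norm_def)
  next
    case (2 i')
    \<comment> \<open>Starting from the empty \<open>T\<close>, the recursion adds exactly
      \<open>k\<close> elements and so ends at the sets to which the hypothesis on stars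
      applies.\<close>
    have ex: "exact q {} S i"
    proof (rule exact_star[OF q, where k = k])
      fix T assume "spherical G S T" "card T = card {} + k"
      then have "qw G S q summable_on generate G (St G S T)" using assms(5) by (simp add: growth_region_def)
      then show "qw G S q summable_on generate G (St G S T \<inter> S)"
        by (rule summable_on_subset) (rule par_mono, blast)
    qed (use 2 in auto)
    have d: "rel_chains G S q k i = l2_chains G S q (Suc i')" "rel_chains G S q k (Suc i) = l2_chains G S q (Suc (Suc i'))"
      "rel_bdry G S q k i = bdry_q G S q (Suc i')" "rel_bdry G S q k (Suc i) = bdry_q G S q (Suc (Suc i'))"
      using 2 by (auto simp: rel_chains_def rel_bdry_def fun_eq_iff)
    show ?thesis unfolding rel_L2_homology_vanishes_def rel_closure_def d
    proof (intro equalityI subsetI)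
      fix g assume "g \<in> {g \<in> l2_chains G S q (Suc i'). bdry_q G S q (Suc i') g = (\<lambda>_. 0)}"
      then have g: "g \<in> l2_chains G S q (Suc i')" "bdry_q G S q (Suc i') g = (\<lambda>_. 0)" by auto
      obtain b where b: "b \<in> l2_chains G S q (Suc (Suc i'))" "bdry_q G S q (Suc (Suc i')) b = g"
        using bdry_surj[OF q ex[unfolded 2(1)] g] by blast
      have "l2_norm G S q i (\<lambda>\<sigma>. g \<sigma> - g \<sigma>) = 0" by (simp add: l2_norm_def)
      then show "g \<in> {g \<in> l2_chains G S q (Suc i'). \<forall>e>0. \<exists>a\<in>bdry_q G S q (Suc (Suc i')) ` l2_chains G S q (Suc (Suc i')).
          l2_norm G S q i (\<lambda>\<sigma>. g \<sigma> - a \<sigma>) < e}"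
        using g b by (auto intro!: bexI[of _ b])
    next
      fix g assume "g \<in> {g \<in> l2_chains G S q (Suc i'). \<forall>e>0. \<exists>a\<in>bdry_q G S q (Suc (Suc i')) ` l2_chains G S q (Suc (Suc i')).
          l2_norm G S q i (\<lambda>\<sigma>. g \<sigma> - a \<sigma>) < e}"
      then have g: "g \<in> l2_chains G S q (Suc i')"
        and a: "\<And>e. 0 < e \<Longrightarrow> \<exists>b\<in>l2_chains G S q (Suc (Suc i')). l2_norm G S q (Suc i') (\<lambda>\<sigma>. g \<sigma> - bdry_q G S q (Suc (Suc i')) b \<sigma>) < e"
        using 2(1) by auto
      then show "g \<in> {g \<in> l2_chains G S q (Suc i'). bdry_q G S q (Suc i') g = (\<lambda>_. 0)}" using bdry_closed[OF q g a] by simp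
    qed
  qed
qed

end
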